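(* Let $n\ge 3$, let $p>n$, let $k\ge 5$ be an integer, and let $(M^n,g)$ be a smooth asymptotically Euclidean (AE) manifold of class $W^{k,p}_{-\tau}$ with $\tau>\max\{0,\frac{n-4}{2}\}$, satisfying $Q_g\in L^1(M,dV_g)$. Then $$\frac{n-4}{8(n-1)}\,\mathcal{E}(g)=-\lim_{r\to\infty}\int_{S_r}G_{J_g}(X,\nu_\delta)\,d\omega_\delta,$$ where $X=r\partial_r$. In particular, the limit on the right-hand side exists and is finite.
   Context: Weighted spaces. Let $r=|x|$, $\sigma=\sqrt{1+r^2}$ on $\mathbb{R}^n$. $\|u\|_{p,\delta}=\|u\,\sigma^{-\delta-n/p}\|_{L^p}$, and $W^{k,p}_\delta$ is the space of $u\in W^{k,p}_{\mathrm{loc}}$ with $\sum_{j=0}^k\|\nabla^j u\|_{p,\delta-j}<\infty$; the same definition, with norms over the domain, is used on exterior domains. AE manifolds. A complete, smooth, connected $n$-dimensional Riemannian manifold $(M,g)$ is AE of class $W^{k,p}_{-\tau}$ ($\tau>0$) if there is an open set $E\subset M$ with $M\setminus E$ compact and a diffeomorphism $\Phi:E\to\mathbb{R}^n\setminus\overline{B_1(0)}$ (end chart) such that $((\Phi^{-1})^*g)_{ab}-\delta_{ab}\in W^{k,p}_{-\tau}(\mathbb{R}^n\setminus\overline{B_1(0)})$ for all $a,b$. (One end is assumed.) Curvature tensors. $$Q_g=-\frac{1}{2(n-1)}\Delta_gR_g-\frac{2}{(n-2)^2}|\mathrm{Ric}_g|_g^2+\frac{n^3-4n^2+16n-16}{8(n-1)^2(n-2)^2}R_g^2.$$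 Let $DQ_g$ be the linearisation of $g\mapsto Q_g$ at $g$ (from symmetric $(0,2)$-tensor fields to functions) and $DQ_g^*$ its formal $L^2(dV_g)$-adjoint. Then $J_g=-\frac12DQ_g^*(1)$, and the $J$-Einstein tensor is $G_{J_g}=J_g-\frac14Q_g\,g$. Fourth order energy. In the end coordinates (repeated indices summed, partial derivatives in the chart), $$\mathcal{E}(g)=\lim_{r\to\infty}\int_{S_r}\big(\partial_j\partial_i\partial_ig_{aa}-\partial_j\partial_a\partial_ig_{ai}\big)\nu_\delta^j\,d\omega_\delta,$$ where $S_r$ is the Euclidean sphere of radius $r$ in the end, $\nu_\delta=x/r$ its outward Euclidean unit normal, $d\omega_\delta$ the induced Euclidean volume element, and $r\partial_r=x^i\partial_i$. *)

theory Defs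
  imports "HOL-Analysis.Analysis"
begin

section \<open>Iterated partial derivatives and smooth functions\<close>

definition partial :: "'n::finite \<Rightarrow> (real^'n \<Rightarrow> real) \<Rightarrow> real^'n \<Rightarrow> real" where
  "partial i f x = frechet_derivative f (at x) (axis i 1)"

text \<open>\<open>partials [i, j, k] f\<close> is \<open>\<partial>\<^sub>i \<partial>\<^sub>j \<partial>\<^sub>k f\<close>.\<close>

definition partials :: "'n::finite list \<Rightarrow> (real^'n \<Rightarrow> real) \<Rightarrow> real^'n \<Rightarrow> real" where
  "partials is f = foldr partial is f"

text \<open>\<open>C\<^sup>\<infinity>\<close> on an open set: differentiability of all iterated partial derivatives makes all of
  them continuous.\<close>

definition smooth_on :: "(real^'n::finite) set \<Rightarrow> (real^'n \<Rightarrow> real) \<Rightarrow> bool" where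
  "smooth_on S f \<longleftrightarrow> (\<forall>is. \<forall>x\<in>S. partials is f differentiable (at x))"


section \<open>Weighted Sobolev spaces on open subsets of Euclidean space\<close>

definition test_function :: "(real^'n::finite) set \<Rightarrow> (real^'n \<Rightarrow> real) \<Rightarrow> bool" where
  "test_function \<Omega> \<phi> \<longleftrightarrow>
     smooth_on UNIV \<phi> \<and> (\<exists>K. compact K \<and> K \<subseteq> \<Omega> \<and> (\<forall>x. x \<notin> K \<longrightarrow> \<phi> x = 0))"

definition Lp_loc :: "(real^'n::finite) set \<Rightarrow> real \<Rightarrow> (real^'n \<Rightarrow> real) \<Rightarrow> bool" where
  "Lp_loc \<Omega> p f \<longleftrightarrow>
     set_borel_measurable lborel \<Omega> f \<and>
     (\<forall>K. compact K \<and> K \<subseteq> \<Omega> \<longrightarrow> (\<integral>\<^sup>+x\<in>K. ennreal (\<bar>f x\<bar> powr p) \<partial>lborel) < \<infinity>)"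

definition weak_partials ::
  "(real^'n::finite) set \<Rightarrow> 'n list \<Rightarrow> (real^'n \<Rightarrow> real) \<Rightarrow> (real^'n \<Rightarrow> real) \<Rightarrow> bool" where
  "weak_partials \<Omega> is u v \<longleftrightarrow>
     (\<forall>\<phi>. test_function \<Omega> \<phi> \<longrightarrow>
        (LINT x:\<Omega>|lborel. u x * partials is \<phi> x)
          = (-1) ^ length is * (LINT x:\<Omega>|lborel. v x * \<phi> x))"

text \<open>\<open>u \<in> W\<^sup>k\<^sup>,\<^sup>p\<^sub>l\<^sub>o\<^sub>c(\<Omega>)\<close>, with \<open>D is\<close> the weak derivative of \<open>u\<close> for the list \<open>is\<close> of indices.\<close>

definition sobolev_loc ::
  "(real^'n::finite) set \<Rightarrow> nat \<Rightarrow> real \<Rightarrow> (real^'n \<Rightarrow> real)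
    \<Rightarrow> ('n list \<Rightarrow> real^'n \<Rightarrow> real) \<Rightarrow> bool" where
  "sobolev_loc \<Omega> k p u D \<longleftrightarrow>
     Lp_loc \<Omega> p u \<and> D [] = u \<and>
     (\<forall>is. length is \<le> k \<longrightarrow> Lp_loc \<Omega> p (D is) \<and> weak_partials \<Omega> is u (D is))"

definition weight :: "real^'n::finite \<Rightarrow> real" where
  "weight x = sqrt (1 + (norm x)\<^sup>2)"

definition weighted_norm ::
  "(real^'n::finite) set \<Rightarrow> real \<Rightarrow> real \<Rightarrow> (real^'n \<Rightarrow> real) \<Rightarrow> ennreal" where
  "weighted_norm \<Omega> p \<delta> f =
     (let I = (\<integral>\<^sup>+x\<in>\<Omega>. ennreal (\<bar>f x * weight x powr (- \<delta> - real CARD('n) / p)\<bar> powr p) \<partial>lborel)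
      in if I = \<infinity> then \<infinity> else ennreal (enn2real I powr (1 / p)))"

definition nabla_norm :: "('n::finite list \<Rightarrow> real^'n \<Rightarrow> real) \<Rightarrow> nat \<Rightarrow> real^'n \<Rightarrow> real" where
  "nabla_norm D j x = sqrt (\<Sum>is | length is = j. (D is x)\<^sup>2)"

definition weighted_sobolev ::
  "(real^'n::finite) set \<Rightarrow> nat \<Rightarrow> real \<Rightarrow> real \<Rightarrow> (real^'n \<Rightarrow> real) set" where
  "weighted_sobolev \<Omega> k p \<delta> =
     {u. \<exists>D. sobolev_loc \<Omega> k p u D \<and>
             (\<Sum>j\<le>k. weighted_norm \<Omega> p (\<delta> - real j) (nabla_norm D j)) < \<infinity>}"


section \<open>Smooth manifolds\<close>

text \<open>A chart is a pair of its domain and its coordinate map; the values of the coordinate map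
  outside the domain are irrelevant. The dimension of the manifold is \<open>CARD('n)\<close>.\<close>

type_synonym ('a, 'n) chart = "'a set \<times> ('a \<Rightarrow> real^'n)"

definition chart_image :: "('a, 'n::finite) chart \<Rightarrow> (real^'n) set" where
  "chart_image c = snd c ` fst c"

definition chart_inv :: "('a, 'n::finite) chart \<Rightarrow> real^'n \<Rightarrow> 'a" where
  "chart_inv c = inv_into (fst c) (snd c)"

definition is_chart :: "'a topology \<Rightarrow> ('a, 'n::finite) chart \<Rightarrow> bool" where
  "is_chart M c \<longleftrightarrow>
     openin M (fst c) \<and> open (chart_image c) \<and>
     homeomorphic_map (subtopology M (fst c)) (top_of_set (chart_image c)) (snd c)"

definition transition ::
  "('a, 'n::finite) chart \<Rightarrow> ('a, 'n) chart \<Rightarrow> real^'n \<Rightarrow> real^'n" where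
  "transition c d = snd d \<circ> chart_inv c"

definition compatible :: "('a, 'n::finite) chart \<Rightarrow> ('a, 'n) chart \<Rightarrow> bool" where
  "compatible c d \<longleftrightarrow>
     (\<forall>i. smooth_on (snd c ` (fst c \<inter> fst d)) (\<lambda>x. transition c d x $ i)) \<and>
     (\<forall>i. smooth_on (snd d ` (fst c \<inter> fst d)) (\<lambda>x. transition d c x $ i))"

text \<open>A smooth structure is a maximal smooth atlas. Its members are exactly the diffeomorphisms from
  open subsets of the manifold onto open subsets of Euclidean space.\<close>

definition smooth_structure :: "'a topology \<Rightarrow> ('a, 'n::finite) chart set \<Rightarrow> bool" where
  "smooth_structure M A \<longleftrightarrow>
     (\<forall>c\<in>A. is_chart M c) \<and>
     (\<Union>c\<in>A. fst c) = topspace M \<and>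
     (\<forall>c\<in>A. \<forall>d\<in>A. compatible c d) \<and>
     (\<forall>c. is_chart M c \<and> (\<forall>d\<in>A. compatible c d) \<longrightarrow> c \<in> A)"

definition smooth_manifold :: "'a topology \<Rightarrow> ('a, 'n::finite) chart set \<Rightarrow> bool" where
  "smooth_manifold M A \<longleftrightarrow>
     Hausdorff_space M \<and> second_countable M \<and> smooth_structure M A"

definition smooth_function :: "('a, 'n::finite) chart set \<Rightarrow> ('a \<Rightarrow> real) \<Rightarrow> bool" where
  "smooth_function A f \<longleftrightarrow> (\<forall>c\<in>A. smooth_on (chart_image c) (f \<circ> chart_inv c))"

text \<open>An arbitrary chart around a point, used to evaluate coordinate-invariant expressions.\<close>

definition chart_at :: "('a, 'n::finite) chart set \<Rightarrow> 'a \<Rightarrow> ('a, 'n) chart" where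
  "chart_at A q = (SOME c. c \<in> A \<and> q \<in> fst c)"


section \<open>Symmetric (0,2)-tensor fields and Riemannian metrics\<close>

text \<open>A (0,2)-tensor field is given by its matrix of components in every chart of the smooth
  structure, as a function of the coordinates, subject to the usual transformation law.\<close>

type_synonym ('a, 'n) tensor2 = "('a, 'n) chart \<Rightarrow> real^'n \<Rightarrow> real^'n^'n"

definition sym_tensor_field :: "('a, 'n::finite) chart set \<Rightarrow> ('a, 'n) tensor2 \<Rightarrow> bool" where
  "sym_tensor_field A h \<longleftrightarrow>
     (\<forall>c\<in>A. \<forall>i j. smooth_on (chart_image c) (\<lambda>x. h c x $ i $ j)) \<and>
     (\<forall>c\<in>A. \<forall>x\<in>chart_image c. transpose (h c x) = h c x) \<and>
     (\<forall>c\<in>A. \<forall>d\<in>A. \<forall>x\<in>snd c ` (fst c \<inter> fst d). \<forall>i j.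
        h c x $ i $ j =
          (\<Sum>a\<in>UNIV. \<Sum>b\<in>UNIV.
             partial i (\<lambda>y. transition c d y $ a) x * partial j (\<lambda>y. transition c d y $ b) x
               * h d (transition c d x) $ a $ b))"

definition riemannian_metric :: "('a, 'n::finite) chart set \<Rightarrow> ('a, 'n) tensor2 \<Rightarrow> bool" where
  "riemannian_metric A g \<longleftrightarrow>
     sym_tensor_field A g \<and>
     (\<forall>c\<in>A. \<forall>x\<in>chart_image c. \<forall>v. v \<noteq> 0 \<longrightarrow> v \<bullet> (g c x *v v) > 0)"

definition compactly_supported ::
  "'a topology \<Rightarrow> ('a, 'n::finite) chart set \<Rightarrow> ('a, 'n) tensor2 \<Rightarrow> bool" where
  "compactly_supported M A h \<longleftrightarrow>
     (\<exists>K. compactin M K \<and> (\<forall>c\<in>A. \<forall>q\<in>fst c - K. h c (snd c q) = 0))"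

text \<open>The pointwise inner product \<open>g\<^sup>i\<^sup>a g\<^sup>j\<^sup>b S\<^sub>i\<^sub>j T\<^sub>a\<^sub>b\<close>.\<close>

definition matrix_inner :: "real^'n^'n \<Rightarrow> real^'n^'n \<Rightarrow> real^'n^'n \<Rightarrow> real" where
  "matrix_inner G S T =
     (\<Sum>i\<in>UNIV. \<Sum>j\<in>UNIV. \<Sum>a\<in>UNIV. \<Sum>b\<in>UNIV.
        matrix_inv G $ i $ a * matrix_inv G $ j $ b * S $ i $ j * T $ a $ b)"

definition tensor_inner ::
  "('a, 'n::finite) chart set \<Rightarrow> ('a, 'n) tensor2 \<Rightarrow> ('a, 'n) tensor2 \<Rightarrow> ('a, 'n) tensor2
    \<Rightarrow> 'a \<Rightarrow> real" where
  "tensor_inner A g S T q =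
     (let c = chart_at A q; x = snd c q in matrix_inner (g c x) (S c x) (T c x))"

text \<open>\<open>\<mu>\<close> is the Riemannian measure \<open>dV\<^sub>g\<close>, a Borel measure uniquely determined by its
  values \<open>\<surd>det g dx\<close> in the charts.\<close>

definition riemannian_volume ::
  "'a topology \<Rightarrow> ('a, 'n::finite) chart set \<Rightarrow> ('a, 'n) tensor2 \<Rightarrow> 'a measure \<Rightarrow> bool" where
  "riemannian_volume M A g \<mu> \<longleftrightarrow>
     space \<mu> = topspace M \<and>
     sets \<mu> = sigma_sets (topspace M) {U. openin M U} \<and>
     (\<forall>c\<in>A. \<forall>B\<in>sets \<mu>. B \<subseteq> fst c \<longrightarrow>
        emeasure \<mu> B = (\<integral>\<^sup>+x\<in>snd c ` B. ennreal (sqrt (det (g c x))) \<partial>lborel))"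


section \<open>Riemannian distance and completeness\<close>

definition C1_curve_on ::
  "('a, 'n::finite) chart set \<Rightarrow> (real \<Rightarrow> 'a) \<Rightarrow> real \<Rightarrow> real \<Rightarrow> bool" where
  "C1_curve_on A \<gamma> a b \<longleftrightarrow>
     (\<forall>c\<in>A. \<exists>D. continuous_on {t\<in>{a..b}. \<gamma> t \<in> fst c} D \<and>
        (\<forall>t\<in>{a..b}. \<gamma> t \<in> fst c \<longrightarrow>
           ((snd c \<circ> \<gamma>) has_vector_derivative D t) (at t within {a..b})))"

definition piecewise_C1_curve ::
  "'a topology \<Rightarrow> ('a, 'n::finite) chart set \<Rightarrow> (real \<Rightarrow> 'a) \<Rightarrow> bool" where
  "piecewise_C1_curve M A \<gamma> \<longleftrightarrow>
     pathin M \<gamma> \<and>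
     (\<exists>S. finite S \<and> {0, 1} \<subseteq> S \<and> S \<subseteq> {0..1} \<and>
        (\<forall>a\<in>S. \<forall>b\<in>S. a < b \<and> {a<..<b} \<inter> S = {} \<longrightarrow> C1_curve_on A \<gamma> a b))"

definition curve_speed ::
  "('a, 'n::finite) chart set \<Rightarrow> ('a, 'n) tensor2 \<Rightarrow> (real \<Rightarrow> 'a) \<Rightarrow> real \<Rightarrow> real" where
  "curve_speed A g \<gamma> t =
     (let c = chart_at A (\<gamma> t); v = vector_derivative (snd c \<circ> \<gamma>) (at t)
      in sqrt (v \<bullet> (g c (snd c (\<gamma> t)) *v v)))"

definition curve_length ::
  "('a, 'n::finite) chart set \<Rightarrow> ('a, 'n) tensor2 \<Rightarrow> (real \<Rightarrow> 'a) \<Rightarrow> real" where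
  "curve_length A g \<gamma> = integral {0..1} (curve_speed A g \<gamma>)"

definition riemannian_dist ::
  "'a topology \<Rightarrow> ('a, 'n::finite) chart set \<Rightarrow> ('a, 'n) tensor2 \<Rightarrow> 'a \<Rightarrow> 'a \<Rightarrow> real" where
  "riemannian_dist M A g q q' =
     Inf {curve_length A g \<gamma> |\<gamma>. piecewise_C1_curve M A \<gamma> \<and> \<gamma> 0 = q \<and> \<gamma> 1 = q'}"

definition complete_metric ::
  "'a topology \<Rightarrow> ('a, 'n::finite) chart set \<Rightarrow> ('a, 'n) tensor2 \<Rightarrow> bool" where
  "complete_metric M A g \<longleftrightarrow>
     (\<forall>s :: nat \<Rightarrow> 'a.
        range s \<subseteq> topspace M \<and>
        (\<forall>e>0. \<exists>N. \<forall>k\<ge>N. \<forall>l\<ge>N. riemannian_dist M A g (s k) (s l) < e) \<longrightarrow>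
        (\<exists>q\<in>topspace M. (\<lambda>k. riemannian_dist M A g (s k) q) \<longlonglongrightarrow> 0))"


section \<open>Curvature in coordinates\<close>

text \<open>Below, \<open>G\<close> is the matrix of components of the metric as a function of the coordinates.\<close>

definition christoffel ::
  "(real^'n::finite \<Rightarrow> real^'n^'n) \<Rightarrow> 'n \<Rightarrow> 'n \<Rightarrow> 'n \<Rightarrow> real^'n \<Rightarrow> real" where
  "christoffel G k i j x =
     (\<Sum>l\<in>UNIV. matrix_inv (G x) $ k $ l *
        (partial i (\<lambda>y. G y $ j $ l) x + partial j (\<lambda>y. G y $ i $ l) x
          - partial l (\<lambda>y. G y $ i $ j) x)) / 2"

text \<open>\<open>R\<^sub>i\<^sub>j = \<partial>\<^sub>k \<Gamma>\<^sup>k\<^sub>i\<^sub>j - \<partial>\<^sub>j \<Gamma>\<^sup>k\<^sub>i\<^sub>k + \<Gamma>\<^sup>k\<^sub>k\<^sub>l \<Gamma>\<^sup>l\<^sub>i\<^sub>j - \<Gamma>\<^sup>k\<^sub>j\<^sub>l \<Gamma>\<^sup>l\<^sub>i\<^sub>k\<close>,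
  positive on round spheres.\<close>

definition ricci :: "(real^'n::finite \<Rightarrow> real^'n^'n) \<Rightarrow> real^'n \<Rightarrow> real^'n^'n" where
  "ricci G x = (\<chi> i j.
     (\<Sum>k\<in>UNIV. partial k (christoffel G k i j) x - partial j (christoffel G k i k) x) +
     (\<Sum>k\<in>UNIV. \<Sum>l\<in>UNIV.
        christoffel G k k l x * christoffel G l i j x
        - christoffel G k j l x * christoffel G l i k x))"

definition scalar_curvature :: "(real^'n::finite \<Rightarrow> real^'n^'n) \<Rightarrow> real^'n \<Rightarrow> real" where
  "scalar_curvature G x =
     (\<Sum>i\<in>UNIV. \<Sum>j\<in>UNIV. matrix_inv (G x) $ i $ j * ricci G x $ i $ j)"

text \<open>The Laplacian is the trace of the covariant Hessian.\<close>

definition laplacian ::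
  "(real^'n::finite \<Rightarrow> real^'n^'n) \<Rightarrow> (real^'n \<Rightarrow> real) \<Rightarrow> real^'n \<Rightarrow> real" where
  "laplacian G f x =
     (\<Sum>i\<in>UNIV. \<Sum>j\<in>UNIV. matrix_inv (G x) $ i $ j *
        (partials [i, j] f x - (\<Sum>k\<in>UNIV. christoffel G k i j x * partial k f x)))"

definition Q_coord :: "(real^'n::finite \<Rightarrow> real^'n^'n) \<Rightarrow> real^'n \<Rightarrow> real" where
  "Q_coord G x =
     (let n = real CARD('n) in
      - 1 / (2 * (n - 1)) * laplacian G (scalar_curvature G) x
      - 2 / (n - 2)\<^sup>2 * matrix_inner (G x) (ricci G x) (ricci G x)
      + (n ^ 3 - 4 * n\<^sup>2 + 16 * n - 16) / (8 * (n - 1)\<^sup>2 * (n - 2)\<^sup>2) * (scalar_curvature G x)\<^sup>2)"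


section \<open>Q-curvature, its linearisation and the J-Einstein tensor\<close>

definition Q_curvature ::
  "('a, 'n::finite) chart set \<Rightarrow> ('a, 'n) tensor2 \<Rightarrow> 'a \<Rightarrow> real" where
  "Q_curvature A g q = (let c = chart_at A q in Q_coord (g c) (snd c q))"

definition DQ ::
  "('a, 'n::finite) chart set \<Rightarrow> ('a, 'n) tensor2 \<Rightarrow> ('a, 'n) tensor2 \<Rightarrow> 'a \<Rightarrow> real" where
  "DQ A g h q = deriv (\<lambda>t. Q_curvature A (\<lambda>c x. g c x + t *\<^sub>R h c x) q) 0"

text \<open>\<open>L'\<close> is the formal \<open>L\<^sup>2(\<mu>)\<close>-adjoint of an operator \<open>L\<close> from symmetric (0,2)-tensor fields to
  functions. It is uniquely determined on the charts by \<open>L\<close>.\<close>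

definition formal_adjoint ::
  "'a topology \<Rightarrow> ('a, 'n::finite) chart set \<Rightarrow> ('a, 'n) tensor2 \<Rightarrow> 'a measure
    \<Rightarrow> (('a, 'n) tensor2 \<Rightarrow> 'a \<Rightarrow> real) \<Rightarrow> (('a \<Rightarrow> real) \<Rightarrow> ('a, 'n) tensor2) \<Rightarrow> bool" where
  "formal_adjoint M A g \<mu> L L' \<longleftrightarrow>
     (\<forall>f. smooth_function A f \<longrightarrow>
        sym_tensor_field A (L' f) \<and>
        (\<forall>h. sym_tensor_field A h \<and> compactly_supported M A h \<longrightarrow>
           (LINT q|\<mu>. L h q * f q) = (LINT q|\<mu>. tensor_inner A g h (L' f) q)))"

text \<open>In the next two definitions \<open>DQ'\<close> stands for the formal adjoint of \<open>DQ A g\<close>.\<close>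

definition J_tensor :: "((('a \<Rightarrow> real) \<Rightarrow> ('a, 'n::finite) tensor2)) \<Rightarrow> ('a, 'n) tensor2" where
  "J_tensor DQ' = (\<lambda>c x. (- 1 / 2) *\<^sub>R DQ' (\<lambda>_. 1) c x)"

definition J_einstein ::
  "('a, 'n::finite) chart set \<Rightarrow> ('a, 'n) tensor2 \<Rightarrow> (('a \<Rightarrow> real) \<Rightarrow> ('a, 'n) tensor2)
    \<Rightarrow> ('a, 'n) tensor2" where
  "J_einstein A g DQ' =
     (\<lambda>c x. J_tensor DQ' c x - (1 / 4 * Q_curvature A g (chart_inv c x)) *\<^sub>R g c x)"


section \<open>Asymptotically Euclidean manifolds\<close>

definition AE_end ::
  "'a topology \<Rightarrow> ('a, 'n::finite) chart set \<Rightarrow> ('a, 'n) tensor2 \<Rightarrow> nat \<Rightarrow> real \<Rightarrow> real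
    \<Rightarrow> ('a, 'n) chart \<Rightarrow> bool" where
  "AE_end M A g k p \<tau> e \<longleftrightarrow>
     e \<in> A \<and> compactin M (topspace M - fst e) \<and> chart_image e = - cball 0 1 \<and>
     (\<forall>a b. (\<lambda>x. g e x $ a $ b - (if a = b then 1 else 0))
              \<in> weighted_sobolev (- cball 0 1) k p (- \<tau>))"

text \<open>\<open>g\<close> is AE of class \<open>W\<^sup>k\<^sup>,\<^sup>p\<^sub>-\<^sub>\<tau>\<close> with end chart \<open>e\<close>.\<close>

definition AE_manifold ::
  "'a topology \<Rightarrow> ('a, 'n::finite) chart set \<Rightarrow> ('a, 'n) tensor2 \<Rightarrow> nat \<Rightarrow> real \<Rightarrow> real
    \<Rightarrow> ('a, 'n) chart \<Rightarrow> bool" where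
  "AE_manifold M A g k p \<tau> e \<longleftrightarrow>
     smooth_manifold M A \<and> connected_space M \<and>
     riemannian_metric A g \<and> complete_metric M A g \<and>
     \<tau> > 0 \<and> AE_end M A g k p \<tau> e"


section \<open>Sphere integrals and the fourth order energy\<close>

text \<open>The volume element of the sphere of radius \<open>r\<close>, as the cone measure: since
  \<open>\<integral>\<^sub>B\<^sub>r f(r x/|x|) dx = \<integral>\<^sub>0\<^sup>r (s/r)\<^sup>n\<^sup>-\<^sup>1 ds \<integral>\<^sub>S\<^sub>r f d\<omega> = (r/n) \<integral>\<^sub>S\<^sub>r f d\<omega>\<close>, it is \<open>n/r\<close> times the
  image of the Lebesgue measure on the ball under radial projection.\<close>

definition sphere_measure :: "real \<Rightarrow> (real^'n::finite) measure" where
  "sphere_measure r =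
     scale_measure (ennreal (real CARD('n) / r))
       (distr (restrict_space lborel (ball 0 r)) borel (\<lambda>x. (r / norm x) *\<^sub>R x))"

definition energy_flux :: "(real^'n::finite \<Rightarrow> real^'n^'n) \<Rightarrow> real \<Rightarrow> real" where
  "energy_flux G r =
     (LINT x:sphere 0 r|sphere_measure r.
        (\<Sum>j\<in>UNIV. (\<Sum>i\<in>UNIV. \<Sum>a\<in>UNIV.
           partials [j, i, i] (\<lambda>y. G y $ a $ a) x - partials [j, a, i] (\<lambda>y. G y $ a $ i) x)
           * ((1 / r) *\<^sub>R x) $ j))"

definition energy :: "(real^'n::finite \<Rightarrow> real^'n^'n) \<Rightarrow> real" where
  "energy G = Lim at_top (energy_flux G)"

text \<open>\<open>\<integral>\<^sub>S\<^sub>r T(X, \<nu>) d\<omega>\<close> with \<open>X = r\<partial>\<^sub>r = x\<^sup>i\<partial>\<^sub>i\<close> and \<open>\<nu> = x/r\<close>.\<close>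

definition radial_flux :: "(real^'n::finite \<Rightarrow> real^'n^'n) \<Rightarrow> real \<Rightarrow> real" where
  "radial_flux T r =
     (LINT x:sphere 0 r|sphere_measure r. x \<bullet> (T x *v ((1 / r) *\<^sub>R x)))"

end

theory Submission
 imports Defs "HOL-Library.Landau_Symbols"
begin

text \<open>In the end chart the weighted Sobolev condition gives pointwise decay of \<open>g - \<delta>\<close> and of its first four
 derivatives (Morrey's inequality on cubes of size \<open>|x|\<close>). The identity for the formal adjoint, tested
 with tensor fields supported in the end, determines \<open>DQ\<^sub>g\<^sup>*(1)\<close> there: the second order term of \<open>Q\<close> is
 a divergence and drops out, and what remains shows that the J-Einstein tensor is, up to
 \<open>O(|x|\<^sup>-\<^sup>2\<^sup>\<tau>\<^sup>-\<^sup>4)\<close>, an explicit linear operator of order four in \<open>g - \<delta>\<close>. This linear part is divergence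
 free with trace \<open>(n-4)/(8(n-1)) \<Delta>R\<close>, where \<open>R\<close> is the linearised scalar curvature of a smooth
 extension of \<open>g - \<delta>\<close> to \<open>\<real>\<^sup>n\<close>, so by the divergence theorem its flux through large spheres is a multiple
 of the flux of \<open>dR\<close>, which is minus the energy flux. The flux of \<open>dR\<close> converges since \<open>\<Delta>R\<close> agrees with
 \<open>-2(n-1)Q\<close> up to integrable terms.\<close>

text \<open>\<open>DQ\<close> has order four in the variation, but only through the Laplacian of the
  scalar curvature. For every metric, \<open>sqrt det g\<close> times a Laplacian is a coordinate
  divergence; hence its variation is one too and pairs to zero with the function 1. What remains has
  order two with coefficients at least linear in the curvature, so two integrations by parts leave
  at most four derivatives of \<open>g - \<delta>\<close>, which \<open>k \<ge> 5\<close> and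
  \<open>p > n\<close> control pointwise. The variation of the volume density leaves a multiple of
  \<open>Q g\<close>, which the term \<open>Q g / 4\<close> of the J-Einstein tensor cancels. Errors
  of size \<open>r^(-2\<tau>-4)\<close>, multiplied by \<open>|X| = r\<close> and by the sphere area
  \<open>r^(n-1)\<close>, vanish in the limit exactly when \<open>2\<tau> + 4 > n\<close>; the same
  inequality makes them integrable over the end. The linear identities are exact and are applied on
  all of R^n, so no inner boundary term appears. An obstacle of another kind: \<open>DQ\<close> and
  \<open>tensor_inner\<close> are evaluated in an arbitrarily chosen chart, so the coordinate
  invariance of \<open>Q_coord\<close> has to be proved before anything can be computed in the end
  chart.\<close>

abbreviation UNIV_sum :: "('i => 'b::comm_monoid_add) => 'b" (binder "\<Oplus>" 10) where
 "UNIV_sum f \<equiv> sum f UNIV"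

section \<open>Smooth functions\<close>

text \<open>Directional derivatives on an arbitrary Euclidean space: one calculus serves functions
  on the line, on \<open>real^'n\<close> and on pairs of a time and a point, where families of
  metrics live.\<close>

definition dd :: "'a::euclidean_space => ('a => real) => 'a => real" where
 "dd v f x = frechet_derivative f (at x) v"

definition Cinf :: "'a::euclidean_space set => ('a => real) => bool" where
 "Cinf S f \<longleftrightarrow> (\<forall>vs. \<forall>x\<in>S. foldr dd vs f differentiable (at x))"

lemma partial_eq_dd: "partial i = dd (axis i 1)"
 by (simp add: fun_eq_iff partial_def dd_def)

lemma dd_eqI: "(f has_derivative f') (at x) ==> dd v f x = f' v"
 unfolding dd_def using frechet_derivative_at by metis

lemma has_derivative_dd: "f differentiable (at x) ==> (f has_derivative (%v. dd v f x)) (at x)"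
 unfolding dd_def by (simp add: frechet_derivative_works)

lemma dd_linear: "f differentiable (at x) ==> linear (%v. dd v f x)"
 using has_derivative_dd has_derivative_linear by blast

lemma dd_cong:
 assumes "open S" "x \<in> S" "!!y. y \<in> S ==> f y = g y"
 shows "dd v f x = dd v g x"
proof -
 have "(f has_derivative D) (at x) \<longleftrightarrow> (g has_derivative D) (at x)" for D
  using has_derivative_transform_within_open[OF _ assms(1,2), of f D UNIV g]
   has_derivative_transform_within_open[OF _ assms(1,2), of g D UNIV f] assms(3) by auto
 thus ?thesis unfolding dd_def frechet_derivative_def by simp
qed

lemma differentiable_cong_open:
 assumes "open S" "x \<in> S" "!!y. y \<in> S ==> f y = g y" "f differentiable (at x)"
 shows "g differentiable (at x)"
 using has_derivative_transform_within_open[OF _ assms(1,2), of f _ UNIV g] assms(3,4)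
 unfolding differentiable_def by auto

lemma dd_const [simp]: "dd v (%x. c) x = 0"
 by (rule dd_eqI[THEN trans]) (auto intro!: derivative_eq_intros)

lemma dd_add: "f differentiable (at x) ==> g differentiable (at x) ==>
  dd v (%y. f y + g y) x = dd v f x + dd v g x"
 by (rule dd_eqI[THEN trans, OF has_derivative_add[OF has_derivative_dd has_derivative_dd]]) auto

lemma dd_mult: "f differentiable (at x) ==> g differentiable (at x) ==>
  dd v (%y. f y * g y) x = f x * dd v g x + dd v f x * g x"
 by (rule dd_eqI[THEN trans, OF has_derivative_mult[OF has_derivative_dd has_derivative_dd]]) auto

inductive alg :: "('a => real) set => ('a => real) => bool" for B where
 alg_base: "f \<in> B ==> alg B f"
| alg_const: "alg B (%x. c)"
| alg_add: "alg B f ==> alg B g ==> alg B (%x. f x + g x)"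
| alg_mult: "alg B f ==> alg B g ==> alg B (%x. f x * g x)"

lemma alg_sum: "(!!i. i \<in> I ==> alg B (f i)) ==> alg B (%x. \<Sum>i\<in>I. f i x)"
 by (induction I rule: infinite_finite_induct) (auto intro: alg.intros)

text \<open>Smoothness by coinduction up to the algebra generated by \<open>B\<close>: it suffices that the derivatives
 of the generators are polynomials in the generators.\<close>

lemma Cinf_upto:
 assumes S: "open S"
  and d: "!!f x. f \<in> B ==> x \<in> S ==> f differentiable (at x)"
  and dd: "!!f v. f \<in> B ==> \<exists>g. alg B g \<and> (\<forall>x\<in>S. dd v f x = g x)"
  and f: "alg B f"
 shows "Cinf S f"
proof -
 have diff: "alg B f ==> x \<in> S ==> f differentiable (at x)" for f x
  by (induction rule: alg.induct) (auto intro: d)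
 have der: "alg B f ==> \<exists>g. alg B g \<and> (\<forall>x\<in>S. dd v f x = g x)" for f v
 proof (induction rule: alg.induct)
  case (alg_const c)
  show ?case by (rule exI[of _ "%x. 0"]) (auto intro: alg.intros)
 next
  case (alg_add f g)
  then obtain f' g' where *: "alg B f'" "\<forall>x\<in>S. dd v f x = f' x" "alg B g'" "\<forall>x\<in>S. dd v g x = g' x"
   by blast
  show ?case
   by (rule exI[of _ "%x. f' x + g' x"])
    (use * alg_add diff in \<open>auto intro: alg.intros simp: dd_add\<close>)
 next
  case (alg_mult f g)
  then obtain f' g' where *: "alg B f'" "\<forall>x\<in>S. dd v f x = f' x" "alg B g'" "\<forall>x\<in>S. dd v g x = g' x"
   by blast
  show ?case
   by (rule exI[of _ "%x. f x * g' x + f' x * g x"])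
    (use * alg_mult diff in \<open>auto intro!: alg.alg_add alg.alg_mult simp: dd_mult\<close>)
 qed (use dd in auto)
 have "\<exists>g. alg B g \<and> (\<forall>x\<in>S. foldr dd vs f x = g x)" for vs
 proof (induction vs)
  case Nil thus ?case using f by auto
 next
  case (Cons v vs)
  then obtain g where g: "alg B g" "\<forall>x\<in>S. foldr dd vs f x = g x" by blast
  from der[OF g(1), of v] obtain g' where g': "alg B g'" "\<forall>x\<in>S. dd v g x = g' x" by blast
  have "dd v (foldr dd vs f) x = g' x" if "x \<in> S" for x
   using dd_cong[OF S that, of "foldr dd vs f" g v] g g' that by auto
  thus ?case using g' by auto
 qed
 hence "foldr dd vs f differentiable (at x)" if "x \<in> S" for vs x
  using differentiable_cong_open[OF S that] diff[OF _ that] that by (metis (no_types, lifting))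
 thus ?thesis unfolding Cinf_def by blast
qed

lemma Cinf_differentiable: "Cinf S f ==> x \<in> S ==> f differentiable (at x)"
 unfolding Cinf_def by (metis foldr.simps(1) id_apply)

lemma Cinf_dd [intro]: "Cinf S f ==> Cinf S (dd v f)"
 unfolding Cinf_def
proof (intro allI ballI)
 fix vs x assume "\<forall>vs. \<forall>x\<in>S. foldr dd vs f differentiable at x" "x \<in> S"
 hence "foldr dd (vs @ [v]) f differentiable at x" by blast
 thus "foldr dd vs (dd v f) differentiable at x" by simp
qed

lemma Cinf_subset: "Cinf S f ==> T \<subseteq> S ==> Cinf T f"
 unfolding Cinf_def by blast

text \<open>Derivatives at points of \<open>S\<close> see only values near them, and
  \<open>S\<close> is open, so agreement on \<open>S\<close> suffices. The generators are all
  functions that agree on \<open>S\<close> with a smooth one.\<close>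

lemma Cinf_cong:
 assumes "open S" "!!y. y \<in> S ==> f y = g y" "Cinf S f"
 shows "Cinf S g"
proof (rule Cinf_upto[where B = "{g. \<exists>f. Cinf S f \<and> (\<forall>y\<in>S. f y = g y)}"])
 show "alg {g. \<exists>f. Cinf S f \<and> (\<forall>y\<in>S. f y = g y)} g" using assms by (auto intro: alg_base)
next
 fix f v assume "f \<in> {g. \<exists>f. Cinf S f \<and> (\<forall>y\<in>S. f y = g y)}"
 then obtain f' where f': "Cinf S f'" "\<forall>y\<in>S. f' y = f y" by blast
 hence "dd v f x = dd v f' x" if "x \<in> S" for x by (intro dd_cong[OF assms(1) that]) auto
 thus "\<exists>g. alg {g. \<exists>f. Cinf S f \<and> (\<forall>y\<in>S. f y = g y)} g \<and> (\<forall>x\<in>S. dd v f x = g x)"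
  using f' by (intro exI[of _ "dd v f'"]) (auto intro!: alg_base)
next
 fix f x assume "f \<in> {g. \<exists>f. Cinf S f \<and> (\<forall>y\<in>S. f y = g y)}" "x \<in> S"
 thus "f differentiable (at x)"
  using differentiable_cong_open[OF assms(1) \<open>x \<in> S\<close>] Cinf_differentiable by blast
qed (rule assms)

lemma Cinf_open_Un:
 assumes "open S" "open T" "Cinf S f" "Cinf T f"
 shows "Cinf (S \<union> T) f"
 using assms unfolding Cinf_def by blast

lemma Cinf_alg:
 assumes "open S" "alg {f. Cinf S f} f"
 shows "Cinf S f"
proof (rule Cinf_upto[OF assms(1) _ _ assms(2)])
 fix f v assume "f \<in> {f. Cinf S f}"
 thus "\<exists>g. alg {f. Cinf S f} g \<and> (\<forall>x\<in>S. dd v f x = g x)"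
  by (intro exI[of _ "dd v f"]) (auto intro!: alg_base)
qed (auto intro: Cinf_differentiable)

context
 fixes S :: "'a::euclidean_space set"
 assumes S: "open S"
begin

lemma Cinf_const: "Cinf S (%x. c)"
 by (rule Cinf_alg[OF S]) (rule alg.intros)

lemma Cinf_add: "Cinf S f ==> Cinf S g ==> Cinf S (%x. f x + g x)"
 by (rule Cinf_alg[OF S]) (auto intro: alg.intros)

lemma Cinf_mult: "Cinf S f ==> Cinf S g ==> Cinf S (%x. f x * g x)"
 by (rule Cinf_alg[OF S]) (auto intro: alg.intros)

lemma Cinf_uminus: "Cinf S f ==> Cinf S (%x. - f x)"
 using Cinf_mult[OF Cinf_const[of "-1"]] by simp

lemma Cinf_diff: "Cinf S f ==> Cinf S g ==> Cinf S (%x. f x - g x)"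
 using Cinf_add[OF _ Cinf_uminus] by simp

lemma Cinf_sum: "(!!i. i \<in> I ==> Cinf S (f i)) ==> Cinf S (%x. \<Sum>i\<in>I. f i x)"
 by (induction I rule: infinite_finite_induct) (auto intro: Cinf_const Cinf_add)

lemma Cinf_prod: "(!!i. i \<in> I ==> Cinf S (f i)) ==> Cinf S (%x. \<Prod>i\<in>I. f i x)"
 by (induction I rule: infinite_finite_induct) (auto intro: Cinf_const Cinf_mult)

lemma Cinf_power: "Cinf S f ==> Cinf S (%x. f x ^ k)"
 by (induction k) (auto intro: Cinf_const Cinf_mult)

lemma Cinf_linear:
 assumes "bounded_linear f"
 shows "Cinf S f"
proof (rule Cinf_upto[OF S, where B = "{f. bounded_linear f}"])
 fix g :: "'a => real" and v assume "g \<in> {f. bounded_linear f}"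
 hence "dd v g x = g v" for x
  by (intro dd_eqI) (auto intro: bounded_linear_imp_has_derivative)
 thus "\<exists>h. alg {f. bounded_linear f} h \<and> (\<forall>x\<in>S. dd v g x = h x)"
  by (intro exI[of _ "%x. g v"]) (auto intro: alg.intros)
qed (use assms in \<open>auto intro: alg.intros bounded_linear_imp_differentiable\<close>)

lemma dd_compose:
 fixes f :: "'a => 'b::euclidean_space"
 assumes f: "!!b. b \<in> Basis ==> (%x. f x \<bullet> b) differentiable (at x)"
  and \<psi>: "\<psi> differentiable (at (f x))"
 shows "(%x. \<psi> (f x)) differentiable (at x)"
  "dd v (%x. \<psi> (f x)) x = (\<Sum>b\<in>Basis. dd b \<psi> (f x) * dd v (%x. f x \<bullet> b) x)"
proof -
 have "(f has_derivative (%v. \<Sum>b\<in>Basis. dd v (%x. f x \<bullet> b) x *\<^sub>R b)) (at x)"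
  using has_derivative_dd[OF f]
  by (subst has_derivative_componentwise_within)
   (auto intro!: has_derivative_eq_rhs simp: inner_sum_left inner_Basis if_distrib cong: if_cong)
 from diff_chain_at[OF this has_derivative_dd[OF \<psi>]]
 have *: "((%x. \<psi> (f x)) has_derivative
   (%v. dd (\<Sum>b\<in>Basis. dd v (%x. f x \<bullet> b) x *\<^sub>R b) \<psi> (f x))) (at x)"
  by (simp add: o_def)
 show "(%x. \<psi> (f x)) differentiable (at x)" using * differentiable_def by blast
 show "dd v (%x. \<psi> (f x)) x = (\<Sum>b\<in>Basis. dd b \<psi> (f x) * dd v (%x. f x \<bullet> b) x)"
  unfolding dd_eqI[OF *, of v] linear_sum[OF dd_linear[OF \<psi>]] linear_cmul[OF dd_linear[OF \<psi>]]
  by (simp add: mult.commute)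
qed

text \<open>The generators are the smooth functions together with all compositions of a smooth
  \<open>\<psi>\<close> with \<open>f\<close>. By the chain rule a derivative of such a composition
  is a sum of products of generators, so no formula for its higher derivatives is needed.\<close>

lemma Cinf_compose:
 fixes f :: "'a => 'b::euclidean_space"
 assumes f: "!!b. b \<in> Basis ==> Cinf S (%x. f x \<bullet> b)"
  and T: "!!x. x \<in> S ==> f x \<in> T" and \<psi>: "Cinf T \<psi>"
 shows "Cinf S (%x. \<psi> (f x))"
proof -
 define B where "B = {f. Cinf S f} \<union> {%x. \<psi> (f x) |\<psi>. Cinf T \<psi>}"
 have diff: "(%x. f x \<bullet> b) differentiable (at x)" if "b \<in> Basis" "x \<in> S" for b x
  using Cinf_differentiable f that by blast
 show ?thesis
 proof (rule Cinf_upto[OF S, where B = B])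
  show "alg B (%x. \<psi> (f x))" using \<psi> by (auto simp: B_def intro!: alg_base)
 next
  fix g x assume g: "g \<in> B" and x: "x \<in> S"
  from g consider "Cinf S g" | \<psi> where "g = (%x. \<psi> (f x))" "Cinf T \<psi>" by (auto simp: B_def)
  thus "g differentiable (at x)"
  proof cases
   case 1 thus ?thesis using Cinf_differentiable x by blast
  next
   case 2 thus ?thesis
    using dd_compose(1)[OF diff[OF _ x] Cinf_differentiable[OF 2(2) T[OF x]]] by simp
  qed
 next
  fix g v assume "g \<in> B"
  then consider "Cinf S g" | \<psi> where "g = (%x. \<psi> (f x))" "Cinf T \<psi>" by (auto simp: B_def)
  thus "\<exists>h. alg B h \<and> (\<forall>x\<in>S. dd v g x = h x)"
  proof cases
   case 1 thus ?thesis by (intro exI[of _ "dd v g"]) (auto simp: B_def intro!: alg_base)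
  next
   case 2
   have "alg B (%x. \<Sum>b\<in>Basis. dd b \<psi> (f x) * dd v (%x. f x \<bullet> b) x)"
    using 2 f by (intro alg_sum alg_mult alg_base) (auto simp: B_def)
   moreover have "dd v g x = (\<Sum>b\<in>Basis. dd b \<psi> (f x) * dd v (%x. f x \<bullet> b) x)" if "x \<in> S" for x
    unfolding 2(1) using dd_compose(2)[OF diff[OF _ that] Cinf_differentiable[OF 2(2) T[OF that]]] .
   ultimately show ?thesis by blast
  qed
 qed
qed

end

section \<open>Reciprocals and square roots of smooth functions\<close>

lemma Cinf_inverse_real: "Cinf (- {0::real}) inverse"
proof (rule Cinf_upto[where B = "{inverse}"])
 fix f :: "real => real" and v assume f: "f \<in> {inverse}"
 have "dd v f x = (-v) * (inverse x * inverse x)" if "x \<noteq> 0" for x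
  using f by (auto intro!: dd_eqI[THEN trans] derivative_eq_intros simp: that)
 thus "\<exists>g. alg {inverse} g \<and> (\<forall>x\<in>-{0}. dd v f x = g x)"
  by (intro exI[of _ "%x. (-v) * (inverse x * inverse x)"] conjI alg_mult alg_const alg_base) auto
next
fix f :: "real => real" and x :: real assume "f \<in> {inverse}" "x \<in> - {0}"
 thus "f differentiable (at x)"
  unfolding differentiable_def by (auto intro!: exI derivative_eq_intros)
qed (auto intro: alg.intros)

text \<open>The derivative of \<open>sqrt\<close> involves \<open>1 / sqrt\<close>, whose own
  derivative is a multiple of its cube; these two functions form a closed set of generators.\<close>

lemma Cinf_sqrt_real: "Cinf {0<..} sqrt"
proof -
 have d: "(sqrt has_derivative (%v. v / 2 * inverse (sqrt x))) (at x)" if "x > 0" for x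
  using DERIV_real_sqrt[OF that] by (rule has_derivative_eq_rhs[OF has_field_derivative_imp_has_derivative]) (simp add: fun_eq_iff)
 show ?thesis
 proof (rule Cinf_upto[where B = "{sqrt, %x. inverse (sqrt x)}"])
 fix f v assume f: "f \<in> {sqrt, %x. inverse (sqrt x)}"
 have 1: "dd v sqrt x = v / 2 * inverse (sqrt x)" if "x > 0" for x
  by (rule dd_eqI[OF d[OF that]])
 have 2: "dd v (%x. inverse (sqrt x)) x =
   -v / 2 * (inverse (sqrt x) * (inverse (sqrt x) * inverse (sqrt x)))" if "x > 0" for x
  by (rule trans[OF dd_eqI[OF Deriv.has_derivative_inverse[OF _ d[OF that]]]]) (use that in auto)
 have 3: "alg {sqrt, %x. inverse (sqrt x)} (%x. v / 2 * inverse (sqrt x))"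
  "alg {sqrt, %x. inverse (sqrt x)}
    (%x. -v / 2 * (inverse (sqrt x) * (inverse (sqrt x) * inverse (sqrt x))))"
  by (intro alg.intros; simp)+
 show "\<exists>g. alg {sqrt, %x. inverse (sqrt x)} g \<and> (\<forall>x\<in>{0<..}. dd v f x = g x)"
  using f 1 2 3 by (metis (no_types, lifting) greaterThan_iff insert_iff singletonD)
next
 fix f and x :: real assume "f \<in> {sqrt, %x. inverse (sqrt x)}" "x \<in> {0<..}"
 thus "f differentiable (at x)"
  using d[of x] Deriv.has_derivative_inverse[OF _ d[of x]]
  unfolding differentiable_def by auto
qed (auto intro: alg.intros)
qed

lemma Cinf_inverse:
 assumes "open S" "Cinf S f" "!!x. x \<in> S ==> f x \<noteq> 0"
 shows "Cinf S (%x. inverse (f x))"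
 using Cinf_compose[OF assms(1), of f "-{0}" inverse] Cinf_inverse_real assms by auto

lemma Cinf_divide:
 assumes "open S" "Cinf S f" "Cinf S g" "!!x. x \<in> S ==> g x \<noteq> 0"
 shows "Cinf S (%x. f x / g x)"
 using Cinf_mult[OF assms(1,2) Cinf_inverse[OF assms(1,3,4)]] by (simp add: divide_inverse)

lemma Cinf_sqrt:
 assumes "open S" "Cinf S f" "!!x. x \<in> S ==> f x > 0"
 shows "Cinf S (%x. sqrt (f x))"
 using Cinf_compose[OF assms(1), of f "{0<..}" sqrt] Cinf_sqrt_real assms by auto

lemmas Cinf_intros = Cinf_const Cinf_add Cinf_mult Cinf_uminus Cinf_diff Cinf_sum Cinf_prod Cinf_power
 Cinf_dd Cinf_inverse Cinf_divide Cinf_sqrt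

lemma Cinf_continuous_on: "Cinf S f ==> continuous_on S f"
 by (intro continuous_at_imp_continuous_on ballI differentiable_imp_continuous_within)
  (rule Cinf_differentiable)

lemma dd_sum:
 assumes "!!i. i \<in> I ==> f i differentiable (at x)"
 shows "dd v (%y. \<Sum>i\<in>I. f i y) x = (\<Sum>i\<in>I. dd v (f i) x)"
 by (rule dd_eqI[THEN trans, OF has_derivative_sum[OF has_derivative_dd[OF assms]]]) auto

lemma dd_diff: "f differentiable (at x) ==> g differentiable (at x) ==>
  dd v (%y. f y - g y) x = dd v f x - dd v g x"
 by (rule dd_eqI[THEN trans, OF has_derivative_diff[OF has_derivative_dd has_derivative_dd]]) auto

lemma dd_cmult: "f differentiable (at x) ==> dd v (%y. c * f y) x = c * dd v f x"
 by (rule dd_eqI[THEN trans, OF has_derivative_mult_right[OF has_derivative_dd]]) auto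

lemma dd_bounded_linear: "bounded_linear f ==> dd v f x = f v"
 by (rule dd_eqI) (rule bounded_linear_imp_has_derivative)

lemma dd_vec: "f differentiable (at x) ==> dd v f x = (\<Oplus>i. v $ i * partial i f x)"
 for f :: "real^'n::finite => real"
 using linear_sum[OF dd_linear, of f x "%i. v $ i *\<^sub>R axis i 1" UNIV]
  linear_cmul[OF dd_linear, of f x "v $ _" "axis _ 1"] basis_expansion[of v]
 by (simp add: partial_eq_dd scalar_mult_eq_scaleR)

text \<open>The bridge to the coordinate-wise notion: a directional derivative is a combination of
  partial derivatives with constant coefficients, so the members of \<open>smooth_on S\<close> are
  generators closed under \<open>dd\<close>.\<close>

lemma smooth_on_iff_Cinf:
 fixes f :: "real^'n::finite => real"
 assumes "open S"
 shows "smooth_on S f \<longleftrightarrow> Cinf S f"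
proof
 assume "Cinf S f"
 have "foldr partial is f = foldr dd (map (%i. axis i 1) is) f" for "is"
  by (induction "is") (auto simp: partial_eq_dd)
 thus "smooth_on S f" using \<open>Cinf S f\<close>
  unfolding smooth_on_def partials_def Cinf_def by auto
next
 assume f: "smooth_on S f"
 show "Cinf S f"
 proof (rule Cinf_upto[OF assms, where B = "Collect (smooth_on S)"])
  fix f :: "real^'n => real" and v assume "f \<in> Collect (smooth_on S)"
  hence f: "partials is f differentiable at x" if "x \<in> S" for "is" x
   by (auto simp: that smooth_on_def)
  have "partials is (partial i f) differentiable at x" if "x \<in> S" for "is" i x
   using f[OF that, of "is @ [i]"] by (simp add: partials_def)
  hence "alg (Collect (smooth_on S)) (%x. \<Oplus>i. v $ i * partial i f x)"
   by (intro alg_sum alg_mult alg_const alg_base) (auto simp: smooth_on_def)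
  thus "\<exists>g. alg (Collect (smooth_on S)) g \<and> (\<forall>x\<in>S. dd v f x = g x)"
   using dd_vec[OF f[of _ "[]", unfolded partials_def foldr.simps id_apply]]
   by (intro exI[of _ "%x. \<Oplus>i. v $ i * partial i f x"]) auto
 next
  fix f :: "real^'n => real" and x assume "f \<in> Collect (smooth_on S)" "x \<in> S"
  hence "partials [] f differentiable at x" unfolding smooth_on_def by blast
  thus "f differentiable at x" by (simp add: partials_def)
 qed (use f in \<open>auto intro: alg.intros\<close>)
qed

text \<open>The second difference \<open>f(x+sv+sw) - f(x+sv) - f(x+sw) + f(x)\<close> equals
 \<open>s\<^sup>2\<close> times a mixed derivative at a nearby point, in either order.\<close>

lemma second_difference:
 assumes "Cinf S f" "s > 0"
  and sub: "!!a b. a \<in> {0..s} ==> b \<in> {0..s} ==> x + a *\<^sub>R v + b *\<^sub>R w \<in> S"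
 shows "\<exists>a\<in>{0..s}. \<exists>b\<in>{0..s}.
  f (x + s *\<^sub>R v + s *\<^sub>R w) - f (x + s *\<^sub>R v) - f (x + s *\<^sub>R w) + f x
   = s * s * dd w (dd v f) (x + a *\<^sub>R v + b *\<^sub>R w)"
proof -
 have 1: "((%a. f (x + a *\<^sub>R v + c *\<^sub>R w)) has_real_derivative dd v f (x + a *\<^sub>R v + c *\<^sub>R w)) (at a)"
  if "a \<in> {0..s}" "c \<in> {0..s}" for a c
 proof -
  have *: "f differentiable (at (x + a *\<^sub>R v + c *\<^sub>R w))"
   using Cinf_differentiable[OF assms(1)] sub that by blast
  have "((%a. x + a *\<^sub>R v + c *\<^sub>R w) has_derivative (%h. h *\<^sub>R v)) (at a)"
   by (auto intro!: derivative_eq_intros)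
  from diff_chain_at[OF this has_derivative_dd[OF *]]
  show ?thesis by (simp add: o_def has_field_derivative_def linear_cmul[OF dd_linear[OF *]] mult_commute_abs)
 qed
 have 2: "((%b. dd v f (x + a *\<^sub>R v + b *\<^sub>R w)) has_real_derivative dd w (dd v f) (x + a *\<^sub>R v + b *\<^sub>R w)) (at b)"
  if "a \<in> {0..s}" "b \<in> {0..s}" for a b
 proof -
  have *: "dd v f differentiable (at (x + a *\<^sub>R v + b *\<^sub>R w))"
   using Cinf_differentiable[OF Cinf_dd[OF assms(1)]] sub that by blast
  have "((%b. x + a *\<^sub>R v + b *\<^sub>R w) has_derivative (%h. h *\<^sub>R w)) (at b)"
   by (auto intro!: derivative_eq_intros)
  from diff_chain_at[OF this has_derivative_dd[OF *]]
  show ?thesis by (simp add: o_def has_field_derivative_def linear_cmul[OF dd_linear[OF *]] mult_commute_abs)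
 qed
 have "((%a. f (x + a *\<^sub>R v + s *\<^sub>R w) - f (x + a *\<^sub>R v)) has_real_derivative
   dd v f (x + a *\<^sub>R v + s *\<^sub>R w) - dd v f (x + a *\<^sub>R v)) (at a)" if "a \<in> {0..s}" for a
  using DERIV_diff[OF 1[OF that, of s] 1[OF that, of 0]] assms(2) by simp
 hence "\<exists>a. 0 < a \<and> a < s \<and>
  f (x + s *\<^sub>R v + s *\<^sub>R w) - f (x + s *\<^sub>R v) - (f (x + 0 *\<^sub>R v + s *\<^sub>R w) - f (x + 0 *\<^sub>R v))
   = (s - 0) * (dd v f (x + a *\<^sub>R v + s *\<^sub>R w) - dd v f (x + a *\<^sub>R v))"
  by (intro MVT2 assms(2)) auto
 then obtain a where a: "a > 0" "a < s"
  "f (x + s *\<^sub>R v + s *\<^sub>R w) - f (x + s *\<^sub>R v) - (f (x + 0 *\<^sub>R v + s *\<^sub>R w) - f (x + 0 *\<^sub>R v))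
   = (s - 0) * (dd v f (x + a *\<^sub>R v + s *\<^sub>R w) - dd v f (x + a *\<^sub>R v))"
  by blast
 have "\<exists>b. 0 < b \<and> b < s \<and>
  dd v f (x + a *\<^sub>R v + s *\<^sub>R w) - dd v f (x + a *\<^sub>R v + 0 *\<^sub>R w)
   = (s - 0) * dd w (dd v f) (x + a *\<^sub>R v + b *\<^sub>R w)"
  by (intro MVT2 assms(2) 2) (use a in auto)
 then obtain b where b: "b > 0" "b < s"
  "dd v f (x + a *\<^sub>R v + s *\<^sub>R w) - dd v f (x + a *\<^sub>R v + 0 *\<^sub>R w)
   = (s - 0) * dd w (dd v f) (x + a *\<^sub>R v + b *\<^sub>R w)"
  by blast
 show ?thesis
  using a b by (intro bexI[of _ a] bexI[of _ b]) (auto simp: algebra_simps)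
qed

lemma dd_commute:
 assumes "open S" "Cinf S f" "x \<in> S"
 shows "dd v (dd w f) x = dd w (dd v f) x"
proof -
 have cont: "continuous (at x) (dd v (dd w f))" "continuous (at x) (dd w (dd v f))"
  using Cinf_continuous_on[OF Cinf_dd[OF Cinf_dd[OF assms(2)]]] assms
   continuous_on_eq_continuous_at by blast+
 have "\<bar>dd v (dd w f) x - dd w (dd v f) x\<bar> \<le> e" if "e > 0" for e
 proof -
  from cont(1) that obtain d1 where d1: "d1 > 0"
   "!!y. dist y x < d1 ==> \<bar>dd v (dd w f) y - dd v (dd w f) x\<bar> < e/2"
   unfolding continuous_at_eps_delta dist_real_def using half_gt_zero by meson
  from cont(2) that obtain d2 where d2: "d2 > 0"
   "!!y. dist y x < d2 ==> \<bar>dd w (dd v f) y - dd w (dd v f) x\<bar> < e/2"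
   unfolding continuous_at_eps_delta dist_real_def using half_gt_zero by meson
  obtain d3 where d3: "d3 > 0" "ball x d3 \<subseteq> S" using assms openE by blast
  define d where "d = min d1 (min d2 d3)"
  \<comment> \<open>The \<open>+ 1\<close> keeps the denominator positive when \<open>v\<close> and
    \<open>w\<close> vanish. The parallelogram with sides \<open>s v\<close> and \<open>s w\<close>
    at \<open>x\<close> then stays within distance \<open>d\<close> of \<open>x\<close>.\<close>
  define s where "s = d / 2 / (norm v + norm w + 1)"
  have d: "d > 0" using d1 d2 d3 by (simp add: d_def)
  have s: "s > 0" unfolding s_def using d by (intro divide_pos_pos) (auto intro: add_nonneg_pos)
  have "norm v + norm w + 1 > 0" by (intro add_nonneg_pos) auto
  hence sl: "s * (norm v + norm w + 1) = d / 2"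
   unfolding s_def by (subst times_divide_eq_left, subst nonzero_mult_div_cancel_right) auto
  have near: "dist (x + a *\<^sub>R v + b *\<^sub>R w) x < d" if "a \<in> {0..s}" "b \<in> {0..s}" for a b
  proof -
   have "norm (a *\<^sub>R v + b *\<^sub>R w) \<le> s * norm v + s * norm w"
    using that by (intro norm_triangle_le add_mono) (auto intro: mult_right_mono)
   also have "\<dots> < d" using sl d s by (simp add: algebra_simps)
   finally show ?thesis by (simp add: dist_norm add.assoc)
  qed
  hence inS: "x + a *\<^sub>R v + b *\<^sub>R w \<in> S" if "a \<in> {0..s}" "b \<in> {0..s}" for a b
  proof -
   have "dist x (x + a *\<^sub>R v + b *\<^sub>R w) < d3"
    using near[OF that] by (simp add: d_def dist_commute)
   thus ?thesis using d3(2) by auto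
  qed
  obtain a b where 1: "a \<in> {0..s}" "b \<in> {0..s}"
   "f (x + s *\<^sub>R v + s *\<^sub>R w) - f (x + s *\<^sub>R v) - f (x + s *\<^sub>R w) + f x
   = s * s * dd w (dd v f) (x + a *\<^sub>R v + b *\<^sub>R w)"
   using second_difference[OF assms(2) s, of x v w] inS by blast
  obtain a' b' where 2: "a' \<in> {0..s}" "b' \<in> {0..s}"
   "f (x + s *\<^sub>R w + s *\<^sub>R v) - f (x + s *\<^sub>R w) - f (x + s *\<^sub>R v) + f x
   = s * s * dd v (dd w f) (x + b' *\<^sub>R w + a' *\<^sub>R v)"
  proof -
   have "x + b *\<^sub>R w + a *\<^sub>R v \<in> S" if "a \<in> {0..s}" "b \<in> {0..s}" for a b
    using inS[OF that] by (simp add: add.commute add.left_commute)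
   from second_difference[OF assms(2) s this] obtain b a where
    "b \<in> {0..s}" "a \<in> {0..s}"
    "f (x + s *\<^sub>R w + s *\<^sub>R v) - f (x + s *\<^sub>R w) - f (x + s *\<^sub>R v) + f x
     = s * s * dd v (dd w f) (x + b *\<^sub>R w + a *\<^sub>R v)" by blast
   thus ?thesis using that[of a b] by simp
  qed
  have "x + s *\<^sub>R w + s *\<^sub>R v = x + s *\<^sub>R v + s *\<^sub>R w" by simp
  hence "dd v (dd w f) (x + a' *\<^sub>R v + b' *\<^sub>R w) = dd w (dd v f) (x + a *\<^sub>R v + b *\<^sub>R w)"
  proof -
   have "s * s * dd v (dd w f) (x + a' *\<^sub>R v + b' *\<^sub>R w)
     = s * s * dd w (dd v f) (x + a *\<^sub>R v + b *\<^sub>R w)"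
   proof -
    have "x + s *\<^sub>R w + s *\<^sub>R v = x + s *\<^sub>R v + s *\<^sub>R w"
     "x + b' *\<^sub>R w + a' *\<^sub>R v = x + a' *\<^sub>R v + b' *\<^sub>R w" by simp_all
    note 3 = 2(3)[unfolded this]
    show ?thesis using 1(3) 3 by linarith
   qed
   thus ?thesis using s by simp
  qed
  moreover have "\<bar>dd v (dd w f) (x + a' *\<^sub>R v + b' *\<^sub>R w) - dd v (dd w f) x\<bar> < e/2"
   "\<bar>dd w (dd v f) (x + a *\<^sub>R v + b *\<^sub>R w) - dd w (dd v f) x\<bar> < e/2"
   by (rule d1(2) d2(2), use near[OF 1(1,2)] near[OF 2(1,2)] in \<open>simp add: d_def\<close>)+
  ultimately show ?thesis by (simp only: abs_le_iff abs_less_iff) linarith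
 qed
 hence "\<bar>dd v (dd w f) x - dd w (dd v f) x\<bar> \<le> 0"
  by (metis field_le_epsilon add_0)
 thus ?thesis by simp
qed

section \<open>The divergence theorem on balls\<close>

lemma lborel_integral_affine:
 fixes f :: "'a::euclidean_space => real"
 assumes [measurable]: "f \<in> borel_measurable borel" and c: "c \<noteq> 0"
 shows "(LINT x|lborel. f x) = \<bar>c\<bar> ^ DIM('a) * (LINT x|lborel. f (t + c *\<^sub>R x))"
proof -
 have "(LINT x|lborel. f x) =
  (LINT x|density (distr lborel borel (%x. t + c *\<^sub>R x)) (%_. ennreal (\<bar>c\<bar> ^ DIM('a))). f x)"
  using lborel_affine[OF c, of t] by (simp add: ennreal_power)
 also have "\<dots> = \<bar>c\<bar> ^ DIM('a) * (LINT x|lborel. f (t + c *\<^sub>R x))"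
  by (subst integral_density) (auto simp: integral_distr)
 finally show ?thesis .
qed

lemma lborel_integrable_affine:
 fixes f :: "'a::euclidean_space => real"
 assumes [measurable]: "f \<in> borel_measurable borel" and c: "c \<noteq> 0"
 shows "integrable lborel (%x. f (t + c *\<^sub>R x)) \<longleftrightarrow> integrable lborel f"
proof -
 have "integrable lborel f \<longleftrightarrow>
  integrable (density (distr lborel borel (%x. t + c *\<^sub>R x)) (%_. ennreal (\<bar>c\<bar> ^ DIM('a)))) f"
  using lborel_affine[OF c, of t] by (simp add: ennreal_power)
 also have "\<dots> \<longleftrightarrow> integrable (distr lborel borel (%x. t + c *\<^sub>R x)) (%x. \<bar>c\<bar> ^ DIM('a) *\<^sub>R f x)"
  by (subst integrable_density) auto
 also have "\<dots> \<longleftrightarrow> integrable lborel (%x. f (t + c *\<^sub>R x))"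
  using c by (subst integrable_distr_eq) auto
 finally show ?thesis by simp
qed

lemma ball_sets_borel [measurable]: "ball c r \<in> sets borel"
 by (rule borel_open) simp

lemma AE_norm_neq: "AE x in lborel. norm (x::'a::euclidean_space) \<noteq> s"
proof -
 have "negligible (frontier (ball (0::'a) s))" by (rule negligible_convex_frontier) simp
 moreover have "{x::'a. norm x = s} \<subseteq> frontier (ball 0 s) \<union> {0}"
 proof (cases "s > 0")
  case True thus ?thesis by (auto simp: frontier_ball)
 qed (auto simp: not_less)
 ultimately have "negligible {x::'a. norm x = s}"
  by (meson negligible_Un negligible_sing negligible_subset)
 hence "AE x in lebesgue. norm (x::'a) \<noteq> s"
  using negligible_iff_null_sets AE_iff_null_sets
  by (metis (mono_tags, lifting) AE_I' mem_Collect_eq subsetI)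
 thus ?thesis by (simp add: AE_completion_iff)
qed

lemma integrable_bounded_support:
 fixes f :: "'a::euclidean_space => real"
 assumes [measurable]: "f \<in> borel_measurable borel"
  and b: "!!x. \<bar>f x\<bar> \<le> C" and z: "!!x. norm x > R ==> f x = 0"
 shows "integrable lborel f"
proof (rule Bochner_Integration.integrable_bound)
 show "integrable lborel (%x::'a. C * indicator (cball 0 R) x)"
  by (intro integrable_mult_right integrable_real_indicator)
   (auto simp: emeasure_bounded_finite[OF bounded_cball, unfolded infinity_ennreal_def])
 show "AE x in lborel. norm (f x) \<le> norm (C * indicator (cball 0 R) x)"
  using b[THEN order_trans[OF _ abs_ge_self]] z by (intro AE_I2) (auto split: split_indicator simp: not_le)
qed simp

lemma difference_quotient_LIMSEQ:
 fixes w :: "'a::euclidean_space => real"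
 assumes "(w has_derivative D) (at x)"
 shows "(%m. (w (x + (1 / Suc m) *\<^sub>R v) - w x) * Suc m) \<longlonglongrightarrow> D v"
proof -
 have "((%s. x + s *\<^sub>R v) has_derivative (%h. h *\<^sub>R v)) (at 0)"
  by (auto intro!: derivative_eq_intros)
 from diff_chain_at[OF this, of w D] assms
 have "((%s. w (x + s *\<^sub>R v)) has_derivative (%h. D (h *\<^sub>R v))) (at 0)" by (simp add: o_def)
 moreover have "D (h *\<^sub>R v) = D v * h" for h
  using linear_cmul[OF has_derivative_linear[OF assms]] by simp
 ultimately have "((%s. w (x + s *\<^sub>R v)) has_real_derivative D v) (at 0)"
  by (simp add: has_field_derivative_def mult_commute_abs)
 hence lim: "((%h. (w (x + h *\<^sub>R v) - w x) / h) \<longlongrightarrow> D v) (at 0)"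
  by (simp add: DERIV_def)
 have "filterlim (%m. 1 / real (Suc m)) (at 0) sequentially"
  by (intro filterlim_atI) (use LIMSEQ_inverse_real_of_nat in \<open>auto simp: inverse_eq_divide\<close>)
 from filterlim_compose[OF lim this] show ?thesis by simp
qed

text \<open>By translation invariance the difference quotients have integral zero.\<close>

lemma integral_derivative_eq_0:
 fixes w :: "'a::euclidean_space => real"
 assumes L: "!!x y. \<bar>w x - w y\<bar> \<le> L * norm (x - y)"
  and z: "!!x. norm x > R ==> w x = 0"
  and d [measurable]: "d \<in> borel_measurable borel"
  and D: "AE x in lborel. \<exists>D. (w has_derivative D) (at x) \<and> D v = d x"
 shows "(LINT x|lborel. d x) = 0"
proof -
 have "continuous_on UNIV w"
 proof (rule lipschitz_on_continuous_on)
  show "(max L 0)-lipschitz_on UNIV w"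
  proof (rule lipschitz_onI)
   fix x y :: 'a
   have "L * norm (x - y) \<le> max L 0 * norm (x - y)" by (intro mult_right_mono) auto
   thus "dist (w x) (w y) \<le> max L 0 * dist x y" using L[of x y] by (simp add: dist_norm)
  qed simp
 qed
 hence w [measurable]: "w \<in> borel_measurable borel"
  by (rule borel_measurable_continuous_onI)
 obtain C where C: "!!x. \<bar>w x\<bar> \<le> C"
 proof -
  have "\<bar>w x\<bar> \<le> \<bar>w 0\<bar> + \<bar>L\<bar> * \<bar>R\<bar>" for x
  proof (cases "norm x > R")
   case False
   have "\<bar>w x\<bar> \<le> \<bar>w 0\<bar> + \<bar>w x - w 0\<bar>" by linarith
   also have "\<bar>w x - w 0\<bar> \<le> \<bar>L\<bar> * \<bar>R\<bar>"
    using L[of x 0] False by (auto intro!: order_trans[OF L] mult_mono)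
   finally show ?thesis by simp
  qed (simp add: z)
  thus ?thesis using that by blast
 qed
 have wi: "integrable lborel w" by (rule integrable_bounded_support[OF w C z])
 \<comment> \<open>By the Lipschitz bound all quotients are dominated by one constant on one ball,
   since the steps \<open>1 / Suc m\<close> are at most 1.\<close>
 have "(%m. LINT x|lborel. (w (x + (1 / Suc m) *\<^sub>R v) - w x) * Suc m) \<longlonglongrightarrow> (LINT x|lborel. d x)"
 proof (rule integral_dominated_convergence)
  show "integrable lborel (%x::'a. \<bar>L\<bar> * norm v * indicator (cball 0 (R + norm v)) x)"
   by (intro integrable_mult_right integrable_real_indicator)
    (auto simp: emeasure_bounded_finite[OF bounded_cball, unfolded infinity_ennreal_def])
  show "AE x in lborel. (%m. (w (x + (1 / Suc m) *\<^sub>R v) - w x) * Suc m) \<longlonglongrightarrow> d x"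
   using D
  proof eventually_elim
   case (elim x)
   then obtain D where D: "(w has_derivative D) (at x)" "D v = d x" by blast
   show ?case using difference_quotient_LIMSEQ[OF D(1), of v] unfolding D(2) .
  qed
 next
  fix m
  show "AE x in lborel. norm ((w (x + (1 / Suc m) *\<^sub>R v) - w x) * Suc m)
    \<le> \<bar>L\<bar> * norm v * indicator (cball 0 (R + norm v)) x"
  proof (rule AE_I2)
   fix x
   have vm: "norm ((1 / Suc m) *\<^sub>R v) \<le> norm v"
    using mult_right_mono[of "1 / Suc m" 1 "norm v"] by simp
   show "norm ((w (x + (1 / Suc m) *\<^sub>R v) - w x) * Suc m)
    \<le> \<bar>L\<bar> * norm v * indicator (cball 0 (R + norm v)) x"
   proof (cases "norm x \<le> R + norm v")
    case True
    have "\<bar>w (x + (1 / Suc m) *\<^sub>R v) - w x\<bar> \<le> \<bar>L\<bar> * norm ((1 / Suc m) *\<^sub>R v)"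
    proof (rule order_trans[OF L])
     show "L * norm (x + (1 / Suc m) *\<^sub>R v - x) \<le> \<bar>L\<bar> * norm ((1 / Suc m) *\<^sub>R v)"
      unfolding add_diff_cancel_left' by (rule mult_right_mono) auto
    qed
    also have "\<dots> = \<bar>L\<bar> * norm v / Suc m" by simp
    finally have "\<bar>w (x + (1 / Suc m) *\<^sub>R v) - w x\<bar> * Suc m \<le> \<bar>L\<bar> * norm v"
     by (subst (asm) pos_le_divide_eq) auto
    thus ?thesis using True by (simp add: abs_mult)
   next
    case False
    have "norm x \<le> norm (x + (1 / Suc m) *\<^sub>R v) + norm ((1 / Suc m) *\<^sub>R v)"
     by (metis add_diff_cancel_right' norm_triangle_ineq4)
    hence "norm (x + (1 / Suc m) *\<^sub>R v) > R" using False vm by linarith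
    moreover have "norm x > R" using False norm_ge_zero[of v] by linarith
    ultimately show ?thesis using z by simp
   qed
  qed
 qed auto
 moreover have "(LINT x|lborel. (w (x + (1 / Suc m) *\<^sub>R v) - w x) * Suc m) = 0" for m
 proof -
  have "integrable lborel (%x. w (x + (1 / Suc m) *\<^sub>R v))"
   using lborel_integrable_affine[OF w, of 1 "(1 / Suc m) *\<^sub>R v"] wi by (simp add: add.commute)
  moreover have "(LINT x|lborel. w (x + (1 / Suc m) *\<^sub>R v)) = (LINT x|lborel. w x)"
   using lborel_integral_affine[OF w, of 1 "(1 / Suc m) *\<^sub>R v"] by (simp add: add.commute)
  ultimately show ?thesis using wi by simp
 qed
 ultimately show ?thesis by (simp add: LIMSEQ_const_iff)
qed

lemma Cinf_lipschitz_on_cball: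
 fixes V :: "'a::euclidean_space => real"
 assumes V: "Cinf UNIV V"
 obtains L where "L \<ge> 0" "!!x y. x \<in> cball 0 r ==> y \<in> cball 0 r ==> \<bar>V x - V y\<bar> \<le> L * norm (x - y)"
proof -
 have "\<exists>B. \<forall>x\<in>cball 0 r. \<bar>dd b V x\<bar> \<le> B" for b
 proof -
  have "compact (dd b V ` cball 0 r)"
   using Cinf_continuous_on[OF Cinf_dd[OF V]]
   by (intro compact_continuous_image) (auto intro: continuous_on_subset)
  thus ?thesis by (force dest: compact_imp_bounded simp: bounded_iff)
 qed
 then obtain B where B: "!!b x. x \<in> cball 0 r ==> \<bar>dd b V x\<bar> \<le> B b" by metis
 define L where "L = (\<Sum>b\<in>Basis. \<bar>B b\<bar>)"
 have "onorm (%v. dd v V x) \<le> L" if "x \<in> cball 0 r" for x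
 proof (rule onorm_le)
  fix v
  have diff: "V differentiable (at x)" by (rule Cinf_differentiable[OF V]) simp
  have "dd v V x = dd (\<Sum>b\<in>Basis. (v \<bullet> b) *\<^sub>R b) V x" by (simp add: euclidean_representation)
  also have "\<dots> = (\<Sum>b\<in>Basis. (v \<bullet> b) * dd b V x)"
   unfolding linear_sum[OF dd_linear[OF diff]] linear_cmul[OF dd_linear[OF diff]] by simp
  finally have eq: "dd v V x = (\<Sum>b\<in>Basis. (v \<bullet> b) * dd b V x)" .
  have "norm (dd v V x) \<le> (\<Sum>b\<in>Basis. norm ((v \<bullet> b) * dd b V x))"
   unfolding eq by (rule norm_sum)
  also have "\<dots> \<le> (\<Sum>b\<in>Basis. norm v * \<bar>B b\<bar>)"
  proof (intro sum_mono)
   fix b :: 'a assume "b \<in> Basis"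
   thus "norm ((v \<bullet> b) * dd b V x) \<le> norm v * \<bar>B b\<bar>"
    unfolding norm_mult real_norm_def abs_mult
    using Basis_le_norm[of b v] B[OF that, of b] by (intro mult_mono) auto
  qed
  also have "\<dots> = L * norm v" by (simp add: L_def sum_distrib_left mult.commute)
  finally show "norm (dd v V x) \<le> L * norm v" .
 qed
 hence "norm (V x - V y) \<le> L * norm (x - y)" if "x \<in> cball 0 r" "y \<in> cball 0 r" for x y
  using that Cinf_differentiable[OF V]
  by (intro differentiable_bound[where S = "cball 0 r" and f' = "%x v. dd v V x"])
   (auto intro!: has_derivative_at_withinI has_derivative_dd)
 moreover have "L \<ge> 0" by (simp add: L_def sum_nonneg)
 ultimately show ?thesis using that by auto
qed

lemma Cinf_bounded_on_cball:
 fixes V :: "'a::euclidean_space => real"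
 assumes V: "Cinf UNIV V"
 obtains C where "C \<ge> 0" "!!x. x \<in> cball 0 r ==> \<bar>V x\<bar> \<le> C"
proof -
 have "compact (V ` cball 0 r)"
  using Cinf_continuous_on[OF V]
  by (intro compact_continuous_image) (auto intro: continuous_on_subset)
 then obtain C where "\<forall>x\<in>cball 0 r. \<bar>V x\<bar> \<le> C"
  by (force dest: compact_imp_bounded simp: bounded_iff)
 thus ?thesis using that[of "max C 0"] by force
qed

lemma Cinf_borel_measurable: "Cinf UNIV f ==> f \<in> borel_measurable borel"
 by (rule borel_measurable_continuous_onI) (rule Cinf_continuous_on)

text \<open>\<open>V\<close> is controlled only on the ball, but the cutoff vanishes outside it: if
  one of the points lies outside, the difference of the products is bounded through the oscillation
  of the cutoff alone.\<close>

lemma lipschitz_mult_cutoff: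
 fixes V \<phi> :: "'a::real_normed_vector => real"
 assumes V: "!!x y. x \<in> cball 0 r ==> y \<in> cball 0 r ==> \<bar>V x - V y\<bar> \<le> L * norm (x - y)"
  "!!x. x \<in> cball 0 r ==> \<bar>V x\<bar> \<le> C" and LC: "L \<ge> 0" "C \<ge> 0" "K \<ge> 0"
  and \<phi>: "!!x y. \<bar>\<phi> x - \<phi> y\<bar> \<le> K * norm (x - y)" "!!x. \<bar>\<phi> x\<bar> \<le> 1" "!!x. norm x > r ==> \<phi> x = 0"
 shows "\<bar>\<phi> x * V x - \<phi> y * V y\<bar> \<le> (C * K + L) * norm (x - y)"
proof -
 have one: "\<bar>\<phi> x * V x - \<phi> y * V y\<bar> \<le> (C * K + L) * norm (x - y)" if x: "norm x \<le> r" for x y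
 proof (cases "norm y \<le> r")
  case True
  have "\<phi> x * V x - \<phi> y * V y = (\<phi> x - \<phi> y) * V x + \<phi> y * (V x - V y)" by (simp add: algebra_simps)
  hence "\<bar>\<phi> x * V x - \<phi> y * V y\<bar> \<le> \<bar>\<phi> x - \<phi> y\<bar> * \<bar>V x\<bar> + \<bar>\<phi> y\<bar> * \<bar>V x - V y\<bar>"
   by (metis abs_mult abs_triangle_ineq)
  also have "\<dots> \<le> K * norm (x - y) * C + 1 * (L * norm (x - y))"
   using x True LC by (intro add_mono mult_mono \<phi> V) auto
  finally show ?thesis by (simp add: algebra_simps)
 next
  case False
  hence "\<bar>\<phi> x * V x - \<phi> y * V y\<bar> = \<bar>\<phi> x - \<phi> y\<bar> * \<bar>V x\<bar>" using \<phi>(3)[of y] by (simp add: abs_mult)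
  also have "\<dots> \<le> K * norm (x - y) * C" using x LC by (intro mult_mono \<phi> V) auto
  also have "\<dots> \<le> (C * K + L) * norm (x - y)" using LC by (simp add: algebra_simps)
  finally show ?thesis .
 qed
 show ?thesis
 proof (cases "norm x \<le> r")
  case True thus ?thesis by (rule one)
 next
  case False
  show ?thesis
  proof (cases "norm y \<le> r")
   case True
   from one[OF this, of x] show ?thesis by (simp add: abs_minus_commute norm_minus_commute)
  next
   case F: False
   have "0 \<le> (C * K + L) * norm (x - y)" using LC by (intro mult_nonneg_nonneg add_nonneg_nonneg) auto
   thus ?thesis using F False \<phi>(3) by simp
  qed
 qed
qed

lemma has_derivative_norm_at:
 "x \<noteq> 0 ==> (norm has_derivative (%v. (x \<bullet> v) / norm x)) (at (x::'a::real_inner))"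
 using has_derivative_norm[of x] by (simp add: sgn_div_norm inner_commute divide_inverse mult.commute)

text \<open>Test the derivative with the radial cutoff that decreases linearly from 1 to 0 in the shell
 \<open>r - \<epsilon> < |x| < r\<close>.\<close>

lemma integral_shell:
 fixes V :: "'a::euclidean_space => real"
 assumes V: "Cinf UNIV V" and \<epsilon>: "0 < \<epsilon>" "\<epsilon> < r"
 shows "(LINT x|lborel. max 0 (min 1 ((r - norm x) / \<epsilon>)) * dd v V x)
  = (LINT x|lborel. indicator {x. r - \<epsilon> < norm x \<and> norm x < r} x * (V x * (x \<bullet> v) / norm x)) / \<epsilon>"
proof -
 define \<phi> where "\<phi> = (%x::'a. max 0 (min 1 ((r - norm x) / \<epsilon>)))"
 define \<psi> where "\<psi> = (%x::'a. indicator {x. r - \<epsilon> < norm x \<and> norm x < r} x * (x \<bullet> v) / norm x / \<epsilon>)"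
 obtain L where L: "L \<ge> 0" "!!x y. x \<in> cball 0 r ==> y \<in> cball 0 r ==> \<bar>V x - V y\<bar> \<le> L * norm (x - y)"
  using Cinf_lipschitz_on_cball[OF V] by metis
 obtain C where C: "C \<ge> 0" "!!x. x \<in> cball 0 r ==> \<bar>V x\<bar> \<le> C"
  using Cinf_bounded_on_cball[OF V] by metis
 obtain C' where C': "C' \<ge> 0" "!!x. x \<in> cball 0 r ==> \<bar>dd v V x\<bar> \<le> C'"
  using Cinf_bounded_on_cball[OF Cinf_dd[OF V]] by metis
 have Vm [measurable]: "V \<in> borel_measurable borel" "dd v V \<in> borel_measurable borel"
  using V by (auto intro: Cinf_borel_measurable)
 have [measurable]: "\<phi> \<in> borel_measurable borel" "\<psi> \<in> borel_measurable borel"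
  unfolding \<phi>_def \<psi>_def by measurable
 have \<phi>1: "\<bar>\<phi> x\<bar> \<le> 1" "0 \<le> \<phi> x" for x by (auto simp: \<phi>_def)
 have \<phi>z: "\<phi> x = 0" if "norm x > r" for x
 proof -
  have "(r - norm x) / \<epsilon> < 0" using that \<epsilon> by (simp add: divide_less_0_iff)
  thus ?thesis unfolding \<phi>_def by simp
 qed
 have \<phi>L: "\<bar>\<phi> x - \<phi> y\<bar> \<le> (1 / \<epsilon>) * norm (x - y)" for x y
 proof -
  have "\<bar>\<phi> x - \<phi> y\<bar> \<le> \<bar>(r - norm x) / \<epsilon> - (r - norm y) / \<epsilon>\<bar>"
   unfolding \<phi>_def by (auto simp: max_def min_def)
  also have "\<dots> = \<bar>norm y - norm x\<bar> / \<epsilon>" using \<epsilon> by (simp flip: diff_divide_distrib)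
  also have "\<dots> \<le> norm (x - y) / \<epsilon>"
   using \<epsilon> norm_triangle_ineq3[of y x] by (intro divide_right_mono) (auto simp: norm_minus_commute)
  finally show ?thesis by simp
 qed
 have D\<phi>: "\<exists>D. (\<phi> has_derivative D) (at x) \<and> D v = - \<psi> x"
  if x: "norm x \<noteq> 0" "norm x \<noteq> r - \<epsilon>" "norm x \<noteq> r" for x
 proof -
  have op: "open {x::'a. norm x < r - \<epsilon>}" "open {x::'a. r < norm x}"
   "open {x::'a. r - \<epsilon> < norm x \<and> norm x < r}"
   by (auto intro!: open_Collect_less open_Collect_conj continuous_intros)
  consider "norm x < r - \<epsilon>" | "r - \<epsilon> < norm x" "norm x < r" | "r < norm x" using x by linarith
  thus ?thesis
  proof cases
   case 1
   have "(\<phi> has_derivative (%_. 0)) (at x)"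
    by (rule has_derivative_transform_within_open[OF _ op(1), of "%_. 1"])
     (use 1 \<epsilon> in \<open>auto simp: \<phi>_def min_def max_def field_simps\<close>)
   thus ?thesis using 1 \<epsilon> by (auto simp: \<psi>_def)
  next
   case 3
   have "(\<phi> has_derivative (%_. 0)) (at x)"
    by (rule has_derivative_transform_within_open[OF _ op(2), of "%_. 0"])
     (use 3 \<phi>z in auto)
   thus ?thesis using 3 \<epsilon> by (auto simp: \<psi>_def)
  next
   case 2
   have "((%x. (r - norm x) / \<epsilon>) has_derivative (%v. - ((x \<bullet> v) / norm x) / \<epsilon>)) (at x)"
    using x \<epsilon> by (auto intro!: derivative_eq_intros has_derivative_norm_at)
   hence "(\<phi> has_derivative (%v. - ((x \<bullet> v) / norm x) / \<epsilon>)) (at x)"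
    by (rule has_derivative_transform_within_open[OF _ op(3)])
     (use 2 \<epsilon> in \<open>auto simp: \<phi>_def min_def max_def field_simps\<close>)
   thus ?thesis using 2 \<epsilon> by (auto simp: \<psi>_def)
  qed
 qed
 have "AE x::'a in lborel. \<exists>D. ((%x. \<phi> x * V x) has_derivative D) (at x)
   \<and> D v = \<phi> x * dd v V x - \<psi> x * V x"
  using AE_norm_neq[of 0] AE_norm_neq[of "r - \<epsilon>"] AE_norm_neq[of r]
 proof eventually_elim
  case (elim x)
  then obtain D where D: "(\<phi> has_derivative D) (at x)" "D v = - \<psi> x" using D\<phi> by blast
  have "((%x. \<phi> x * V x) has_derivative (%v. \<phi> x * dd v V x + D v * V x)) (at x)"
   by (rule has_derivative_mult[OF D(1) has_derivative_dd]) (rule Cinf_differentiable[OF V], simp)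
  thus ?case using D(2)
   by (intro exI[of _ "%v. \<phi> x * dd v V x + D v * V x"] conjI) auto
 qed
 moreover have "\<bar>\<phi> x * V x - \<phi> y * V y\<bar> \<le> (C * (1 / \<epsilon>) + L) * norm (x - y)" for x y
  by (rule lipschitz_mult_cutoff[OF L(2) C(2) L(1) C(1) _ \<phi>L \<phi>1(1) \<phi>z]) (use \<epsilon> in auto)
 moreover have "norm x > r ==> \<phi> x * V x = 0" for x using \<phi>z by simp
 moreover have "(%x. \<phi> x * dd v V x - \<psi> x * V x) \<in> borel_measurable borel" by measurable
 ultimately have "(LINT x|lborel. \<phi> x * dd v V x - \<psi> x * V x) = 0"
  by (intro integral_derivative_eq_0[where w = "%x. \<phi> x * V x"]) assumption+
 moreover have "integrable lborel (%x. \<phi> x * dd v V x)"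
 proof (rule integrable_bounded_support[of _ "1 * C'" r])
  show "\<bar>\<phi> x * dd v V x\<bar> \<le> 1 * C'" for x
  proof (cases "norm x \<le> r")
   case True thus ?thesis unfolding abs_mult by (intro mult_mono \<phi>1 C') auto
  qed (use C' \<phi>z in auto)
 qed (use \<phi>z in auto)
 moreover have "integrable lborel (%x. \<psi> x * V x)"
 proof (rule integrable_bounded_support[of _ "(norm v / \<epsilon>) * C" r])
  show "\<bar>\<psi> x * V x\<bar> \<le> (norm v / \<epsilon>) * C" for x
  proof (cases "norm x \<le> r")
   case True
   have "\<bar>x \<bullet> v\<bar> / norm x / \<epsilon> \<le> norm v / \<epsilon>"
    using \<epsilon> Cauchy_Schwarz_ineq2[of x v] by (intro divide_right_mono) (auto simp: divide_le_eq mult.commute)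
   hence "\<bar>\<psi> x\<bar> \<le> norm v / \<epsilon>" using \<epsilon>
    by (auto simp: \<psi>_def abs_mult split: split_indicator)
   thus ?thesis unfolding abs_mult using True \<epsilon> by (intro mult_mono C') (auto intro: C)
  next
   case False
   hence "\<psi> x = 0" by (simp add: \<psi>_def)
   thus ?thesis using C(1) \<epsilon> by simp
  qed
 qed (simp_all add: \<psi>_def)
 ultimately have "(LINT x|lborel. \<phi> x * dd v V x) = (LINT x|lborel. \<psi> x * V x)" by simp
 also have "\<dots> = (LINT x|lborel. indicator {x. r - \<epsilon> < norm x \<and> norm x < r} x * (V x * (x \<bullet> v) / norm x) / \<epsilon>)"
  by (intro Bochner_Integration.integral_cong) (auto simp: \<psi>_def)
 finally show ?thesis by (simp only: \<phi>_def integral_divide_zero)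
qed

lemma integral_ball_homogeneous:
 fixes f :: "'a::euclidean_space => real"
 assumes [measurable]: "f \<in> borel_measurable borel"
  and f: "!!c x. c > 0 ==> f (c *\<^sub>R x) = f x" and s: "0 < s" "0 < r"
 shows "(LINT x|lborel. indicator (ball 0 s) x * f x)
  = (s / r) ^ DIM('a) * (LINT x|lborel. indicator (ball 0 r) x * f x)"
proof -
 have "(LINT x|lborel. indicator (ball 0 s) x * f x)
  = \<bar>s / r\<bar> ^ DIM('a) * (LINT x|lborel. indicator (ball 0 s) (0 + (s / r) *\<^sub>R x) * f (0 + (s / r) *\<^sub>R x))"
  by (rule lborel_integral_affine) (use s in auto)
 also have "(%x. indicator (ball 0 s) (0 + (s / r) *\<^sub>R x) * f (0 + (s / r) *\<^sub>R x))
   = (%x. indicator (ball 0 r) x * f x)"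
 proof -
  have "s / r * norm x < s \<longleftrightarrow> norm x < r" for x :: 'a using s by (simp add: field_simps)
  thus ?thesis using s f[of "s / r"] by (auto split: split_indicator simp: fun_eq_iff)
 qed
 finally show ?thesis using s by simp
qed

text \<open>Ball integrals of a function homogeneous of degree zero scale like the
  \<open>n\<close>-th power of the radius, so the integral over a shell is an explicit fraction of
  the one over the ball. Divided by \<open>\<epsilon>\<close>, this fraction tends to
  \<open>n / r\<close>.\<close>

lemma integral_shell_homogeneous:
 fixes f :: "'a::euclidean_space => real"
 assumes f_meas [measurable]: "f \<in> borel_measurable borel"
  and f: "!!c x. c > 0 ==> f (c *\<^sub>R x) = f x" "!!x. \<bar>f x\<bar> \<le> C" and \<epsilon>: "0 < \<epsilon>" "\<epsilon> < r"
 shows "(LINT x|lborel. indicator {x. r - \<epsilon> < norm x \<and> norm x < r} x * f x)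
  = (1 - (1 - \<epsilon> / r) ^ DIM('a)) * (LINT x|lborel. indicator (ball 0 r) x * f x)"
proof -
 have C: "C \<ge> 0" using f(2)[of 0] by linarith
 have int: "integrable lborel (%x. indicator (ball 0 s) x * f x)" for s
  by (rule integrable_bounded_support[of _ C s]) (use f(2) C in \<open>auto split: split_indicator\<close>)
 have "(LINT x|lborel. indicator {x. r - \<epsilon> < norm x \<and> norm x < r} x * f x)
  = (LINT x|lborel. indicator (ball 0 r) x * f x - indicator (ball 0 (r - \<epsilon>)) x * f x)"
 proof (rule integral_cong_AE)
  show "AE x in lborel. indicator {x. r - \<epsilon> < norm x \<and> norm x < r} x * f x
    = indicator (ball 0 r) x * f x - indicator (ball 0 (r - \<epsilon>)) x * f x"
   using AE_norm_neq[of "r - \<epsilon>"] by eventually_elim (use \<epsilon> in \<open>auto split: split_indicator\<close>)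
 qed measurable
 also have "\<dots> = (LINT x|lborel. indicator (ball 0 r) x * f x)
   - (LINT x|lborel. indicator (ball 0 (r - \<epsilon>)) x * f x)"
  by (rule Bochner_Integration.integral_diff[OF int int])
 also have "(LINT x|lborel. indicator (ball 0 (r - \<epsilon>)) x * f x)
   = ((r - \<epsilon>) / r) ^ DIM('a) * (LINT x|lborel. indicator (ball 0 r) x * f x)"
  by (rule integral_ball_homogeneous[OF f_meas f(1)]) (use \<epsilon> in auto)
 also have "(r - \<epsilon>) / r = 1 - \<epsilon> / r" using \<epsilon> by (simp add: field_simps)
 finally show ?thesis by (simp add: algebra_simps)
qed

text \<open>Let \<open>\<epsilon>\<close> tend to 0 in \<open>integral_shell\<close>. On the left
  the cutoff tends to the indicator of the ball. On the right \<open>V x\<close> may be replaced by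
  its value at the radial projection of \<open>x\<close>, with an error of order
  \<open>\<epsilon>\<close>, after which the integrand is homogeneous of degree zero. This is the
  divergence theorem for one component, with the boundary integral already in the cone form of
  \<open>sphere_measure\<close>.\<close>

lemma integral_ball_derivative:
 fixes V :: "'a::euclidean_space => real"
 assumes V: "Cinf UNIV V" and r: "r > 0"
 shows "(LINT x|lborel. indicator (ball 0 r) x * dd v V x)
  = real DIM('a) / r * (LINT x|lborel. indicator (ball 0 r) x * (V ((r / norm x) *\<^sub>R x) * (x \<bullet> v) / norm x))"
proof -
 define f where "f = (%x. V ((r / norm x) *\<^sub>R x) * (x \<bullet> v) / norm x)"
 define I where "I = (LINT x|lborel. indicator (ball 0 r) x * f x)"
 \<comment> \<open>The shift by two keeps \<open>\<epsilon> m\<close> strictly below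
   \<open>r\<close>, as \<open>integral_shell\<close> demands, even for
   \<open>m = 0\<close>.\<close>
 define \<epsilon> where "\<epsilon> = (%m. r / Suc (Suc m))"
 define F where "F = (%x. V x * (x \<bullet> v) / norm x)"
 define sh where "sh = (%m. {x::'a. r - \<epsilon> m < norm x \<and> norm x < r})"
 have clip: "max 0 (min 1 t) = 0" if "t \<le> 0" for t :: real using that by linarith
 have \<epsilon>: "0 < \<epsilon> m" "\<epsilon> m < r" for m
  using r by (auto simp: \<epsilon>_def divide_less_eq algebra_simps intro!: add_pos_nonneg)
 obtain L where L: "L \<ge> 0" "!!x y. x \<in> cball 0 r ==> y \<in> cball 0 r ==> \<bar>V x - V y\<bar> \<le> L * norm (x - y)"
  using Cinf_lipschitz_on_cball[OF V] by metis
 obtain C where C: "C \<ge> 0" "!!x. x \<in> cball 0 r ==> \<bar>V x\<bar> \<le> C"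
  using Cinf_bounded_on_cball[OF V] by metis
 obtain C' where C': "C' \<ge> 0" "!!x. x \<in> cball 0 r ==> \<bar>dd v V x\<bar> \<le> C'"
  using Cinf_bounded_on_cball[OF Cinf_dd[OF V]] by metis
 have Vm [measurable]: "V \<in> borel_measurable borel" "dd v V \<in> borel_measurable borel"
  using V by (auto intro: Cinf_borel_measurable)
 have [measurable]: "f \<in> borel_measurable borel" "F \<in> borel_measurable borel"
  unfolding f_def F_def by measurable
 have [measurable]: "sh m \<in> sets borel" for m unfolding sh_def by measurable
 have xv: "\<bar>(x \<bullet> v) / norm x\<bar> \<le> norm v" for x :: 'a
  using Cauchy_Schwarz_ineq2[of x v] by (cases "x = 0") (auto simp: divide_le_eq mult.commute)
 have rad: "(r / norm x) *\<^sub>R x \<in> cball 0 r" for x :: 'a using r by (cases "x = 0") auto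
 have fb: "\<bar>f x\<bar> \<le> C * norm v" for x
  unfolding f_def times_divide_eq_right[symmetric] abs_mult using C xv rad by (intro mult_mono) auto
 have fh: "f (c *\<^sub>R x) = f x" if "c > 0" for c x using that by (simp add: f_def)
 have sh0: "integrable lborel (%x. indicator (sh m) x * (1::real))" for m
  by (rule integrable_bounded_support[of _ 1 r]) (auto simp: sh_def split: split_indicator)
 have int_f: "integrable lborel (%x. indicator (sh m) x * f x)" for m
  by (rule integrable_bounded_support[of _ "C * norm v" r])
   (use fb C in \<open>auto simp: sh_def split: split_indicator\<close>)
 have int_F: "integrable lborel (%x. indicator (sh m) x * F x)" for m
 proof (rule integrable_bounded_support[of _ "C * norm v" r])
  show "\<bar>indicator (sh m) x * F x\<bar> \<le> C * norm v" for x
  proof (cases "x \<in> sh m")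
   case True
   have "\<bar>F x\<bar> \<le> C * norm v"
    unfolding F_def times_divide_eq_right[symmetric] abs_mult
    using C xv True by (intro mult_mono) (auto simp: sh_def)
   thus ?thesis using True by simp
  qed (use C in auto)
 qed (auto simp: sh_def split: split_indicator)
 have vol: "(LINT x|lborel. indicator (sh m) x * (1::real))
   = (1 - (1 - \<epsilon> m / r) ^ DIM('a)) * (LINT x::'a|lborel. indicator (ball 0 r) x * 1)" for m
  unfolding sh_def by (rule integral_shell_homogeneous[where C = 1]) (use \<epsilon> in auto)
 have vol_f: "(LINT x|lborel. indicator (sh m) x * f x) = (1 - (1 - \<epsilon> m / r) ^ DIM('a)) * I" for m
  unfolding sh_def I_def by (rule integral_shell_homogeneous[OF _ fh fb]) (use \<epsilon> in auto)
 \<comment> \<open>A difference quotient of \<open>(1 - h)^n\<close> at \<open>h = 0\<close>, taken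
   along \<open>h = \<epsilon> m / r\<close>.\<close>
 have lim1: "(%m. (1 - (1 - \<epsilon> m / r) ^ DIM('a)) / \<epsilon> m) \<longlonglongrightarrow> DIM('a) / r"
 proof -
  have "((%h. (1 - h) ^ DIM('a)) has_derivative (%h. - real DIM('a) * h)) (at (0::real))"
   by (auto intro!: derivative_eq_intros)
  from LIMSEQ_Suc[OF difference_quotient_LIMSEQ[OF this, of 1]]
  have "(%m. ((1 - 1 / Suc (Suc m)) ^ DIM('a) - 1) * Suc (Suc m)) \<longlonglongrightarrow> - real DIM('a)" by simp
  hence "(%m. - (((1 - 1 / Suc (Suc m)) ^ DIM('a) - 1) * Suc (Suc m)) / r) \<longlonglongrightarrow> - (- real DIM('a)) / r"
   by (intro tendsto_divide tendsto_minus) (use r in auto)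
  moreover have "- (((1 - 1 / Suc (Suc m)) ^ DIM('a) - 1) * Suc (Suc m)) / r
    = (1 - (1 - \<epsilon> m / r) ^ DIM('a)) / \<epsilon> m" for m
  proof -
   have "\<epsilon> m / r = 1 / Suc (Suc m)" using r by (simp add: \<epsilon>_def)
   have "- ((X - 1) * k) / r = (1 - X) / (r / k)" if "k > 0" for X k :: real
    using r that by (simp add: divide_simps algebra_simps)
   from this[of "Suc (Suc m)" "(1 - 1 / Suc (Suc m)) ^ DIM('a)"] show ?thesis
    unfolding \<open>\<epsilon> m / r = _\<close> unfolding \<epsilon>_def by simp
  qed
  ultimately show ?thesis by simp
 qed
 have \<epsilon>0: "\<epsilon> \<longlonglongrightarrow> 0"
  unfolding \<epsilon>_def using LIMSEQ_Suc[OF LIMSEQ_Suc[OF lim_const_over_n[of r]]] by simp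
 have "(%m. \<epsilon> m * ((1 - (1 - \<epsilon> m / r) ^ DIM('a)) / \<epsilon> m)) \<longlonglongrightarrow> 0 * (DIM('a) / r)"
  by (rule tendsto_mult[OF \<epsilon>0 lim1])
 hence lim2: "(%m. 1 - (1 - \<epsilon> m / r) ^ DIM('a)) \<longlonglongrightarrow> 0"
  using \<epsilon>(1) by (simp add: less_imp_neq[symmetric])
 define A where "A = (%m. (LINT x|lborel. max 0 (min 1 ((r - norm x) / \<epsilon> m)) * dd v V x))"
 have A1: "A m = (LINT x|lborel. indicator (sh m) x * F x) / \<epsilon> m" for m
  unfolding A_def sh_def F_def by (rule integral_shell[OF V \<epsilon>])
 have A2: "A \<longlonglongrightarrow> (LINT x|lborel. indicator (ball 0 r) x * dd v V x)"
  unfolding A_def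
 proof (rule integral_dominated_convergence)
  show "integrable lborel (%x::'a. C' * indicator (cball 0 r) x)"
   by (intro integrable_mult_right integrable_real_indicator)
    (auto simp: emeasure_bounded_finite[OF bounded_cball, unfolded infinity_ennreal_def])
  show "AE x in lborel. (%m. max 0 (min 1 ((r - norm x) / \<epsilon> m)) * dd v V x)
    \<longlonglongrightarrow> indicator (ball 0 r) x * dd v V x"
  proof (rule AE_I2)
   fix x
   show "(%m. max 0 (min 1 ((r - norm x) / \<epsilon> m)) * dd v V x)
    \<longlonglongrightarrow> indicator (ball 0 r) x * dd v V x"
   proof (cases "norm x < r")
    case True
    from order_tendstoD(2)[OF \<epsilon>0, of "r - norm x"] True
    have "\<forall>\<^sub>F m in sequentially. \<epsilon> m < r - norm x" by simp
    hence "\<forall>\<^sub>F m in sequentially. max 0 (min 1 ((r - norm x) / \<epsilon> m)) * dd v V x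
      = indicator (ball 0 r) x * dd v V x"
     by eventually_elim (use True \<epsilon> in \<open>auto simp: min_def max_def field_simps\<close>)
    thus ?thesis by (rule tendsto_eventually)
   next
    case False
    hence "(r - norm x) / \<epsilon> m \<le> 0" for m using \<epsilon>(1)[of m] by (simp add: divide_le_0_iff)
    hence "max 0 (min 1 ((r - norm x) / \<epsilon> m)) = 0" for m by (rule clip)
    thus ?thesis using False by simp
   qed
  qed
 next
  fix m
  show "AE x in lborel. norm (max 0 (min 1 ((r - norm x) / \<epsilon> m)) * dd v V x) \<le> C' * indicator (cball 0 r) x"
  proof (rule AE_I2)
   fix x
   show "norm (max 0 (min 1 ((r - norm x) / \<epsilon> m)) * dd v V x) \<le> C' * indicator (cball 0 r) x"
   proof (cases "norm x \<le> r")
    case True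
    have "\<bar>max 0 (min 1 ((r - norm x) / \<epsilon> m))\<bar> * \<bar>dd v V x\<bar> \<le> 1 * C'"
     using True C' by (intro mult_mono) auto
    thus ?thesis using True by (simp add: abs_mult)
   next
    case False
    hence "(r - norm x) / \<epsilon> m \<le> 0" using \<epsilon>(1)[of m] by (simp add: divide_le_0_iff)
    hence "max 0 (min 1 ((r - norm x) / \<epsilon> m)) = 0" by (rule clip)
    thus ?thesis using False by simp
   qed
  qed
 qed measurable
 \<comment> \<open>On the shell \<open>F - f\<close> is at most \<open>L \<epsilon> m |v|\<close>.
   This absorbs the factor \<open>1 / \<epsilon> m\<close>, and the volume of the shell still tends
   to 0.\<close>
 have diff: "\<bar>A m - (1 - (1 - \<epsilon> m / r) ^ DIM('a)) / \<epsilon> m * I\<bar>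
   \<le> L * norm v * ((1 - (1 - \<epsilon> m / r) ^ DIM('a)) * (LINT x::'a|lborel. indicator (ball 0 r) x * 1))" for m
 proof -
  have "A m - (1 - (1 - \<epsilon> m / r) ^ DIM('a)) / \<epsilon> m * I
    = ((LINT x|lborel. indicator (sh m) x * F x) - (LINT x|lborel. indicator (sh m) x * f x)) / \<epsilon> m"
   unfolding A1 vol_f times_divide_eq_left by (rule diff_divide_distrib[symmetric])
  also have "\<dots> = (LINT x|lborel. (indicator (sh m) x * F x - indicator (sh m) x * f x) / \<epsilon> m)"
   using int_F int_f by simp
  finally have eq: "A m - (1 - (1 - \<epsilon> m / r) ^ DIM('a)) / \<epsilon> m * I
    = (LINT x|lborel. (indicator (sh m) x * F x - indicator (sh m) x * f x) / \<epsilon> m)" .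
  have "\<bar>A m - (1 - (1 - \<epsilon> m / r) ^ DIM('a)) / \<epsilon> m * I\<bar>
    \<le> (LINT x|lborel. \<bar>(indicator (sh m) x * F x - indicator (sh m) x * f x) / \<epsilon> m\<bar>)"
   unfolding eq by (rule integral_abs_bound)
  also have "\<dots> \<le> (LINT x|lborel. L * norm v * (indicator (sh m) x * 1))"
  proof (intro integral_mono)
   fix x
   show "\<bar>(indicator (sh m) x * F x - indicator (sh m) x * f x) / \<epsilon> m\<bar>
     \<le> L * norm v * (indicator (sh m) x * 1)"
   proof (cases "x \<in> sh m")
    case True
    hence x: "norm x < r" "r - norm x < \<epsilon> m" "x \<noteq> 0" using \<epsilon>(2)[of m] by (auto simp: sh_def)
    have "norm (x - (r / norm x) *\<^sub>R x) = norm ((1 - r / norm x) *\<^sub>R x)" by (simp add: algebra_simps)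
    also have "\<dots> = \<bar>1 - r / norm x\<bar> * \<bar>norm x\<bar>" by simp
    also have "\<dots> = \<bar>norm x - r\<bar>"
     using x by (simp only: abs_mult[symmetric]) (simp add: left_diff_distrib)
    finally have nx: "norm (x - (r / norm x) *\<^sub>R x) \<le> \<epsilon> m" using x by simp
    have "F x - f x = (V x - V ((r / norm x) *\<^sub>R x)) * ((x \<bullet> v) / norm x)"
     by (simp add: F_def f_def algebra_simps diff_divide_distrib)
    hence "\<bar>F x - f x\<bar> = \<bar>V x - V ((r / norm x) *\<^sub>R x)\<bar> * \<bar>(x \<bullet> v) / norm x\<bar>" by (simp add: abs_mult)
    also have "\<dots> \<le> (L * \<epsilon> m) * norm v"
    proof (intro mult_mono xv)
     have "\<bar>V x - V ((r / norm x) *\<^sub>R x)\<bar> \<le> L * norm (x - (r / norm x) *\<^sub>R x)"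
      using x by (intro L rad) auto
     also have "\<dots> \<le> L * \<epsilon> m" by (intro mult_left_mono nx L)
     finally show "\<bar>V x - V ((r / norm x) *\<^sub>R x)\<bar> \<le> L * \<epsilon> m" .
    qed (use L \<epsilon>(1)[of m] in auto)
    finally have "\<bar>F x - f x\<bar> / \<epsilon> m \<le> L * norm v"
     using \<epsilon>(1)[of m] by (simp add: divide_le_eq mult_ac)
    thus ?thesis using True \<epsilon>(1)[of m] by (simp add: abs_divide)
   qed simp
  qed (use int_F int_f sh0 in auto)
  also have "\<dots> = L * norm v * ((1 - (1 - \<epsilon> m / r) ^ DIM('a)) * (LINT x::'a|lborel. indicator (ball 0 r) x * 1))"
   by (simp only: integral_mult_right_zero vol)
  finally show ?thesis .
 qed
 define vol0 where "vol0 = (LINT x::'a|lborel. indicator (ball 0 r) x * (1::real))"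
 have "(%m. L * norm v * ((1 - (1 - \<epsilon> m / r) ^ DIM('a)) * vol0)) \<longlonglongrightarrow> L * norm v * (0 * vol0)"
  by (rule tendsto_mult[OF tendsto_const tendsto_mult[OF lim2 tendsto_const]])
 hence lim3: "(%m. L * norm v * ((1 - (1 - \<epsilon> m / r) ^ DIM('a)) * vol0)) \<longlonglongrightarrow> 0"
  by (simp only: mult_zero_left mult_zero_right)
 have "(%m. A m - (1 - (1 - \<epsilon> m / r) ^ DIM('a)) / \<epsilon> m * I) \<longlonglongrightarrow> 0"
 proof (rule Lim_null_comparison[OF always_eventually lim3], intro allI)
  fix m
  show "norm (A m - (1 - (1 - \<epsilon> m / r) ^ DIM('a)) / \<epsilon> m * I)
    \<le> L * norm v * ((1 - (1 - \<epsilon> m / r) ^ DIM('a)) * vol0)"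
   unfolding vol0_def real_norm_def by (rule diff)
 qed
 from tendsto_add[OF this tendsto_mult_right[OF lim1, of I]]
 have "A \<longlonglongrightarrow> DIM('a) / r * I" by (simp only: diff_add_cancel add_0)
 from LIMSEQ_unique[OF A2 this] show ?thesis by (simp add: I_def f_def)
qed

text \<open>Unfolds the cone measure. The integrand is known to be measurable only on the sphere,
  while the radial projection sends the origin to itself, off the sphere: a null set for the
  integral, but it needs separate care for measurability.\<close>

lemma sphere_measure_integral:
 fixes f :: "real^'n::finite => real"
 assumes [measurable]: "set_borel_measurable borel (sphere 0 r) f" and r: "r > 0"
 shows "(LINT x:sphere 0 r|sphere_measure r. f x)
  = real CARD('n) / r * (LINT x|lborel. indicator (ball 0 r) x * f ((r / norm x) *\<^sub>R x))"
proof -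
 define c where "c = real CARD('n) / r"
 define N :: "(real^'n) measure" where
  "N = distr (restrict_space lborel (ball 0 r)) borel (%x. (r / norm x) *\<^sub>R x)"
 have m: "(%x::real^'n. (r / norm x) *\<^sub>R x) \<in> restrict_space lborel (ball 0 r) \<rightarrow>\<^sub>M borel"
  by (rule measurable_restrict_space1) measurable
 have f: "(%x. indicator (sphere 0 r) x *\<^sub>R f x) \<in> borel_measurable borel"
  using assms(1) by (simp add: set_borel_measurable_def)
 have "sphere_measure r = density N (%_. ennreal c)"
 proof (rule measure_eqI)
  fix A :: "(real^'n) set" assume "A \<in> sets (sphere_measure r)"
  hence "A \<in> sets N" by (simp add: sphere_measure_def N_def)
  thus "emeasure (sphere_measure r) A = emeasure (density N (%_. ennreal c)) A"
   by (simp add: emeasure_density_const sphere_measure_def N_def c_def)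
 qed (simp add: sphere_measure_def N_def)
 hence "(LINT x:sphere 0 r|sphere_measure r. f x)
  = (LINT x|density N (%_. ennreal c). indicator (sphere 0 r) x *\<^sub>R f x)"
  by (simp add: set_lebesgue_integral_def)
 also have "\<dots> = (LINT x|N. c *\<^sub>R (indicator (sphere 0 r) x *\<^sub>R f x))"
  using f r by (intro integral_density) (auto simp: N_def c_def)
 also have "\<dots> = c * (LINT x|N. indicator (sphere 0 r) x *\<^sub>R f x)" by simp
 also have "(LINT x|N. indicator (sphere 0 r) x *\<^sub>R f x) = (LINT x|restrict_space lborel (ball 0 r).
   indicator (sphere 0 r) ((r / norm x) *\<^sub>R x) *\<^sub>R f ((r / norm x) *\<^sub>R x))"
  unfolding N_def by (rule integral_distr[OF m f])
 also have "\<dots> = (LINT x|lborel. indicator (ball 0 r) x *\<^sub>R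
   (indicator (sphere 0 r) ((r / norm x) *\<^sub>R x) *\<^sub>R f ((r / norm x) *\<^sub>R x)))"
  by (rule integral_restrict_space) simp
 also have "\<dots> = (LINT x|lborel. indicator (ball 0 r) x * f ((r / norm x) *\<^sub>R x))"
 proof (rule integral_cong_AE)
  show "AE x in lborel. indicator (ball 0 r) x *\<^sub>R
   (indicator (sphere 0 r) ((r / norm x) *\<^sub>R x) *\<^sub>R f ((r / norm x) *\<^sub>R x))
   = indicator (ball 0 r) x * f ((r / norm (x::real^'n)) *\<^sub>R x)"
   using AE_norm_neq[of 0] by eventually_elim (use r in \<open>auto split: split_indicator\<close>)
  have *: "(%x::real^'n. indicator (sphere 0 r) ((r / norm x) *\<^sub>R x) *\<^sub>R f ((r / norm x) *\<^sub>R x))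
    \<in> borel_measurable borel"
   by (rule measurable_compose[OF _ f]) measurable
  thus m1: "(%x. indicator (ball 0 r) x *\<^sub>R (indicator (sphere 0 r) ((r / norm x) *\<^sub>R x) *\<^sub>R
    f ((r / norm (x::real^'n)) *\<^sub>R x))) \<in> borel_measurable lborel" by measurable
  have "(%x. indicator (ball 0 r) x * f ((r / norm x) *\<^sub>R x)) = (%x::real^'n. if x = 0 then
   indicator (ball 0 r) x * f 0 else indicator (ball 0 r) x *\<^sub>R (indicator (sphere 0 r) ((r / norm x) *\<^sub>R x) *\<^sub>R
    f ((r / norm x) *\<^sub>R x)))"
   using r by (auto simp: fun_eq_iff split: split_indicator)
  also have "\<dots> \<in> borel_measurable lborel" using m1 by measurable
  finally show "(%x. indicator (ball 0 r) x * f ((r / norm (x::real^'n)) *\<^sub>R x)) \<in> borel_measurable lborel" .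
 qed
 finally show ?thesis by (simp add: c_def)
qed

theorem sphere_divergence:
 fixes V :: "'n::finite => real^'n => real"
 assumes V: "!!j. Cinf UNIV (V j)" and r: "r > 0"
 shows "(LINT x:sphere 0 r|sphere_measure r. \<Oplus>j. V j x * ((1 / r) *\<^sub>R x) $ j)
  = (LINT x|lborel. indicator (ball 0 r) x * (\<Oplus>j. partial j (V j) x))"
proof -
 have [measurable]: "V j \<in> borel_measurable borel" "partial j (V j) \<in> borel_measurable borel" for j
  using V by (auto intro: Cinf_borel_measurable simp: partial_eq_dd)
 have nth: "(%x::real^'n. x $ j) \<in> borel_measurable borel" for j
  by (intro borel_measurable_continuous_onI continuous_intros)
 have nth' [measurable]: "(%x::real^'n. x \<bullet> axis j 1) \<in> borel_measurable borel" for j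
  by (intro borel_measurable_continuous_onI continuous_intros)
 have int1: "integrable lborel (%x. indicator (ball 0 r) x * partial j (V j) x)" for j
 proof -
  obtain C where "C \<ge> 0" "!!x. x \<in> cball 0 r ==> \<bar>partial j (V j) x\<bar> \<le> C"
   using Cinf_bounded_on_cball[OF Cinf_dd[OF V]] by (metis partial_eq_dd)
  thus ?thesis by (intro integrable_bounded_support[of _ C r]) (auto split: split_indicator)
 qed
 have int2: "integrable lborel (%x. indicator (ball 0 r) x * (V j ((r / norm x) *\<^sub>R x) * (x \<bullet> axis j 1) / norm x))" for j
 proof -
  obtain C where C: "C \<ge> 0" "!!x. x \<in> cball 0 r ==> \<bar>V j x\<bar> \<le> C"
   using Cinf_bounded_on_cball[OF V] by metis
  have "\<bar>V j ((r / norm x) *\<^sub>R x) * (x \<bullet> axis j 1) / norm x\<bar> \<le> C * 1" for x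
  proof -
   have "\<bar>(x \<bullet> axis j 1) / norm x\<bar> \<le> 1"
    using component_le_norm_cart[of x j] by (cases "x = 0") (auto simp: inner_axis divide_le_eq)
   moreover have "(r / norm x) *\<^sub>R x \<in> cball 0 r" using r by (cases "x = 0") auto
   ultimately show ?thesis
    unfolding times_divide_eq_right[symmetric] abs_mult using C by (intro mult_mono) auto
  qed
  thus ?thesis using C
   by (intro integrable_bounded_support[of _ C r]) (auto split: split_indicator)
 qed
 have "(LINT x:sphere 0 r|sphere_measure r. \<Oplus>j. V j x * ((1 / r) *\<^sub>R x) $ j)
  = real CARD('n) / r * (LINT x|lborel. indicator (ball 0 r) x * (\<Sum>j\<in>UNIV.
    V j ((r / norm x) *\<^sub>R x) * ((1 / r) *\<^sub>R ((r / norm x) *\<^sub>R x)) $ j))"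
 proof (intro sphere_measure_integral r)
  have [measurable]: "sphere (0::real^'n) r \<in> sets borel" by (intro borel_closed) simp
  note [measurable] = nth
  show "set_borel_measurable borel (sphere 0 r) (%x. \<Oplus>j. V j x * ((1 / r) *\<^sub>R x) $ j)"
   unfolding set_borel_measurable_def vector_scaleR_component by measurable
 qed
 also have "\<dots> = real CARD('n) / r * (LINT x|lborel. (\<Oplus>j. indicator (ball 0 r) x *
    (V j ((r / norm x) *\<^sub>R x) * (x \<bullet> axis j 1) / norm x)))"
  using r by (simp add: sum_distrib_left inner_axis mult_ac)
 also have "\<dots> = (\<Oplus>j. real CARD('n) / r * (LINT x|lborel. indicator (ball 0 r) x *
    (V j ((r / norm x) *\<^sub>R x) * (x \<bullet> axis j 1) / norm x)))"
  by (subst Bochner_Integration.integral_sum[OF int2]) (simp add: sum_distrib_left)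
 also have "\<dots> = (\<Oplus>j. (LINT x|lborel. indicator (ball 0 r) x * partial j (V j) x))"
  using integral_ball_derivative[OF V r] by (simp add: partial_eq_dd)
 also have "\<dots> = (LINT x|lborel. (\<Oplus>j. indicator (ball 0 r) x * partial j (V j) x))"
  by (subst Bochner_Integration.integral_sum[OF int1]) simp
 finally show ?thesis by (simp add: sum_distrib_left)
qed

text \<open>On a ball slightly larger than the support, the boundary integral in
  \<open>integral_ball_derivative\<close> is zero.\<close>

lemma integral_dd_compact_support:
 fixes w :: "'a::euclidean_space => real"
 assumes w: "Cinf UNIV w" and z: "!!x. norm x > R ==> w x = 0"
 shows "(LINT x|lborel. dd v w x) = 0"
proof -
 define r where "r = \<bar>R\<bar> + 1"
 have "dd v w x = 0" if "norm x > R" for x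
  by (rule trans[OF dd_cong[of "{x. norm x > R}" x w "%_. 0"] dd_const])
   (use that z in \<open>auto intro!: open_Collect_less continuous_intros\<close>)
 hence "(LINT x|lborel. dd v w x) = (LINT x|lborel. indicator (ball 0 r) x * dd v w x)"
  by (intro Bochner_Integration.integral_cong) (auto simp: r_def split: split_indicator)
 also have "\<dots> = real DIM('a) / r * (LINT x|lborel. indicator (ball 0 r) x * (w ((r / norm x) *\<^sub>R x) * (x \<bullet> v) / norm x))"
  by (rule integral_ball_derivative[OF w]) (simp add: r_def)
 also have "(LINT x|lborel. indicator (ball 0 r) x * (w ((r / norm x) *\<^sub>R x) * (x \<bullet> v) / norm x))
   = (LINT x::'a|lborel. 0)"
 proof (intro Bochner_Integration.integral_cong refl)
  fix x :: 'a
  show "indicator (ball 0 r) x * (w ((r / norm x) *\<^sub>R x) * (x \<bullet> v) / norm x) = 0"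
  proof (cases "x = 0")
   case False
   hence "norm ((r / norm x) *\<^sub>R x) > R" by (simp add: r_def)
   thus ?thesis using z by simp
  qed simp
 qed
 finally show ?thesis by simp
qed

section \<open>Bump functions and weak derivatives\<close>

text \<open>\<open>flat 0\<close> is the usual \<open>exp (-1/t)\<close>. The powers of
  \<open>1/t\<close> are carried along because the derivative of \<open>flat k\<close> is a
  combination of \<open>flat (k + 1)\<close> and \<open>flat (k + 2)\<close>, so the family is
  closed under differentiation.\<close>

definition flat :: "nat => real => real" where
 "flat k t = (if t \<le> 0 then 0 else inverse t ^ k * exp (- inverse t))"

lemma flat_DERIV: "(flat k has_real_derivative flat (k + 2) t - real k * flat (k + 1) t) (at t)"
proof -
 consider "t > 0" | "t < 0" | "t = 0" by linarith
 thus ?thesis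
 proof cases
  case 1
  have "((%t. inverse t ^ k * exp (- inverse t)) has_real_derivative
   flat (k + 2) t - real k * flat (k + 1) t) (at t)"
   using 1 by (auto intro!: derivative_eq_intros simp: flat_def power2_eq_square algebra_simps)
    (cases k; simp)
  thus ?thesis
   by (rule has_field_derivative_transform_within_open[of _ _ _ "{0<..}"]) (use 1 in \<open>auto simp: flat_def\<close>)
 next
  case 2
  have "((%t. 0) has_real_derivative 0) (at t)" by simp
  hence "(flat k has_real_derivative 0) (at t)"
   by (rule has_field_derivative_transform_within_open[of _ _ _ "{..<0}"]) (use 2 in \<open>auto simp: flat_def\<close>)
  thus ?thesis using 2 by (simp add: flat_def)
 next
  case 3
  have "((%h. (flat k (0 + h) - flat k 0) / h) \<longlongrightarrow> 0) (at 0)"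
  proof (rule filterlim_split_at)
   have "\<forall>\<^sub>F h in at_left 0. (flat k (0 + h) - flat k 0) / h = 0"
    by (auto simp: eventually_at_filter flat_def)
   thus "((%h. (flat k (0 + h) - flat k 0) / h) \<longlongrightarrow> 0) (at_left 0)" by (rule tendsto_eventually)
   have "((%h. inverse h ^ (k + 1) / exp (inverse h)) \<longlongrightarrow> 0) (at_right (0::real))"
    by (rule filterlim_compose[OF tendsto_power_div_exp_0 filterlim_inverse_at_top_right])
   moreover have "\<forall>\<^sub>F h in at_right 0. inverse h ^ (k + 1) / exp (inverse h) = (flat k (0 + h) - flat k 0) / h"
    by (auto simp: eventually_at_filter flat_def exp_minus divide_inverse)
   ultimately show "((%h. (flat k (0 + h) - flat k 0) / h) \<longlongrightarrow> 0) (at_right 0)"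
    using tendsto_cong by fast
  qed
  thus ?thesis using 3 by (simp add: DERIV_def flat_def)
 qed
qed

lemma Cinf_flat: "Cinf UNIV (flat k)"
proof (rule Cinf_upto[where B = "range flat"])
 fix f :: "real => real" and v assume "f \<in> range flat"
 then obtain k where k: "f = flat k" by blast
 have "dd v f t = v * (flat (k + 2) t + (- real k) * flat (k + 1) t)" for t
  using flat_DERIV[of k t] unfolding k has_field_derivative_def
  by (simp add: dd_eqI algebra_simps)
 moreover have "alg (range flat) (%t. v * (flat (k + 2) t + (- real k) * flat (k + 1) t))"
  by (intro alg.intros) auto
 ultimately show "\<exists>g. alg (range flat) g \<and> (\<forall>t\<in>UNIV. dd v f t = g t)" by blast
next
 fix f :: "real => real" and x assume "f \<in> range flat"
 thus "f differentiable (at x)" using flat_DERIV by (auto simp: has_field_derivative_def differentiable_def)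
qed (auto intro: alg.intros)

lemma flat_bounds: "0 \<le> flat 0 t" "flat 0 t \<le> 1" "t \<le> 0 ==> flat 0 t = 0" "t > 0 ==> flat 0 t > 0"
 by (auto simp: flat_def)

lemma flat_LIMSEQ: "(%m. flat 0 (real m * t)) \<longlonglongrightarrow> (if t > 0 then 1 else 0)"
proof (cases "t > 0")
 case True
 have "(%m. exp (- (inverse (real m) * inverse t))) \<longlonglongrightarrow> exp (- (0 * inverse t))"
  by (intro tendsto_intros lim_inverse_n)
 moreover have "\<forall>\<^sub>F m in sequentially. exp (- (inverse (real m) * inverse t)) = flat 0 (real m * t)"
  using eventually_gt_at_top[of 0] by eventually_elim (use True in \<open>auto simp: flat_def mult_le_0_iff\<close>)
 ultimately show ?thesis using True tendsto_cong by fastforce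
next
 case False
 hence "flat 0 (real m * t) = 0" for m by (intro flat_bounds) (simp add: mult_nonneg_nonpos)
 thus ?thesis using False by simp
qed

text \<open>As \<open>m\<close> grows, each factor tends to the indicator of an open half-space; the
  bumps live in the box and tend boundedly to its indicator.\<close>

definition box_bump :: "'a::euclidean_space => 'a => real => 'a => real" where
 "box_bump a b m x = (\<Prod>i\<in>Basis. flat 0 (m * (x \<bullet> i - a \<bullet> i)) * flat 0 (m * (b \<bullet> i - x \<bullet> i)))"

lemma Cinf_inner: "open S ==> Cinf S (%x. x \<bullet> b)"
 by (intro Cinf_linear bounded_linear_inner_left)

lemma Cinf_flat_compose: "open S ==> Cinf S f ==> Cinf S (%x. flat k (f x))"
 using Cinf_compose[of S f UNIV "flat k"] Cinf_flat by simp

lemma Cinf_box_bump: "Cinf UNIV (box_bump a b m)"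
 unfolding box_bump_def by (intro Cinf_intros Cinf_flat_compose Cinf_inner open_UNIV)

lemma box_bump_bounds: "0 \<le> box_bump a b m x" "box_bump a b m x \<le> 1"
 unfolding box_bump_def
 by (auto intro!: prod_nonneg prod_le_1 mult_le_one mult_nonneg_nonneg flat_bounds)

lemma box_bump_eq_0: "m \<ge> 0 ==> x \<notin> box a b ==> box_bump a b m x = 0"
proof -
 assume m: "m \<ge> 0" and "x \<notin> box a b"
 then obtain i where i: "i \<in> Basis" "x \<bullet> i \<le> a \<bullet> i \<or> b \<bullet> i \<le> x \<bullet> i" by (auto simp: mem_box not_less)
 hence "flat 0 (m * (x \<bullet> i - a \<bullet> i)) * flat 0 (m * (b \<bullet> i - x \<bullet> i)) = 0"
  using m by (auto intro!: flat_bounds mult_nonneg_nonpos)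
 thus ?thesis unfolding box_bump_def using i(1) by (intro prod_zero) auto
qed

lemma box_bump_LIMSEQ: "(%m. box_bump a b (real m) x) \<longlonglongrightarrow> indicator (box a b) x"
proof -
 have "(%m. box_bump a b (real m) x) \<longlonglongrightarrow> (\<Prod>i\<in>Basis.
   (if x \<bullet> i - a \<bullet> i > 0 then 1 else 0) * (if b \<bullet> i - x \<bullet> i > 0 then 1 else (0::real)))"
  unfolding box_bump_def by (intro tendsto_intros flat_LIMSEQ)
 also have "(\<Prod>i\<in>Basis. (if x \<bullet> i - a \<bullet> i > 0 then 1 else 0) * (if b \<bullet> i - x \<bullet> i > 0 then 1 else (0::real)))
   = indicator (box a b) x"
 proof (cases "x \<in> box a b")
  case True thus ?thesis by (auto simp: mem_box)
 next
  case False
  then obtain i where "i \<in> Basis" "x \<bullet> i \<le> a \<bullet> i \<or> b \<bullet> i \<le> x \<bullet> i" by (auto simp: mem_box not_less)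
  hence "(\<Prod>i\<in>Basis. (if x \<bullet> i - a \<bullet> i > 0 then 1 else 0) * (if b \<bullet> i - x \<bullet> i > 0 then 1 else (0::real))) = 0"
   by (intro prod_zero) force+
  thus ?thesis using False by simp
 qed
 finally show ?thesis .
qed

text \<open>A function of \<open>x \<bullet> x\<close> and not of \<open>norm x\<close>, which makes
  it smooth at the origin too; \<open>a\<close> and \<open>b\<close> are therefore thresholds for
  the squared norm.\<close>

definition radial_step :: "real => real => 'a::euclidean_space => real" where
 "radial_step a b x = flat 0 (x \<bullet> x - a) / (flat 0 (x \<bullet> x - a) + flat 0 (b - x \<bullet> x))"

lemma radial_step:
 assumes "a < b"
 shows "Cinf UNIV (radial_step a b)" "x \<bullet> x \<le> a ==> radial_step a b x = 0" "x \<bullet> x \<ge> b ==> radial_step a b x = 1"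
proof -
 have pos: "flat 0 (s - a) + flat 0 (b - s) > 0" for s
  using assms flat_bounds(1)[of "s - a"] flat_bounds(1)[of "b - s"]
   flat_bounds(4)[of "s - a"] flat_bounds(4)[of "b - s"] by linarith
 have "Cinf UNIV (%x::'a. \<Sum>i\<in>Basis. (x \<bullet> i) * (x \<bullet> i))"
  by (intro Cinf_intros Cinf_inner open_UNIV)
 hence "Cinf UNIV (%x::'a. x \<bullet> x)" using euclidean_inner[of x x for x :: 'a] by simp
 thus "Cinf UNIV (radial_step a b :: 'a => real)"
  unfolding radial_step_def
  by (intro Cinf_intros Cinf_flat_compose open_UNIV less_imp_neq[OF pos, symmetric])
 show "x \<bullet> x \<le> a ==> radial_step a b x = 0" by (simp add: radial_step_def flat_bounds)
 show "x \<bullet> x \<ge> b ==> radial_step a b x = 1"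
  using pos[of "x \<bullet> x"] by (simp add: radial_step_def flat_bounds)
qed

text \<open>The positive and the negative part of \<open>f\<close> are densities of two measures
  that agree on open boxes, an intersection-stable generator of the Borel sets. So the measures
  agree, and densities are unique almost everywhere.\<close>

lemma AE_eq_0_if_box_integrals_eq_0:
 fixes f :: "'a::euclidean_space => real"
 assumes f: "integrable lborel f"
  and z: "!!a b. (LINT x|lborel. indicator (box a b) x * f x) = 0"
 shows "AE x in lborel. f x = 0"
proof -
 have [measurable]: "f \<in> borel_measurable borel" using f by (simp add: integrable_iff_bounded)
 define P where "P = (%x. ennreal (max 0 (f x)))"
 define N where "N = (%x. ennreal (max 0 (- f x)))"
 have [measurable]: "P \<in> borel_measurable borel" "N \<in> borel_measurable borel" unfolding P_def N_def by measurable
 have int: "integrable lborel (%x. max 0 (f x) * indicator (box a b) x)"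
  "integrable lborel (%x. max 0 (- f x) * indicator (box a b) x)" for a b
  by (rule Bochner_Integration.integrable_bound[OF f]; auto split: split_indicator)+
 have P: "(\<integral>\<^sup>+x. P x * indicator (box a b) x \<partial>lborel) = ennreal (LINT x|lborel. max 0 (f x) * indicator (box a b) x)" for a b
  unfolding P_def using int(1)[of a b]
  by (subst nn_integral_eq_integral[symmetric]) (auto intro!: nn_integral_cong split: split_indicator)
 have N: "(\<integral>\<^sup>+x. N x * indicator (box a b) x \<partial>lborel) = ennreal (LINT x|lborel. max 0 (- f x) * indicator (box a b) x)" for a b
  unfolding N_def using int(2)[of a b]
  by (subst nn_integral_eq_integral[symmetric]) (auto intro!: nn_integral_cong split: split_indicator)
 have PN: "(LINT x|lborel. max 0 (f x) * indicator (box a b) x) = (LINT x|lborel. max 0 (- f x) * indicator (box a b) x)" for a b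
 proof -
  have "(LINT x|lborel. max 0 (f x) * indicator (box a b) x) - (LINT x|lborel. max 0 (- f x) * indicator (box a b) x)
   = (LINT x|lborel. max 0 (f x) * indicator (box a b) x - max 0 (- f x) * indicator (box a b) x)"
   using int by simp
  also have "\<dots> = (LINT x|lborel. indicator (box a b) x * f x)"
   by (intro Bochner_Integration.integral_cong) (auto split: split_indicator)
  finally show ?thesis using z by simp
 qed
 have "density lborel P = density lborel N"
 proof (rule measure_eqI_generator_eq)
  let ?E = "range (%(a, b). box a b::'a set)"
  show "Int_stable ?E" by (auto simp: Int_stable_def box_Int_box)
  show "?E \<subseteq> Pow UNIV" "sets (density lborel P) = sigma_sets UNIV ?E"
   "sets (density lborel N) = sigma_sets UNIV ?E"
   by (simp_all add: borel_eq_box)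
  let ?A = "%n::nat. box (- (real n *\<^sub>R One)) (real n *\<^sub>R One) :: 'a set"
  show "range ?A \<subseteq> ?E" "(\<Union>i. ?A i) = UNIV" unfolding UN_box_eq_UNIV by auto
  show "emeasure (density lborel P) (?A i) \<noteq> \<infinity>" for i by (simp add: emeasure_density P)
  show "emeasure (density lborel P) X = emeasure (density lborel N) X" if "X \<in> ?E" for X
   using that by (auto simp: emeasure_density P N PN)
 qed
 hence "AE x in lborel. P x = N x" by (subst (asm) sigma_finite_measure.density_unique_iff[OF sigma_finite_lborel]) auto
 thus ?thesis by eventually_elim (auto simp: P_def N_def max_def split: if_splits)
qed

text \<open>Box bumps are admissible test functions and tend to indicators of boxes, so the
  integrals of \<open>f\<close> over all boxes whose closure lies in \<open>\<Omega>\<close> vanish.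
  Countably many such boxes cover \<open>\<Omega>\<close> (Lindelof), which makes the exceptional
  set a null set.\<close>

lemma du_bois_reymond:
 fixes f :: "'a::euclidean_space => real"
 assumes \<Omega>: "open \<Omega>"
  and f: "!!a b. cbox a b \<subseteq> \<Omega> ==> integrable lborel (%x. indicator (cbox a b) x * f x)"
  and z: "!!\<phi> a b. Cinf UNIV \<phi> ==> cbox a b \<subseteq> \<Omega> ==> (!!x. x \<notin> cbox a b ==> \<phi> x = 0) ==>
   (LINT x|lborel. indicator \<Omega> x * (f x * \<phi> x)) = 0"
 shows "AE x in lborel. x \<in> \<Omega> \<longrightarrow> f x = 0"
proof -
 have box0: "(LINT x|lborel. indicator (box a b) x * f x) = 0" if ab: "cbox a b \<subseteq> \<Omega>" for a b
 proof -
  have fm [measurable]: "(%x. indicator (cbox a b) x * f x) \<in> borel_measurable borel"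
   using f[OF ab] by (simp add: integrable_iff_bounded)
  have [measurable]: "box_bump a b m \<in> borel_measurable borel" for m
   by (rule Cinf_borel_measurable[OF Cinf_box_bump])
  have eq: "indicator (box a b) x * f x = indicator (box a b) x * (indicator (cbox a b) x * f x)" for x
   using box_subset_cbox[of a b] by (auto split: split_indicator)
  have "(%m. LINT x|lborel. box_bump a b (real m) x * (indicator (cbox a b) x * f x))
    \<longlonglongrightarrow> (LINT x|lborel. indicator (box a b) x * f x)"
   unfolding eq
  proof (rule integral_dominated_convergence)
   show "integrable lborel (%x. \<bar>indicator (cbox a b) x * f x\<bar>)" using f[OF ab] by (rule integrable_abs)
   show "AE x in lborel. norm (box_bump a b (real m) x * (indicator (cbox a b) x * f x))
     \<le> \<bar>indicator (cbox a b) x * f x\<bar>" for m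
    by (intro AE_I2) (auto simp: abs_mult box_bump_bounds intro!: mult_left_le_one_le mult_nonneg_nonneg)
   show "AE x in lborel. (%m. box_bump a b (real m) x * (indicator (cbox a b) x * f x))
     \<longlonglongrightarrow> indicator (box a b) x * (indicator (cbox a b) x * f x)"
    by (intro AE_I2 tendsto_intros box_bump_LIMSEQ)
  qed measurable
  moreover have "(LINT x|lborel. box_bump a b (real m) x * (indicator (cbox a b) x * f x)) = 0" for m
  proof -
   have bb: "box_bump a b (real m) x = 0" if "x \<notin> cbox a b" for x
    using that box_subset_cbox[of a b] by (intro box_bump_eq_0) auto
   have "(LINT x|lborel. box_bump a b (real m) x * (indicator (cbox a b) x * f x))
    = (LINT x|lborel. indicator \<Omega> x * (f x * box_bump a b (real m) x))"
    using ab bb by (intro Bochner_Integration.integral_cong) (auto split: split_indicator)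
   thus ?thesis using z[OF Cinf_box_bump ab bb] by simp
  qed
  ultimately show ?thesis by (simp add: LIMSEQ_const_iff)
 qed
 have AE_box: "AE x in lborel. x \<in> box c d \<longrightarrow> f x = 0" if cd: "cbox c d \<subseteq> \<Omega>" for c d
 proof -
  have "AE x in lborel. indicator (box c d) x * f x = 0"
  proof (rule AE_eq_0_if_box_integrals_eq_0)
   have [measurable]: "(%x. indicator (cbox c d) x * f x) \<in> borel_measurable borel"
    using f[OF cd] by (simp add: integrable_iff_bounded)
   have eq: "(%x. indicator (box c d) x * f x) = (%x. indicator (box c d) x * (indicator (cbox c d) x * f x))"
    using box_subset_cbox[of c d] by (auto split: split_indicator simp: fun_eq_iff)
   show "integrable lborel (%x. indicator (box c d) x * f x)"
    unfolding eq by (rule Bochner_Integration.integrable_bound[OF f[OF cd]]) (auto split: split_indicator)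
   fix a b
   define a' where "a' = (\<Sum>i\<in>Basis. max (a \<bullet> i) (c \<bullet> i) *\<^sub>R i)"
   define b' where "b' = (\<Sum>i\<in>Basis. min (b \<bullet> i) (d \<bullet> i) *\<^sub>R i)"
   have box: "box a b \<inter> box c d = box a' b'" by (simp add: box_Int_box a'_def b'_def)
   have "cbox a' b' \<subseteq> cbox c d" by (auto simp: mem_box a'_def b'_def)
   hence "(LINT x|lborel. indicator (box a' b') x * f x) = 0" using cd by (intro box0) auto
   thus "(LINT x|lborel. indicator (box a b) x * (indicator (box c d) x * f x)) = 0"
    by (simp add: box[symmetric] indicator_inter_arith mult.assoc)
  qed
  thus ?thesis by eventually_elim (auto split: split_indicator_asm)
 qed
 define \<F> where "\<F> = {box c d |c d. cbox c d \<subseteq> \<Omega>}"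
 have "\<Union>\<F> = \<Omega>"
 proof
  show "\<Union>\<F> \<subseteq> \<Omega>"
  proof (intro Union_least)
   fix B assume "B \<in> \<F>"
   then obtain c d where "B = box c d" "cbox c d \<subseteq> \<Omega>" by (auto simp: \<F>_def)
   thus "B \<subseteq> \<Omega>" using box_subset_cbox[of c d] by simp
  qed
  show "\<Omega> \<subseteq> \<Union>\<F>"
  proof
   fix x assume "x \<in> \<Omega>"
   from open_contains_cbox[OF \<Omega> this] obtain c d where "x \<in> box c d" "cbox c d \<subseteq> \<Omega>" by metis
   thus "x \<in> \<Union>\<F>" by (auto simp: \<F>_def)
  qed
 qed
 moreover have "!!B. B \<in> \<F> ==> open B" by (auto simp: \<F>_def)
 then obtain \<F>' where F': "\<F>' \<subseteq> \<F>" "countable \<F>'" "\<Union>\<F>' = \<Union>\<F>"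
  using Lindelof[of \<F>] by metis
 have "AE x in lborel. \<forall>B\<in>\<F>'. x \<in> B \<longrightarrow> f x = 0"
 proof (subst AE_ball_countable[OF F'(2)], rule ballI)
  fix B assume "B \<in> \<F>'"
  then obtain c d where "B = box c d" "cbox c d \<subseteq> \<Omega>" using F'(1) by (auto simp: \<F>_def)
  thus "AE x in lborel. x \<in> B \<longrightarrow> f x = 0" using AE_box by simp
 qed
 ultimately show ?thesis using F'(3) by (auto elim!: eventually_mono)
qed

lemma Cinf_extend_zero:
 assumes "open \<Omega>" "closed K" "K \<subseteq> \<Omega>" "Cinf \<Omega> f" "!!x. x \<in> \<Omega> - K ==> f x = 0"
 shows "Cinf UNIV (%x. if x \<in> \<Omega> then f x else 0)"
proof -
 have "Cinf \<Omega> (%x. if x \<in> \<Omega> then f x else 0)"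
  by (rule Cinf_cong[OF assms(1) _ assms(4)]) simp
 moreover have "Cinf (- K) (%x. if x \<in> \<Omega> then f x else 0)"
  by (rule Cinf_cong[OF _ _ Cinf_const[of _ 0]]) (use assms in auto)
 moreover have "\<Omega> \<union> - K = UNIV" using assms by auto
 ultimately show ?thesis using Cinf_open_Un[OF assms(1) open_Compl[OF assms(2)]] by metis
qed

lemma integration_by_parts_compact:
 fixes u \<phi> :: "'a::euclidean_space => real"
 assumes \<Omega>: "open \<Omega>" and u: "Cinf \<Omega> u" and \<phi>: "Cinf UNIV \<phi>"
  and K: "compact K" "K \<subseteq> \<Omega>" "!!x. x \<notin> K ==> \<phi> x = 0"
 shows "(LINT x|lborel. indicator \<Omega> x * (u x * dd v \<phi> x)) = - (LINT x|lborel. indicator \<Omega> x * (dd v u x * \<phi> x))"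
  and "integrable lborel (%x. indicator \<Omega> x * (u x * \<phi> x))"
proof -
 have int: "integrable lborel (%x. indicator \<Omega> x * (u x * \<phi> x))"
  if u: "Cinf \<Omega> u" and \<phi>: "Cinf UNIV \<phi>" and z: "!!x. x \<notin> K ==> \<phi> x = 0" for u \<phi>
 proof -
  have *: "(%x. indicator \<Omega> x * (u x * \<phi> x)) = (%x. if x \<in> \<Omega> then u x * \<phi> x else 0)" by auto
  have "Cinf UNIV (%x. if x \<in> \<Omega> then u x * \<phi> x else 0)"
   using K z by (intro Cinf_extend_zero[OF \<Omega> _ K(2)] Cinf_mult[OF \<Omega> u] compact_imp_closed Cinf_subset[OF \<phi>]) auto
  hence c: "Cinf UNIV (%x. indicator \<Omega> x * (u x * \<phi> x))" by (simp add: *)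
  obtain R where R: "!!x. x \<in> K ==> norm x \<le> R"
   using compact_imp_bounded[OF K(1)] by (auto simp: bounded_iff)
  obtain C where C: "C \<ge> 0" "!!x. x \<in> cball 0 R ==> \<bar>indicator \<Omega> x * (u x * \<phi> x)\<bar> \<le> C"
   using Cinf_bounded_on_cball[OF c] by metis
  show ?thesis
  proof (rule integrable_bounded_support[OF Cinf_borel_measurable[OF c], of C R])
   show "\<bar>indicator \<Omega> x * (u x * \<phi> x)\<bar> \<le> C" for x
    using C R z[of x] by (cases "x \<in> K") auto
   show "norm x > R ==> indicator \<Omega> x * (u x * \<phi> x) = 0" for x using R[of x] z[of x] by fastforce
  qed
 qed
 show "integrable lborel (%x. indicator \<Omega> x * (u x * \<phi> x))" by (rule int[OF u \<phi> K(3)])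
 define w where "w = (%x. if x \<in> \<Omega> then u x * \<phi> x else 0)"
 have w: "Cinf UNIV w" unfolding w_def
  using K by (intro Cinf_extend_zero[OF \<Omega> _ K(2)] Cinf_mult[OF \<Omega> u] compact_imp_closed Cinf_subset[OF \<phi>]) auto
 have dz: "dd v \<phi> x = 0" if "x \<notin> K" for x
  by (rule trans[OF dd_cong[of "- K" x \<phi> "%_. 0"] dd_const])
   (use that K in \<open>auto intro: compact_imp_closed\<close>)
 have "dd v w x = indicator \<Omega> x * (u x * dd v \<phi> x) + indicator \<Omega> x * (dd v u x * \<phi> x)" for x
 proof (cases "x \<in> \<Omega>")
  case True
  have "dd v w x = dd v (%x. u x * \<phi> x) x"
   by (rule dd_cong[OF \<Omega> True]) (simp add: w_def)
  also have "\<dots> = u x * dd v \<phi> x + dd v u x * \<phi> x"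
   using True by (intro dd_mult Cinf_differentiable[OF u] Cinf_differentiable[OF \<phi>]) auto
  finally show ?thesis using True by simp
 next
  case False
  hence "dd v w x = dd v (%_. 0) x"
   using K by (intro dd_cong[of "- K"]) (auto simp: w_def intro: compact_imp_closed)
  thus ?thesis using False by simp
 qed
 moreover obtain R where R: "!!x. x \<in> K ==> norm x \<le> R"
  using compact_imp_bounded[OF K(1)] by (auto simp: bounded_iff)
 have "(LINT x|lborel. dd v w x) = 0"
  by (rule integral_dd_compact_support[OF w, of R]) (use R K(3) in \<open>force simp: w_def\<close>)
 ultimately have "(LINT x|lborel. indicator \<Omega> x * (u x * dd v \<phi> x) + indicator \<Omega> x * (dd v u x * \<phi> x)) = 0"
  by simp
 thus "(LINT x|lborel. indicator \<Omega> x * (u x * dd v \<phi> x)) = - (LINT x|lborel. indicator \<Omega> x * (dd v u x * \<phi> x))"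
  using int[OF u Cinf_dd[OF \<phi>] dz] int[OF Cinf_dd[OF u] \<phi> K(3)] by simp
qed

section \<open>Classical and weak derivatives of higher order\<close>

lemma partials_Nil [simp]: "partials [] f = f"
 and partials_Cons: "partials (i # is) f = dd (axis i 1) (partials is f)"
 by (simp_all add: partials_def partial_eq_dd)

lemma partials_snoc: "partials (is @ [i]) f = partials is (partial i f)"
 by (simp add: partials_def)

lemma Cinf_partials: "Cinf S f ==> Cinf S (partials is f)"
 by (induction "is") (auto simp: partials_Cons)

lemma dd_partials_commute:
 assumes "open S" "Cinf S f" "x \<in> S"
 shows "dd (axis i 1) (partials is f) x = partials is (dd (axis i 1) f) x"
 using assms(3)
proof (induction "is" arbitrary: x)
 case (Cons j "is")
 have "dd (axis i 1) (partials (j # is) f) x = dd (axis j 1) (dd (axis i 1) (partials is f)) x"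
  unfolding partials_Cons by (rule dd_commute[OF assms(1) Cinf_partials[OF assms(2)] Cons.prems])
 also have "\<dots> = dd (axis j 1) (partials is (dd (axis i 1) f)) x"
  by (rule dd_cong[OF assms(1) Cons.prems Cons.IH])
 finally show ?case by (simp add: partials_Cons)
qed simp

text \<open>Each integration by parts takes the outermost derivative off \<open>\<phi>\<close> and
  makes it the innermost one on \<open>u\<close>; symmetry of second derivatives restores the order
  of the list.\<close>

lemma classical_partials_weak:
 fixes u :: "real^'n::finite => real"
 assumes \<Omega>: "open \<Omega>" and u: "Cinf \<Omega> u" and \<phi>: "Cinf UNIV \<phi>"
  and K: "compact K" "K \<subseteq> \<Omega>" "!!x. x \<notin> K ==> \<phi> x = 0"
 shows "(LINT x|lborel. indicator \<Omega> x * (u x * partials is \<phi> x))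
  = (- 1) ^ length is * (LINT x|lborel. indicator \<Omega> x * (partials is u x * \<phi> x))"
 using u
proof (induction "is" arbitrary: u)
 case (Cons i "is")
 have z: "partials is \<phi> x = 0" if "x \<notin> K" for x
 proof -
  have "partials is \<phi> y = 0" if "y \<in> - K" for y
   using that
  proof (induction "is" arbitrary: y)
   case (Cons j "is")
   have "dd (axis j 1) (partials is \<phi>) y = dd (axis j 1) (%_. 0) y"
    by (rule dd_cong[OF _ Cons.prems Cons.IH]) (use K in \<open>auto intro: compact_imp_closed\<close>)
   thus ?case by (simp add: partials_Cons)
  qed (use K in auto)
  thus ?thesis using that by simp
 qed
 have "(LINT x|lborel. indicator \<Omega> x * (u x * partials (i # is) \<phi> x))
   = - (LINT x|lborel. indicator \<Omega> x * (dd (axis i 1) u x * partials is \<phi> x))"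
  unfolding partials_Cons
  by (rule integration_by_parts_compact(1)[OF \<Omega> Cons.prems Cinf_partials[OF \<phi>] K(1,2) z])
 also have "(LINT x|lborel. indicator \<Omega> x * (dd (axis i 1) u x * partials is \<phi> x))
  = (- 1) ^ length is * (LINT x|lborel. indicator \<Omega> x * (partials is (dd (axis i 1) u) x * \<phi> x))"
  by (rule Cons.IH) (rule Cinf_dd[OF Cons.prems])
 also have "(LINT x|lborel. indicator \<Omega> x * (partials is (dd (axis i 1) u) x * \<phi> x))
  = (LINT x|lborel. indicator \<Omega> x * (partials (i # is) u x * \<phi> x))"
  by (intro Bochner_Integration.integral_cong refl)
   (auto simp: partials_Cons dd_partials_commute[OF \<Omega> Cons.prems] split: split_indicator)
 finally show ?case by simp
qed simp

text \<open>Lets the weighted norms, which speak of some family of weak derivatives, be evaluated on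
  the classical derivatives of the smooth metric components.\<close>

lemma weak_partials_AE_eq:
 fixes u :: "real^'n::finite => real"
 assumes \<Omega>: "open \<Omega>" and u: "Cinf \<Omega> u" and v: "Lp_loc \<Omega> p v" "p \<ge> 1"
  and w: "weak_partials \<Omega> is u v"
 shows "AE x in lborel. x \<in> \<Omega> \<longrightarrow> v x = partials is u x"
proof -
 have vm: "(%x. indicator \<Omega> x * v x) \<in> borel_measurable borel"
  using v(1) by (simp add: Lp_loc_def set_borel_measurable_def)
 have int_v: "integrable lborel (%x. indicator (cbox a b) x * v x)" if ab: "cbox a b \<subseteq> \<Omega>" for a b
 proof -
  have eq: "(%x. indicator (cbox a b) x * v x) = (%x. indicator (cbox a b) x * (indicator \<Omega> x * v x))"
   using ab by (auto simp: fun_eq_iff split: split_indicator)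
  have m: "(%x. indicator (cbox a b) x * v x) \<in> borel_measurable borel"
   unfolding eq using vm by measurable
  have "(\<integral>\<^sup>+x. ennreal \<bar>indicator (cbox a b) x * v x\<bar> \<partial>lborel)
   \<le> (\<integral>\<^sup>+x. indicator (cbox a b) x + ennreal (\<bar>indicator (cbox a b) x * v x\<bar> powr p) \<partial>lborel)"
  proof (rule nn_integral_mono)
   fix x
   show "ennreal \<bar>indicator (cbox a b) x * v x\<bar>
     \<le> indicator (cbox a b) x + ennreal (\<bar>indicator (cbox a b) x * v x\<bar> powr p)"
   proof (cases "x \<in> cbox a b")
    case True
    \<comment> \<open>Local integrability from local \<open>L^p\<close> by a pointwise bound:
      \<open>|v|\<close> is at most 1 or at most \<open>|v|^p\<close>, since
      \<open>p \<ge> 1\<close>.\<close>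
    have "\<bar>v x\<bar> \<le> 1 + \<bar>v x\<bar> powr p"
    proof (cases "\<bar>v x\<bar> \<le> 1")
     case False
     hence "\<bar>v x\<bar> powr 1 \<le> \<bar>v x\<bar> powr p" using v by (intro powr_mono) auto
     thus ?thesis using False by simp
    qed (use powr_ge_zero[of "\<bar>v x\<bar>" p] in linarith)
    hence "ennreal \<bar>v x\<bar> \<le> ennreal 1 + ennreal (\<bar>v x\<bar> powr p)"
     by (subst ennreal_plus[symmetric]) (auto intro: ennreal_leI simp del: ennreal_plus)
    thus ?thesis using True by simp
   qed simp
  qed
  also have "\<dots> = (\<integral>\<^sup>+x. indicator (cbox a b) x \<partial>lborel)
    + (\<integral>\<^sup>+x. ennreal (\<bar>indicator (cbox a b) x * v x\<bar> powr p) \<partial>lborel)"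
   using m by (intro nn_integral_add) auto
  also have "(\<integral>\<^sup>+x. ennreal (\<bar>indicator (cbox a b) x * v x\<bar> powr p) \<partial>lborel)
    = (\<integral>\<^sup>+x\<in>cbox a b. ennreal (\<bar>v x\<bar> powr p) \<partial>lborel)"
   by (intro nn_integral_cong) (auto split: split_indicator)
  also have "(\<integral>\<^sup>+x. indicator (cbox a b) x \<partial>lborel) + \<dots> < \<infinity>"
   using v(1) ab compact_cbox[of a b]
   by (auto simp: Lp_loc_def ennreal_add_less_top emeasure_bounded_finite[OF bounded_cbox, unfolded infinity_ennreal_def])
  finally show ?thesis using m by (simp add: integrable_iff_bounded)
 qed
 have int_u: "integrable lborel (%x. indicator (cbox a b) x * partials is u x)" if ab: "cbox a b \<subseteq> \<Omega>" for a b
  using borel_integrable_compact[of "cbox a b" "partials is u"] ab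
   continuous_on_subset[OF Cinf_continuous_on[OF Cinf_partials[OF u, of "is"]] ab]
  by (simp add: indicator_def if_distrib cong: if_cong)
 have "AE x in lborel. x \<in> \<Omega> \<longrightarrow> v x - partials is u x = 0"
 proof (rule du_bois_reymond[OF \<Omega>])
  fix a b assume "cbox a b \<subseteq> \<Omega>"
  thus "integrable lborel (%x. indicator (cbox a b) x * (v x - partials is u x))"
   using int_v int_u by (simp add: right_diff_distrib)
 next
  fix \<phi> :: "real^'n => real" and a b assume \<phi>: "Cinf UNIV \<phi>" and ab: "cbox a b \<subseteq> \<Omega>"
   and z: "!!x. x \<notin> cbox a b ==> \<phi> x = 0"
  have "test_function \<Omega> \<phi>"
   unfolding test_function_def using \<phi> ab z compact_cbox smooth_on_iff_Cinf[OF open_UNIV] by blast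
  hence "(LINT x|lborel. indicator \<Omega> x * (u x * partials is \<phi> x))
   = (- 1) ^ length is * (LINT x|lborel. indicator \<Omega> x * (v x * \<phi> x))"
   using w by (simp add: weak_partials_def set_lebesgue_integral_def)
  hence eq: "(LINT x|lborel. indicator \<Omega> x * (v x * \<phi> x)) = (LINT x|lborel. indicator \<Omega> x * (partials is u x * \<phi> x))"
   using classical_partials_weak[OF \<Omega> u \<phi> compact_cbox ab z, of "is"] by simp
  have i1: "integrable lborel (%x. indicator \<Omega> x * (partials is u x * \<phi> x))"
   by (rule integration_by_parts_compact(2)[OF \<Omega> Cinf_partials[OF u] \<phi> compact_cbox ab z])
  obtain C where C: "!!x. \<bar>\<phi> x\<bar> \<le> C"
  proof -
   obtain R where "\<forall>x\<in>cbox a b. norm x \<le> R"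
    using bounded_cbox[of a b] unfolding bounded_iff by blast
   hence R: "cbox a b \<subseteq> cball 0 R" by auto
   obtain C where C: "C \<ge> 0" "!!x. x \<in> cball 0 R ==> \<bar>\<phi> x\<bar> \<le> C"
    using Cinf_bounded_on_cball[OF \<phi>] by metis
   have "\<bar>\<phi> x\<bar> \<le> C" for x using C R z[of x] by (cases "x \<in> cbox a b") auto
   thus ?thesis using that by blast
  qed
  have "integrable lborel (%x. C * (indicator (cbox a b) x * v x))"
   using int_v[OF ab] by simp
  hence i2: "integrable lborel (%x. indicator \<Omega> x * (v x * \<phi> x))"
  proof (rule Bochner_Integration.integrable_bound)
   have "(%x. indicator \<Omega> x * v x * \<phi> x) \<in> borel_measurable borel"
    using vm Cinf_borel_measurable[OF \<phi>] by measurable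
   thus "(%x. indicator \<Omega> x * (v x * \<phi> x)) \<in> borel_measurable lborel" by (simp add: mult.assoc)
   show "AE x in lborel. norm (indicator \<Omega> x * (v x * \<phi> x)) \<le> norm (C * (indicator (cbox a b) x * v x))"
   proof (rule AE_I2)
    fix x
    have "\<bar>v x\<bar> * \<bar>\<phi> x\<bar> \<le> \<bar>C\<bar> * \<bar>v x\<bar>" using C[of x] by (subst mult.commute) (intro mult_right_mono, auto)
    thus "norm (indicator \<Omega> x * (v x * \<phi> x)) \<le> norm (C * (indicator (cbox a b) x * v x))"
     using z[of x] ab by (cases "x \<in> cbox a b") (auto simp: abs_mult split: split_indicator)
   qed
  qed
  show "(LINT x|lborel. indicator \<Omega> x * ((v x - partials is u x) * \<phi> x)) = 0"
   using i1 i2 eq by (simp add: left_diff_distrib right_diff_distrib)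
 qed
 thus ?thesis by eventually_elim simp
qed

section \<open>The weighted Sobolev embedding\<close>

text \<open>Cubes instead of balls: averages over a \<open>cbox\<close> can be differentiated under
  the integral sign by the Leibniz rule, and scaling maps cubes to cubes.\<close>

definition cube :: "'a::euclidean_space => real => 'a set" where
 "cube x \<rho> = cbox (x - \<rho> *\<^sub>R One) (x + \<rho> *\<^sub>R One)"

lemma mem_cube: "z \<in> cube x \<rho> \<longleftrightarrow> (\<forall>i\<in>Basis. \<bar>z \<bullet> i - x \<bullet> i\<bar> \<le> \<rho>)"
 by (fastforce simp: cube_def mem_box inner_diff_left inner_add_left abs_le_iff)

lemma compact_cube [simp]: "compact (cube x \<rho>)"
 by (simp add: cube_def)

lemma cube_sets [measurable]: "cube x \<rho> \<in> sets borel"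
 by (simp add: cube_def)

lemma cube_affine: "c > 0 ==> x + c *\<^sub>R y \<in> cube x (c * \<rho>) \<longleftrightarrow> y \<in> cube 0 \<rho>"
 by (auto simp: mem_cube inner_add_left abs_mult)

lemma cube_mono: "\<rho> \<le> \<rho>' ==> cube x \<rho> \<subseteq> cube x \<rho>'"
 by (force simp: mem_cube)

lemma cube_norm_le: "z \<in> cube (x::'a::euclidean_space) \<rho> ==> norm (z - x) \<le> real DIM('a) * \<rho>"
proof -
 assume z: "z \<in> cube x \<rho>"
 have "norm (z - x) \<le> (\<Sum>i\<in>Basis. \<bar>(z - x) \<bullet> i\<bar>)" by (rule norm_le_l1)
 also have "\<dots> \<le> (\<Sum>i\<in>(Basis::'a set). (\<rho>::real))"
  using z by (intro sum_mono) (auto simp: mem_cube inner_diff_left)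
 finally show ?thesis by simp
qed

lemma measure_unit_cube: "(LINT y|lborel. indicator (cube (0::'a::euclidean_space) 1) y) = (2::real) ^ DIM('a)"
 by (simp add: cube_def measure_lborel_cbox_eq inner_diff_left inner_add_left)

text \<open>Integrate \<open>a \<le> s + a^p s^(1-p)\<close>, which holds for every
  \<open>s > 0\<close>. The free parameter is chosen later so that the two terms balance, which has
  the effect of Hoelder's inequality. The second integral is rescaled to the cube of half-width
  \<open>t \<rho>\<close> and then enlarged to the one of half-width \<open>\<rho>\<close>.\<close>

lemma cube_average:
 fixes H :: "'a::euclidean_space => real"
 assumes [measurable]: "H \<in> borel_measurable borel" and C: "!!z. \<bar>H z\<bar> \<le> C"
  and p: "p > 1" and s: "s > 0" and t: "0 < t" "t \<le> 1" and \<rho>: "\<rho> > 0"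
 shows "(LINT y|lborel. indicator (cube 0 1) y * \<bar>H (x + (t * \<rho>) *\<^sub>R y)\<bar>)
  \<le> 2 ^ DIM('a) * s + s powr (1 - p) * inverse ((t * \<rho>) ^ DIM('a)) *
    (LINT z|lborel. indicator (cube x \<rho>) z * \<bar>H z\<bar> powr p)"
proof -
 have C0: "C \<ge> 0" using C[of 0] by linarith
 have young: "a \<le> s + a powr p * s powr (1 - p)" if "a \<ge> 0" for a
 proof (cases "a \<le> s")
  case False
  hence "a powr p * a powr (1 - p) = a" using s by (simp flip: powr_add)
  moreover have "a powr (1 - p) \<le> s powr (1 - p)" using False s p by (intro powr_mono2') auto
  ultimately have "a \<le> a powr p * s powr (1 - p)" by (metis mult_left_mono powr_ge_zero)
  thus ?thesis using s by simp
 qed (auto intro: add_increasing2)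
 have supp: "norm z \<le> norm c + real DIM('a) * r" if "z \<in> cube c r" for z c :: 'a and r :: real
  using cube_norm_le[OF that] norm_triangle_ineq[of c "z - c"] by simp
 have int: "integrable lborel (%z. indicator (cube c r) z * f z)"
  if [measurable]: "f \<in> borel_measurable borel" and "!!z. \<bar>f z\<bar> \<le> B" for c :: 'a and r B :: real and f
 proof (rule integrable_bounded_support[of _ B "norm c + real DIM('a) * r"])
  show "\<bar>indicator (cube c r) z * f z\<bar> \<le> B" for z
   using that(2)[of z] by (auto split: split_indicator)
  show "norm z > norm c + real DIM('a) * r ==> indicator (cube c r) z * f z = 0" for z
   using supp[of z c r] by (auto split: split_indicator)
 qed measurable
 have Cp: "\<bar>\<bar>H z\<bar> powr p\<bar> \<le> C powr p" for z using C p C0 by (simp add: powr_mono2)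
 have "(LINT y|lborel. indicator (cube 0 1) y * \<bar>H (x + (t * \<rho>) *\<^sub>R y)\<bar>)
  \<le> (LINT y|lborel. s * indicator (cube 0 1) y
    + s powr (1 - p) * (indicator (cube 0 1) y * \<bar>H (x + (t * \<rho>) *\<^sub>R y)\<bar> powr p))"
 proof (intro integral_mono)
  show "integrable lborel (%y. indicator (cube 0 1) y * \<bar>H (x + (t * \<rho>) *\<^sub>R y)\<bar>)"
   by (rule int[of _ C]) (use C in auto)
  have "integrable lborel (%y. indicator (cube 0 1) y * (%_::'a. 1::real) y)" by (rule int[of _ 1]) auto
  moreover have "integrable lborel (%y. indicator (cube 0 1) y * \<bar>H (x + (t * \<rho>) *\<^sub>R y)\<bar> powr p)"
   by (rule int[of _ "C powr p"]) (use Cp in auto)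
  ultimately show "integrable lborel (%y. s * indicator (cube 0 1) y
    + s powr (1 - p) * (indicator (cube 0 1) y * \<bar>H (x + (t * \<rho>) *\<^sub>R y)\<bar> powr p))" by simp
  show "indicator (cube 0 1) y * \<bar>H (x + (t * \<rho>) *\<^sub>R y)\<bar> \<le> s * indicator (cube 0 1) y
    + s powr (1 - p) * (indicator (cube 0 1) y * \<bar>H (x + (t * \<rho>) *\<^sub>R y)\<bar> powr p)" for y
   using young[of "\<bar>H (x + (t * \<rho>) *\<^sub>R y)\<bar>"] by (auto split: split_indicator simp: mult.commute)
 qed
 also have "\<dots> = (LINT y|lborel. s * indicator (cube (0::'a) 1) y)
   + (LINT y|lborel. s powr (1 - p) * (indicator (cube 0 1) y * \<bar>H (x + (t * \<rho>) *\<^sub>R y)\<bar> powr p))"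
 proof (rule Bochner_Integration.integral_add)
  have "integrable lborel (%y. indicator (cube 0 1) y * (%_::'a. 1::real) y)" by (rule int[of _ 1]) auto
  thus "integrable lborel (%y. s * indicator (cube (0::'a) 1) y)" by simp
  have "integrable lborel (%y. indicator (cube 0 1) y * \<bar>H (x + (t * \<rho>) *\<^sub>R y)\<bar> powr p)"
   by (rule int[of _ "C powr p"]) (use Cp in auto)
  thus "integrable lborel (%y. s powr (1 - p) * (indicator (cube 0 1) y * \<bar>H (x + (t * \<rho>) *\<^sub>R y)\<bar> powr p))"
   by simp
 qed
 also have "\<dots> = 2 ^ DIM('a) * s
   + s powr (1 - p) * (LINT y|lborel. indicator (cube 0 1) y * \<bar>H (x + (t * \<rho>) *\<^sub>R y)\<bar> powr p)"
  by (simp only: integral_mult_right_zero measure_unit_cube) simp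
 also have "(LINT y|lborel. indicator (cube 0 1) y * \<bar>H (x + (t * \<rho>) *\<^sub>R y)\<bar> powr p)
   = inverse ((t * \<rho>) ^ DIM('a)) * (LINT z|lborel. indicator (cube x (t * \<rho>)) z * \<bar>H z\<bar> powr p)"
 proof -
  have tr: "t * \<rho> > 0" using t \<rho> by simp
  have "(LINT z|lborel. indicator (cube x (t * \<rho>)) z * \<bar>H z\<bar> powr p)
   = \<bar>t * \<rho>\<bar> ^ DIM('a) * (LINT y|lborel. indicator (cube x (t * \<rho>)) (x + (t * \<rho>) *\<^sub>R y)
     * \<bar>H (x + (t * \<rho>) *\<^sub>R y)\<bar> powr p)"
   by (rule lborel_integral_affine) (use tr in auto)
  also have "(%y. indicator (cube x (t * \<rho>)) (x + (t * \<rho>) *\<^sub>R y)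
     * \<bar>H (x + (t * \<rho>) *\<^sub>R y)\<bar> powr p) = (%y. indicator (cube 0 1) y * \<bar>H (x + (t * \<rho>) *\<^sub>R y)\<bar> powr p)"
   using cube_affine[OF tr, of x _ 1] by (auto simp: fun_eq_iff split: split_indicator)
  finally have e: "(LINT z|lborel. indicator (cube x (t * \<rho>)) z * \<bar>H z\<bar> powr p)
   = \<bar>t * \<rho>\<bar> ^ DIM('a) * (LINT y|lborel. indicator (cube 0 1) y * \<bar>H (x + (t * \<rho>) *\<^sub>R y)\<bar> powr p)" .
  have "inverse ((t * \<rho>) ^ DIM('a)) * (t * \<rho>) ^ DIM('a) = 1" using t \<rho> by (intro left_inverse) simp
  thus ?thesis unfolding e using tr by (simp only: abs_of_pos mult.assoc[symmetric] mult_1_left)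
 qed
 also have "(LINT z|lborel. indicator (cube x (t * \<rho>)) z * \<bar>H z\<bar> powr p)
   \<le> (LINT z|lborel. indicator (cube x \<rho>) z * \<bar>H z\<bar> powr p)"
 proof (intro integral_mono)
  have "integrable lborel (%z. indicator (cube x r) z * \<bar>H z\<bar> powr p)" for r
   by (rule int[of _ "C powr p"]) (use Cp in auto)
  thus "integrable lborel (%z. indicator (cube x (t * \<rho>)) z * \<bar>H z\<bar> powr p)"
   "integrable lborel (%z. indicator (cube x \<rho>) z * \<bar>H z\<bar> powr p)" by this+
  have "cube x (t * \<rho>) \<subseteq> cube x \<rho>" using t \<rho> by (intro cube_mono) auto
  thus "indicator (cube x (t * \<rho>)) z * \<bar>H z\<bar> powr p \<le> indicator (cube x \<rho>) z * \<bar>H z\<bar> powr p" for z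
   by (auto split: split_indicator)
 qed
 finally show ?thesis using t \<rho> by (simp add: mult_left_mono mult.assoc)
qed

text \<open>The mean \<open>F(t)\<close> of \<open>u\<close> over the cube of half-width \<open>t\<rho>\<close> satisfies \<open>F(0) = u(x)\<close> and
 \<open>|F'(t)| \<le> C t\<^sup>-\<^sup>n\<^sup>/\<^sup>p\<close>, which is integrable at 0 as \<open>p > n\<close>.\<close>

lemma morrey:
 fixes u :: "'a::euclidean_space => real" and \<rho> p A A' :: real
 assumes V: "cube x \<rho> \<subseteq> V" and u: "Cinf V u"
  and p: "p > real DIM('a)" and \<rho>: "\<rho> > 0" and A: "A > 0" "A' > 0"
  and iu: "(LINT z|lborel. indicator (cube x \<rho>) z * \<bar>u z\<bar> powr p) \<le> A powr p * \<rho> ^ DIM('a)"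
  and idu: "!!b. b \<in> Basis ==>
   (LINT z|lborel. indicator (cube x \<rho>) z * \<bar>dd b u z\<bar> powr p) \<le> A' powr p * \<rho> ^ DIM('a)"
 shows "2 ^ DIM('a) * \<bar>u x\<bar> \<le> (2 ^ DIM('a) + 1) * A
  + \<rho> * DIM('a) * (2 ^ DIM('a) + 1) * A' / (1 - DIM('a) / p)"
proof -
 let ?n = "real DIM('a)" and ?Q = "cube (0::'a) 1"
 have n1: "?n \<ge> 1" using DIM_positive[where 'a='a] by linarith
 have p1: "p > 1" using p n1 by linarith
 have np: "0 < ?n / p" "?n / p < 1" using p n1 by auto
 have inQ: "x + (t * \<rho>) *\<^sub>R y \<in> cube x \<rho>" if "0 \<le> t" "t \<le> 1" "y \<in> ?Q" for t :: real and y
  unfolding mem_cube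
 proof
  fix i :: 'a assume "i \<in> Basis"
  hence "\<bar>y \<bullet> i\<bar> \<le> 1" using that(3) by (simp add: mem_cube)
  hence "(t * \<rho>) * \<bar>y \<bullet> i\<bar> \<le> (1 * \<rho>) * 1" using that \<rho> by (intro mult_mono) auto
  thus "\<bar>(x + (t * \<rho>) *\<^sub>R y) \<bullet> i - x \<bullet> i\<bar> \<le> \<rho>"
   using that \<rho> by (simp add: inner_add_left abs_mult)
 qed
 have avg: "(LINT y|lborel. indicator ?Q y * \<bar>h (x + (t * \<rho>) *\<^sub>R y)\<bar>)
   \<le> (2 ^ DIM('a) + 1) * (B * t powr (- ?n / p))"
  if h: "continuous_on (cube x \<rho>) h" and t: "0 < t" "t \<le> 1" and B: "B > 0"
  and hB: "(LINT z|lborel. indicator (cube x \<rho>) z * \<bar>h z\<bar> powr p) \<le> B powr p * \<rho> ^ DIM('a)" for h t B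
 proof -
  define H where "H = (%z. indicator (cube x \<rho>) z * h z)"
  \<comment> \<open>This choice makes the second term of \<open>cube_average\<close> equal to
    \<open>s\<close>: the powers of \<open>B\<close> combine to \<open>B\<close> and those of
    \<open>t\<close> to \<open>t^(-n/p)\<close>. Hence the constant \<open>2^n + 1\<close>.\<close>
  define s where "s = B * t powr (- ?n / p)"
  have s: "s > 0" using B t by (simp add: s_def)
  have [measurable]: "H \<in> borel_measurable borel"
   using borel_measurable_continuous_on_indicator[OF _ h] by (simp add: H_def)
  obtain C where C: "!!z. z \<in> cube x \<rho> ==> \<bar>h z\<bar> \<le> C"
   using compact_imp_bounded[OF compact_continuous_image[OF h compact_cube]] by (auto simp: bounded_iff)
  have HC: "\<bar>H z\<bar> \<le> max C 0" for z using C[of z] by (auto simp: H_def split: split_indicator)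
  have "(LINT y|lborel. indicator ?Q y * \<bar>h (x + (t * \<rho>) *\<^sub>R y)\<bar>) = (LINT y|lborel. indicator ?Q y * \<bar>H (x + (t * \<rho>) *\<^sub>R y)\<bar>)"
   using inQ t by (intro Bochner_Integration.integral_cong) (auto simp: H_def split: split_indicator)
  also have "\<dots> \<le> 2 ^ DIM('a) * s + s powr (1 - p) * inverse ((t * \<rho>) ^ DIM('a)) *
    (LINT z|lborel. indicator (cube x \<rho>) z * \<bar>H z\<bar> powr p)"
   using s t \<rho> p1 by (intro cube_average[of H "max C 0"]) (auto simp: HC)
  also have "(LINT z|lborel. indicator (cube x \<rho>) z * \<bar>H z\<bar> powr p) = (LINT z|lborel. indicator (cube x \<rho>) z * \<bar>h z\<bar> powr p)"
   by (intro Bochner_Integration.integral_cong) (auto simp: H_def split: split_indicator)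
  also have "2 ^ DIM('a) * s + s powr (1 - p) * inverse ((t * \<rho>) ^ DIM('a)) * \<dots>
   \<le> 2 ^ DIM('a) * s + s powr (1 - p) * inverse ((t * \<rho>) ^ DIM('a)) * (B powr p * \<rho> ^ DIM('a))"
   using t \<rho> by (intro add_left_mono mult_left_mono hB) auto
  also have "s powr (1 - p) * inverse ((t * \<rho>) ^ DIM('a)) * (B powr p * \<rho> ^ DIM('a)) = s"
  proof -
   have "s powr (1 - p) = B powr (1 - p) * t powr (- ?n / p * (1 - p))"
    using B t by (simp add: s_def powr_mult powr_powr)
   moreover have "- ?n / p * (1 - p) = ?n - ?n / p" using p1 by (simp add: field_simps)
   moreover have "inverse ((t * \<rho>) ^ DIM('a)) * \<rho> ^ DIM('a) = t powr (- ?n)"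
    using t \<rho> by (simp add: power_mult_distrib powr_minus powr_realpow)
   moreover have "B powr (1 - p) * B powr p = B" using B by (simp flip: powr_add)
   moreover have "t powr (?n - ?n / p) * t powr (- ?n) = t powr (- ?n / p)" by (simp flip: powr_add)
   ultimately show ?thesis by (simp add: s_def) (metis (no_types, lifting) mult.assoc mult.left_commute)
  qed
  finally show ?thesis by (simp add: s_def algebra_simps)
 qed
 define f where "f = (%t y. u (x + (t * \<rho>) *\<^sub>R y))"
 define fx where "fx = (%t y. \<Sum>b\<in>Basis. (\<rho> * (y \<bullet> b)) * dd b u (x + (t * \<rho>) *\<^sub>R y))"
 define F where "F = (%t. integral ?Q (f t))"
 define F' where "F' = (%t. integral ?Q (fx t))"
 have du: "u differentiable (at z)" if "z \<in> cube x \<rho>" for z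
  using that V by (intro Cinf_differentiable[OF u]) auto
 have contd: "continuous_on (cube x \<rho>) (dd b u)" for b
  using continuous_on_subset[OF Cinf_continuous_on[OF Cinf_dd[OF u]] V] .
 have contu: "continuous_on (cube x \<rho>) u"
  using continuous_on_subset[OF Cinf_continuous_on[OF u] V] .
 have cf: "continuous_on ?Q (f t)" if "0 \<le> t" "t \<le> 1" for t
  unfolding f_def using inQ that by (intro continuous_on_compose2[OF contu]) (auto intro!: continuous_intros)
 have cfx: "continuous_on ({0..1} \<times> ?Q) (%(t, y). fx t y)"
  unfolding fx_def case_prod_beta
  by (intro continuous_intros continuous_on_compose2[OF contd]) (auto intro!: continuous_intros inQ)
 have DF: "(F has_real_derivative F' t) (at t within {0..1})" if t: "t \<in> {0..1}" for t
  unfolding F_def F'_def has_real_derivative_iff_has_vector_derivative cube_def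
 proof (rule leibniz_rule_vector_derivative[where fx = fx])
  fix t y assume "t \<in> {0..1::real}" "y \<in> cbox (0 - 1 *\<^sub>R One) (0 + 1 *\<^sub>R (One::'a))"
  hence in_cube: "x + (t * \<rho>) *\<^sub>R y \<in> cube x \<rho>" by (intro inQ) (auto simp: cube_def)
  have "((%t. x + (t * \<rho>) *\<^sub>R y) has_derivative (%h. (h * \<rho>) *\<^sub>R y)) (at t)"
   by (auto intro!: derivative_eq_intros)
  from diff_chain_at[OF this has_derivative_dd[OF du[OF in_cube]]]
  have "(f' has_derivative (%h. dd ((h * \<rho>) *\<^sub>R y) u (x + (t * \<rho>) *\<^sub>R y))) (at t)"
   if "f' = (%t. f t y)" for f' by (simp add: o_def f_def that)
  moreover have "dd ((h * \<rho>) *\<^sub>R y) u (x + (t * \<rho>) *\<^sub>R y) = h * fx t y" for h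
  proof -
   have "dd ((h * \<rho>) *\<^sub>R y) u (x + (t * \<rho>) *\<^sub>R y)
     = dd ((h * \<rho>) *\<^sub>R (\<Sum>b\<in>Basis. (y \<bullet> b) *\<^sub>R b)) u (x + (t * \<rho>) *\<^sub>R y)"
    by (simp add: euclidean_representation)
   also have "\<dots> = (h * \<rho>) * (\<Sum>b\<in>Basis. (y \<bullet> b) * dd b u (x + (t * \<rho>) *\<^sub>R y))"
    unfolding linear_cmul[OF dd_linear[OF du[OF in_cube]]] linear_sum[OF dd_linear[OF du[OF in_cube]]]
    by simp
   finally show ?thesis by (simp add: fx_def sum_distrib_left mult.assoc)
  qed
  ultimately show "((%t. f t y) has_vector_derivative fx t y) (at t within {0..1})"
   unfolding has_vector_derivative_def by (auto intro!: has_derivative_at_withinI)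
 next
  show "!!t. t \<in> {0..1} ==> f t integrable_on cbox (0 - 1 *\<^sub>R One) (0 + 1 *\<^sub>R One)"
   using cf by (intro integrable_continuous) (auto simp: cube_def)
  show "continuous_on ({0..1} \<times> cbox (0 - 1 *\<^sub>R One) (0 + 1 *\<^sub>R One)) (%(t, y). fx t y)"
   using cfx by (simp add: cube_def)
 qed (use t in auto)
 have leb: "integral ?Q g = (LINT y|lborel. indicator ?Q y * g y)" "integrable lborel (%y. indicator ?Q y * g y)"
  if "continuous_on ?Q g" for g :: "'a => real"
 proof -
  have "set_integrable lborel ?Q g"
   unfolding set_integrable_def by (rule borel_integrable_compact[OF compact_cube that])
  from set_borel_integral_eq_integral(2)[OF this] this
  show "integral ?Q g = (LINT y|lborel. indicator ?Q y * g y)" "integrable lborel (%y. indicator ?Q y * g y)"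
   by (auto simp: set_lebesgue_integral_def set_integrable_def)
 qed
 have cdu: "continuous_on ?Q (%y. dd b u (x + (t * \<rho>) *\<^sub>R y))" if "0 < t" "t \<le> 1" for t b
  using inQ that by (intro continuous_on_compose2[OF contd]) (auto intro!: continuous_intros)
 define K where "K = \<rho> * ?n * (2 ^ DIM('a) + 1) * A'"
 have F'_bound: "\<bar>F' t\<bar> \<le> K * t powr (- ?n / p)" if t: "0 < t" "t \<le> 1" for t
 proof -
  have cfxt: "continuous_on ?Q (fx t)"
   unfolding fx_def using t by (intro continuous_intros cdu)
  have "\<bar>F' t\<bar> \<le> (LINT y|lborel. \<bar>indicator ?Q y * fx t y\<bar>)"
   unfolding F'_def leb(1)[OF cfxt] by (rule integral_abs_bound)
  also have "\<dots> \<le> (LINT y|lborel. (\<Sum>b\<in>Basis. \<rho> * (indicator ?Q y * \<bar>dd b u (x + (t * \<rho>) *\<^sub>R y)\<bar>)))"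
  proof (intro integral_mono)
   show "integrable lborel (%y. \<bar>indicator ?Q y * fx t y\<bar>)" using leb(2)[OF cfxt] by (rule integrable_abs)
   show "integrable lborel (%y. \<Sum>b\<in>Basis. \<rho> * (indicator ?Q y * \<bar>dd b u (x + (t * \<rho>) *\<^sub>R y)\<bar>))"
    using t by (intro Bochner_Integration.integrable_sum integrable_mult_right leb(2) continuous_intros cdu)
   fix y
   show "\<bar>indicator ?Q y * fx t y\<bar> \<le> (\<Sum>b\<in>Basis. \<rho> * (indicator ?Q y * \<bar>dd b u (x + (t * \<rho>) *\<^sub>R y)\<bar>))"
   proof (cases "y \<in> ?Q")
    case True
    have "\<bar>fx t y\<bar> \<le> (\<Sum>b\<in>Basis. \<bar>(\<rho> * (y \<bullet> b)) * dd b u (x + (t * \<rho>) *\<^sub>R y)\<bar>)"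
     unfolding fx_def by (rule sum_abs)
    also have "\<dots> \<le> (\<Sum>b\<in>Basis. \<rho> * \<bar>dd b u (x + (t * \<rho>) *\<^sub>R y)\<bar>)"
    proof (intro sum_mono)
     fix b :: 'a assume "b \<in> Basis"
     hence "\<rho> * \<bar>y \<bullet> b\<bar> \<le> \<rho> * 1" using True \<rho> by (intro mult_left_mono) (auto simp: mem_cube)
     thus "\<bar>(\<rho> * (y \<bullet> b)) * dd b u (x + (t * \<rho>) *\<^sub>R y)\<bar> \<le> \<rho> * \<bar>dd b u (x + (t * \<rho>) *\<^sub>R y)\<bar>"
      using \<rho> unfolding abs_mult by (intro mult_right_mono) auto
    qed
    finally show ?thesis using True by simp
   qed simp
  qed
  also have "\<dots> = (\<Sum>b\<in>Basis. \<rho> * (LINT y|lborel. indicator ?Q y * \<bar>dd b u (x + (t * \<rho>) *\<^sub>R y)\<bar>))"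
   using t by (subst Bochner_Integration.integral_sum)
    (auto intro!: integrable_mult_right leb(2) continuous_intros cdu)
  also have "\<dots> \<le> (\<Sum>b\<in>(Basis::'a set). \<rho> * ((2 ^ DIM('a) + 1) * (A' * t powr (- ?n / p))))"
   using \<rho> by (intro sum_mono mult_left_mono avg contd t A idu) auto
  finally show ?thesis by (simp add: K_def mult_ac)
 qed
 define c where "c = 1 - ?n / p"
 have c: "c > 0" using np by (simp add: c_def)
 have cm: "c - 1 = - ?n / p" by (simp add: c_def)
 have K: "K \<ge> 0" using \<rho> A n1 by (simp add: K_def)
 \<comment> \<open>A primitive of the bound \<open>K t^(-n/p)\<close>; since
   \<open>c = 1 - n/p\<close> is positive, it stays between 0 and \<open>K / c\<close> on the unit
   interval. Monotonicity of \<open>\<Phi> - F\<close> and \<open>\<Phi> + F\<close> replaces an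
   integration of \<open>F'\<close>.\<close>
 define \<Phi> where "\<Phi> = (%t. K / c * t powr c)"
 have D\<Phi>: "(\<Phi> has_real_derivative K * t powr (- ?n / p)) (at t)" if "t > 0" for t
  unfolding \<Phi>_def using that c by (auto intro!: derivative_eq_intros simp: cm)
 \<comment> \<open>First away from 0, where the bound on \<open>F'\<close> is singular; then
   \<open>\<delta>\<close> tends to 0 by continuity of \<open>F\<close>.\<close>
 have step: "\<bar>F 1 - F \<delta>\<bar> \<le> K / c" if \<delta>: "0 < \<delta>" "\<delta> < 1" for \<delta>
 proof -
  have D: "(F has_real_derivative F' t) (at t)" if "\<delta> \<le> t" "t < 1" for t
  proof -
   have "at t within {0..1} = at t"
    by (rule at_within_interior) (use \<delta> that in \<open>simp add: interior_atLeastAtMost_real\<close>)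
   thus ?thesis using DF[of t] \<delta> that by simp
  qed
  have "continuous_on {0..1} F"
   unfolding continuous_on_eq_continuous_within using DF DERIV_continuous by blast
  hence cF: "continuous_on {\<delta>..1} F" by (rule continuous_on_subset) (use \<delta> in auto)
  have c\<Phi>: "continuous_on {\<delta>..1} \<Phi>"
  proof (intro continuous_at_imp_continuous_on ballI)
   fix t assume "t \<in> {\<delta>..1}"
   thus "isCont \<Phi> t" using \<delta> by (intro DERIV_isCont[OF D\<Phi>]) auto
  qed
  have "(%t. \<Phi> t - F t) \<delta> \<le> (%t. \<Phi> t - F t) 1"
  proof (rule DERIV_nonneg_imp_increasing_open[of \<delta> 1 "%t. \<Phi> t - F t"])
   fix t assume t: "\<delta> < t" "t < 1"
   have "((%t. \<Phi> t - F t) has_real_derivative K * t powr (- ?n / p) - F' t) (at t)"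
    by (rule DERIV_diff[OF D\<Phi> D]) (use t \<delta> in auto)
   moreover have "0 \<le> K * t powr (- ?n / p) - F' t" using F'_bound[of t] t \<delta> by linarith
   ultimately show "\<exists>y. ((%t. \<Phi> t - F t) has_real_derivative y) (at t) \<and> 0 \<le> y" by blast
  next
   show "continuous_on {\<delta>..1} (%t. \<Phi> t - F t)" by (intro continuous_intros cF c\<Phi>)
  qed (use \<delta> in auto)
  moreover have "(%t. \<Phi> t + F t) \<delta> \<le> (%t. \<Phi> t + F t) 1"
  proof (rule DERIV_nonneg_imp_increasing_open[of \<delta> 1 "%t. \<Phi> t + F t"])
   fix t assume t: "\<delta> < t" "t < 1"
   have "((%t. \<Phi> t + F t) has_real_derivative K * t powr (- ?n / p) + F' t) (at t)"
    by (rule DERIV_add[OF D\<Phi> D]) (use t \<delta> in auto)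
   moreover have "0 \<le> K * t powr (- ?n / p) + F' t" using F'_bound[of t] t \<delta> by linarith
   ultimately show "\<exists>y. ((%t. \<Phi> t + F t) has_real_derivative y) (at t) \<and> 0 \<le> y" by blast
  next
   show "continuous_on {\<delta>..1} (%t. \<Phi> t + F t)" by (intro continuous_intros cF c\<Phi>)
  qed (use \<delta> in auto)
  moreover have "\<Phi> \<delta> \<ge> 0" "\<Phi> 1 = K / c" using K c by (auto simp: \<Phi>_def)
  ultimately show ?thesis by linarith
 qed
 have "((%\<delta>. \<bar>F 1 - F \<delta>\<bar>) \<longlongrightarrow> \<bar>F 1 - F 0\<bar>) (at_right 0)"
 proof (intro tendsto_intros)
  have "continuous (at 0 within {0..1}) F" using DF[of 0] by (auto intro: DERIV_continuous)
  hence "(F \<longlongrightarrow> F 0) (at 0 within {0..1})" by (simp add: continuous_within)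
  thus "(F \<longlongrightarrow> F 0) (at_right 0)" by (simp add: at_within_Icc_at_right)
 qed
 hence "\<bar>F 1 - F 0\<bar> \<le> K / c"
 proof (rule tendsto_upperbound)
  show "\<forall>\<^sub>F \<delta> in at_right 0. \<bar>F 1 - F \<delta>\<bar> \<le> K / c"
   unfolding eventually_at_right_field using step by (intro exI[of _ 1]) auto
 qed simp
 moreover have "\<bar>F 1\<bar> \<le> (2 ^ DIM('a) + 1) * A"
 proof -
  have "\<bar>F 1\<bar> \<le> (LINT y|lborel. \<bar>indicator ?Q y * f 1 y\<bar>)"
   unfolding F_def using cf[of 1] by (subst leb(1)) (auto intro: integral_abs_bound)
  also have "\<dots> = (LINT y|lborel. indicator ?Q y * \<bar>u (x + (1 * \<rho>) *\<^sub>R y)\<bar>)"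
   by (simp add: f_def abs_mult)
  also have "\<dots> \<le> (2 ^ DIM('a) + 1) * (A * 1 powr (- ?n / p))"
   by (rule avg[OF contu _ _ A(1) iu]) auto
  finally show ?thesis by simp
 qed
 moreover have "F 0 = 2 ^ DIM('a) * u x"
  unfolding F_def using cf[of 0] measure_unit_cube[where 'a='a]
  by (subst leb(1)) (auto simp: f_def)
 ultimately have "2 ^ DIM('a) * \<bar>u x\<bar> \<le> (2 ^ DIM('a) + 1) * A + K / c"
  by (simp add: abs_mult flip: abs_power2)
 thus ?thesis by (simp add: K_def c_def)
qed

section \<open>From Morrey's inequality to decay in weighted spaces\<close>

lemma weight_bounds: "norm x \<le> weight x" "weight x \<le> 1 + norm x" "weight x > 0"
proof -
 have "(norm x)\<^sup>2 \<le> 1 + (norm x)\<^sup>2" "1 + (norm x)\<^sup>2 \<le> (1 + norm x)\<^sup>2"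
  by (simp_all add: power2_sum)
 thus "norm x \<le> weight x" "weight x \<le> 1 + norm x"
  unfolding weight_def by (auto intro: real_le_rsqrt real_le_lsqrt)
 show "weight x > 0" unfolding weight_def by (simp add: add_pos_nonneg)
qed

lemma powr_comparable:
 fixes w r e :: real
 assumes "r > 0" "r / 2 \<le> w" "w \<le> 2 * r"
 shows "w powr e \<le> 2 powr \<bar>e\<bar> * r powr e"
proof (cases "e \<ge> 0")
 case True
 have "w powr e \<le> (2 * r) powr e" using assms True by (intro powr_mono2) auto
 thus ?thesis using assms True by (simp add: powr_mult)
next
 case False
 have "w powr e \<le> (r / 2) powr e" using assms False by (intro powr_mono2') auto
 also have "(r / 2) powr e = r powr e / 2 powr e" by (rule powr_divide)
 also have "\<dots> = 2 powr (- e) * r powr e" unfolding powr_minus_divide by simp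
 finally show ?thesis using False by (simp only: abs_of_neg not_le)
qed

text \<open>Points of the cube have norm between \<open>|x|/2\<close> and \<open>3|x|/2\<close>, so
  the weight is comparable with \<open>|x|\<close> and can be pulled out of the integral;
  \<open>n - \<sigma> p\<close> is the exponent that cancels
  \<open>(\<sigma> - n/p) p\<close>.\<close>

lemma cube_weighted_bound:
 fixes f :: "real^'n::finite => real"
 assumes I: "(\<integral>\<^sup>+z\<in>\<Omega>. ennreal (\<bar>f z * weight z powr (\<sigma> - real CARD('n) / p)\<bar> powr p) \<partial>lborel) \<le> ennreal K"
  and K: "K \<ge> 0" and p: "p > 1" and x: "norm x \<ge> 4" and sub: "cube x \<rho> \<subseteq> \<Omega>"
  and near: "!!z. z \<in> cube x \<rho> ==> norm (z - x) \<le> norm x / 2"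
  and fm: "(%z. indicator \<Omega> z * f z) \<in> borel_measurable borel"
 shows "(LINT z|lborel. indicator (cube x \<rho>) z * \<bar>f z\<bar> powr p)
  \<le> K * 2 powr \<bar>real CARD('n) - \<sigma> * p\<bar> * norm x powr (real CARD('n) - \<sigma> * p)"
proof -
 define e where "e = real CARD('n) - \<sigma> * p"
 define B where "B = 2 powr \<bar>e\<bar> * norm x powr e"
 have B: "B \<ge> 0" by (simp add: B_def)
 have [measurable]: "(weight :: real^'n => real) \<in> borel_measurable borel"
  unfolding weight_def by measurable
 have pw: "\<bar>f z\<bar> powr p \<le> \<bar>f z * weight z powr (\<sigma> - real CARD('n) / p)\<bar> powr p * B"
  if "z \<in> cube x \<rho>" for z
 proof -
  have "norm x / 2 \<le> norm z" "norm z \<le> 3 / 2 * norm x"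
   using near[OF that] norm_triangle_ineq2[of x z] norm_triangle_ineq2[of z x]
   by (auto simp: norm_minus_commute)
  hence "norm x / 2 \<le> weight z" "weight z \<le> 2 * norm x" using weight_bounds[of z] x by linarith+
  hence "weight z powr e \<le> B" unfolding B_def using x by (intro powr_comparable) auto
  hence "\<bar>f z * weight z powr (\<sigma> - real CARD('n) / p)\<bar> powr p * weight z powr e
    \<le> \<bar>f z * weight z powr (\<sigma> - real CARD('n) / p)\<bar> powr p * B"
   by (intro mult_left_mono) auto
  also have "\<bar>f z * weight z powr (\<sigma> - real CARD('n) / p)\<bar> powr p * weight z powr e
   = \<bar>f z\<bar> powr p * (weight z powr ((\<sigma> - real CARD('n) / p) * p) * weight z powr e)"
   by (simp add: abs_mult powr_mult powr_powr)
  also have "weight z powr ((\<sigma> - real CARD('n) / p) * p) * weight z powr e = 1"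
   using p weight_bounds(3)[of z] by (simp add: e_def left_diff_distrib flip: powr_add)
  finally show ?thesis by simp
 qed
 have "(\<integral>\<^sup>+z. ennreal (indicator (cube x \<rho>) z * \<bar>f z\<bar> powr p) \<partial>lborel)
   \<le> (\<integral>\<^sup>+z. ennreal B * (ennreal (\<bar>f z * weight z powr (\<sigma> - real CARD('n) / p)\<bar> powr p) * indicator \<Omega> z) \<partial>lborel)"
 proof (rule nn_integral_mono)
  fix z
  show "ennreal (indicator (cube x \<rho>) z * \<bar>f z\<bar> powr p)
   \<le> ennreal B * (ennreal (\<bar>f z * weight z powr (\<sigma> - real CARD('n) / p)\<bar> powr p) * indicator \<Omega> z)"
  proof (cases "z \<in> cube x \<rho>")
   case True
   thus ?thesis using pw[OF True] sub B
    by (auto simp: ennreal_mult[symmetric] mult.commute intro!: ennreal_leI)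
  qed simp
 qed
 also have "\<dots> \<le> ennreal B * (\<integral>\<^sup>+z\<in>\<Omega>. ennreal (\<bar>f z * weight z powr (\<sigma> - real CARD('n) / p)\<bar> powr p) \<partial>lborel)"
 proof -
  have "(%z. ennreal (\<bar>(indicator \<Omega> z * f z) * weight z powr (\<sigma> - real CARD('n) / p)\<bar> powr p))
   \<in> borel_measurable lborel" using fm by measurable
  also have "(%z. ennreal (\<bar>(indicator \<Omega> z * f z) * weight z powr (\<sigma> - real CARD('n) / p)\<bar> powr p))
   = (%z. ennreal (\<bar>f z * weight z powr (\<sigma> - real CARD('n) / p)\<bar> powr p) * indicator \<Omega> z)"
   by (auto simp: fun_eq_iff split: split_indicator)
  finally show ?thesis by (subst nn_integral_cmult) auto
 qed
 also have "\<dots> \<le> ennreal B * ennreal K" by (intro mult_left_mono I) simp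
 also have "\<dots> = ennreal (B * K)" using B K by (simp add: ennreal_mult)
 finally have nn: "(\<integral>\<^sup>+z. ennreal (indicator (cube x \<rho>) z * \<bar>f z\<bar> powr p) \<partial>lborel) \<le> ennreal (B * K)" .
 have eq: "indicator (cube x \<rho>) z * \<bar>f z\<bar> powr p = \<bar>indicator (cube x \<rho>) z * f z\<bar> powr p" for z
  using p by (auto split: split_indicator)
 have "(LINT z|lborel. indicator (cube x \<rho>) z * \<bar>f z\<bar> powr p)
   = enn2real (\<integral>\<^sup>+z. ennreal (indicator (cube x \<rho>) z * \<bar>f z\<bar> powr p) \<partial>lborel)"
 proof (rule integral_eq_nn_integral)
  have e: "(%z. indicator (cube x \<rho>) z * f z) = (%z. indicator (cube x \<rho>) z * (indicator \<Omega> z * f z))"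
   using sub by (auto simp: fun_eq_iff split: split_indicator)
  have "(%z. indicator (cube x \<rho>) z * f z) \<in> borel_measurable lborel"
   unfolding e using fm by measurable
  thus "(%z. indicator (cube x \<rho>) z * \<bar>f z\<bar> powr p) \<in> borel_measurable lborel"
   unfolding eq by measurable
 qed auto
 also have "\<dots> \<le> B * K" using nn B K by (intro enn2real_leI) auto
 finally show ?thesis by (simp add: B_def e_def mult_ac)
qed

text \<open>\<open>morrey\<close> on a cube whose width is proportional to \<open>|x|\<close>. The
  gradient is weighted with one more power of \<open>|x|\<close>, which compensates the factor
  \<open>\<rho>\<close> in front of the gradient term, so both terms have size
  \<open>|x|^(-\<sigma>)\<close>.\<close>

lemma weighted_sobolev_pointwise:
 fixes u :: "real^'n::finite => real"
 assumes u: "Cinf (- cball 0 1) u" and p: "p > real CARD('n)"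
  and I: "(\<integral>\<^sup>+z\<in>- cball 0 1. ennreal (\<bar>u z * weight z powr (\<sigma> - real CARD('n) / p)\<bar> powr p) \<partial>lborel) < \<infinity>"
  and dI: "!!i. (\<integral>\<^sup>+z\<in>- cball 0 1. ennreal (\<bar>partial i u z * weight z powr (\<sigma> + 1 - real CARD('n) / p)\<bar> powr p) \<partial>lborel) < \<infinity>"
 shows "u \<in> O[at_infinity](%x. norm x powr (- \<sigma>))"
proof -
 let ?n = "real CARD('n)"
 have n1: "?n \<ge> 1" using zero_less_card_finite[where 'a='n] by linarith
 have p1: "p > 1" using p n1 by linarith
 have np: "0 < ?n / p" "?n / p < 1" using p n1 by auto
 define K where "K = enn2real (\<integral>\<^sup>+z\<in>- cball 0 1. ennreal (\<bar>u z * weight z powr (\<sigma> - ?n / p)\<bar> powr p) \<partial>lborel)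
  + (\<Oplus>i. enn2real (\<integral>\<^sup>+z\<in>- cball 0 1. ennreal (\<bar>partial i u z * weight z powr (\<sigma> + 1 - ?n / p)\<bar> powr p) \<partial>lborel))"
 have K: "K \<ge> 0" unfolding K_def by (intro add_nonneg_nonneg sum_nonneg) auto
 have IK: "(\<integral>\<^sup>+z\<in>- cball 0 1. ennreal (\<bar>u z * weight z powr (\<sigma> - ?n / p)\<bar> powr p) \<partial>lborel) \<le> ennreal K"
 proof -
  define J where "J = (\<integral>\<^sup>+z\<in>- cball 0 1. ennreal (\<bar>u z * weight z powr (\<sigma> - ?n / p)\<bar> powr p) \<partial>lborel)"
  have "enn2real J \<le> K" unfolding K_def J_def by (simp add: sum_nonneg)
  hence "ennreal (enn2real J) \<le> ennreal K" by (rule ennreal_leI)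
  moreover have "J < \<infinity>" unfolding J_def by (rule I)
  ultimately show ?thesis unfolding J_def[symmetric] by simp
 qed
 have dIK: "(\<integral>\<^sup>+z\<in>- cball 0 1. ennreal (\<bar>partial i u z * weight z powr (\<sigma> + 1 - ?n / p)\<bar> powr p) \<partial>lborel) \<le> ennreal K" for i
 proof -
  define J where "J = (%i. \<integral>\<^sup>+z\<in>- cball 0 1. ennreal (\<bar>partial i u z * weight z powr (\<sigma> + 1 - ?n / p)\<bar> powr p) \<partial>lborel)"
  have "enn2real (J i) \<le> (\<Oplus>i. enn2real (J i))" by (rule member_le_sum) auto
  also have "\<dots> \<le> K" unfolding K_def J_def by simp
  finally have "ennreal (enn2real (J i)) \<le> ennreal K" by (rule ennreal_leI)
  moreover have "J i < \<infinity>" unfolding J_def by (rule dI)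
  ultimately have "J i \<le> ennreal K" by simp
  thus ?thesis by (simp only: J_def)
 qed
 \<comment> \<open>\<open>(2n)^n\<close> undoes the denominator in
   \<open>\<rho>^n = |x|^n / (2n)^n\<close>; the \<open>+ 1\<close> makes the constants positive
   even if \<open>K = 0\<close>, as \<open>morrey\<close> requires.\<close>
 define c where "c = (%\<sigma>. K * 2 powr \<bar>?n - \<sigma> * p\<bar> * (2 * ?n) powr ?n + 1)"
 have c: "c s > 0" for s unfolding c_def using K by (intro add_nonneg_pos mult_nonneg_nonneg) auto
 define C where "C = (2 ^ CARD('n) + 1) * c \<sigma> powr (1 / p)
   + ?n * (2 ^ CARD('n) + 1) * c (\<sigma> + 1) powr (1 / p) / (1 - ?n / p)"
 have bound: "\<bar>u x\<bar> \<le> C * norm x powr (- \<sigma>)" if x: "norm x \<ge> 4" for x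
 proof -
  \<comment> \<open>By \<open>cube_norm_le\<close> the cube then lies within \<open>|x|/2\<close> of
    \<open>x\<close>, hence in the exterior domain as \<open>|x| \<ge> 4\<close>.\<close>
  define \<rho> where "\<rho> = norm x / (2 * ?n)"
  have \<rho>: "\<rho> > 0" unfolding \<rho>_def using x n1 by (intro divide_pos_pos) linarith+
  have near: "norm (z - x) \<le> norm x / 2" if "z \<in> cube x \<rho>" for z
   using cube_norm_le[OF that] n1 by (simp add: \<rho>_def)
  have sub: "cube x \<rho> \<subseteq> - cball 0 1"
  proof
   fix z assume "z \<in> cube x \<rho>"
   from near[OF this] norm_triangle_ineq2[of x z] x have "norm z > 1" by (simp add: norm_minus_commute)
   thus "z \<in> - cball 0 1" by simp
  qed
  have meas: "(%z. indicator (- cball 0 1) z * f z) \<in> borel_measurable borel"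
   if "Cinf (- cball (0::real^'n) 1) f" for f
   using borel_measurable_continuous_on_indicator[OF _ Cinf_continuous_on[OF that]] by simp
  define A where "A = (%s. c s powr (1 / p) * norm x powr (- s))"
  have A: "A s > 0" for s
   unfolding A_def using c[of s] x by (intro mult_pos_pos) (simp_all add: less_imp_neq[symmetric], auto)
  have Ap: "K * 2 powr \<bar>?n - s * p\<bar> * norm x powr (?n - s * p) \<le> A s powr p * \<rho> ^ CARD('n)" for s
  proof -
   have "A s powr p = c s * norm x powr (- s * p)"
    using c[of s] p1 by (simp add: A_def powr_mult powr_powr)
   moreover have "\<rho> ^ CARD('n) = norm x powr ?n / (2 * ?n) powr ?n"
    using \<rho> x n1 by (simp add: powr_realpow[symmetric] \<rho>_def powr_divide)
   ultimately have "A s powr p * \<rho> ^ CARD('n) = c s / (2 * ?n) powr ?n * norm x powr (?n - s * p)"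
    by (simp add: powr_diff powr_minus divide_inverse)
   moreover have "K * 2 powr \<bar>?n - s * p\<bar> \<le> c s / (2 * ?n) powr ?n"
    using n1 by (simp add: c_def le_divide_eq)
   ultimately show ?thesis using mult_right_mono by fastforce
  qed
  have "2 ^ DIM(real^'n) * \<bar>u x\<bar> \<le> (2 ^ DIM(real^'n) + 1) * A \<sigma>
   + \<rho> * DIM(real^'n) * (2 ^ DIM(real^'n) + 1) * A (\<sigma> + 1) / (1 - DIM(real^'n) / p)"
  proof (rule morrey[OF sub u])
   show "(LINT z|lborel. indicator (cube x \<rho>) z * \<bar>u z\<bar> powr p) \<le> A \<sigma> powr p * \<rho> ^ DIM(real^'n)"
    using cube_weighted_bound[OF IK K p1 x sub near meas[OF u]] Ap[of \<sigma>] by simp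
   fix b :: "real^'n" assume "b \<in> Basis"
   then obtain i where i: "b = axis i 1" by (auto simp: Basis_vec_def)
   show "(LINT z|lborel. indicator (cube x \<rho>) z * \<bar>dd b u z\<bar> powr p) \<le> A (\<sigma> + 1) powr p * \<rho> ^ DIM(real^'n)"
    using cube_weighted_bound[OF dIK K p1 x sub near meas[OF Cinf_dd[OF u, of "axis i 1"], folded partial_eq_dd]]
     Ap[of "\<sigma> + 1"] by (simp add: i partial_eq_dd)
  qed (use p \<rho> A in auto)
  also have "\<dots> \<le> C * norm x powr (- \<sigma>)"
  proof -
   define T where "T = ?n * (2 ^ CARD('n) + 1) / (1 - ?n / p)"
   define Y where "Y = c (\<sigma> + 1) powr (1 / p) * norm x powr (- \<sigma>)"
   have T: "T \<ge> 0" using np by (simp add: T_def)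
   have Y: "Y \<ge> 0" by (simp add: Y_def)
   have "norm x powr (- (\<sigma> + 1)) = norm x powr (- \<sigma>) / norm x" using x by (simp add: powr_diff)
   hence "\<rho> * A (\<sigma> + 1) = Y * (1 / (2 * ?n))"
    using x by (auto simp: \<rho>_def A_def Y_def)
   also have "\<dots> \<le> Y * 1"
   proof (intro mult_left_mono Y)
    have "1 \<le> 2 * ?n" using n1 by linarith
    thus "1 / (2 * ?n) \<le> 1" by simp
   qed
   finally have "T * (\<rho> * A (\<sigma> + 1)) \<le> T * Y" using T by (intro mult_left_mono) auto
   moreover have "\<rho> * ?n * (2 ^ CARD('n) + 1) * A (\<sigma> + 1) / (1 - ?n / p) = T * (\<rho> * A (\<sigma> + 1))"
    unfolding T_def by (simp only: times_divide_eq_left) (simp only: mult_ac)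
   moreover have "C * norm x powr (- \<sigma>) = (2 ^ CARD('n) + 1) * A \<sigma> + T * Y"
    unfolding C_def A_def T_def Y_def distrib_right
    by (simp only: times_divide_eq_left times_divide_eq_right mult.assoc)
   ultimately show ?thesis by simp
  qed
  finally have "2 ^ CARD('n) * \<bar>u x\<bar> \<le> C * norm x powr (- \<sigma>)" by simp
  moreover have "1 * \<bar>u x\<bar> \<le> 2 ^ CARD('n) * \<bar>u x\<bar>" by (intro mult_right_mono) auto
  ultimately show ?thesis by linarith
 qed
 show ?thesis
 proof (rule bigoI)
  show "\<forall>\<^sub>F x in at_infinity. norm (u x) \<le> C * norm (norm x powr (- \<sigma>))"
   unfolding eventually_at_infinity using bound by (intro exI[of _ 4]) auto
 qed
qed

text \<open>The pointwise bound on a derivative costs one further derivative, hence the strict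
  inequality; \<open>k \<ge> 5\<close> covers the orders 0 to 4.\<close>

lemma weighted_sobolev_decay:
 fixes u :: "real^'n::finite => real"
 assumes u: "Cinf (- cball 0 1) u" and p: "p > real CARD('n)" and k: "length is < k"
  and w: "u \<in> weighted_sobolev (- cball 0 1) k p (- \<tau>)"
 shows "partials is u \<in> O[at_infinity](%x. norm x powr (- \<tau> - real (length is)))"
proof -
 let ?n = "real CARD('n)" and ?\<Omega> = "- cball 0 1 :: (real^'n) set"
 have p1: "p > 1" using p zero_less_card_finite[where 'a='n] by linarith
 obtain D where D: "sobolev_loc ?\<Omega> k p u D"
  "(\<Sum>j\<le>k. weighted_norm ?\<Omega> p (- \<tau> - real j) (nabla_norm D j)) < \<infinity>"
  using w by (auto simp: weighted_sobolev_def)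
 have I: "(\<integral>\<^sup>+z\<in>?\<Omega>. ennreal (\<bar>partials js u z * weight z powr (\<tau> + real (length js) - ?n / p)\<bar> powr p) \<partial>lborel) < \<infinity>"
  if js: "length js \<le> k" for js
 proof -
  let ?j = "length js"
  have Djs: "Lp_loc ?\<Omega> p (D js)" "weak_partials ?\<Omega> js u (D js)"
   using D(1) js by (auto simp: sobolev_loc_def)
  have AE: "AE x in lborel. x \<in> ?\<Omega> \<longrightarrow> D js x = partials js u x"
   using weak_partials_AE_eq[OF _ u Djs(1) _ Djs(2)] p1 by auto
  have "weighted_norm ?\<Omega> p (- \<tau> - real ?j) (nabla_norm D ?j) < \<infinity>"
   by (rule le_less_trans[OF member_le_sum[of ?j "{..k}"] D(2)]) (use js in auto)
  hence fin: "(\<integral>\<^sup>+x\<in>?\<Omega>. ennreal (\<bar>nabla_norm D ?j x * weight x powr (- (- \<tau> - real ?j) - ?n / p)\<bar> powr p) \<partial>lborel) < \<infinity>"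
   unfolding weighted_norm_def Let_def by (auto split: if_splits simp: less_top)
  have "(\<integral>\<^sup>+z\<in>?\<Omega>. ennreal (\<bar>partials js u z * weight z powr (\<tau> + real ?j - ?n / p)\<bar> powr p) \<partial>lborel)
   \<le> (\<integral>\<^sup>+x\<in>?\<Omega>. ennreal (\<bar>nabla_norm D ?j x * weight x powr (- (- \<tau> - real ?j) - ?n / p)\<bar> powr p) \<partial>lborel)"
  proof (rule nn_integral_mono_AE)
   show "AE z in lborel. ennreal (\<bar>partials js u z * weight z powr (\<tau> + real ?j - ?n / p)\<bar> powr p) * indicator ?\<Omega> z
    \<le> ennreal (\<bar>nabla_norm D ?j z * weight z powr (- (- \<tau> - real ?j) - ?n / p)\<bar> powr p) * indicator ?\<Omega> z"
    using AE
   proof eventually_elim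
    case (elim z)
    show ?case
    proof (cases "z \<in> ?\<Omega>")
     case True
     have fin_js: "finite {is :: 'n list. length is = ?j}"
      using finite_lists_length_eq[of "UNIV :: 'n set" ?j] by simp
     have "(D js z)\<^sup>2 \<le> (\<Sum>is | length is = ?j. (D is z)\<^sup>2)"
      by (rule member_le_sum[where f = "%is. (D is z)\<^sup>2"]) (use fin_js in auto)
     hence "\<bar>D js z\<bar> \<le> nabla_norm D ?j z"
      unfolding nabla_norm_def by (intro real_le_rsqrt) simp
     hence "\<bar>partials js u z\<bar> \<le> \<bar>nabla_norm D ?j z\<bar>" using elim True by auto
     hence "\<bar>partials js u z * weight z powr (\<tau> + real ?j - ?n / p)\<bar>
       \<le> \<bar>nabla_norm D ?j z * weight z powr (- (- \<tau> - real ?j) - ?n / p)\<bar>"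
      unfolding abs_mult by (intro mult_mono) (auto simp: add.commute)
     hence "\<bar>partials js u z * weight z powr (\<tau> + real ?j - ?n / p)\<bar> powr p
       \<le> \<bar>nabla_norm D ?j z * weight z powr (- (- \<tau> - real ?j) - ?n / p)\<bar> powr p"
      using p1 by (intro powr_mono2) auto
     thus ?thesis by (intro mult_right_mono ennreal_leI) auto
    qed simp
   qed
  qed
  thus ?thesis using fin by (rule le_less_trans)
 qed
 have "partials is u \<in> O[at_infinity](%x. norm x powr (- (\<tau> + real (length is))))"
 proof (rule weighted_sobolev_pointwise[OF Cinf_partials[OF u] p])
  show "(\<integral>\<^sup>+z\<in>?\<Omega>. ennreal (\<bar>partials is u z * weight z powr (\<tau> + real (length is) - ?n / p)\<bar> powr p) \<partial>lborel) < \<infinity>"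
   by (rule I) (use k in simp)
  fix i
  show "(\<integral>\<^sup>+z\<in>?\<Omega>. ennreal (\<bar>partial i (partials is u) z * weight z powr (\<tau> + real (length is) + 1 - ?n / p)\<bar> powr p) \<partial>lborel) < \<infinity>"
   using I[of "i # is"] k by (simp add: partials_Cons partial_eq_dd add_ac)
 qed
 thus ?thesis by simp
qed

section \<open>Decay classes at infinity\<close>

abbreviation exterior :: "(real^'n::finite) set" where
 "exterior \<equiv> - cball 0 1"

text \<open>The pointwise counterpart of the weighted spaces, in the manner of symbol classes:
  exponents add under products and grow by one under each derivative.\<close>

definition decay :: "nat => real => (real^'n::finite => real) => bool" where
 "decay m a f \<longleftrightarrow> Cinf exterior f \<and> (\<forall>is. length is \<le> m \<longrightarrow>
  partials is f \<in> O[at_infinity](%x. norm x powr (- a - real (length is))))"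

lemma open_exterior [simp]: "open (exterior :: (real^'n::finite) set)"
 by (simp add: open_Compl)

lemma eventually_exterior: "\<forall>\<^sub>F x in at_infinity. x \<in> exterior"
 unfolding eventually_at_infinity by (rule exI[of _ 2]) auto

lemma decay_Cinf: "decay m a f ==> Cinf exterior f"
 by (simp add: decay_def)

lemma decay_bigo: "decay m a f ==> f \<in> O[at_infinity](%x. norm x powr (- a))"
 unfolding decay_def by (auto dest!: spec[of _ "[]"])

lemma decay_0: "decay 0 a f \<longleftrightarrow> Cinf exterior f \<and> f \<in> O[at_infinity](%x. norm x powr (- a))"
 by (simp add: decay_def)

text \<open>Peels off the derivative that is applied first, so that inductions over \<open>m\<close>
  need the sum and product rules for a single derivative only.\<close>

lemma decay_Suc:
 "decay (Suc m) a f \<longleftrightarrow> decay 0 a f \<and> (\<forall>i. decay m (a + 1) (partial i f))"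
proof
 assume f: "decay (Suc m) a f"
 have "partials is (partial i f) \<in> O[at_infinity](%x. norm x powr (- (a + 1) - real (length is)))"
  if "length is \<le> m" for i "is"
 proof -
  have *: "\<forall>is. length is \<le> Suc m \<longrightarrow>
    partials is f \<in> O[at_infinity](%x. norm x powr (- a - real (length is)))"
   using f unfolding decay_def by blast
  have "partials (is @ [i]) f \<in> O[at_infinity](%x. norm x powr (- a - real (length (is @ [i]))))"
   by (rule *[rule_format]) (use that in simp)
  moreover have "- a - real (length (is @ [i])) = - (a + 1) - real (length is)" by simp
  ultimately show ?thesis unfolding partials_snoc by (simp only:)
 qed
 thus "decay 0 a f \<and> (\<forall>i. decay m (a + 1) (partial i f))"
  using f by (auto simp: decay_0 decay_bigo decay_Cinf decay_def partial_eq_dd)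
next
 assume f: "decay 0 a f \<and> (\<forall>i. decay m (a + 1) (partial i f))"
 have "partials is f \<in> O[at_infinity](%x. norm x powr (- a - real (length is)))" if "length is \<le> Suc m" for "is"
 proof (cases "is" rule: rev_cases)
  case Nil thus ?thesis using f by (simp add: decay_0)
 next
  case (snoc js i)
  have "decay m (a + 1) (partial i f)" using f by blast
  hence "partials js (partial i f) \<in> O[at_infinity](%x. norm x powr (- (a + 1) - real (length js)))"
   using that snoc unfolding decay_def by simp
  moreover have "- (a + 1) - real (length js) = - a - real (length is)" by (simp add: snoc)
  ultimately show ?thesis unfolding snoc partials_snoc by (simp only:)
 qed
 thus "decay (Suc m) a f" using f by (simp add: decay_def)
qed

lemma decay_partial: "decay (Suc m) a f ==> b \<le> a + 1 ==> decay m b (partial i f)"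
 and decay_mono: "decay m a f ==> m' \<le> m ==> b \<le> a ==> decay m' b f"
proof -
 show mono: "decay m a f ==> m' \<le> m ==> b \<le> a ==> decay m' b f" for m m' a b and f :: "real^'n => real"
 proof -
  assume f: "decay m a f" "m' \<le> m" "b \<le> a"
  have "(%x::real^'n. norm x powr (- a - l)) \<in> O[at_infinity](%x. norm x powr (- b - l))" for l
  proof (rule bigoI[where c = 1])
   show "\<forall>\<^sub>F x::real^'n in at_infinity. norm (norm x powr (- a - l)) \<le> 1 * norm (norm x powr (- b - l))"
    unfolding eventually_at_infinity
   proof (intro exI[of _ 1] allI impI)
    fix x :: "real^'n" assume "1 \<le> norm x"
    hence "norm x powr (- a - l) \<le> norm x powr (- b - l)" using f(3) by (intro powr_mono) auto
    thus "norm (norm x powr (- a - l)) \<le> 1 * norm (norm x powr (- b - l))" by simp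
   qed
  qed
  from landau_o.big_trans[OF _ this]
  show "decay m' b f" using f(1,2) unfolding decay_def by (meson le_trans)
 qed
 show "decay (Suc m) a f ==> b \<le> a + 1 ==> decay m b (partial i f)"
  unfolding decay_Suc by (auto intro: mono)
qed

lemma decay_cong:
 assumes "decay m a f" "!!x. x \<in> exterior ==> f x = g x"
 shows "decay m a g"
proof -
 have eq: "partials is f x = partials is g x" if "x \<in> exterior" for "is" x
  using that
 proof (induction "is" arbitrary: x)
  case (Cons i "is")
  thus ?case unfolding partials_Cons by (intro dd_cong[OF open_exterior Cons.prems]) auto
 qed (use assms in auto)
 have "partials is g \<in> O[at_infinity](h)" if "partials is f \<in> O[at_infinity](h)" for "is" h
  using that eventually_mono[OF eventually_exterior eq[of _ "is"]]
  by (subst landau_o.big.in_cong[symmetric]) auto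
 thus ?thesis using assms(1) Cinf_cong[OF open_exterior assms(2)] unfolding decay_def by auto
qed

lemma partial_add: "f differentiable (at x) ==> g differentiable (at x) ==>
  partial i (%y. f y + g y) x = partial i f x + partial i g x"
 by (simp add: partial_eq_dd dd_add)

lemma partial_mult: "f differentiable (at x) ==> g differentiable (at x) ==>
  partial i (%y. f y * g y) x = f x * partial i g x + partial i f x * g x"
 by (simp add: partial_eq_dd dd_mult)

lemma dd_const_fun [simp]: "dd v (%x. c) = (%x. 0)"
 by (simp add: fun_eq_iff)

lemma decay_zero: "decay m a (%x. 0)"
 by (induction m arbitrary: a) (auto simp: decay_Suc decay_0 partial_eq_dd[abs_def] Cinf_const)

lemma decay_const: "a \<le> 0 ==> decay m a (%x. c)"
proof -
 have "decay m 0 (%x. c)"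
  by (cases m) (auto simp: decay_Suc decay_0 Cinf_const partial_eq_dd decay_zero
    intro!: bigoI[where c = "\<bar>c\<bar>"] eventually_mono[OF eventually_exterior])
 thus "a \<le> 0 ==> decay m a (%x. c)" using decay_mono by blast
qed

lemma decay_add: "decay m a f ==> decay m a g ==> decay m a (%x. f x + g x)"
proof (induction m arbitrary: a f g)
 case 0 thus ?case by (auto simp: decay_0 Cinf_add intro: sum_in_bigo)
next
 case (Suc m)
 have "decay m (a + 1) (partial i (%x. f x + g x))" for i
 proof (rule decay_cong)
  show "decay m (a + 1) (%x. partial i f x + partial i g x)"
   using Suc.prems by (intro Suc.IH) (auto simp: decay_Suc)
 next
  fix x :: "real^'a" assume "x \<in> exterior"
  thus "partial i f x + partial i g x = partial i (%x. f x + g x) x"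
   using Suc.prems by (intro partial_add[symmetric] Cinf_differentiable[OF decay_Cinf])
 qed
 moreover have "decay 0 a (%x. f x + g x)"
  using Suc.prems by (auto simp: decay_0 Cinf_add decay_Suc intro: sum_in_bigo)
 ultimately show ?case by (simp add: decay_Suc)
qed

lemma decay_mult:
 fixes f g :: "real^'n::finite => real"
 shows "decay m a f ==> decay m b g ==> c \<le> a + b ==> decay m c (%x. f x * g x)"
proof -
 have base: "decay 0 (a + b) (%x. f x * g x)" if "decay 0 a f" "decay 0 b g" for a b and f g :: "real^'n::finite => real"
 proof -
  have "(%x. f x * g x) \<in> O[at_infinity](%x. norm x powr (- a) * norm x powr (- b))"
   using that by (intro landau_o.big.mult) (auto simp: decay_0)
  thus ?thesis using that by (simp add: decay_0 Cinf_mult flip: powr_add)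
 qed
 have main: "decay m a f ==> decay m b g ==> decay m (a + b) (%x. f x * g x)" for f g :: "real^'n::finite => real" and m a b
 proof (induction m arbitrary: a b f g)
  case 0 thus ?case by (rule base)
 next
  case (Suc m)
  have f: "decay m a f" and g: "decay m b g" using Suc.prems decay_mono[of "Suc m" _ _ m] by auto
  have "decay m (a + b + 1) (partial i (%x. f x * g x))" for i
  proof (rule decay_cong)
   have "decay m (a + (b + 1)) (%x. f x * partial i g x)"
    using Suc.prems by (intro Suc.IH f) (auto simp: decay_Suc)
   moreover have "decay m ((a + 1) + b) (%x. partial i f x * g x)"
    using Suc.prems by (intro Suc.IH g) (auto simp: decay_Suc)
   ultimately show "decay m (a + b + 1) (%x. f x * partial i g x + partial i f x * g x)"
    by (intro decay_add) (simp_all add: algebra_simps)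
  next
   fix x :: "real^'n" assume "x \<in> exterior"
   thus "f x * partial i g x + partial i f x * g x = partial i (%x. f x * g x) x"
    using Suc.prems by (intro partial_mult[symmetric] Cinf_differentiable[OF decay_Cinf])
  qed
  moreover have "decay 0 (a + b) (%x. f x * g x)"
   using Suc.prems by (intro base) (auto simp: decay_Suc)
  ultimately show ?case by (simp add: decay_Suc)
 qed
 show "decay m a f ==> decay m b g ==> c \<le> a + b ==> decay m c (%x. f x * g x)"
  using main decay_mono by blast
qed

lemma decay_cmult: "decay m a f ==> decay m a (%x. c * f x)"
 by (rule decay_mult[OF decay_const[of 0]]) auto

lemma decay_uminus: "decay m a f ==> decay m a (%x. - f x)"
 using decay_cmult[of m a f "-1"] by simp

lemma decay_diff: "decay m a f ==> decay m a g ==> decay m a (%x. f x - g x)"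
 using decay_add[OF _ decay_uminus] by fastforce

lemma decay_sum: "(!!i. i \<in> I ==> decay m a (f i)) ==> decay m a (%x. \<Sum>i\<in>I. f i x)"
 by (induction I rule: infinite_finite_induct) (auto intro: decay_zero decay_add)

lemma decay_divide: "decay m a f ==> decay m a (%x. f x / c)"
 using decay_cmult[of m a f "inverse c"] by (simp add: divide_inverse mult.commute)

section \<open>Smooth matrix-valued functions\<close>

lemma invertible_matrix_inv:
 fixes M :: "real^'n^'n"
 assumes "det M \<noteq> 0"
 shows "M ** matrix_inv M = mat 1" "matrix_inv M ** M = mat 1"
proof -
 have "\<exists>N. M ** N = mat 1 \<and> N ** M = mat 1" using assms by (simp flip: invertible_def add: invertible_det_nz)
 from someI_ex[OF this] show "M ** matrix_inv M = mat 1" "matrix_inv M ** M = mat 1"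
  by (simp_all add: matrix_inv_def)
qed

lemma matrix_inv_nth:
 fixes M :: "real^'n^'n"
 assumes "det M \<noteq> 0"
 shows "(\<Oplus>c. M $ a $ c * matrix_inv M $ c $ b) = (if a = b then 1 else 0)"
  "(\<Oplus>c. matrix_inv M $ a $ c * M $ c $ b) = (if a = b then 1 else 0)"
 using invertible_matrix_inv[OF assms] by (simp_all add: matrix_matrix_mult_def mat_def vec_eq_iff)

lemma matrix_inv_unique:
 fixes M N :: "real^'n^'n"
 assumes "N ** M = mat 1"
 shows "matrix_inv M = N"
proof -
 have "M ** N = mat 1" using assms matrix_left_right_inverse by blast
 hence "invertible M" using assms unfolding invertible_def by blast
 hence "M ** matrix_inv M = mat 1" by (intro invertible_matrix_inv) (simp add: invertible_det_nz)
 hence "N ** (M ** matrix_inv M) = N" by simp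
 thus ?thesis using assms by (simp add: matrix_mul_assoc)
qed

lemma matrix_inv_sym:
 fixes M :: "real^'n^'n"
 assumes "det M \<noteq> 0" "transpose M = M"
 shows "matrix_inv M $ i $ j = matrix_inv M $ j $ i"
proof -
 have "transpose (matrix_inv M) ** M = transpose (M ** matrix_inv M)"
  using assms(2) by (simp add: matrix_transpose_mul)
 also have "\<dots> = mat 1" using invertible_matrix_inv[OF assms(1)] by simp
 finally have "matrix_inv M = transpose (matrix_inv M)" by (rule matrix_inv_unique)
 from arg_cong[OF this, of "%N. N $ i $ j"] show ?thesis by (simp only: transpose_def vec_lambda_beta)
qed

text \<open>Cramer's rule: entries of the inverse are quotients of polynomials in the entries, which
  is the source of their smoothness.\<close>

lemma matrix_inv_cramer:
 fixes M :: "real^'n^'n"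
 assumes "det M \<noteq> 0"
 shows "matrix_inv M $ i $ j = det (\<chi> a b. if b = i then axis j 1 $ a else M $ a $ b) / det M"
proof -
 have "M *v (matrix_inv M *v axis j 1) = axis j 1"
  using invertible_matrix_inv(1)[OF assms] by (simp add: matrix_vector_mul_assoc)
 hence "matrix_inv M *v axis j 1 = (\<chi> k. det (\<chi> a b. if b = k then axis j 1 $ a else M $ a $ b) / det M)"
  using cramer[OF assms] by blast
 hence "(matrix_inv M *v axis j 1) $ i = det (\<chi> a b. if b = i then axis j 1 $ a else M $ a $ b) / det M"
  by simp
 thus ?thesis by (simp add: matrix_vector_mult_def axis_def if_distrib cong: if_cong)
qed

lemma Cinf_det:
 fixes G :: "'a::euclidean_space => real^'n^'n"
 assumes "open S" "!!i j. Cinf S (%x. G x $ i $ j)"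
 shows "Cinf S (%x. det (G x))"
 unfolding det_def by (intro Cinf_intros assms)

lemma Cinf_matrix_inv:
 fixes G :: "'a::euclidean_space => real^'n^'n"
 assumes S: "open S" and G: "!!i j. Cinf S (%x. G x $ i $ j)" and d: "!!x. x \<in> S ==> det (G x) \<noteq> 0"
 shows "Cinf S (%x. matrix_inv (G x) $ i $ j)"
proof (rule Cinf_cong[OF S])
 show "det (\<chi> a b. if b = i then axis j 1 $ a else G x $ a $ b) / det (G x) = matrix_inv (G x) $ i $ j"
  if "x \<in> S" for x using matrix_inv_cramer[OF d[OF that]] by simp
 have "Cinf S (%x. (\<chi> a b. if b = i then axis j 1 $ a else G x $ a $ b) $ k $ l)" for k l
  by (cases "l = i") (auto intro: Cinf_const[OF S] G)
 thus "Cinf S (%x. det (\<chi> a b. if b = i then axis j 1 $ a else G x $ a $ b) / det (G x))"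
  by (intro Cinf_divide[OF S] Cinf_det[OF S] G d)
qed

text \<open>Differentiate \<open>matrix_inv G ** G = mat 1\<close> and multiply by the inverse from
  the right.\<close>

lemma dd_matrix_inv:
 fixes G :: "'a::euclidean_space => real^'n^'n"
 assumes S: "open S" and G: "!!i j. Cinf S (%x. G x $ i $ j)" and d: "!!x. x \<in> S ==> det (G x) \<noteq> 0"
  and x: "x \<in> S"
 shows "dd v (%x. matrix_inv (G x) $ a $ b) x
  = - (\<Oplus>c e. matrix_inv (G x) $ a $ c * dd v (%x. G x $ c $ e) x * matrix_inv (G x) $ e $ b)"
proof -
 let ?U = "%i j y. matrix_inv (G y) $ i $ j"
 have dU: "?U i j differentiable (at x)" for i j
  using Cinf_differentiable[OF Cinf_matrix_inv[OF S G d] x] .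
 have dG: "(%y. G y $ i $ j) differentiable (at x)" for i j
  using Cinf_differentiable[OF G x] .
 have *: "(\<Oplus>c. ?U a c x * dd v (%y. G y $ c $ e) x) + (\<Oplus>c. dd v (?U a c) x * G x $ c $ e) = 0" for e
 proof -
  have "dd v (%y. \<Oplus>c. ?U a c y * G y $ c $ e) x = dd v (%y. if a = e then 1 else 0) x"
   by (rule dd_cong[OF S x]) (use matrix_inv_nth(2)[OF d] in blast)
  hence "(\<Oplus>c. ?U a c x * dd v (%y. G y $ c $ e) x + dd v (?U a c) x * G x $ c $ e) = 0"
   by (simp add: dd_sum dd_mult dU dG)
  thus ?thesis by (simp add: sum.distrib)
 qed
 have "dd v (?U a b) x = (\<Oplus>c. dd v (?U a c) x * (if c = b then 1 else 0))"
  by (simp add: if_distrib[of "%r. _ * r"] cong: if_cong)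
 also have "\<dots> = (\<Oplus>c. dd v (?U a c) x * (\<Oplus>e. G x $ c $ e * ?U e b x))"
  by (simp only: matrix_inv_nth(1)[OF d[OF x]])
 also have "\<dots> = (\<Oplus>e. (\<Oplus>c. dd v (?U a c) x * G x $ c $ e) * ?U e b x)"
  by (simp only: sum_distrib_left sum_distrib_right mult.assoc) (rule sum.swap)
 also have "\<dots> = (\<Oplus>e. - (\<Oplus>c. ?U a c x * dd v (%y. G y $ c $ e) x) * ?U e b x)"
  using * by (simp add: add_eq_0_iff)
 also have "\<dots> = - (\<Oplus>e c. ?U a c x * dd v (%y. G y $ c $ e) x * ?U e b x)"
  by (simp add: sum_distrib_right sum_negf)
 also have "(\<Oplus>e c. ?U a c x * dd v (%y. G y $ c $ e) x * ?U e b x)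
   = (\<Oplus>c e. ?U a c x * dd v (%y. G y $ c $ e) x * ?U e b x)" by (rule sum.swap)
 finally show ?thesis .
qed

lemma dd_prod:
 assumes "finite I" "!!i. i \<in> I ==> f i differentiable (at x)"
 shows "(%y. \<Prod>i\<in>I. f i y) differentiable (at x)"
  "dd v (%y. \<Prod>i\<in>I. f i y) x = (\<Sum>i\<in>I. dd v (f i) x * (\<Prod>j\<in>I - {i}. f j x))"
proof -
 have "((%y. \<Prod>i\<in>I. f i y) has_derivative (%v. \<Sum>i\<in>I. dd v (f i) x * (\<Prod>j\<in>I - {i}. f j x))) (at x)"
  using assms by (intro has_derivative_prod has_derivative_dd) auto
 thus "(%y. \<Prod>i\<in>I. f i y) differentiable (at x)"
  "dd v (%y. \<Prod>i\<in>I. f i y) x = (\<Sum>i\<in>I. dd v (f i) x * (\<Prod>j\<in>I - {i}. f j x))"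
  by (auto simp: differentiable_def intro: dd_eqI)
qed

text \<open>A permutation other than the identity moves at least two indices, so only the identity
 contributes to the derivative of the determinant at the identity matrix.\<close>

lemma dd_det_at_id:
 fixes H :: "'a::euclidean_space => real^'n^'n"
 assumes dH: "!!i j. (%x. H x $ i $ j) differentiable (at x)" and H: "H x = mat 1"
 shows "dd v (%x. det (H x)) x = (\<Oplus>i. dd v (%x. H x $ i $ i) x)"
proof -
 have perm0: "(\<Oplus>i. dd v (%x. H x $ i $ p i) x * (\<Prod>j\<in>UNIV - {i}. H x $ j $ p j)) = 0"
  if p: "p permutes UNIV" "p \<noteq> id" for p :: "'n => 'n"
 proof (rule sum.neutral, rule ballI)
  fix i :: 'n
  obtain j where j: "j \<noteq> i" "p j \<noteq> j"
  proof -
   obtain k where k: "p k \<noteq> k" using p(2) by (auto simp: fun_eq_iff)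
   show ?thesis
   proof (cases "k = i")
    case False thus ?thesis using k that by blast
   next
    case True
    have "p (p k) \<noteq> p k" using k permutes_inj[OF p(1)] by (metis injD)
    thus ?thesis using that[of "p k"] k True by auto
   qed
  qed
  hence "(\<Prod>j\<in>UNIV - {i}. H x $ j $ p j) = 0"
   by (intro prod_zero bexI[of _ j]) (auto simp: H mat_def)
  thus "dd v (%x. H x $ i $ p i) x * (\<Prod>j\<in>UNIV - {i}. H x $ j $ p j) = 0" by simp
 qed
 have fin: "finite {p :: 'n => 'n. p permutes UNIV}" by (rule finite_permutations) simp
 have "dd v (%x. det (H x)) x = (\<Sum>p | p permutes (UNIV::'n set). of_int (sign p)
   * (\<Oplus>i. dd v (%x. H x $ i $ p i) x * (\<Prod>j\<in>UNIV - {i}. H x $ j $ p j)))"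
  unfolding det_def
  by (subst dd_sum) (auto intro!: differentiable_mult dd_prod dH simp: dd_cmult dd_prod dH)
 also have "\<dots> = (\<Sum>p \<in> {id :: 'n => 'n}. of_int (sign p)
   * (\<Oplus>i. dd v (%x. H x $ i $ p i) x * (\<Prod>j\<in>UNIV - {i}. H x $ j $ p j)))"
  by (rule sum.mono_neutral_right) (use fin perm0 permutes_id in auto)
 also have "\<dots> = (\<Oplus>i. dd v (%x. H x $ i $ i) x)"
  by (simp add: sign_id H mat_def)
 finally show ?thesis .
qed

text \<open>Jacobi's formula. The factorisation \<open>det (G y) = det (G x) * det (H y)\<close>
  with \<open>H y = matrix_inv (G x) ** G y\<close> reduces it to the derivative at the identity
  matrix.\<close>

lemma dd_det:
 fixes G :: "'a::euclidean_space => real^'n^'n"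
 assumes S: "open S" and G: "!!i j. Cinf S (%x. G x $ i $ j)" and d: "det (G x) \<noteq> 0"
  and x: "x \<in> S"
 shows "dd v (%x. det (G x)) x
  = det (G x) * (\<Oplus>a b. matrix_inv (G x) $ a $ b * dd v (%x. G x $ b $ a) x)"
proof -
 define H where "H = (%y. matrix_inv (G x) ** G y)"
 have dG: "(%y. G y $ i $ j) differentiable (at x)" for i j
  using Cinf_differentiable[OF G x] .
 have Hn: "(%y. H y $ i $ j) = (%y. \<Oplus>c. matrix_inv (G x) $ i $ c * G y $ c $ j)" for i j
  by (simp add: H_def matrix_matrix_mult_def)
 have dH: "(%y. H y $ i $ j) differentiable (at x)" for i j
 proof -
  have "(%y. c * G y $ i $ j) differentiable (at x)" for c i j
   by (intro differentiable_mult differentiable_const dG)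
  thus ?thesis unfolding Hn by (intro differentiable_sum) auto
 qed
 have "G x ** H y = G y" for y
  using invertible_matrix_inv[OF d] by (simp add: H_def matrix_mul_assoc)
 hence "(%y. det (G y)) = (%y. det (G x) * det (H y))" by (simp add: fun_eq_iff flip: det_mul)
 moreover have "(%y. det (H y)) differentiable (at x)"
 proof -
  have "(%y. \<Prod>i\<in>UNIV. H y $ i $ p i) differentiable (at x)" for p
   by (rule dd_prod(1)) (auto intro: dH)
  thus ?thesis unfolding det_def
   by (intro differentiable_sum differentiable_mult differentiable_const finite_permutations) auto
 qed
 ultimately have "dd v (%y. det (G y)) x = det (G x) * dd v (%y. det (H y)) x"
  by (simp add: dd_cmult)
 also have "dd v (%y. det (H y)) x = (\<Oplus>i. dd v (%x. H x $ i $ i) x)"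
  by (rule dd_det_at_id[OF dH]) (use invertible_matrix_inv[OF d] in \<open>simp add: H_def\<close>)
 also have "\<dots> = (\<Oplus>a b. matrix_inv (G x) $ a $ b * dd v (%x. G x $ b $ a) x)"
 proof -
  have "(%y. c * G y $ i $ j) differentiable (at x)" for c i j
   by (intro differentiable_mult differentiable_const dG)
  thus ?thesis unfolding Hn by (simp add: dd_sum dd_cmult dG)
 qed
 finally show ?thesis .
qed

lemma dd_sqrt_det:
 fixes G :: "'a::euclidean_space => real^'n^'n"
 assumes S: "open S" and G: "!!i j. Cinf S (%x. G x $ i $ j)" and d: "det (G x) > 0"
  and x: "x \<in> S"
 shows "dd v (%x. sqrt (det (G x))) x
  = sqrt (det (G x)) * ((\<Oplus>a b. matrix_inv (G x) $ a $ b * dd v (%x. G x $ b $ a) x) / 2)"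
proof -
 have "((%y. det (G y)) has_derivative (%v. dd v (%y. det (G y)) x)) (at x)"
  using Cinf_differentiable[OF Cinf_det[OF S G] x] by (rule has_derivative_dd)
 from dd_eqI[OF has_derivative_real_sqrt[OF d this]]
 have "dd v (%x. sqrt (det (G x))) x = dd v (%y. det (G y)) x * (inverse (sqrt (det (G x))) / 2)" .
 moreover have "det (G x) * inverse (sqrt (det (G x))) = sqrt (det (G x))"
  using real_div_sqrt[of "det (G x)"] d by (simp only: divide_inverse less_imp_le)
 moreover have "a * b * (c / 2) = (a * c) * (b / 2)" for a b c :: real by simp
 ultimately show ?thesis
  unfolding dd_det[OF S G less_imp_neq[OF d, symmetric] x, of v] by (simp only:)
qed

section \<open>Curvature of smooth families of metrics\<close>

text \<open>Smoothness in time and space together, on a set of pairs: time derivatives are then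
  directional derivatives like the others and commute with the spatial ones.\<close>

abbreviation joint :: "(real \<times> (real^'n::finite)) set => (real => real^'n => real) => bool" where
 "joint T F \<equiv> Cinf T (%z. F (fst z) (snd z))"

definition dt :: "(real => real^'n::finite => real) => real => real^'n => real" where
 "dt F t x = dd (1, 0) (%z. F (fst z) (snd z)) (t, x)"

lemma partial_slice:
 assumes "joint T F" "(t, x) \<in> T"
 shows "F t differentiable (at x)"
  "partial i (F t) x = dd (0, axis i 1) (%z. F (fst z) (snd z)) (t, x)"
proof -
 have "((%y. (t, y)) has_derivative (%h. (0, h))) (at x)"
  by (auto intro!: derivative_eq_intros)
 from diff_chain_at[OF this has_derivative_dd[OF Cinf_differentiable[OF assms]]]
 have *: "(F t has_derivative (%h. dd (0, h) (%z. F (fst z) (snd z)) (t, x))) (at x)"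
  by (simp add: o_def)
 thus "F t differentiable (at x)"
  "partial i (F t) x = dd (0, axis i 1) (%z. F (fst z) (snd z)) (t, x)"
  by (auto simp: differentiable_def partial_eq_dd intro: dd_eqI)
qed

lemma time_slice:
 assumes "joint T F" "(t, x) \<in> T"
 shows "((%s. F s x) has_real_derivative dt F t x) (at t)"
proof -
 have diff: "(%z. F (fst z) (snd z)) differentiable (at (t, x))" using Cinf_differentiable[OF assms] .
 have "((%s. (s, x)) has_derivative (%h. (h, 0))) (at t)"
  by (auto intro!: derivative_eq_intros)
 from diff_chain_at[OF this has_derivative_dd[OF diff]]
 have "((%s. F s x) has_derivative (%h. dd (h, 0) (%z. F (fst z) (snd z)) (t, x))) (at t)"
  by (simp add: o_def)
 moreover have "dd (h, 0) (%z. F (fst z) (snd z)) (t, x) = h * dt F t x" for h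
  using linear_cmul[OF dd_linear[OF diff], of h "(1, 0)"] by (simp add: dt_def)
 ultimately show ?thesis by (simp add: has_field_derivative_def mult_commute_abs)
qed

context
 fixes T :: "(real \<times> (real^'n::finite)) set"
 assumes T: "open T"
begin

lemma joint_partial: "joint T F ==> joint T (%t. partial i (F t))"
 by (rule Cinf_cong[OF T _ Cinf_dd[of T "%z. F (fst z) (snd z)" "(0, axis i 1)"]])
  (auto simp: partial_slice(2)[of T F])

lemma joint_dt: "joint T F ==> joint T (dt F)"
 by (rule Cinf_cong[OF T _ Cinf_dd[of T "%z. F (fst z) (snd z)" "(1, 0)"]]) (auto simp: dt_def)

lemma dt_partial:
 assumes F: "joint T F" and tx: "(t, x) \<in> T"
 shows "dt (%t. partial i (F t)) t x = partial i (dt F t) x"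
proof -
 let ?F = "%z. F (fst z) (snd z)"
 have "dt (%t. partial i (F t)) t x = dd (1, 0) (dd (0, axis i 1) ?F) (t, x)"
  unfolding dt_def by (rule dd_cong[OF T tx]) (use partial_slice(2)[OF F] in auto)
 also have "\<dots> = dd (0, axis i 1) (dd (1, 0) ?F) (t, x)" by (rule dd_commute[OF T F tx])
 also have "\<dots> = dd (0, axis i 1) (%z. dt F (fst z) (snd z)) (t, x)" by (simp add: dt_def)
 also have "\<dots> = partial i (dt F t) x" using partial_slice(2)[OF joint_dt[OF F] tx] by simp
 finally show ?thesis .
qed

lemma dt_add: "joint T F ==> joint T G ==> (t, x) \<in> T ==>
  dt (%t x. F t x + G t x) t x = dt F t x + dt G t x"
 unfolding dt_def by (rule dd_add) (auto intro: Cinf_differentiable)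

lemma dt_diff: "joint T F ==> joint T G ==> (t, x) \<in> T ==>
  dt (%t x. F t x - G t x) t x = dt F t x - dt G t x"
 unfolding dt_def by (rule dd_diff) (auto intro: Cinf_differentiable)

lemma dt_mult: "joint T F ==> joint T G ==> (t, x) \<in> T ==>
  dt (%t x. F t x * G t x) t x = F t x * dt G t x + dt F t x * G t x"
 unfolding dt_def by (rule dd_mult[THEN trans]) (auto intro: Cinf_differentiable)

lemma dt_sum: "(!!i. i \<in> I ==> joint T (F i)) ==> (t, x) \<in> T ==>
  dt (%t x. \<Sum>i\<in>I. F i t x) t x = (\<Sum>i\<in>I. dt (F i) t x)"
 unfolding dt_def by (rule dd_sum) (auto intro: Cinf_differentiable)

lemma dt_cmult: "joint T F ==> (t, x) \<in> T ==> dt (%t x. c * F t x) t x = c * dt F t x"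
 unfolding dt_def by (rule dd_cmult) (auto intro: Cinf_differentiable)

context
 fixes G :: "real => real^'n => real^'n^'n"
 assumes G: "!!i j. joint T (%t x. G t x $ i $ j)"
  and d: "!!t x. (t, x) \<in> T ==> det (G t x) \<noteq> 0"
begin

lemma joint_matrix_inv: "joint T (%t x. matrix_inv (G t x) $ i $ j)"
 by (rule Cinf_matrix_inv[OF T G]) (use d in auto)

lemma joint_christoffel: "joint T (%t. christoffel (G t) k i j)"
 unfolding christoffel_def divide_inverse
 by (intro Cinf_intros T joint_partial joint_matrix_inv G)

lemma joint_ricci: "joint T (%t x. ricci (G t) x $ i $ j)"
 unfolding ricci_def vec_lambda_beta
 by (intro Cinf_intros T joint_partial joint_christoffel)

lemma joint_scalar: "joint T (%t. scalar_curvature (G t))"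
 unfolding scalar_curvature_def
 by (intro Cinf_intros T joint_ricci joint_matrix_inv)

lemma joint_laplacian: "joint T F ==> joint T (%t. laplacian (G t) (F t))"
 unfolding laplacian_def partials_def foldr.simps o_def id_def
 by (intro Cinf_intros T joint_partial joint_christoffel joint_matrix_inv)

lemma joint_matrix_inner:
 assumes "!!i j. joint T (%t x. S t x $ i $ j)" "!!i j. joint T (%t x. S' t x $ i $ j)"
 shows "joint T (%t x. matrix_inner (G t x) (S t x) (S' t x))"
 unfolding matrix_inner_def
 by (intro Cinf_intros T joint_matrix_inv assms)

lemma joint_Q: "joint T (%t. Q_coord (G t))"
 unfolding Q_coord_def Let_def
 by (intro Cinf_intros T joint_laplacian joint_scalar joint_matrix_inner joint_ricci)

lemma joint_sqrt_det: "(!!t x. (t, x) \<in> T ==> det (G t x) > 0) ==> joint T (%t x. sqrt (det (G t x)))"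
 by (rule Cinf_sqrt[OF T Cinf_det[OF T G]]) auto

end
end

lemma joint_const:
 fixes f :: "real^'n::finite => real"
 assumes S: "open S" and f: "Cinf S f"
 shows "joint (UNIV \<times> S) (%t. f)"
proof (rule Cinf_compose[of "UNIV \<times> S" snd S f])
 show "open (UNIV \<times> S)" using S by (intro open_Times) auto
 fix b :: "real^'n"
 have "bounded_linear (%z :: real \<times> (real^'n). snd z \<bullet> b)"
  by (intro bounded_linear_compose[OF bounded_linear_inner_left bounded_linear_snd])
 thus "Cinf (UNIV \<times> S) (%z :: real \<times> (real^'n). snd z \<bullet> b)"
  using S by (intro Cinf_linear open_Times) auto
qed (use f in auto)

lemma joint_at:
 fixes F :: "real => real^'n::finite => real"
 assumes F: "joint T F" and S: "open S" "!!x. x \<in> S ==> (t, x) \<in> T"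
 shows "Cinf S (F t)"
proof -
 have "Cinf S (%x. F (fst (t, x)) (snd (t, x)))"
 proof (rule Cinf_compose[OF S(1), of "%x. (t, x)" T])
  fix b :: "real \<times> (real^'n)"
  have "(t, x) \<bullet> b = t * fst b + x \<bullet> snd b" for x by (simp add: inner_prod_def)
  thus "Cinf S (%x. (t, x) \<bullet> b)"
   using S(1) by (auto intro!: Cinf_intros Cinf_inner)
 qed (use S F in auto)
 thus ?thesis by simp
qed

lemma sum_rotate3: "(\<Sum>i\<in>A. \<Sum>j\<in>B. \<Sum>l\<in>C. f i j l) = (\<Sum>l\<in>C. \<Sum>i\<in>A. \<Sum>j\<in>B. f i j l)"
proof -
 have "(\<Sum>i\<in>A. \<Sum>j\<in>B. \<Sum>l\<in>C. f i j l) = (\<Sum>i\<in>A. \<Sum>l\<in>C. \<Sum>j\<in>B. f i j l)"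
  by (rule sum.cong[OF refl], rule sum.swap)
 also have "\<dots> = (\<Sum>l\<in>C. \<Sum>i\<in>A. \<Sum>j\<in>B. f i j l)" by (rule sum.swap)
 finally show ?thesis .
qed

text \<open>Symmetry and nondegeneracy only, not positivity: for the perturbed tensors
  \<open>g + t h\<close> in an arbitrary chart, a nonzero determinant is all that is at
  hand.\<close>

locale metric_coords =
 fixes S :: "(real^'n::finite) set" and G :: "real^'n => real^'n^'n"
 assumes S: "open S"
  and G: "!!i j. Cinf S (%x. G x $ i $ j)"
  and G_sym: "!!x i j. x \<in> S ==> G x $ i $ j = G x $ j $ i"
  and G_det: "!!x. x \<in> S ==> det (G x) \<noteq> 0"
begin

abbreviation U :: "'n => 'n => real^'n => real" where
 "U i j x \<equiv> matrix_inv (G x) $ i $ j"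

lemma J: "joint (UNIV \<times> S) (%t x. G x $ i $ j)" "open (UNIV \<times> S)"
 using joint_const[OF S G] S by (auto intro: open_Times)

lemma Cinf_U: "Cinf S (U i j)"
 by (rule Cinf_matrix_inv[OF S G G_det])

lemma U_sym: "x \<in> S ==> U i j x = U j i x"
 by (rule matrix_inv_sym[OF G_det]) (auto simp: transpose_def vec_eq_iff G_sym)

lemma Cinf_christoffel: "Cinf S (christoffel G k i j)"
 using joint_at[OF joint_christoffel[OF J(2) J(1)] S, of 0] G_det by auto

lemma Cinf_scalar: "Cinf S (scalar_curvature G)"
 using joint_at[OF joint_scalar[OF J(2) J(1)] S, of 0] G_det by auto

lemma Cinf_Q: "Cinf S (Q_coord G)"
 using joint_at[OF joint_Q[OF J(2) J(1)] S, of 0] G_det by auto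

lemma diff: "Cinf S f ==> x \<in> S ==> f differentiable (at x)"
 by (rule Cinf_differentiable)

lemma partial_G_sym: "x \<in> S ==> partial k (%y. G y $ i $ j) x = partial k (%y. G y $ j $ i) x"
 unfolding partial_eq_dd by (rule dd_cong[OF S]) (auto intro: G_sym)

lemma christoffel_sym: "x \<in> S ==> christoffel G k i j x = christoffel G k j i x"
 unfolding christoffel_def using partial_G_sym by (simp add: add.commute)

lemma partial_U: "x \<in> S ==> partial v (U a b) x
  = - (\<Oplus>c e. U a c x * partial v (%y. G y $ c $ e) x * U e b x)"
 unfolding partial_eq_dd by (rule dd_matrix_inv[OF S G G_det])

text \<open>The logarithmic derivative of \<open>det G\<close>; half of it is that of the volume
  density.\<close>

definition \<alpha> :: "'n => real^'n => real" where
 "\<alpha> l x = (\<Oplus>a b. U a b x * partial l (%y. G y $ b $ a) x)"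

definition \<beta> :: "'n => real^'n => real" where
 "\<beta> l x = (\<Oplus>a b. U a b x * partial a (%y. G y $ b $ l) x)"

lemma sum_christoffel:
 assumes x: "x \<in> S"
 shows "(\<Oplus>i j. U i j x * christoffel G k i j x) = (\<Oplus>l. U k l x * (\<beta> l x - \<alpha> l x / 2))"
proof -
 let ?d = "%i a b. partial i (%y. G y $ a $ b) x"
 have "(\<Oplus>i j. U i j x * christoffel G k i j x)
  = (\<Oplus>i j l. U k l x * (U i j x * ?d i j l + U i j x * ?d j i l - U i j x * ?d l i j) / 2)"
  by (simp add: christoffel_def sum_distrib_left sum_divide_distrib algebra_simps)
 also have "\<dots> = (\<Oplus>l i j. U k l x * (U i j x * ?d i j l + U i j x * ?d j i l - U i j x * ?d l i j) / 2)"
  by (rule sum_rotate3)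
 also have "\<dots> = (\<Oplus>l. U k l x * ((\<Oplus>i j. U i j x * ?d i j l)
   + (\<Oplus>i j. U i j x * ?d j i l) - (\<Oplus>i j. U i j x * ?d l i j)) / 2)"
  by (simp only: sum_distrib_left[symmetric] sum_divide_distrib[symmetric] sum.distrib sum_subtractf)
 finally have eq: "(\<Oplus>i j. U i j x * christoffel G k i j x)
  = (\<Oplus>l. U k l x * ((\<Oplus>i j. U i j x * ?d i j l)
   + (\<Oplus>i j. U i j x * ?d j i l) - (\<Oplus>i j. U i j x * ?d l i j)) / 2)" .
 have b2: "(\<Oplus>i j. U i j x * ?d j i l) = \<beta> l x" for l
  unfolding \<beta>_def by (subst sum.swap) (intro sum.cong refl, simp add: U_sym[OF x])
 have b1: "(\<Oplus>i j. U i j x * ?d i j l) = \<beta> l x" for l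
  by (simp add: \<beta>_def)
 have b3: "(\<Oplus>i j. U i j x * ?d l i j) = \<alpha> l x" for l
  unfolding \<alpha>_def by (intro sum.cong refl arg_cong2[of _ _ _ _ "(*)"] partial_G_sym[OF x])
 have "U k l x * (\<beta> l x + \<beta> l x - \<alpha> l x) / 2 = U k l x * (\<beta> l x - \<alpha> l x / 2)" for l
  by (simp add: field_simps)
 thus ?thesis unfolding eq b1 b2 b3 by (simp only:)
qed

lemma sum_partial_U:
 assumes x: "x \<in> S"
 shows "(\<Oplus>i. partial i (U i j) x) = - (\<Oplus>l. U j l x * \<beta> l x)"
proof -
 have "(\<Oplus>i. partial i (U i j) x)
  = - (\<Oplus>i c e. U i c x * partial i (%y. G y $ c $ e) x * U e j x)"
  by (simp add: partial_U[OF x] sum_negf)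
 also have "(\<Oplus>i c e. U i c x * partial i (%y. G y $ c $ e) x * U e j x)
   = (\<Oplus>e i c. U i c x * partial i (%y. G y $ c $ e) x * U e j x)"
  by (rule sum_rotate3)
 also have "\<dots> = (\<Oplus>e. \<beta> e x * U e j x)" by (simp add: \<beta>_def sum_distrib_right)
 finally show ?thesis by (simp only: U_sym[OF x, of _ j] mult.commute)
qed

lemma partial_sqrt_det:
 assumes x: "x \<in> S" and d: "det (G x) > 0"
 shows "partial i (%x. sqrt (det (G x))) x = sqrt (det (G x)) * (\<alpha> i x / 2)"
 unfolding partial_eq_dd \<alpha>_def by (rule dd_sqrt_det[OF S G d x])

text \<open>The divergence form of the Laplace-Beltrami operator. Derivatives of the inverse metric
  contribute \<open>- \<beta>\<close>, those of the density \<open>\<alpha> / 2\<close>; together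
  these are minus the contracted Christoffel symbols of \<open>sum_christoffel\<close>.\<close>

lemma laplacian_divergence:
 assumes f: "Cinf S f" and d: "!!x. x \<in> S ==> det (G x) > 0" and x: "x \<in> S"
 shows "sqrt (det (G x)) * laplacian G f x
  = (\<Oplus>i. partial i (%y. sqrt (det (G y)) * (\<Oplus>j. U i j y * partial j f y)) x)"
proof -
 let ?w = "%y. sqrt (det (G y))"
 have dw: "?w differentiable (at x)"
  using Cinf_differentiable[OF Cinf_sqrt[OF S Cinf_det[OF S G] d] x] .
 have dU: "U i j differentiable (at x)" for i j using diff[OF Cinf_U x] .
 have df: "partial j f differentiable (at x)" for j
  unfolding partial_eq_dd by (rule diff[OF Cinf_dd[OF f] x])
 have "(\<Oplus>i. partial i (%y. ?w y * (\<Oplus>j. U i j y * partial j f y)) x)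
  = (\<Oplus>i. ?w x * (\<Oplus>j. U i j x * partial i (partial j f) x + partial i (U i j) x * partial j f x)
    + partial i ?w x * (\<Oplus>j. U i j x * partial j f x))"
  by (simp add: partial_eq_dd dd_mult dd_sum dw dU df[unfolded partial_eq_dd])
 also have "\<dots> = ?w x * ((\<Oplus>i j. U i j x * partial i (partial j f) x)
   + (\<Oplus>i j. partial i (U i j) x * partial j f x)
   + (\<Oplus>i j. \<alpha> i x / 2 * U i j x * partial j f x))"
  by (simp add: partial_sqrt_det[OF x d[OF x]] sum_distrib_left sum.distrib algebra_simps)
 also have "(\<Oplus>i j. partial i (U i j) x * partial j f x)
   = - (\<Oplus>j. (\<Oplus>l. U j l x * \<beta> l x) * partial j f x)"
  by (subst sum.swap) (simp only: sum_distrib_right[symmetric] sum_partial_U[OF x], simp add: sum_negf)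
 also have "(\<Oplus>i j. \<alpha> i x / 2 * U i j x * partial j f x)
   = (\<Oplus>j. (\<Oplus>l. U j l x * (\<alpha> l x / 2)) * partial j f x)"
 proof (subst sum.swap, intro sum.cong refl)
  fix j
  have "(\<Oplus>i. \<alpha> i x / 2 * U i j x * partial j f x) = (\<Oplus>i. \<alpha> i x / 2 * U i j x) * partial j f x"
   by (rule sum_distrib_right[symmetric])
  also have "(\<Oplus>i. \<alpha> i x / 2 * U i j x) = (\<Oplus>l. U j l x * (\<alpha> l x / 2))"
   by (intro sum.cong refl) (simp add: U_sym[OF x, of _ j])
  finally show "(\<Oplus>i. \<alpha> i x / 2 * U i j x * partial j f x) = (\<Oplus>l. U j l x * (\<alpha> l x / 2)) * partial j f x" .
 qed
 finally have "(\<Oplus>i. partial i (%y. ?w y * (\<Oplus>j. U i j y * partial j f y)) x)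
  = ?w x * ((\<Oplus>i j. U i j x * partial i (partial j f) x)
   - (\<Oplus>j. (\<Oplus>l. U j l x * (\<beta> l x - \<alpha> l x / 2)) * partial j f x))"
  by (simp add: algebra_simps sum.distrib sum_subtractf)
 moreover have "laplacian G f x = (\<Oplus>i j. U i j x * partial i (partial j f) x)
   - (\<Oplus>k. (\<Oplus>i j. U i j x * christoffel G k i j x) * partial k f x)"
 proof -
  have "laplacian G f x = (\<Oplus>i j. U i j x * partial i (partial j f) x)
   - (\<Oplus>i j k. U i j x * christoffel G k i j x * partial k f x)"
   by (simp add: laplacian_def partials_def right_diff_distrib sum_subtractf sum_distrib_left mult.assoc)
  also have "(\<Oplus>i j k. U i j x * christoffel G k i j x * partial k f x)
   = (\<Oplus>k i j. U i j x * christoffel G k i j x * partial k f x)"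
   by (rule sum_rotate3)
  finally show ?thesis by (simp add: sum_distrib_right)
 qed
 ultimately show ?thesis by (simp add: sum_christoffel[OF x])
qed

end

section \<open>Coordinate invariance\<close>

lemma matrix_add_rdistrib: "(A + B) ** C = A ** C + B ** (C :: real^'n^'m)"
 by (simp add: vec_eq_iff matrix_matrix_mult_def sum.distrib distrib_right)

lemma partial_compose:
 fixes y :: "real^'n::finite => real^'n"
 assumes "!!a. (%x. y x $ a) differentiable (at x)" "f differentiable (at (y x))"
 shows "(%x. f (y x)) differentiable (at x)"
  "partial i (%x. f (y x)) x = (\<Oplus>a. partial a f (y x) * partial i (%x. y x $ a) x)"
proof -
 have *: "(%x. y x \<bullet> b) differentiable (at x)" if "b \<in> Basis" for b
  using that assms(1) by (auto simp: Basis_vec_def inner_axis)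
 have Basis: "(Basis :: (real^'n) set) = range (%i. axis i 1)" by (auto simp: Basis_vec_def)
 have inj: "inj (%i::'n. axis i (1::real))" by (auto simp: inj_def axis_eq_axis)
 show "(%x. f (y x)) differentiable (at x)" by (rule dd_compose(1)[OF open_UNIV * assms(2)])
 have "dd (axis i 1) (%x. f (y x)) x = (\<Sum>b\<in>Basis. dd b f (y x) * dd (axis i 1) (%x. y x \<bullet> b) x)"
  by (rule dd_compose(2)[OF open_UNIV * assms(2)])
 also have "\<dots> = (\<Oplus>a. dd (axis a 1) f (y x) * dd (axis i 1) (%x. y x $ a) x)"
  unfolding Basis by (subst sum.reindex[OF inj]) (simp add: inner_axis)
 finally show "partial i (%x. f (y x)) x = (\<Oplus>a. partial a f (y x) * partial i (%x. y x $ a) x)"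
  by (simp add: partial_eq_dd)
qed

lemma Cinf_compose_vec:
 fixes y :: "real^'n::finite => real^'n"
 assumes S: "open S" and y: "!!a. Cinf S (%x. y x $ a)" "!!x. x \<in> S ==> y x \<in> S'" and f: "Cinf S' f"
 shows "Cinf S (%x. f (y x))"
 by (rule Cinf_compose[OF S _ y(2) f]) (use y(1) in \<open>auto simp: Basis_vec_def inner_axis\<close>)

text \<open>The Riemann tensor with upper index \<open>c\<close>. With the Christoffel symbols read
  as matrices \<open>\<Gamma>_i\<close>, it is
  \<open>\<partial>_j \<Gamma>_i - \<partial>_i \<Gamma>_j\<close> plus the commutator of
  \<open>\<Gamma>_j\<close> and \<open>\<Gamma>_i\<close>; contracting \<open>c\<close> with
  \<open>j\<close> gives \<open>ricci\<close>.\<close>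

definition riem :: "(real^'n::finite => real^'n^'n) => 'n => 'n => 'n => 'n => real^'n => real" where
 "riem G c l j i x = partial j (christoffel G c i l) x - partial i (christoffel G c j l) x
  + (\<Oplus>m. christoffel G c j m x * christoffel G m i l x - christoffel G c i m x * christoffel G m j l x)"

lemma ricci_riem: "ricci G x $ i $ j = (\<Oplus>k. riem G k i k j x)"
 if sym: "!!k i j. christoffel G k i j x = christoffel G k j i x"
  "!!l k i j. partial l (christoffel G k i j) x = partial l (christoffel G k j i) x" for G :: "real^'n::finite => real^'n^'n"
proof -
 have "(\<Oplus>k. riem G k i k j x) = (\<Oplus>k. partial k (christoffel G k j i) x - partial j (christoffel G k k i) x)
  + (\<Oplus>k l. christoffel G k k l x * christoffel G l j i x - christoffel G k j l x * christoffel G l k i x)"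
  by (simp add: riem_def sum.distrib)
 thus ?thesis by (simp add: ricci_def sym(1)[of _ i] sym(2)[of _ _ i])
qed

text \<open>\<open>G\<close> is the pullback of \<open>G'\<close> under the coordinate change \<open>y\<close>.\<close>

locale coordinate_change = metric_coords S G + primed: metric_coords S' G'
 for S :: "(real^'n::finite) set" and G and S' :: "(real^'n) set" and G' +
 fixes y :: "real^'n => real^'n"
 assumes y: "!!a. Cinf S (%x. y x $ a)" and yS: "!!x. x \<in> S ==> y x \<in> S'"
  and pullback: "!!x i j. x \<in> S ==> G x $ i $ j = (\<Oplus>a. \<Sum>b\<in>UNIV.
   partial i (%y'. y y' $ a) x * partial j (%y'. y y' $ b) x * G' (y x) $ a $ b)"
begin

abbreviation V :: "'n => 'n => real^'n => real" where
 "V i j x \<equiv> matrix_inv (G' x) $ i $ j"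

definition B :: "'n => 'n => real^'n => real" where
 "B a i = partial i (%x. y x $ a)"

definition Bm :: "real^'n => real^'n^'n" where
 "Bm x = (\<chi> a i. B a i x)"

lemma Cinf_B: "Cinf S (B a i)"
 unfolding B_def partial_eq_dd by (rule Cinf_dd[OF y])

lemma diff_B: "x \<in> S ==> B a i differentiable (at x)"
 by (rule diff[OF Cinf_B])

lemma Hess_sym: "x \<in> S ==> partial j (B a i) x = partial i (B a j) x"
 unfolding B_def partial_eq_dd by (rule dd_commute[OF S y])

lemma chain:
 assumes "Cinf S' f" "x \<in> S"
 shows "partial i (%x. f (y x)) x = (\<Oplus>a. partial a f (y x) * B a i x)"
  "(%x. f (y x)) differentiable (at x)"
proof -
 have "f differentiable (at (y x))" by (rule Cinf_differentiable[OF assms(1) yS[OF assms(2)]])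
 from partial_compose[OF diff[OF y assms(2)] this]
 show "partial i (%x. f (y x)) x = (\<Oplus>a. partial a f (y x) * B a i x)"
  "(%x. f (y x)) differentiable (at x)" by (auto simp: B_def)
qed

lemma G_matrix: "x \<in> S ==> G x = transpose (Bm x) ** G' (y x) ** Bm x"
proof (simp only: vec_eq_iff, intro allI)
 fix i j assume x: "x \<in> S"
 have "(transpose (Bm x) ** G' (y x) ** Bm x) $ i $ j
   = (\<Oplus>b a. B a i x * G' (y x) $ a $ b * B b j x)"
  by (simp add: matrix_matrix_mult_def transpose_def Bm_def sum_distrib_right)
 also have "\<dots> = (\<Oplus>a b. B a i x * G' (y x) $ a $ b * B b j x)" by (rule sum.swap)
 also have "\<dots> = G x $ i $ j"
  unfolding pullback[OF x] B_def by (intro sum.cong refl) (simp only: mult_ac)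
 finally show "G x $ i $ j = (transpose (Bm x) ** G' (y x) ** Bm x) $ i $ j" ..
qed

lemma det_Bm: "x \<in> S ==> det (Bm x) \<noteq> 0"
 using G_det[of x] G_matrix[of x] by (auto simp: det_mul)

lemma U_matrix:
 assumes "x \<in> S"
 shows "Bm x ** matrix_inv (G x) ** transpose (Bm x) = matrix_inv (G' (y x))"
  "matrix_inv (G x) = matrix_inv (Bm x) ** matrix_inv (G' (y x)) ** transpose (matrix_inv (Bm x))"
proof -
 let ?B = "Bm x" and ?C = "matrix_inv (Bm x)" and ?V = "matrix_inv (G' (y x))"
 have C: "?B ** ?C = mat 1" "?C ** ?B = mat 1" using invertible_matrix_inv[OF det_Bm[OF assms]] .
 have Ct: "transpose ?C ** transpose ?B = mat 1" "transpose ?B ** transpose ?C = mat 1"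
  using C by (simp_all flip: matrix_transpose_mul)
 have V: "?V ** G' (y x) = mat 1" using invertible_matrix_inv[OF primed.G_det[OF yS[OF assms]]] by blast
 have "(?C ** ?V ** transpose ?C) ** (transpose ?B ** G' (y x) ** ?B)
   = ?C ** (?V ** ((transpose ?C ** transpose ?B) ** G' (y x))) ** ?B"
  by (simp only: matrix_mul_assoc)
 also have "\<dots> = mat 1" by (simp add: Ct V C)
 finally show eq: "matrix_inv (G x) = ?C ** ?V ** transpose ?C"
  unfolding G_matrix[OF assms] by (rule matrix_inv_unique)
 have "?B ** (?C ** ?V ** transpose ?C) ** transpose ?B = (?B ** ?C) ** ?V ** (transpose ?C ** transpose ?B)"
  by (simp only: matrix_mul_assoc)
 thus "?B ** matrix_inv (G x) ** transpose ?B = ?V" by (simp add: eq C Ct)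
qed

lemma U_contract:
 assumes "x \<in> S"
 shows "(\<Oplus>k l. B c k x * U k l x * B b l x) = V c b (y x)"
proof -
 have "(Bm x ** matrix_inv (G x) ** transpose (Bm x)) $ c $ b = V c b (y x)"
  using U_matrix(1)[OF assms] by simp
 thus ?thesis
  by (simp add: matrix_matrix_mult_def transpose_def Bm_def sum_distrib_right) (subst sum.swap, simp)
qed

text \<open>Differentiating the pullback formula produces six terms \<open>P\<close> with second
  derivatives of the coordinate change. \<open>P\<close> is symmetric in its first two indices, so
  four of them cancel in this combination and the other two agree.\<close>

lemma lowered_christoffel:
 assumes x: "x \<in> S"
 shows "partial i (%y. G y $ j $ l) x + partial j (%y. G y $ i $ l) x - partial l (%y. G y $ i $ j) x
  = (\<Oplus>b. B b l x * (2 * (\<Oplus>a. partial i (B a j) x * G' (y x) $ a $ b)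
   + (\<Oplus>c a. B c i x * B a j x * (partial c (%y. G' y $ a $ b) (y x)
     + partial a (%y. G' y $ c $ b) (y x) - partial b (%y. G' y $ c $ a) (y x)))))"
proof -
 let ?g = "%a b. G' (y x) $ a $ b" and ?d = "%c a b. partial c (%y. G' y $ a $ b) (y x)"
 have gs: "?g a b = ?g b a" for a b by (rule primed.G_sym[OF yS[OF x]])
 have ds: "?d c a b = ?d c b a" for c a b by (rule primed.partial_G_sym[OF yS[OF x]])
 have D: "partial k (%y. G y $ j $ l) x = (\<Oplus>a b. partial k (B a j) x * B b l x * ?g a b)
   + (\<Oplus>a b. B a j x * partial k (B b l) x * ?g a b)
   + (\<Oplus>a b c. B a j x * B b l x * B c k x * ?d c a b)" for k j l
 proof -
  have dG: "(%x. G' (y x) $ a $ b) differentiable (at x)"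
   "partial k (%x. G' (y x) $ a $ b) x = (\<Oplus>c. ?d c a b * B c k x)" for a b k
   by (rule chain[OF primed.G x])+
  have "partial k (%y. G y $ j $ l) x
    = partial k (%x. \<Oplus>a b. B a j x * B b l x * G' (y x) $ a $ b) x"
   unfolding partial_eq_dd by (rule dd_cong[OF S x]) (simp add: pullback B_def)
  also have "\<dots> = (\<Oplus>a b. B a j x * B b l x * partial k (%x. G' (y x) $ a $ b) x
    + (B a j x * partial k (B b l) x + partial k (B a j) x * B b l x) * ?g a b)"
   using dG(1) diff_B[OF x] by (simp add: partial_eq_dd dd_sum dd_mult)
  finally show ?thesis unfolding dG(2)
   by (simp add: sum.distrib distrib_right distrib_left sum_distrib_left mult_ac)
 qed
 let ?H = "%a i j. partial i (B a j) x"
 have T1: "(\<Oplus>a b. B a j x * ?H b k l * ?g a b) = (\<Oplus>a b. ?H a k l * B b j x * ?g a b)"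
  for j k l by (rule trans[OF sum.swap], intro sum.cong refl, subst gs, simp only: mult_ac)
 define P where "P = (%i j l. \<Oplus>a b. ?H a i j * B b l x * ?g a b)"
 have Ps: "P i j l = P j i l" for i j l unfolding P_def by (simp add: Hess_sym[OF x])
 define R where "R = (%k j l. \<Oplus>a b c. B a j x * B b l x * B c k x * ?d c a b)"
 have D': "partial k (%y. G y $ j $ l) x = P k j l + P k l j + R k j l" for k j l
  unfolding D T1 P_def R_def by simp
 have "partial i (%y. G y $ j $ l) x + partial j (%y. G y $ i $ l) x - partial l (%y. G y $ i $ j) x
  = 2 * P i j l + (R i j l + R j i l - R l i j)"
  unfolding D' using Ps[of i j l] Ps[of i l j] Ps[of j l i] by simp
 moreover have "P i j l = (\<Oplus>b. B b l x * (\<Oplus>a. ?H a i j * ?g a b))"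
  unfolding P_def by (subst sum.swap) (simp add: sum_distrib_left mult_ac)
 moreover have "R i j l = (\<Oplus>b c a. B b l x * (B c i x * B a j x * ?d c a b))"
  unfolding R_def by (rule trans[OF _ sum_rotate3[symmetric]]) (simp only: mult_ac)
 moreover have "R j i l = (\<Oplus>b c a. B b l x * (B c i x * B a j x * ?d a c b))"
  unfolding R_def by (subst sum.swap) (simp add: mult_ac)
 moreover have "R l i j = (\<Oplus>b c a. B b l x * (B c i x * B a j x * ?d b c a))"
  unfolding R_def by (subst sum_rotate3) (simp add: mult_ac)
 ultimately show ?thesis
  by (simp add: sum_distrib_left sum.distrib sum_subtractf distrib_left right_diff_distrib mult_ac)
qed

text \<open>By \<open>U_contract\<close> the Jacobians around the inverse metric turn it into the
  inverse of \<open>G'\<close>, which then also removes \<open>G'\<close> from the second derivative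
  term.\<close>

lemma christoffel_transform:
 assumes x: "x \<in> S"
 shows "(\<Oplus>k. B c k x * christoffel G k i j x)
  = partial i (B c j) x + (\<Oplus>b. (\<Oplus>a. christoffel G' c a b (y x) * B a i x) * B b j x)"
proof -
 let ?L = "%l. partial i (%y. G y $ j $ l) x + partial j (%y. G y $ i $ l) x - partial l (%y. G y $ i $ j) x"
 define E where "E = (%d a b. partial d (%y. G' y $ a $ b) (y x)
     + partial a (%y. G' y $ d $ b) (y x) - partial b (%y. G' y $ d $ a) (y x))"
 define Z where "Z = (%b. 2 * (\<Oplus>a. partial i (B a j) x * G' (y x) $ a $ b)
   + (\<Oplus>d a. B d i x * B a j x * E d a b))"
 have L: "?L l = (\<Oplus>b. B b l x * Z b)" for l
  using lowered_christoffel[OF x, of i j l] by (simp add: Z_def E_def)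
 have "(\<Oplus>k. B c k x * christoffel G k i j x) = (\<Oplus>k l b. B c k x * U k l x * B b l x * Z b) / 2"
  by (simp add: christoffel_def L sum_distrib_left sum_divide_distrib mult_ac)
 also have "(\<Oplus>k l b. B c k x * U k l x * B b l x * Z b) = (\<Oplus>b. V c b (y x) * Z b)"
  by (subst sum_rotate3) (simp add: U_contract[OF x, symmetric] sum_distrib_right)
 also have "\<dots> / 2 = (\<Oplus>a. partial i (B a j) x * (\<Oplus>b. V c b (y x) * G' (y x) $ b $ a))
   + (\<Oplus>b d a. V c b (y x) * (B d i x * B a j x * E d a b)) / 2"
 proof -
  have "(\<Oplus>b. V c b (y x) * Z b) = 2 * (\<Oplus>b a. V c b (y x) * (partial i (B a j) x * G' (y x) $ a $ b))
   + (\<Oplus>b d a. V c b (y x) * (B d i x * B a j x * E d a b))"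
   by (simp add: Z_def distrib_left sum.distrib sum_distrib_left mult_ac)
  also have "(\<Oplus>b a. V c b (y x) * (partial i (B a j) x * G' (y x) $ a $ b))
   = (\<Oplus>a. partial i (B a j) x * (\<Oplus>b. V c b (y x) * G' (y x) $ b $ a))"
   unfolding sum_distrib_left
   by (subst sum.swap, intro sum.cong refl) (simp add: primed.G_sym[OF yS[OF x]] mult.left_commute)
  finally show ?thesis by simp
 qed
 also have "(\<Oplus>a. partial i (B a j) x * (\<Oplus>b. V c b (y x) * G' (y x) $ b $ a)) = partial i (B c j) x"
  unfolding matrix_inv_nth(2)[OF primed.G_det[OF yS[OF x]]]
  by (simp add: if_distrib[of "%r. _ * r"] cong: if_cong)
 also have "(\<Oplus>b d a. V c b (y x) * (B d i x * B a j x * E d a b)) / 2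
   = (\<Oplus>a. (\<Oplus>d. christoffel G' c d a (y x) * B d i x) * B a j x)"
 proof -
  have "(\<Oplus>b d a. V c b (y x) * (B d i x * B a j x * E d a b))
   = (\<Oplus>a d b. V c b (y x) * (B d i x * B a j x * E d a b))"
   by (rule trans[OF sum_rotate3], rule sum.cong[OF refl], rule sum.swap)
  moreover have "christoffel G' c d a (y x) = (\<Oplus>b. V c b (y x) * E d a b) / 2" for d a
   by (simp add: christoffel_def E_def)
  ultimately show ?thesis
   by (simp add: sum_distrib_left sum_distrib_right sum_divide_distrib mult_ac)
 qed
 finally show ?thesis .
qed

definition M :: "'n => 'n => 'n => real^'n => real" where
 "M i c b x = (\<Oplus>a. christoffel G' c a b (y x) * B a i x)"

text \<open>In matrix form \<open>christoffel_transform\<close> reads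
  \<open>Bm ** Am i = Hm i + Mm i ** Bm\<close>, where \<open>Hm i\<close> is a derivative of the
  Jacobian. Differentiate along \<open>j\<close> and antisymmetrise in \<open>i\<close> and
  \<open>j\<close>: the second derivatives of the Jacobian and the mixed terms
  \<open>Mm i ** Hm j + Mm j ** Hm i\<close> are symmetric and drop out, and what is left says that
  the Jacobian intertwines the two curvatures.\<close>

lemma riem_transform:
 assumes x: "x \<in> S"
 shows "(\<Oplus>k. B c k x * riem G k l j i x)
  = (\<Oplus>e d a. riem G' c e d a (y x) * B d j x * B a i x * B e l x)"
proof -
 have Cc: "Cinf S (christoffel G k i j)" for k i j by (rule Cinf_christoffel)
 have dc: "christoffel G k i j differentiable (at x)" for k i j by (rule diff[OF Cc x])
 have Cc': "Cinf S' (christoffel G' k i j)" for k i j by (rule primed.Cinf_christoffel)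
 have dM: "M i c b differentiable (at x)" for i c b
  unfolding M_def using chain(2)[OF Cc' x] diff_B[OF x] by simp
 have CH: "Cinf S (partial i (B c l))" for i c l
  unfolding partial_eq_dd by (rule Cinf_dd[OF Cinf_B])
 have dH: "partial i (B c l) differentiable (at x)" for i c l
  by (rule diff[OF CH x])
 define Hm where "Hm = (%j. \<chi> c k. partial j (B c k) x)"
 define Am where "Am = (%i. \<chi> k l. christoffel G k i l x)"
 define Mm where "Mm = (%i. \<chi> c b. M i c b x)"
 define dA where "dA = (%j i. \<chi> k l. partial j (christoffel G k i l) x)"
 define dMm where "dMm = (%j i. \<chi> c b. partial j (M i c b) x)"
 define dHm where "dHm = (%j i. \<chi> c l. partial j (partial i (B c l)) x)"
 have e1: "(\<Oplus>k. B c k x * christoffel G k i l x) = partial i (B c l) x + (\<Oplus>b. M i c b x * B b l x)"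
  if "x \<in> S" for x c i l
  using christoffel_transform[OF that, of c i l] by (simp add: M_def)
 have m1: "Bm x ** Am i = Hm i + Mm i ** Bm x" for i
  using e1[OF x] by (simp add: vec_eq_iff matrix_matrix_mult_def Bm_def Am_def Hm_def Mm_def)
 have "(\<Oplus>k. B c k x * partial j (christoffel G k i l) x + partial j (B c k) x * christoffel G k i l x)
  = partial j (partial i (B c l)) x + (\<Oplus>b. M i c b x * partial j (B b l) x + partial j (M i c b) x * B b l x)"
  for c i j l
 proof -
  have "dd (axis j 1) (%x. \<Oplus>k. B c k x * christoffel G k i l x) x
   = dd (axis j 1) (%x. partial i (B c l) x + (\<Oplus>b. M i c b x * B b l x)) x"
   by (rule dd_cong[OF S x e1])
  moreover have "(%x. \<Oplus>b. M i c b x * B b l x) differentiable (at x)"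
   using dM diff_B[OF x] by simp
  ultimately show ?thesis
   using dc diff_B[OF x] dM dH by (simp add: dd_sum dd_mult dd_add partial_eq_dd)
 qed
 hence m2: "Hm j ** Am i + Bm x ** dA j i = dHm j i + dMm j i ** Bm x + Mm i ** Hm j" for j i
  by (simp add: vec_eq_iff matrix_matrix_mult_def Bm_def Am_def Hm_def Mm_def dA_def dHm_def dMm_def sum.distrib add_ac)
 have dHs: "dHm j i = dHm i j" for i j
  unfolding dHm_def partial_eq_dd using dd_commute[OF S Cinf_B x] by simp
 have "Bm x ** (dA j i + Am j ** Am i) = dHm j i + (dMm j i + Mm j ** Mm i) ** Bm x + (Mm i ** Hm j + Mm j ** Hm i)" (is "?lhs i j = _") for i j
 proof -
  have "Bm x ** (dA j i + Am j ** Am i) = Bm x ** dA j i + (Bm x ** Am j) ** Am i"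
   by (simp add: matrix_add_ldistrib matrix_mul_assoc)
  also have "\<dots> = (Hm j ** Am i + Bm x ** dA j i) + Mm j ** (Bm x ** Am i)"
   by (simp add: m1[of j] matrix_add_rdistrib matrix_mul_assoc)
  also have "\<dots> = dHm j i + (dMm j i + Mm j ** Mm i) ** Bm x + (Mm i ** Hm j + Mm j ** Hm i)"
   by (simp add: m2 m1[of i] matrix_add_ldistrib matrix_add_rdistrib matrix_mul_assoc)
  finally show ?thesis .
 qed
 note key = this
 have "a + p + (r + s) - (a + q + (s + r)) = p - q" for a p q r s :: "real^'n^'n"
  by (simp add: algebra_simps)
 hence "Bm x ** (dA j i + Am j ** Am i) - Bm x ** (dA i j + Am i ** Am j)
   = (dMm j i + Mm j ** Mm i) ** Bm x - (dMm i j + Mm i ** Mm j) ** Bm x"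
  unfolding key dHs[of j i] by this
 hence "(Bm x ** (dA j i + Am j ** Am i) - Bm x ** (dA i j + Am i ** Am j)) $ c $ l
   = ((dMm j i + Mm j ** Mm i) ** Bm x - (dMm i j + Mm i ** Mm j) ** Bm x) $ c $ l" by simp
 hence "(\<Oplus>k. B c k x * riem G k l j i x)
  = (\<Oplus>e. (partial j (M i c e) x - partial i (M j c e) x
    + (\<Oplus>m. M j c m x * M i m e x - M i c m x * M j m e x)) * B e l x)"
 proof -
  have l: "(Bm x ** (dA j i + Am j ** Am i)) $ c $ l = (\<Oplus>k. B c k x *
    (partial j (christoffel G k i l) x + (\<Oplus>m. christoffel G k j m x * christoffel G m i l x)))" for i j
   by (simp add: matrix_matrix_mult_def Bm_def Am_def dA_def)
  have r: "((dMm j i + Mm j ** Mm i) ** Bm x) $ c $ l = (\<Sum>e\<in>UNIV.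
    (partial j (M i c e) x + (\<Oplus>m. M j c m x * M i m e x)) * B e l x)" for i j
   by (simp add: matrix_matrix_mult_def Bm_def Mm_def dMm_def)
  note \<open>(Bm x ** _ - _) $ c $ l = _\<close>[unfolded vector_minus_component l r]
  moreover have "p * (a - b + (s - t)) = p * (a + s) - p * (b + t)" "(a - b + (s - t)) * p = (a + s) * p - (b + t) * p"
   for p a b s t :: real by (simp_all add: algebra_simps)
  ultimately show ?thesis unfolding riem_def sum_subtractf by (simp only: sum_subtractf)
 qed
 also have "\<dots> = (\<Oplus>e. (\<Oplus>d a. riem G' c e d a (y x) * B d j x * B a i x) * B e l x)"
 proof (intro sum.cong refl arg_cong2[of _ _ _ _ "(*)"])
  fix e
  have pM: "partial j (M i c e) x = (\<Oplus>d a. partial d (christoffel G' c a e) (y x) * B d j x * B a i x)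
    + (\<Oplus>a. christoffel G' c a e (y x) * partial j (B a i) x)" for i j
  proof -
   have "partial j (M i c e) x = (\<Oplus>a. christoffel G' c a e (y x) * partial j (B a i) x
     + partial j (%x. christoffel G' c a e (y x)) x * B a i x)"
    unfolding M_def using chain(2)[OF Cc' x] diff_B[OF x] by (simp add: partial_eq_dd dd_sum dd_mult)
   also have "\<dots> = (\<Oplus>a. christoffel G' c a e (y x) * partial j (B a i) x)
     + (\<Oplus>a d. partial d (christoffel G' c a e) (y x) * B d j x * B a i x)"
    by (simp add: chain(1)[OF Cc' x] sum.distrib sum_distrib_right)
   also have "(\<Oplus>a d. partial d (christoffel G' c a e) (y x) * B d j x * B a i x)
     = (\<Oplus>d a. partial d (christoffel G' c a e) (y x) * B d j x * B a i x)" by (rule sum.swap)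
   finally show ?thesis by (simp only: add.commute)
  qed
  have MM: "(\<Oplus>m. M j c m x * M i m e x) = (\<Oplus>d a. (\<Sum>m\<in>UNIV.
    christoffel G' c d m (y x) * christoffel G' m a e (y x)) * B d j x * B a i x)" for i j
  proof -
   have "(\<Oplus>m. M j c m x * M i m e x) = (\<Oplus>m d. \<Sum>a\<in>UNIV.
     christoffel G' c d m (y x) * christoffel G' m a e (y x) * B d j x * B a i x)"
    unfolding M_def sum_product by (intro sum.cong refl) (simp only: mult_ac)
   also have "\<dots> = (\<Oplus>d a. \<Sum>m\<in>UNIV.
     christoffel G' c d m (y x) * christoffel G' m a e (y x) * B d j x * B a i x)"
    by (rule sum_rotate3[symmetric])
   finally show ?thesis by (simp add: sum_distrib_right)
  qed
  have sw: "(\<Oplus>d a. f d a * B d i x * B a j x) = (\<Oplus>d a. f a d * B d j x * B a i x)" for f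
   by (rule trans[OF sum.swap]) (simp only: mult_ac)
  have "partial j (M i c e) x - partial i (M j c e) x + (\<Oplus>m. M j c m x * M i m e x - M i c m x * M j m e x)
   = (\<Oplus>d a. partial d (christoffel G' c a e) (y x) * B d j x * B a i x)
   - (\<Oplus>d a. partial a (christoffel G' c d e) (y x) * B d j x * B a i x)
   + ((\<Oplus>d a. (\<Oplus>m. christoffel G' c d m (y x) * christoffel G' m a e (y x)) * B d j x * B a i x)
   - (\<Oplus>d a. (\<Oplus>m. christoffel G' c a m (y x) * christoffel G' m d e (y x)) * B d j x * B a i x))"
   unfolding sum_subtractf MM pM sw[of "%d a. partial d (christoffel G' c a e) (y x)"]
    sw[of "%d a. \<Oplus>m. christoffel G' c d m (y x) * christoffel G' m a e (y x)"]
    Hess_sym[OF x, of j _ i] by simp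
  show "partial j (M i c e) x - partial i (M j c e) x + (\<Oplus>m. M j c m x * M i m e x - M i c m x * M j m e x)
   = (\<Oplus>d a. riem G' c e d a (y x) * B d j x * B a i x)"
  proof -
   have "p * b * c - q * b * c + (s * b * c - t * b * c) = (p - q + (s - t)) * b * c" for p q s t b c :: real
    by (simp add: algebra_simps)
   thus ?thesis
    using \<open>partial j (M i c e) x - _ + _ = _\<close>
    unfolding riem_def sum_subtractf by (simp only: sum_subtractf[symmetric] sum.distrib[symmetric])
  qed
 qed
 finally show ?thesis by (simp add: sum_distrib_right)
qed

text \<open>\<open>riem_transform\<close> carries the Jacobian on the upper index; multiplying by
  its inverse \<open>C\<close> frees that index, and in the contraction \<open>C\<close> cancels the
  Jacobian on the contracted lower index.\<close>

lemma ricci_transform: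
 assumes x: "x \<in> S"
 shows "ricci G x = transpose (Bm x) ** ricci G' (y x) ** Bm x"
proof (simp only: vec_eq_iff, intro allI)
 fix i j
 define C where "C = matrix_inv (Bm x)"
 define Y where "Y = (%c d. \<Oplus>e a. riem G' c e d a (y x) * B a j x * B e i x)"
 have CB: "(\<Oplus>c. C $ k $ c * B c l x) = (if k = l then 1 else 0)"
  "(\<Oplus>k. B d k x * C $ k $ c) = (if d = c then 1 else 0)" for k l c d
  using matrix_inv_nth[OF det_Bm[OF x]] by (simp_all add: C_def Bm_def)
 have W: "(\<Oplus>k. B c k x * riem G k i m j x) = (\<Oplus>d. B d m x * Y c d)" for c m
  unfolding riem_transform[OF x] Y_def
  by (rule trans[OF sum.swap]) (simp add: sum_distrib_left mult_ac)
 have r: "riem G k i m j x = (\<Oplus>c. C $ k $ c * (\<Oplus>d. B d m x * Y c d))" for k m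
 proof -
  have "(\<Oplus>c. C $ k $ c * (\<Oplus>l. B c l x * riem G l i m j x))
   = (\<Oplus>l. (\<Oplus>c. C $ k $ c * B c l x) * riem G l i m j x)"
   by (simp only: sum_distrib_left sum_distrib_right mult.assoc) (rule sum.swap)
  also have "\<dots> = riem G k i m j x"
   unfolding CB by (simp add: if_distrib[of "%r. r * _"] cong: if_cong)
  finally show ?thesis unfolding W ..
 qed
 have "(\<Oplus>k. riem G k i k j x) = (\<Oplus>k c d. B d k x * C $ k $ c * Y c d)"
  unfolding r by (simp add: sum_distrib_left mult_ac)
 also have "\<dots> = (\<Oplus>c d k. B d k x * C $ k $ c * Y c d)"
  by (rule sum_rotate3[symmetric])
 also have "\<dots> = (\<Oplus>c d. (if d = c then 1 else 0) * Y c d)"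
  by (simp add: CB sum_distrib_right[symmetric])
 also have "\<dots> = (\<Oplus>c. Y c c)"
  by (simp add: if_distrib[of "%r. r * _"] cong: if_cong)
 also have "\<dots> = (\<Oplus>e a c. riem G' c e c a (y x) * B a j x * B e i x)"
  unfolding Y_def by (rule sum_rotate3[symmetric])
 also have "\<dots> = (\<Oplus>e a. (\<Oplus>c. riem G' c e c a (y x)) * B a j x * B e i x)"
  by (simp only: sum_distrib_right)
 finally have "(\<Oplus>k. riem G k i k j x) = (\<Oplus>e a. (\<Oplus>c. riem G' c e c a (y x)) * B a j x * B e i x)" .
 moreover have "ricci G x $ i $ j = (\<Oplus>k. riem G k i k j x)"
 proof (rule ricci_riem)
  show "partial l (christoffel G k i j) x = partial l (christoffel G k j i) x" for l k i j
   unfolding partial_eq_dd by (rule dd_cong[OF S x christoffel_sym])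
 qed (rule christoffel_sym[OF x])
 moreover have "ricci G' (y x) $ e $ a = (\<Oplus>c. riem G' c e c a (y x))" for e a
 proof (rule ricci_riem)
  show "partial l (christoffel G' k i j) (y x) = partial l (christoffel G' k j i) (y x)" for l k i j
   unfolding partial_eq_dd by (rule dd_cong[OF primed.S yS[OF x] primed.christoffel_sym])
 qed (rule primed.christoffel_sym[OF yS[OF x]])
 ultimately have "ricci G x $ i $ j = (\<Oplus>e a. ricci G' (y x) $ e $ a * B a j x * B e i x)"
  by simp
 also have "\<dots> = (\<Oplus>a e. ricci G' (y x) $ e $ a * B a j x * B e i x)" by (rule sum.swap)
 also have "\<dots> = (transpose (Bm x) ** ricci G' (y x) ** Bm x) $ i $ j"
  by (simp add: matrix_matrix_mult_def transpose_def Bm_def sum_distrib_right sum_distrib_left mult_ac)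
 finally show "ricci G x $ i $ j = (transpose (Bm x) ** ricci G' (y x) ** Bm x) $ i $ j" .
qed

text \<open>Pullback of covariant tensors is dual to pushforward of contravariant ones. Together
  with \<open>U_matrix\<close> this gives the invariance of traces and of
  \<open>matrix_inner\<close>.\<close>

lemma pairing_transform:
 "(\<Oplus>i j. (transpose (Bm x) ** P ** Bm x) $ i $ j * X $ i $ j)
  = (\<Oplus>a b. P $ a $ b * (Bm x ** X ** transpose (Bm x)) $ a $ b)"
proof -
 have "(\<Oplus>i j. (transpose (Bm x) ** P ** Bm x) $ i $ j * X $ i $ j)
  = (\<Oplus>i j b a. B a i x * P $ a $ b * B b j x * X $ i $ j)"
  by (simp add: matrix_matrix_mult_def transpose_def Bm_def sum_distrib_right)
 also have "\<dots> = (\<Oplus>b i j a. B a i x * P $ a $ b * B b j x * X $ i $ j)"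
  by (rule sum_rotate3)
 also have "\<dots> = (\<Oplus>b a i j. B a i x * P $ a $ b * B b j x * X $ i $ j)"
  by (rule sum.cong[OF refl sum_rotate3])
 also have "\<dots> = (\<Oplus>a b i j. B a i x * P $ a $ b * B b j x * X $ i $ j)"
  by (rule sum.swap)
 also have "\<dots> = (\<Oplus>a b. P $ a $ b * (\<Oplus>i j. B a i x * X $ i $ j * B b j x))"
  by (simp add: sum_distrib_left mult_ac)
 also have "(%a b. \<Oplus>i j. B a i x * X $ i $ j * B b j x)
   = (%a b. (Bm x ** X ** transpose (Bm x)) $ a $ b)"
 proof (intro ext)
  fix a b
  have "(\<Oplus>i j. B a i x * X $ i $ j * B b j x) = (\<Oplus>j i. B a i x * X $ i $ j * B b j x)"
   by (rule sum.swap)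
  thus "(\<Oplus>i j. B a i x * X $ i $ j * B b j x) = (Bm x ** X ** transpose (Bm x)) $ a $ b"
   by (simp add: matrix_matrix_mult_def transpose_def Bm_def sum_distrib_right)
 qed
 finally show ?thesis .
qed

lemma trace_transform:
 assumes x: "x \<in> S"
 shows "(\<Oplus>i j. matrix_inv (G x) $ i $ j * (transpose (Bm x) ** P ** Bm x) $ i $ j)
  = (\<Oplus>a b. matrix_inv (G' (y x)) $ a $ b * P $ a $ b)"
 using pairing_transform[of x P "matrix_inv (G x)"] unfolding U_matrix(1)[OF x] by (simp only: mult.commute)

lemma matrix_inner_transform:
 assumes x: "x \<in> S"
 shows "matrix_inner (G x) (transpose (Bm x) ** P ** Bm x) (transpose (Bm x) ** R ** Bm x)
  = matrix_inner (G' (y x)) P R"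
proof -
 have alt: "matrix_inner N P R = (\<Oplus>i j. P $ i $ j * (matrix_inv N ** R ** transpose (matrix_inv N)) $ i $ j)"
  for N P R :: "real^'n^'n"
  unfolding matrix_inner_def
 proof (intro sum.cong refl)
  fix i j
  have "(\<Oplus>a b. matrix_inv N $ i $ a * matrix_inv N $ j $ b * P $ i $ j * R $ a $ b)
   = (\<Oplus>b a. matrix_inv N $ i $ a * matrix_inv N $ j $ b * P $ i $ j * R $ a $ b)" by (rule sum.swap)
  thus "(\<Oplus>a b. matrix_inv N $ i $ a * matrix_inv N $ j $ b * P $ i $ j * R $ a $ b)
   = P $ i $ j * (matrix_inv N ** R ** transpose (matrix_inv N)) $ i $ j"
   by (simp add: matrix_matrix_mult_def transpose_def sum_distrib_left sum_distrib_right mult_ac)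
 qed
 let ?B = "Bm x" and ?U = "matrix_inv (G x)" and ?V = "matrix_inv (G' (y x))"
 have "?B ** (?U ** (transpose ?B ** R ** ?B) ** transpose ?U) ** transpose ?B
   = (?B ** ?U ** transpose ?B) ** R ** transpose (?B ** ?U ** transpose ?B)"
  by (simp only: matrix_transpose_mul transpose_transpose matrix_mul_assoc)
 also have "\<dots> = ?V ** R ** transpose ?V" unfolding U_matrix(1)[OF x] ..
 finally show ?thesis unfolding alt pairing_transform by simp
qed

lemma scalar_transform: "x \<in> S ==> scalar_curvature G x = scalar_curvature G' (y x)"
 unfolding scalar_curvature_def ricci_transform by (rule trace_transform)

text \<open>The second derivatives of the coordinate change in the coordinate Hessian cancel against
  the inhomogeneous term of \<open>christoffel_transform\<close>, so the covariant Hessian is a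
  tensor, and its trace is invariant.\<close>

lemma laplacian_transform:
 assumes x: "x \<in> S" and f': "Cinf S' f'" and f: "!!x. x \<in> S ==> f x = f' (y x)"
 shows "laplacian G f x = laplacian G' f' (y x)"
proof -
 define h where "h = (\<chi> b a. partials [b, a] f' (y x) - (\<Oplus>k. christoffel G' k b a (y x) * partial k f' (y x)))"
 have Cf': "Cinf S' (partial a f')" for a unfolding partial_eq_dd by (rule Cinf_dd[OF f'])
 have pf: "partial j f x = (\<Oplus>a. partial a f' (y x) * B a j x)" if "x \<in> S" for j x
 proof -
  have "partial j f x = partial j (%x. f' (y x)) x"
   unfolding partial_eq_dd by (rule dd_cong[OF S that f])
  thus ?thesis by (simp add: chain[OF f' that])
 qed
 have ppf: "partial i (partial j f) x = (\<Oplus>a b. partial b (partial a f') (y x) * B b i x * B a j x)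
   + (\<Oplus>a. partial a f' (y x) * partial i (B a j) x)" for i j
 proof -
  have "partial i (partial j f) x = partial i (%x. \<Oplus>a. partial a f' (y x) * B a j x) x"
   unfolding partial_eq_dd[of i] by (rule dd_cong[OF S x pf])
  also have "\<dots> = (\<Oplus>a. partial a f' (y x) * partial i (B a j) x + partial i (%x. partial a f' (y x)) x * B a j x)"
   using chain(2)[OF Cf' x] diff_B[OF x] by (simp add: partial_eq_dd[of i] dd_sum dd_mult)
  finally show ?thesis by (simp add: chain(1)[OF Cf' x] sum.distrib sum_distrib_right)
 qed
 have hess: "partials [i, j] f x - (\<Oplus>k. christoffel G k i j x * partial k f x)
   = (transpose (Bm x) ** h ** Bm x) $ i $ j" for i j
 proof -
  have "(\<Oplus>k. christoffel G k i j x * partial k f x)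
   = (\<Oplus>a. partial a f' (y x) * (\<Oplus>k. B a k x * christoffel G k i j x))"
   unfolding pf[OF x] sum_distrib_left by (rule trans[OF sum.swap]) (simp only: mult_ac)
  also have "\<dots> = (\<Oplus>a. partial a f' (y x) * partial i (B a j) x)
    + (\<Oplus>a b c. partial a f' (y x) * christoffel G' a c b (y x) * B c i x * B b j x)"
   by (simp add: christoffel_transform[OF x] distrib_left sum.distrib sum_distrib_left sum_distrib_right mult_ac)
  also have "(\<Oplus>a b c. partial a f' (y x) * christoffel G' a c b (y x) * B c i x * B b j x)
   = (\<Oplus>b c a. partial a f' (y x) * christoffel G' a c b (y x) * B c i x * B b j x)"
   by (rule sum_rotate3[symmetric])
  finally have "partials [i, j] f x - (\<Oplus>k. christoffel G k i j x * partial k f x)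
   = (\<Oplus>b c. partial c (partial b f') (y x) * B c i x * B b j x)
   - (\<Oplus>b c a. partial a f' (y x) * christoffel G' a c b (y x) * B c i x * B b j x)"
   by (simp add: partials_def ppf)
  also have "\<dots> = (\<Oplus>b c. B c i x * h $ c $ b * B b j x)"
   unfolding sum_subtractf[symmetric]
   by (intro sum.cong refl) (simp add: h_def partials_def left_diff_distrib right_diff_distrib
     sum_distrib_left sum_distrib_right mult_ac)
  finally show ?thesis by (simp add: matrix_matrix_mult_def transpose_def Bm_def sum_distrib_right)
 qed
 have "laplacian G f x = (\<Oplus>i j. matrix_inv (G x) $ i $ j * (transpose (Bm x) ** h ** Bm x) $ i $ j)"
  unfolding laplacian_def hess ..
 also have "\<dots> = (\<Oplus>a b. matrix_inv (G' (y x)) $ a $ b * h $ a $ b)"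
  by (rule trace_transform[OF x])
 also have "\<dots> = laplacian G' f' (y x)" by (simp add: laplacian_def h_def)
 finally show ?thesis .
qed

theorem Q_coord_transform:
 assumes x: "x \<in> S"
 shows "Q_coord G x = Q_coord G' (y x)"
proof -
 have "laplacian G (scalar_curvature G) x = laplacian G' (scalar_curvature G') (y x)"
  by (rule laplacian_transform[OF x primed.Cinf_scalar scalar_transform])
 thus ?thesis
  unfolding Q_coord_def Let_def ricci_transform[OF x] matrix_inner_transform[OF x] scalar_transform[OF x]
  by (simp only:)
qed

end

section \<open>Tensor fields in charts\<close>

text \<open>The segment from the identity to \<open>N\<close> consists of positive definite, hence
  invertible matrices, so the determinant cannot change sign along it.\<close>

lemma pos_def_det_pos:
 fixes N :: "real^'n^'n"
 assumes pos: "!!v. v \<noteq> 0 ==> v \<bullet> (N *v v) > 0"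
 shows "det N > 0"
proof (rule ccontr)
 define C where "C = (%t::real. (1 - t) *\<^sub>R mat 1 + t *\<^sub>R N)"
 have nz: "det (C t) \<noteq> 0" if t: "0 \<le> t" "t \<le> 1" for t
 proof
  assume "det (C t) = 0"
  hence "\<not> invertible (C t)" by (simp add: invertible_det_nz)
  then obtain v where v: "v \<noteq> 0" "C t *v v = 0"
   unfolding invertible_left_inverse matrix_left_invertible_ker by blast
  have "v \<bullet> (C t *v v) = (1 - t) * (v \<bullet> v) + t * (v \<bullet> (N *v v))"
   by (simp add: C_def matrix_vector_mult_add_rdistrib scaleR_matrix_vector_assoc[symmetric] inner_add_right)
  moreover have "(1 - t) * (v \<bullet> v) + t * (v \<bullet> (N *v v)) > 0"
   using t v pos[OF v(1)] by (cases "t = 0") (auto intro!: add_nonneg_pos mult_nonneg_nonneg)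
  ultimately show False using v by simp
 qed
 assume "\<not> det N > 0"
 hence "det (C 1) \<le> 0" by (simp add: C_def)
 moreover have "det (C 0) = 1" by (simp add: C_def)
 moreover have "continuous_on {0..1} (%t. det (C t))"
  unfolding det_def C_def by (intro continuous_intros)
 ultimately obtain t where "0 \<le> t" "t \<le> 1" "det (C t) = 0"
  using IVT2'[of "%t. det (C t)" 1 0 0] by auto
 thus False using nz by blast
qed

definition overlap :: "('a, 'n::finite) chart => ('a, 'n) chart => (real^'n) set" where
 "overlap c d = snd c ` (fst c \<inter> fst d)"

definition jac :: "('a, 'n::finite) chart => ('a, 'n) chart => real^'n => real^'n^'n" where
 "jac c d x = (\<chi> a i. partial i (%y. transition c d y $ a) x)"

locale smooth_mfd =
 fixes M :: "'a topology" and A :: "('a, 'n::finite) chart set"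
 assumes mfd: "smooth_manifold M A"
begin

lemma chart: "c \<in> A ==> is_chart M c"
 and compatible: "c \<in> A ==> d \<in> A ==> compatible c d"
 and cover: "(\<Union>c\<in>A. fst c) = topspace M"
 and Hausdorff: "Hausdorff_space M"
 using mfd by (auto simp: smooth_manifold_def smooth_structure_def)

lemma chart_basic:
 assumes "c \<in> A"
 shows "openin M (fst c)" "open (chart_image c)" "inj_on (snd c) (fst c)" "fst c \<subseteq> topspace M"
proof -
 show 1: "openin M (fst c)" and "open (chart_image c)" using chart[OF assms] by (auto simp: is_chart_def)
 show 2: "fst c \<subseteq> topspace M" using openin_subset[OF 1] .
 have "homeomorphic_map (subtopology M (fst c)) (top_of_set (chart_image c)) (snd c)"
  using chart[OF assms] by (simp add: is_chart_def)
 from homeomorphic_imp_injective_map[OF this] show "inj_on (snd c) (fst c)"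
  using 2 by (simp add: Int_absorb1)
qed

lemma chart_inv:
 assumes "c \<in> A"
 shows "x \<in> chart_image c ==> chart_inv c x \<in> fst c" "x \<in> chart_image c ==> snd c (chart_inv c x) = x"
  "q \<in> fst c ==> chart_inv c (snd c q) = q" "q \<in> fst c ==> snd c q \<in> chart_image c"
 using chart_basic(3)[OF assms]
 by (auto simp: chart_inv_def chart_image_def inv_into_into f_inv_into_f)

lemma open_chart_image:
 assumes c: "c \<in> A" and V: "openin M V" "V \<subseteq> fst c"
 shows "open (snd c ` V)"
proof -
 have h: "homeomorphic_map (subtopology M (fst c)) (top_of_set (chart_image c)) (snd c)"
  using chart[OF c] by (simp add: is_chart_def)
 have "openin (subtopology M (fst c)) V" using V by (metis openin_subtopology inf.absorb1)
 hence "openin (top_of_set (chart_image c)) (snd c ` V)"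
  using homeomorphic_map_openness[OF h, of V] V(2) chart_basic(4)[OF c] by (auto simp: Int_absorb1)
 thus ?thesis using chart_basic(2)[OF c] openin_open_trans by blast
qed

lemma open_chart_inv:
 assumes c: "c \<in> A" and W: "open W" "W \<subseteq> chart_image c"
 shows "openin M (chart_inv c ` W)"
proof -
 have h: "homeomorphic_map (subtopology M (fst c)) (top_of_set (chart_image c)) (snd c)"
  using chart[OF c] by (simp add: is_chart_def)
 have sub: "chart_inv c ` W \<subseteq> fst c" using W(2) chart_inv(1)[OF c] by blast
 have im: "snd c ` (chart_inv c ` W) = W"
  using W(2) chart_inv(2)[OF c] by (force simp: image_image)
 have "openin (top_of_set (chart_image c)) W" using W by (simp add: open_subset)
 hence "openin (subtopology M (fst c)) (chart_inv c ` W)"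
  using homeomorphic_map_openness[OF h, of "chart_inv c ` W"] sub chart_basic(4)[OF c]
  by (simp add: im Int_absorb1)
 thus ?thesis using chart_basic(1)[OF c] openin_trans_full by blast
qed

lemma open_overlap: "c \<in> A ==> d \<in> A ==> open (overlap c d)"
 unfolding overlap_def by (rule open_chart_image) (auto intro: openin_Int chart_basic)

lemma overlap_iff:
 assumes "c \<in> A"
 shows "x \<in> overlap c d \<longleftrightarrow> x \<in> chart_image c \<and> chart_inv c x \<in> fst d"
 using chart_inv[OF assms] by (force simp: overlap_def chart_image_def)

lemma transition_overlap:
 assumes "c \<in> A" "d \<in> A" "x \<in> overlap c d"
 shows "transition c d x \<in> overlap d c" "chart_inv d (transition c d x) = chart_inv c x"
 using assms chart_inv by (auto simp: overlap_iff transition_def)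

lemma Cinf_transition: "c \<in> A ==> d \<in> A ==> Cinf (overlap c d) (%x. transition c d x $ i)"
 using compatible[of c d] open_overlap[of c d]
 by (simp add: compatible_def overlap_def smooth_on_iff_Cinf)

lemma tensor_Cinf:
 assumes "sym_tensor_field A T" "c \<in> A"
 shows "Cinf (chart_image c) (%x. T c x $ i $ j)"
proof -
 have "smooth_on (chart_image c) (%x. T c x $ i $ j)"
  using assms unfolding sym_tensor_field_def by blast
 thus ?thesis using smooth_on_iff_Cinf[OF chart_basic(2)[OF assms(2)]] by blast
qed

lemma tensor_sym: "sym_tensor_field A T ==> c \<in> A ==> x \<in> chart_image c ==> T c x $ i $ j = T c x $ j $ i"
proof -
 assume "sym_tensor_field A T" "c \<in> A" "x \<in> chart_image c"
 hence "transpose (T c x) = T c x" unfolding sym_tensor_field_def by blast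
 from arg_cong[OF this, of "%N. N $ j $ i"] show ?thesis by (simp add: transpose_def)
qed

lemma tensor_pullback:
 assumes T: "sym_tensor_field A T" and cd: "c \<in> A" "d \<in> A" and x: "x \<in> overlap c d"
 shows "T c x $ i $ j = (\<Oplus>a b. partial i (%y. transition c d y $ a) x
   * partial j (%y. transition c d y $ b) x * T d (transition c d x) $ a $ b)"
  "T c x = transpose (jac c d x) ** T d (transition c d x) ** jac c d x"
proof -
 show 1: "T c x $ i $ j = (\<Oplus>a b. partial i (%y. transition c d y $ a) x
   * partial j (%y. transition c d y $ b) x * T d (transition c d x) $ a $ b)" for i j
  using T cd x unfolding sym_tensor_field_def overlap_def by blast
 show "T c x = transpose (jac c d x) ** T d (transition c d x) ** jac c d x"
 proof (simp only: vec_eq_iff, intro allI)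
  fix i j
  have "(transpose (jac c d x) ** T d (transition c d x) ** jac c d x) $ i $ j
   = (\<Oplus>b a. partial i (%y. transition c d y $ a) x * T d (transition c d x) $ a $ b
     * partial j (%y. transition c d y $ b) x)"
   by (simp add: matrix_matrix_mult_def transpose_def jac_def sum_distrib_right)
  also have "\<dots> = (\<Oplus>a b. partial i (%y. transition c d y $ a) x * T d (transition c d x) $ a $ b
     * partial j (%y. transition c d y $ b) x)" by (rule sum.swap)
  finally show "T c x $ i $ j = (transpose (jac c d x) ** T d (transition c d x) ** jac c d x) $ i $ j"
   unfolding 1 by (simp only: mult_ac)
 qed
qed

text \<open>Shrinking the overlaps to the points where \<open>T\<close> is nondegenerate makes this
  applicable to \<open>g + t h\<close>, which need not be a metric everywhere.\<close>

lemma coordinate_change: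
 assumes T: "sym_tensor_field A T" and cd: "c \<in> A" "d \<in> A"
 shows "coordinate_change {x \<in> overlap c d. det (T c x) \<noteq> 0} (T c)
  {x \<in> overlap d c. det (T d x) \<noteq> 0} (T d) (transition c d)"
proof -
 have mc: "metric_coords {x \<in> overlap c d. det (T c x) \<noteq> 0} (T c)" if cd: "c \<in> A" "d \<in> A" for c d
 proof
  have sub: "overlap c d \<subseteq> chart_image c" by (auto simp: overlap_iff[OF cd(1)])
  have C: "Cinf (overlap c d) (%x. T c x $ i $ j)" for i j
   by (rule Cinf_subset[OF tensor_Cinf[OF T cd(1)] sub])
  have "continuous_on (overlap c d) (%x. det (T c x))"
   by (rule Cinf_continuous_on[OF Cinf_det[OF open_overlap[OF cd] C]])
  from continuous_open_preimage[OF this open_overlap[OF cd], of "- {0}"]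
  show "open {x \<in> overlap c d. det (T c x) \<noteq> 0}"
   by (simp add: vimage_def Int_def open_Compl)
  show "Cinf {x \<in> overlap c d. det (T c x) \<noteq> 0} (%x. T c x $ i $ j)" for i j
   by (rule Cinf_subset[OF C]) auto
  show "T c x $ i $ j = T c x $ j $ i" if "x \<in> {x \<in> overlap c d. det (T c x) \<noteq> 0}" for x i j
   using that sub by (intro tensor_sym[OF T cd(1)]) auto
 qed auto
 interpret S: metric_coords "{x \<in> overlap c d. det (T c x) \<noteq> 0}" "T c" by (rule mc[OF cd])
 interpret S': metric_coords "{x \<in> overlap d c. det (T d x) \<noteq> 0}" "T d" by (rule mc[OF cd(2,1)])
 show ?thesis
 proof
  show "Cinf {x \<in> overlap c d. det (T c x) \<noteq> 0} (%x. transition c d x $ a)" for a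
   by (rule Cinf_subset[OF Cinf_transition[OF cd]]) auto
  fix x assume x: "x \<in> {x \<in> overlap c d. det (T c x) \<noteq> 0}"
  hence xo: "x \<in> overlap c d" and dx: "det (T c x) \<noteq> 0" by auto
  have "det (T d (transition c d x)) \<noteq> 0"
   using dx unfolding tensor_pullback(2)[OF T cd xo] by (auto simp: det_mul)
  thus "transition c d x \<in> {x \<in> overlap d c. det (T d x) \<noteq> 0}"
   using transition_overlap(1)[OF cd xo] by simp
  show "T c x $ i $ j = (\<Oplus>a b. partial i (%y'. transition c d y' $ a) x
   * partial j (%y'. transition c d y' $ b) x * T d (transition c d x) $ a $ b)" for i j
   by (rule tensor_pullback(1)[OF T cd xo])
 qed
qed

lemma Q_coord_invariant:
 assumes T: "sym_tensor_field A T" and cd: "c \<in> A" "d \<in> A" and q: "q \<in> fst c" "q \<in> fst d"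
  and det: "det (T c (snd c q)) \<noteq> 0"
 shows "Q_coord (T c) (snd c q) = Q_coord (T d) (snd d q)"
proof -
 interpret coordinate_change "{x \<in> overlap c d. det (T c x) \<noteq> 0}" "T c"
  "{x \<in> overlap d c. det (T d x) \<noteq> 0}" "T d" "transition c d" by (rule coordinate_change[OF T cd])
 have "transition c d (snd c q) = snd d q" using chart_inv(3)[OF cd(1) q(1)] by (simp add: transition_def)
 moreover have "snd c q \<in> {x \<in> overlap c d. det (T c x) \<noteq> 0}" using q det by (auto simp: overlap_def)
 ultimately show ?thesis using Q_coord_transform[of "snd c q"] by simp
qed

lemma matrix_inner_invariant:
 assumes T: "sym_tensor_field A T" "sym_tensor_field A P" "sym_tensor_field A R"
  and cd: "c \<in> A" "d \<in> A" and q: "q \<in> fst c" "q \<in> fst d" and det: "det (T c (snd c q)) \<noteq> 0"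
 shows "matrix_inner (T c (snd c q)) (P c (snd c q)) (R c (snd c q))
  = matrix_inner (T d (snd d q)) (P d (snd d q)) (R d (snd d q))"
proof -
 interpret coordinate_change "{x \<in> overlap c d. det (T c x) \<noteq> 0}" "T c"
  "{x \<in> overlap d c. det (T d x) \<noteq> 0}" "T d" "transition c d" by (rule coordinate_change[OF T(1) cd])
 have tr: "transition c d (snd c q) = snd d q" using chart_inv(3)[OF cd(1) q(1)] by (simp add: transition_def)
 have x: "snd c q \<in> overlap c d" "snd c q \<in> {x \<in> overlap c d. det (T c x) \<noteq> 0}"
  using q det by (auto simp: overlap_def)
 have "Bm (snd c q) = jac c d (snd c q)" by (simp add: Bm_def B_def jac_def)
 thus ?thesis
  using matrix_inner_transform[OF x(2)] unfolding tensor_pullback(2)[OF T(2) cd x(1)] tensor_pullback(2)[OF T(3) cd x(1)]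
  by (simp add: tr)
qed

lemma chart_at: "q \<in> topspace M ==> chart_at A q \<in> A \<and> q \<in> fst (chart_at A q)"
 unfolding chart_at_def by (rule someI_ex) (use cover in blast)

lemma jac_chain:
 assumes cde: "c \<in> A" "d \<in> A" "e \<in> A" and x: "x \<in> overlap c d" "x \<in> overlap c e"
 shows "jac c e x = jac d e (transition c d x) ** jac c d x"
proof -
 have y: "transition c d x \<in> overlap d e"
  using x transition_overlap[OF cde(1,2) x(1)] cde by (auto simp: overlap_iff)
 have op: "open (overlap c d \<inter> overlap c e)" by (intro open_Int open_overlap cde)
 have comp: "transition c e z = transition d e (transition c d z)" if "z \<in> overlap c d" for z
  using transition_overlap(2)[OF cde(1,2) that] by (simp add: transition_def)
 have "partial i (%z. transition c e z $ a) x
   = (\<Oplus>b. partial b (%z. transition d e z $ a) (transition c d x) * partial i (%z. transition c d z $ b) x)" for a i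
 proof -
  have "partial i (%z. transition c e z $ a) x = partial i (%z. transition d e (transition c d z) $ a) x"
   unfolding partial_eq_dd by (rule dd_cong[OF op]) (use x comp in auto)
  also have "\<dots> = (\<Oplus>b. partial b (%z. transition d e z $ a) (transition c d x) * partial i (%z. transition c d z $ b) x)"
   by (rule partial_compose(2)) (use Cinf_differentiable[OF Cinf_transition] cde x y in auto)
  finally show ?thesis .
 qed
 thus ?thesis by (simp add: vec_eq_iff jac_def matrix_matrix_mult_def)
qed

text \<open>Makes a global tensor field out of a matrix-valued function with compact support in the
  image of the chart \<open>e\<close>: pulled back to the other charts, and zero off the domain of
  \<open>e\<close>. The adjoint identity is tested with such fields.\<close>

definition extend :: "('a, 'n) chart => (real^'n => real^'n^'n) => ('a, 'n) tensor2" where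
 "extend e H c x = (if x \<in> overlap c e
  then transpose (jac c e x) ** H (transition c e x) ** jac c e x else 0)"

lemma compactin_chart_inv:
 assumes e: "e \<in> A" and K: "compact K" "K \<subseteq> chart_image e"
 shows "compactin M (chart_inv e ` K)"
proof (rule image_compactin)
 show "compactin (top_of_set (chart_image e)) K"
  using K by (simp add: compactin_subtopology)
 show "continuous_map (top_of_set (chart_image e)) M (chart_inv e)"
  unfolding continuous_map_alt
 proof (intro conjI allI impI)
  show "chart_inv e \<in> topspace (top_of_set (chart_image e)) \<rightarrow> topspace M"
   using chart_inv(1)[OF e] chart_basic(4)[OF e] by auto
  fix V assume "openin M V"
  hence "open (snd e ` (V \<inter> fst e))"
   by (intro open_chart_image[OF e] openin_Int chart_basic(1)[OF e]) auto
  moreover have "chart_inv e -` V \<inter> topspace (top_of_set (chart_image e)) = snd e ` (V \<inter> fst e)"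
  proof (intro set_eqI iffI)
   fix x assume "x \<in> chart_inv e -` V \<inter> topspace (top_of_set (chart_image e))"
   thus "x \<in> snd e ` (V \<inter> fst e)"
    using chart_inv(1,2)[OF e, of x] by (intro image_eqI[of _ _ "chart_inv e x"]) auto
  qed (use chart_inv(3,4)[OF e] in auto)
  moreover have "snd e ` (V \<inter> fst e) \<subseteq> chart_image e" by (auto simp: chart_image_def)
  ultimately show "openin (top_of_set (chart_image e)) (chart_inv e -` V \<inter> topspace (top_of_set (chart_image e)))"
   by (simp add: open_subset)
 qed
qed

context
 fixes e :: "('a, 'n) chart" and H :: "real^'n => real^'n^'n" and K :: "(real^'n) set"
 assumes e: "e \<in> A" and K: "compact K" "K \<subseteq> chart_image e"
  and H: "!!i j. Cinf UNIV (%x. H x $ i $ j)" and H_sym: "!!x. transpose (H x) = H x"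
  and H0: "!!x. x \<notin> K ==> H x = 0"
begin

lemma extend_zero:
 assumes c: "c \<in> A" and q: "q \<in> fst c" "q \<notin> chart_inv e ` K"
 shows "extend e H c (snd c q) = 0"
proof (cases "snd c q \<in> overlap c e")
 case True
 hence "q \<in> fst e" using chart_inv(3)[OF c q(1)] by (simp add: overlap_iff[OF c])
 have "transition c e (snd c q) = snd e q" using chart_inv(3)[OF c q(1)] by (simp add: transition_def)
 moreover have "snd e q \<notin> K" using q(2) chart_inv(3)[OF e \<open>q \<in> fst e\<close>] by force
 ultimately have "H (transition c e (snd c q)) = 0" using H0 by simp
 moreover have "N ** 0 = 0" "0 ** N = 0" for N :: "real^'n^'n"
  by (simp_all add: matrix_matrix_mult_def vec_eq_iff)
 ultimately show ?thesis by (simp add: extend_def)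
qed (simp add: extend_def)

text \<open>The compact set is closed because the manifold is Hausdorff. So the extension vanishes
  near every point off that set, also at boundary points of the chart domain, which gives smoothness
  there.\<close>

lemma open_extend_zero: "c \<in> A ==> open (snd c ` (fst c - chart_inv e ` K))"
 using compactin_imp_closedin[OF Hausdorff compactin_chart_inv[OF e K]]
 by (intro open_chart_image openin_diff chart_basic) auto

lemma extend_self: "extend e H e = H"
proof
 fix x
 show "extend e H e x = H x"
 proof (cases "x \<in> chart_image e")
  case True
  have ov: "overlap e e = chart_image e" by (simp add: overlap_def chart_image_def)
  have id: "transition e e z = z" if "z \<in> chart_image e" for z
   using chart_inv(2)[OF e that] by (simp add: transition_def)
  have "partial i (%z. transition e e z $ a) x = (if a = i then 1 else 0)" for a i
  proof -
   have "partial i (%z. transition e e z $ a) x = partial i (%z. z $ a) x"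
    unfolding partial_eq_dd by (rule dd_cong[OF chart_basic(2)[OF e] True]) (simp add: id)
   also have "\<dots> = axis i 1 $ a"
    unfolding partial_eq_dd by (rule dd_bounded_linear) (rule bounded_linear_vec_nth)
   finally show ?thesis by (simp add: axis_def)
  qed
  hence "jac e e x = mat 1" by (simp add: jac_def mat_def)
  thus ?thesis using True by (simp add: extend_def ov id)
 next
  case False
  hence "x \<notin> overlap e e" by (simp add: overlap_iff[OF e])
  moreover have "H x = 0" using False K(2) by (intro H0) auto
  ultimately show ?thesis by (simp add: extend_def)
 qed
qed

lemma extend_tensor: "sym_tensor_field A (extend e H)"
 unfolding sym_tensor_field_def
proof (intro conjI ballI allI)
 fix c i j assume c: "c \<in> A"
 let ?O = "overlap c e" and ?Z = "snd c ` (fst c - chart_inv e ` K)"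
 have O: "open ?O" by (rule open_overlap[OF c e])
 have J: "Cinf ?O (%x. jac c e x $ a $ i)" for a i
  unfolding jac_def vec_lambda_beta partial_eq_dd by (rule Cinf_dd[OF Cinf_transition[OF c e]])
 have HT: "Cinf ?O (%x. H (transition c e x) $ a $ b)" for a b
  by (rule Cinf_compose_vec[OF O Cinf_transition[OF c e] UNIV_I H])
 have "Cinf ?O (%x. extend e H c x $ i $ j)"
 proof (rule Cinf_cong[OF O])
  show "Cinf ?O (%x. (transpose (jac c e x) ** H (transition c e x) ** jac c e x) $ i $ j)"
   unfolding matrix_matrix_mult_def transpose_def vec_lambda_beta
   by (intro Cinf_intros O J HT)
 qed (simp add: extend_def)
 moreover have "Cinf ?Z (%x. extend e H c x $ i $ j)"
  by (rule Cinf_cong[OF open_extend_zero[OF c] _ Cinf_const[OF open_extend_zero[OF c], of 0]])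
   (use extend_zero[OF c] in auto)
 ultimately have "Cinf (?O \<union> ?Z) (%x. extend e H c x $ i $ j)"
  by (rule Cinf_open_Un[OF O open_extend_zero[OF c]])
 moreover have "chart_image c \<subseteq> ?O \<union> ?Z"
 proof
  fix x assume x: "x \<in> chart_image c"
  show "x \<in> ?O \<union> ?Z"
  proof (cases "chart_inv c x \<in> fst e")
   case True thus ?thesis using x by (simp add: overlap_iff[OF c])
  next
   case False
   have "chart_inv e ` K \<subseteq> fst e" using K(2) chart_inv(1)[OF e] by auto
   hence "chart_inv c x \<in> fst c - chart_inv e ` K" using False chart_inv(1)[OF c x] by auto
   thus ?thesis using chart_inv(2)[OF c x] by force
  qed
 qed
 ultimately have "Cinf (chart_image c) (%x. extend e H c x $ i $ j)" by (rule Cinf_subset)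
 thus "smooth_on (chart_image c) (%x. extend e H c x $ i $ j)"
  using smooth_on_iff_Cinf[OF chart_basic(2)[OF c]] by blast
next
 fix c x assume "c \<in> A" "x \<in> chart_image c"
 have t0: "transpose (0 :: real^'n^'n) = 0" by (simp add: transpose_def vec_eq_iff)
 show "transpose (extend e H c x) = extend e H c x"
  by (simp add: extend_def matrix_transpose_mul H_sym matrix_mul_assoc t0)
next
 fix c d x i j assume c: "c \<in> A" and d: "d \<in> A" and x': "x \<in> snd c ` (fst c \<inter> fst d)"
 hence x: "x \<in> overlap c d" by (simp add: overlap_def)
 have "extend e H c x = transpose (jac c d x) ** extend e H d (transition c d x) ** jac c d x"
 proof (cases "x \<in> overlap c e")
  case True
  hence y: "transition c d x \<in> overlap d e"
   using x transition_overlap[OF c d x] by (auto simp: overlap_iff[OF c] overlap_iff[OF d])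
  have "transition c e x = transition d e (transition c d x)"
   using transition_overlap(2)[OF c d x] by (simp add: transition_def)
  thus ?thesis using True y
   by (simp add: extend_def jac_chain[OF c d e x True] matrix_transpose_mul matrix_mul_assoc)
 next
  case False
  hence "transition c d x \<notin> overlap d e"
   using x transition_overlap[OF c d x] by (auto simp: overlap_iff[OF c] overlap_iff[OF d])
  moreover have "N ** 0 = 0" "0 ** N = 0" for N :: "real^'n^'n"
   by (simp_all add: matrix_matrix_mult_def vec_eq_iff)
  ultimately show ?thesis using False by (simp add: extend_def)
 qed
 hence "extend e H c x $ i $ j = (\<Oplus>b a. partial i (%y. transition c d y $ a) x
   * extend e H d (transition c d x) $ a $ b * partial j (%y. transition c d y $ b) x)"
  by (simp add: matrix_matrix_mult_def transpose_def jac_def sum_distrib_right)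
 also have "\<dots> = (\<Oplus>a b. partial i (%y. transition c d y $ a) x
   * extend e H d (transition c d x) $ a $ b * partial j (%y. transition c d y $ b) x)" by (rule sum.swap)
 finally show "extend e H c x $ i $ j = (\<Oplus>a. \<Sum>b\<in>UNIV.
      partial i (%y. transition c d y $ a) x * partial j (%y. transition c d y $ b) x
       * extend e H d (transition c d x) $ a $ b)"
  by (simp only: mult_ac)
qed

lemma extend_compactly_supported: "compactly_supported M A (extend e H)"
 unfolding compactly_supported_def using compactin_chart_inv[OF e K] extend_zero by blast

end

lemma tensor_add_scaleR:
 assumes T: "sym_tensor_field A T" and R: "sym_tensor_field A R"
 shows "sym_tensor_field A (%c x. T c x + t *\<^sub>R R c x)"
 unfolding sym_tensor_field_def
proof (intro conjI ballI allI)
 fix c i j assume c: "c \<in> A"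
 show "smooth_on (chart_image c) (%x. (T c x + t *\<^sub>R R c x) $ i $ j)"
  using tensor_Cinf[OF T c, of i j] tensor_Cinf[OF R c, of i j] chart_basic(2)[OF c]
  by (simp add: smooth_on_iff_Cinf Cinf_intros)
next
 fix c x assume "c \<in> A" "x \<in> chart_image c"
 thus "transpose (T c x + t *\<^sub>R R c x) = T c x + t *\<^sub>R R c x"
  using tensor_sym[OF T] tensor_sym[OF R] by (simp add: transpose_def vec_eq_iff)
next
 fix c d x i j assume "c \<in> A" "d \<in> A" "x \<in> snd c ` (fst c \<inter> fst d)"
 hence "c \<in> A" "d \<in> A" "x \<in> overlap c d" by (auto simp: overlap_def)
 thus "(T c x + t *\<^sub>R R c x) $ i $ j = (\<Oplus>a. \<Sum>b\<in>UNIV.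
      partial i (%y. transition c d y $ a) x * partial j (%y. transition c d y $ b) x
       * (T d (transition c d x) + t *\<^sub>R R d (transition c d x)) $ a $ b)"
  by (simp add: tensor_pullback(1)[OF T] tensor_pullback(1)[OF R] sum.distrib sum_distrib_left algebra_simps)
qed

end

section \<open>The formal adjoint in a chart\<close>

lemma partial_cong:
 "open Z ==> x \<in> Z ==> (!!y. y \<in> Z ==> f y = g y) ==> partial i f x = partial i g x"
 unfolding partial_eq_dd by (rule dd_cong)

context
 fixes Z :: "(real^'n::finite) set" and G G' :: "real^'n => real^'n^'n"
 assumes Z: "open Z" and GG': "!!x. x \<in> Z ==> G x = G' x"
begin

lemma christoffel_cong: "x \<in> Z ==> christoffel G k i j x = christoffel G' k i j x"
proof -
 assume x: "x \<in> Z"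
 have "partial i (%y. G y $ j $ l) x = partial i (%y. G' y $ j $ l) x" for i j l
  by (rule partial_cong[OF Z x]) (simp add: GG')
 thus ?thesis by (simp add: christoffel_def GG'[OF x])
qed

lemma ricci_cong: "x \<in> Z ==> ricci G x = ricci G' x"
proof -
 assume x: "x \<in> Z"
 have "partial l (christoffel G k i j) x = partial l (christoffel G' k i j) x" for k i j l
  by (rule partial_cong[OF Z x christoffel_cong])
 thus ?thesis by (simp add: ricci_def christoffel_cong[OF x])
qed

lemma scalar_cong: "x \<in> Z ==> scalar_curvature G x = scalar_curvature G' x"
 by (simp add: scalar_curvature_def GG' ricci_cong)

lemma Q_coord_cong: "x \<in> Z ==> Q_coord G x = Q_coord G' x"
proof -
 assume x: "x \<in> Z"
 have 1: "partial k (scalar_curvature G) y = partial k (scalar_curvature G') y" if "y \<in> Z" for k y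
  by (rule partial_cong[OF Z that scalar_cong])
 have "partial l (partial k (scalar_curvature G)) x = partial l (partial k (scalar_curvature G')) x" for k l
  by (rule partial_cong[OF Z x 1])
 thus ?thesis
  by (simp add: Q_coord_def laplacian_def partials_def Let_def 1[OF x] christoffel_cong[OF x]
    ricci_cong[OF x] scalar_cong[OF x] GG'[OF x])
qed

end

text \<open>A compactly supported direction \<open>H\<close> in which a metric in coordinates is
  varied; \<open>H\<close> lives on the whole space, the form in which \<open>extend\<close> takes
  it.\<close>

locale variation = metric_coords S G for S :: "(real^'n::finite) set" and G +
 fixes H :: "real^'n => real^'n^'n" and K :: "(real^'n) set"
 assumes det_pos: "!!x. x \<in> S ==> det (G x) > 0"
  and H: "!!i j. Cinf UNIV (%x. H x $ i $ j)" and H_sym: "!!x. transpose (H x) = H x"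
  and K: "compact K" "K \<subseteq> S" and H0: "!!x. x \<notin> K ==> H x = 0"
begin

definition Gt :: "real => real^'n => real^'n^'n" where
 "Gt t x = G x + t *\<^sub>R H x"

text \<open>\<open>G + t H\<close> may degenerate for large \<open>t\<close>. \<open>T\<close> is an
  open set of pairs on which it does not, and it contains all pairs with \<open>t = 0\<close>, which
  is what derivatives at \<open>t = 0\<close> need.\<close>

definition T :: "(real \<times> (real^'n)) set" where
 "T = {z. snd z \<in> S \<and> det (Gt (fst z) (snd z)) > 0}"

lemma joint_Gt': "joint (UNIV \<times> S) (%t x. Gt t x $ i $ j)"
proof -
 have US: "open (UNIV \<times> S :: (real \<times> (real^'n)) set)" using S by (intro open_Times) auto
 have "Cinf (UNIV \<times> S) (%z :: real \<times> (real^'n). fst z)"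
  by (rule Cinf_linear[OF US]) (rule bounded_linear_fst)
 thus ?thesis
  unfolding Gt_def vector_add_component vector_scaleR_component real_scaleR_def
  by (intro Cinf_intros US joint_const[OF S G] joint_const[OF S Cinf_subset[OF H]]) auto
qed

lemma open_T: "open T"
proof -
 have US: "open (UNIV \<times> S :: (real \<times> (real^'n)) set)" using S by (intro open_Times) auto
 have "continuous_on (UNIV \<times> S) (%z. det (Gt (fst z) (snd z)))"
  by (rule Cinf_continuous_on[OF Cinf_det[OF US joint_Gt']])
 from continuous_open_preimage[OF this US, of "{0<..}"]
 have "open ((UNIV \<times> S) \<inter> (%z. det (Gt (fst z) (snd z))) -` {0<..})" by simp
 also have "(UNIV \<times> S) \<inter> (%z. det (Gt (fst z) (snd z))) -` {0<..} = T" by (auto simp: T_def)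
 finally show ?thesis .
qed

lemma joint_Gt: "joint T (%t x. Gt t x $ i $ j)"
 by (rule Cinf_subset[OF joint_Gt']) (auto simp: T_def)

lemma T0: "x \<in> S ==> (0, x) \<in> T"
 using det_pos by (simp add: T_def Gt_def)

lemma Gt0: "Gt 0 = G"
 by (simp add: Gt_def fun_eq_iff)

lemma det_Gt: "(t, x) \<in> T ==> det (Gt t x) > 0" "(t, x) \<in> T ==> det (Gt t x) \<noteq> 0"
 by (auto simp: T_def)

lemma Gt_outside: "x \<notin> K ==> Gt t x = G x"
 by (simp add: Gt_def H0)

definition DQt :: "real^'n => real" where
 "DQt x = deriv (%t. Q_coord (Gt t) x) 0"

lemma DQt: "x \<in> S ==> DQt x = dt (%t. Q_coord (Gt t)) 0 x"
 unfolding DQt_def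
 by (rule DERIV_imp_deriv[OF time_slice[OF joint_Q[OF open_T joint_Gt det_Gt(2)] T0]])

lemma Cinf_dt: "joint T F ==> Cinf S (dt F 0)"
 by (rule joint_at[OF joint_dt[OF open_T] S T0])

lemma Cinf_DQt: "Cinf S DQt"
 by (rule Cinf_cong[OF S _ Cinf_dt[OF joint_Q[OF open_T joint_Gt det_Gt(2)]]]) (simp_all add: DQt)

lemma dt_outside:
 assumes F: "joint T F" and x: "x \<in> S - K" and const: "!!t. F t x = F 0 x"
 shows "dt F 0 x = 0"
proof -
 have "((%t. F t x) has_real_derivative dt F 0 x) (at 0)" by (rule time_slice[OF F T0]) (use x in auto)
 moreover have "(%t. F t x) = (%t. F 0 x)" using const by (rule ext)
 ultimately have "((%t. F 0 x) has_real_derivative dt F 0 x) (at 0)" by simp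
 from DERIV_unique[OF this DERIV_const] show ?thesis .
qed

end

section \<open>Volume, Q-curvature and adjoint identity in the end chart\<close>

locale end_chart = smooth_mfd M A for M :: "'a topology" and A :: "('a, 'n::finite) chart set" +
 fixes g :: "('a, 'n) tensor2" and \<mu> :: "'a measure" and e :: "('a, 'n) chart"
 assumes metric: "riemannian_metric A g" and vol: "riemannian_volume M A g \<mu>" and e: "e \<in> A"
begin

lemma g_tensor: "sym_tensor_field A g"
 using metric by (simp add: riemannian_metric_def)

lemma g_det_pos: "c \<in> A ==> x \<in> chart_image c ==> det (g c x) > 0"
 using metric unfolding riemannian_metric_def by (intro pos_def_det_pos) blast

lemma metric_coords_e: "metric_coords (chart_image e) (g e)"
proof
 show "det (g e x) \<noteq> 0" if "x \<in> chart_image e" for x using g_det_pos[OF e that] by simp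
qed (use chart_basic(2)[OF e] tensor_Cinf[OF g_tensor e] tensor_sym[OF g_tensor e] in auto)

abbreviation w :: "real^'n => real" where
 "w x \<equiv> sqrt (det (g e x))"

lemma Cinf_w: "Cinf (chart_image e) w"
 by (rule Cinf_sqrt[OF chart_basic(2)[OF e] Cinf_det[OF chart_basic(2)[OF e] tensor_Cinf[OF g_tensor e]] g_det_pos[OF e]])

context
 fixes F :: "'a => real" and f :: "real^'n => real"
 assumes f: "continuous_on (chart_image e) f"
  and Ff: "!!q. q \<in> fst e ==> F q = f (snd e q)"
  and F0: "!!q. q \<in> topspace M - fst e ==> F q = 0"
begin

text \<open>\<open>riemannian_volume\<close> gives the measures of sets inside a chart. These values
  say that \<open>\<mu>\<close>, restricted to the domain of \<open>e\<close>, is the image of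
  \<open>sqrt (det g) dx\<close> under the inverse chart, so for \<open>F\<close> vanishing off the
  domain integration over the manifold becomes integration over the chart image.\<close>

lemma chart_pushforward:
 "integrable \<mu> F \<longleftrightarrow> integrable lborel (%x. indicator (chart_image e) x * (f x * w x))"
 "(LINT q|\<mu>. F q) = (LINT x|lborel. indicator (chart_image e) x * (f x * w x))"
proof -
 let ?\<Omega> = "chart_image e"
 have \<Omega>: "open ?\<Omega>" "?\<Omega> \<in> sets borel" using chart_basic(2)[OF e] by auto
 have sp: "space \<mu> = topspace M" and st: "sets \<mu> = sigma_sets (topspace M) {U. openin M U}"
  and em: "!!B. B \<in> sets \<mu> ==> B \<subseteq> fst e ==>
   emeasure \<mu> B = (\<integral>\<^sup>+x\<in>snd e ` B. ennreal (w x) \<partial>lborel)"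
  using vol e by (auto simp: riemannian_volume_def)
 have op: "U \<in> sets \<mu>" if "openin M U" for U using that by (simp add: st sigma_sets.Basic)
 have fe: "fst e \<in> sets \<mu>" by (rule op[OF chart_basic(1)[OF e]])
 have wm [measurable]: "(%x. indicator ?\<Omega> x * w x) \<in> borel_measurable borel"
  using borel_measurable_continuous_on_indicator[OF \<Omega>(2) Cinf_continuous_on[OF Cinf_w]] by simp
 have fm [measurable]: "(%x. indicator ?\<Omega> x * f x) \<in> borel_measurable borel"
  using borel_measurable_continuous_on_indicator[OF \<Omega>(2) f] by simp
 define N where "N = density lborel (%x. ennreal (indicator ?\<Omega> x * w x))"
 have spN: "space (restrict_space N ?\<Omega>) = ?\<Omega>" "?\<Omega> \<in> sets N"
  using \<Omega> by (auto simp: N_def space_restrict_space)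
 have pre: "chart_inv e -` B \<inter> ?\<Omega> = snd e ` (B \<inter> fst e)" for B
  using chart_inv[OF e] by (auto intro!: image_eqI)
 have inv_m: "chart_inv e \<in> measurable (restrict_space N ?\<Omega>) \<mu>"
 proof (rule measurable_sigma_sets[OF st])
  show "chart_inv e \<in> space (restrict_space N ?\<Omega>) \<rightarrow> topspace M"
   using chart_inv(1)[OF e] chart_basic(4)[OF e] by (auto simp: spN)
  fix U assume "U \<in> {U. openin M U}"
  hence "open (snd e ` (U \<inter> fst e))"
   by (intro open_chart_image[OF e]) (auto intro: openin_Int chart_basic(1)[OF e])
  moreover have "snd e ` (U \<inter> fst e) \<subseteq> ?\<Omega>" by (auto simp: chart_image_def)
  ultimately show "chart_inv e -` U \<inter> space (restrict_space N ?\<Omega>) \<in> sets (restrict_space N ?\<Omega>)"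
   unfolding spN(1) pre using spN(2) by (subst sets_restrict_space_iff) (auto simp: N_def)
 qed (auto dest: openin_subset)
 have Fm: "F \<in> borel_measurable \<mu>"
 proof (rule borel_measurableI)
  fix B :: "real set" assume B: "open B"
  define W where "W = ?\<Omega> \<inter> f -` B"
  have W: "open W" "W \<subseteq> ?\<Omega>" unfolding W_def using continuous_open_preimage[OF f \<Omega>(1) B] by auto
  have "F -` B \<inter> space \<mu> = chart_inv e ` W \<union> (if 0 \<in> B then topspace M - fst e else {})"
  proof (intro set_eqI iffI)
   fix q assume "q \<in> F -` B \<inter> space \<mu>"
   hence q: "F q \<in> B" "q \<in> topspace M" by (auto simp: sp)
   show "q \<in> chart_inv e ` W \<union> (if 0 \<in> B then topspace M - fst e else {})"
   proof (cases "q \<in> fst e")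
    case True
    thus ?thesis using q Ff[OF True] chart_inv(3,4)[OF e True]
     by (intro UnI1 image_eqI[of _ _ "snd e q"]) (auto simp: W_def)
   qed (use q F0[of q] in auto)
  next
   fix q assume q: "q \<in> chart_inv e ` W \<union> (if 0 \<in> B then topspace M - fst e else {})"
   show "q \<in> F -` B \<inter> space \<mu>"
   proof (cases "q \<in> chart_inv e ` W")
    case True
    then obtain x where x: "x \<in> W" "q = chart_inv e x" by blast
    hence "q \<in> fst e" "snd e q = x" using W(2) chart_inv(1,2)[OF e] by auto
    thus ?thesis using x Ff chart_basic(4)[OF e] by (auto simp: W_def sp)
   next
    case False
    hence "0 \<in> B" "q \<in> topspace M - fst e" using q by (auto split: if_splits)
    thus ?thesis using F0[of q] by (simp add: sp)
   qed
  qed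
  moreover have "chart_inv e ` W \<in> sets \<mu>" by (rule op[OF open_chart_inv[OF e W]])
  moreover have "topspace M - fst e \<in> sets \<mu>" using fe sets.compl_sets[of "fst e" \<mu>] by (simp add: sp)
  ultimately show "F -` B \<inter> space \<mu> \<in> sets \<mu>" by auto
 qed
 have eq: "density \<mu> (indicator (fst e)) = distr (restrict_space N ?\<Omega>) \<mu> (chart_inv e)"
 proof (rule measure_eqI)
  fix B assume "B \<in> sets (density \<mu> (indicator (fst e)))"
  hence B: "B \<in> sets \<mu>" by simp
  have Bm: "snd e ` (B \<inter> fst e) \<in> sets borel"
   using measurable_sets[OF inv_m B] unfolding spN(1) pre
   using spN(2) by (subst (asm) sets_restrict_space_iff) (auto simp: N_def)
  have "emeasure (density \<mu> (indicator (fst e))) B = (\<integral>\<^sup>+q. indicator (B \<inter> fst e) q \<partial>\<mu>)"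
  proof -
   have "emeasure (density \<mu> (indicator (fst e))) B = (\<integral>\<^sup>+q. indicator (fst e) q * indicator B q \<partial>\<mu>)"
    by (rule emeasure_density) (use fe B in auto)
   also have "\<dots> = (\<integral>\<^sup>+q. indicator (B \<inter> fst e) q \<partial>\<mu>)"
    by (intro nn_integral_cong) (auto split: split_indicator)
   finally show ?thesis .
  qed
  also have "\<dots> = emeasure \<mu> (B \<inter> fst e)" using B fe by simp
  also have "\<dots> = (\<integral>\<^sup>+x\<in>snd e ` (B \<inter> fst e). ennreal (w x) \<partial>lborel)"
   using B fe by (intro em) auto
  also have "\<dots> = (\<integral>\<^sup>+x. ennreal (indicator ?\<Omega> x * w x) * indicator (snd e ` (B \<inter> fst e)) x \<partial>lborel)"
  proof (intro nn_integral_cong)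
   fix x
   have "x \<in> snd e ` (B \<inter> fst e) ==> x \<in> ?\<Omega>" by (auto simp: chart_image_def)
   thus "ennreal (w x) * indicator (snd e ` (B \<inter> fst e)) x
     = ennreal (indicator ?\<Omega> x * w x) * indicator (snd e ` (B \<inter> fst e)) x"
    by (auto split: split_indicator)
  qed
  also have "\<dots> = emeasure N (snd e ` (B \<inter> fst e))"
   unfolding N_def using Bm by (subst emeasure_density) auto
  also have "\<dots> = emeasure (restrict_space N ?\<Omega>) (snd e ` (B \<inter> fst e))"
   using spN(2) by (subst emeasure_restrict_space) (auto simp: chart_image_def)
  also have "\<dots> = emeasure (distr (restrict_space N ?\<Omega>) \<mu> (chart_inv e)) B"
   using inv_m B by (simp add: emeasure_distr spN(1) pre)
  finally show "emeasure (density \<mu> (indicator (fst e))) B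
    = emeasure (distr (restrict_space N ?\<Omega>) \<mu> (chart_inv e)) B" .
 qed simp
 have ind_eq: "(indicator (fst e) :: 'a => ennreal) = (%q. ennreal (indicator (fst e) q))"
  by (auto split: split_indicator)
 have Find: "indicator (fst e) q *\<^sub>R F q = F q" if "q \<in> space \<mu>" for q
  using that F0[of q] by (auto simp: sp split: split_indicator)
 have im: "(%q. indicator (fst e) q :: real) \<in> borel_measurable \<mu>" using fe by simp
 have wx: "indicator ?\<Omega> x * w x \<ge> 0" for x
  using g_det_pos[OF e, of x] by (auto split: split_indicator)
 have fmN: "(%x. indicator ?\<Omega> x *\<^sub>R f x) \<in> borel_measurable lborel" using fm by simp
 have resc: "(indicator ?\<Omega> x * w x) *\<^sub>R (indicator ?\<Omega> x *\<^sub>R f x) = indicator ?\<Omega> x * (f x * w x)" for x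
  by (auto split: split_indicator)
 have Fe: "F (chart_inv e x) = f x" if "x \<in> ?\<Omega>" for x
  using Ff chart_inv(1,2)[OF e that] by simp
 have "integrable \<mu> F \<longleftrightarrow> integrable \<mu> (%q. indicator (fst e) q *\<^sub>R F q)"
  by (rule Bochner_Integration.integrable_cong[OF refl]) (rule Find[symmetric])
 also have "\<dots> \<longleftrightarrow> integrable (density \<mu> (indicator (fst e))) F"
  unfolding ind_eq using Fm im by (subst integrable_density) auto
 also have "\<dots> \<longleftrightarrow> integrable (restrict_space N ?\<Omega>) (%x. F (chart_inv e x))"
  unfolding eq by (rule integrable_distr_eq[OF inv_m Fm])
 also have "\<dots> \<longleftrightarrow> integrable (restrict_space N ?\<Omega>) f"
  by (rule Bochner_Integration.integrable_cong) (auto simp: Fe spN)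
 also have "\<dots> \<longleftrightarrow> integrable N (%x. indicator ?\<Omega> x *\<^sub>R f x)"
  using spN(2) by (intro integrable_restrict_space) (auto simp: N_def)
 also have "\<dots> \<longleftrightarrow> integrable lborel (%x. (indicator ?\<Omega> x * w x) *\<^sub>R (indicator ?\<Omega> x *\<^sub>R f x))"
  unfolding N_def using wm wx fmN by (intro integrable_density) auto
 finally show "integrable \<mu> F \<longleftrightarrow> integrable lborel (%x. indicator ?\<Omega> x * (f x * w x))" by (simp only: resc)
 have "(LINT q|\<mu>. F q) = (LINT q|\<mu>. indicator (fst e) q *\<^sub>R F q)"
  by (rule Bochner_Integration.integral_cong[OF refl]) (rule Find[symmetric])
 also have "\<dots> = (LINT q|density \<mu> (indicator (fst e)). F q)"
  unfolding ind_eq using Fm im by (subst integral_density) auto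
 also have "\<dots> = (LINT x|restrict_space N ?\<Omega>. F (chart_inv e x))"
  unfolding eq by (rule integral_distr[OF inv_m Fm])
 also have "\<dots> = (LINT x|restrict_space N ?\<Omega>. f x)"
  by (rule Bochner_Integration.integral_cong) (auto simp: Fe spN)
 also have "\<dots> = (LINT x|N. indicator ?\<Omega> x *\<^sub>R f x)"
  using spN(2) by (intro integral_restrict_space) (auto simp: N_def)
 also have "\<dots> = (LINT x|lborel. (indicator ?\<Omega> x * w x) *\<^sub>R (indicator ?\<Omega> x *\<^sub>R f x))"
  unfolding N_def using wm wx fmN by (intro integral_density) auto
 finally show "(LINT q|\<mu>. F q) = (LINT x|lborel. indicator ?\<Omega> x * (f x * w x))" by (simp only: resc)
qed

end

lemma Q_curvature_chart: "q \<in> fst e ==> Q_curvature A g q = Q_coord (g e) (snd e q)"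
proof -
 assume q: "q \<in> fst e"
 hence qM: "q \<in> topspace M" using chart_basic(4)[OF e] by auto
 define c where "c = chart_at A q"
 have c: "c \<in> A" "q \<in> fst c" unfolding c_def using chart_at[OF qM] by auto
 have "det (g c (snd c q)) \<noteq> 0" using g_det_pos[OF c(1) chart_inv(4)[OF c]] by simp
 from Q_coord_invariant[OF g_tensor c(1) e c(2) q this] show ?thesis
  by (simp add: Q_curvature_def Let_def flip: c_def)
qed

lemma integrable_Q_coord:
 assumes "integrable \<mu> (Q_curvature A g)"
 shows "integrable lborel (%x. indicator (chart_image e) x * (Q_coord (g e) x * w x))"
proof -
 have fe: "fst e \<in> sets \<mu>"
  using vol chart_basic(1)[OF e] by (auto simp: riemannian_volume_def sigma_sets.Basic)
 have "integrable \<mu> (%q. indicator (fst e) q *\<^sub>R Q_curvature A g q)"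
  by (rule integrable_mult_indicator[OF fe assms])
 moreover have "continuous_on (chart_image e) (Q_coord (g e))"
  by (rule Cinf_continuous_on[OF metric_coords.Cinf_Q[OF metric_coords_e]])
 ultimately show ?thesis
  by (subst chart_pushforward(1)[symmetric]) (auto simp: Q_curvature_chart)
qed

text \<open>The adjoint identity at the function 1, tested with \<open>extend e H\<close>. Both
  integrands are given in an arbitrary chart around each point and are moved to \<open>e\<close> by
  invariance.\<close>

lemma formal_adjoint_chart:
 assumes var: "variation (chart_image e) (g e) H K"
  and adj: "formal_adjoint M A g \<mu> (DQ A g) DQ'"
 shows "(LINT x|lborel. indicator (chart_image e) x * (variation.DQt (g e) H x * w x))
  = (LINT x|lborel. indicator (chart_image e) x * (matrix_inner (g e x) (H x) (DQ' (%_. 1) e x) * w x))"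
  and "sym_tensor_field A (DQ' (%_. 1))"
proof -
 interpret v: variation "chart_image e" "g e" H K by (rule var)
 note ext = e v.K v.H v.H_sym v.H0
 define h where "h = extend e H"
 define P where "P = DQ' (%_. 1)"
 have h: "sym_tensor_field A h" "compactly_supported M A h" "h e = H"
  unfolding h_def using extend_tensor[OF ext] extend_compactly_supported[OF ext] extend_self[OF ext] by auto
 have one: "smooth_function A (%_. 1 :: real)"
  unfolding smooth_function_def o_def using smooth_on_iff_Cinf[OF chart_basic(2)] Cinf_const[OF chart_basic(2)] by blast
 have P: "sym_tensor_field A P"
  and eq: "(LINT q|\<mu>. DQ A g h q * 1) = (LINT q|\<mu>. tensor_inner A g h P q)"
  using adj one h(1,2) unfolding formal_adjoint_def P_def by blast+
 show "sym_tensor_field A (DQ' (%_. 1))" using P by (simp add: P_def)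
 have DQ: "DQ A g h q = deriv (%t. Q_coord (%x. g (chart_at A q) x + t *\<^sub>R h (chart_at A q) x) (snd (chart_at A q) q)) 0" for q
  by (simp add: DQ_def Q_curvature_def Let_def)
 have DQe: "DQ A g h q = v.DQt (snd e q)" if q: "q \<in> fst e" for q
 proof -
  have qM: "q \<in> topspace M" using chart_basic(4)[OF e] q by auto
  define c where "c = chart_at A q"
  have c: "c \<in> A" "q \<in> fst c" unfolding c_def using chart_at[OF qM] by auto
  \<comment> \<open>Invariance of \<open>Q_coord\<close> needs a nondegenerate tensor at the point.
    By continuity of the determinant this holds for small \<open>t\<close>, and the derivative at 0
    depends on these only.\<close>
  define D where "D = (%t. det (g c (snd c q) + t *\<^sub>R h c (snd c q)))"
  have "isCont D 0" unfolding D_def det_def by (intro continuous_intros)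
  moreover have "D 0 \<noteq> 0" unfolding D_def using g_det_pos[OF c(1) chart_inv(4)[OF c]] by simp
  ultimately have "\<forall>\<^sub>F t in nhds 0. D t \<noteq> 0"
   using tendsto_imp_eventually_ne[of D "D 0" "at 0" 0] by (simp add: isCont_def eventually_nhds_conv_at)
  hence "\<forall>\<^sub>F t in nhds 0. Q_coord (%x. g c x + t *\<^sub>R h c x) (snd c q) = Q_coord (v.Gt t) (snd e q)"
  proof eventually_elim
   case (elim t)
   have "v.Gt t = (%x. g e x + t *\<^sub>R h e x)" by (simp add: v.Gt_def h(3) fun_eq_iff)
   thus ?case
    using Q_coord_invariant[OF tensor_add_scaleR[OF g_tensor h(1)] c(1) e c(2) q, of t] elim
    by (simp add: D_def)
  qed
  hence "deriv (%t. Q_coord (%x. g c x + t *\<^sub>R h c x) (snd c q)) 0 = deriv (%t. Q_coord (v.Gt t) (snd e q)) 0"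
   by (rule deriv_cong_ev) simp
  thus ?thesis unfolding DQ v.DQt_def c_def .
 qed
 \<comment> \<open>Off the domain of \<open>e\<close> the extension vanishes in a whole
   neighbourhood, so \<open>Q_coord\<close> does not depend on \<open>t\<close> there.\<close>
 have zero: "h (chart_at A q) (snd (chart_at A q) q) = 0" "DQ A g h q = 0" if q: "q \<in> topspace M - fst e" for q
 proof -
  define c where "c = chart_at A q"
  have c: "c \<in> A" "q \<in> fst c" unfolding c_def using chart_at[of q] q by auto
  have "chart_inv e ` K \<subseteq> fst e" using v.K(2) chart_inv(1)[OF e] by auto
  hence qK: "q \<notin> chart_inv e ` K" using q by auto
  thus "h (chart_at A q) (snd (chart_at A q) q) = 0"
   unfolding h_def using extend_zero[OF ext c(1,2)] by (simp add: c_def)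
  have Z: "open (snd c ` (fst c - chart_inv e ` K))" by (rule open_extend_zero[OF ext c(1)])
  have "Q_coord (%x. g c x + t *\<^sub>R h c x) (snd c q) = Q_coord (g c) (snd c q)" for t
   by (rule Q_coord_cong[OF Z]) (use c qK extend_zero[OF ext c(1)] in \<open>auto simp: h_def\<close>)
  thus "DQ A g h q = 0" unfolding DQ by (simp flip: c_def)
 qed
 have "(LINT q|\<mu>. DQ A g h q) = (LINT x|lborel. indicator (chart_image e) x * (v.DQt x * w x))"
  by (rule chart_pushforward(2)[OF Cinf_continuous_on[OF v.Cinf_DQt] DQe zero(2)])
 moreover have "(LINT q|\<mu>. tensor_inner A g h P q)
   = (LINT x|lborel. indicator (chart_image e) x * (matrix_inner (g e x) (H x) (P e x) * w x))"
 proof (rule chart_pushforward(2))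
  have "Cinf (chart_image e) (%x. matrix_inner (g e x) (H x) (P e x))"
   unfolding matrix_inner_def
   by (intro Cinf_intros chart_basic(2)[OF e] v.Cinf_U tensor_Cinf[OF P e] Cinf_subset[OF v.H]) auto
  thus "continuous_on (chart_image e) (%x. matrix_inner (g e x) (H x) (P e x))" by (rule Cinf_continuous_on)
  fix q assume q: "q \<in> fst e"
  have qM: "q \<in> topspace M" using chart_basic(4)[OF e] q by auto
  define c where "c = chart_at A q"
  have c: "c \<in> A" "q \<in> fst c" unfolding c_def using chart_at[OF qM] by auto
  have "det (g c (snd c q)) \<noteq> 0" using g_det_pos[OF c(1) chart_inv(4)[OF c]] by simp
  from matrix_inner_invariant[OF g_tensor h(1) P c(1) e c(2) q this]
  show "tensor_inner A g h P q = matrix_inner (g e (snd e q)) (H (snd e q)) (P e (snd e q))"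
   by (simp add: tensor_inner_def Let_def h(3) flip: c_def)
 next
  fix q assume "q \<in> topspace M - fst e"
  thus "tensor_inner A g h P q = 0" using zero(1)[of q] by (simp add: tensor_inner_def Let_def matrix_inner_def)
 qed
 ultimately show "(LINT x|lborel. indicator (chart_image e) x * (v.DQt x * w x))
  = (LINT x|lborel. indicator (chart_image e) x * (matrix_inner (g e x) (H x) (DQ' (%_. 1) e x) * w x))"
  using eq by (simp add: P_def)
qed

end

section \<open>Linearisation at infinity\<close>

locale asymptotics = metric_coords exterior G for G :: "real^'n::finite => real^'n^'n" +
 fixes \<tau> :: real
 assumes det_pos: "!!x. x \<in> exterior ==> det (G x) > 0" and \<tau>: "\<tau> > 0"
  and G_decay: "!!a b. decay 4 \<tau> (%x. G x $ a $ b - (if a = b then 1 else 0))"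
begin

definition u :: "'n => 'n => real^'n => real" where
 "u a b x = G x $ a $ b - (if a = b then 1 else 0)"

text \<open>Intended for \<open>f1\<close> the part of \<open>f\<close> linear in \<open>u\<close>:
  the error gains a further \<open>|x|^(-\<tau>)\<close>, the size of one more factor
  \<open>u\<close>.\<close>

definition approx :: "nat => real => (real^'n => real) => (real^'n => real) => bool" where
 "approx m a f f1 \<longleftrightarrow> decay m a f1 \<and> decay m (a + \<tau>) (%x. f x - f1 x)"

lemma u_decay: "decay 4 \<tau> (u a b)"
 using G_decay by (simp add: u_def[abs_def])

lemma approx_refl: "decay m a f ==> approx m a f f"
 by (simp add: approx_def decay_zero)

lemma approx_zero: "decay m b f ==> a + \<tau> \<le> b ==> approx m a f (%x. 0)"
 by (auto simp: approx_def decay_zero intro: decay_mono)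

lemma approx_decay:
 assumes "approx m a f f1"
 shows "decay m a f"
proof -
 have "decay m a (%x. f1 x + (f x - f1 x))"
  using assms \<tau> by (intro decay_add) (auto simp: approx_def intro: decay_mono)
 thus ?thesis by simp
qed

lemma approx_Cinf: "approx m a f f1 ==> Cinf exterior f" "approx m a f f1 ==> Cinf exterior f1"
 unfolding approx_def by (rule decay_Cinf[OF approx_decay[unfolded approx_def]]) (auto dest: decay_Cinf)

lemma approx_cong:
 assumes "approx m a f f1" "!!x. x \<in> exterior ==> f x = g x" "!!x. x \<in> exterior ==> f1 x = g1 x"
 shows "approx m a g g1"
 using assms unfolding approx_def by (auto elim!: decay_cong)

lemma approx_add: "approx m a f f1 ==> approx m a g g1 ==> approx m a (%x. f x + g x) (%x. f1 x + g1 x)"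
 unfolding approx_def
proof (intro conjI; elim conjE)
 assume "decay m (a + \<tau>) (%x. f x - f1 x)" "decay m (a + \<tau>) (%x. g x - g1 x)"
 from decay_add[OF this] show "decay m (a + \<tau>) (%x. f x + g x - (f1 x + g1 x))"
  by (rule decay_cong) simp
qed (rule decay_add)

lemma approx_sum: "(!!i. i \<in> I ==> approx m a (f i) (f1 i)) ==>
  approx m a (%x. \<Sum>i\<in>I. f i x) (%x. \<Sum>i\<in>I. f1 i x)"
 by (induction I rule: infinite_finite_induct) (auto intro: approx_add approx_refl decay_zero)

text \<open>\<open>c f - k f1 = (c - k) f + k (f - f1)\<close>, and each summand gains the rate
  \<open>\<tau>\<close>. It serves to replace the inverse metric by the identity.\<close>

lemma approx_mult:
 assumes c: "decay m \<tau> (%x. c x - k)" and f: "approx m a f f1"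
 shows "approx m a (%x. c x * f x) (%x. k * f1 x)"
 unfolding approx_def
proof
 show "decay m a (%x. k * f1 x)" using f by (intro decay_cmult) (simp add: approx_def)
 have "decay m (a + \<tau>) (%x. (c x - k) * f x + k * (f x - f1 x))"
  using f approx_decay[OF f] by (intro decay_add decay_cmult decay_mult[OF c]) (auto simp: approx_def)
 thus "decay m (a + \<tau>) (%x. c x * f x - k * f1 x)" by (rule decay_cong) (simp add: algebra_simps)
qed

lemma approx_cmult: "approx m a f f1 ==> approx m a (%x. k * f x) (%x. k * f1 x)"
 by (rule approx_mult) (simp_all add: decay_zero)

lemma approx_uminus: "approx m a f f1 ==> approx m a (%x. - f x) (%x. - f1 x)"
 using approx_cmult[of m a f f1 "-1"] by simp

lemma approx_diff: "approx m a f f1 ==> approx m a g g1 ==> approx m a (%x. f x - g x) (%x. f1 x - g1 x)"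
 using approx_add[OF _ approx_uminus] by fastforce

lemma approx_half: "approx m a f f1 ==> approx m a (%x. f x / 2) (%x. f1 x / 2)"
 using approx_cmult[of m a f f1 "1/2"] by simp

lemma approx_quadratic: "decay m a f ==> decay m b g ==> c + \<tau> \<le> a + b ==> approx m c (%x. f x * g x) (%x. 0)"
 by (rule approx_zero[OF decay_mult[of _ a _ b _ "a + b"]]) auto

lemma approx_partial:
 assumes f: "approx (Suc m) a f f1" and b: "b = a + 1"
 shows "approx m b (partial i f) (partial i f1)"
 unfolding approx_def
proof
 show "decay m b (partial i f1)" using f b by (intro decay_partial[of m a]) (auto simp: approx_def)
 have "decay m (b + \<tau>) (partial i (%x. f x - f1 x))"
  using f b by (intro decay_partial[of m "a + \<tau>"]) (auto simp: approx_def)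
 thus "decay m (b + \<tau>) (%x. partial i f x - partial i f1 x)"
 proof (rule decay_cong)
  fix x :: "real^'n" assume "x \<in> exterior"
  thus "partial i (%x. f x - f1 x) x = partial i f x - partial i f1 x"
   unfolding partial_eq_dd using approx_Cinf[OF f] by (intro dd_diff Cinf_differentiable)
 qed
qed

lemma u_tendsto: "(u a b \<longlongrightarrow> 0) at_infinity"
proof -
 have lim: "((%x::real^'n. norm x powr (- \<tau>)) \<longlongrightarrow> 0) at_infinity"
  using \<tau> by (intro tendsto_neg_powr filterlim_norm_at_top) auto
 obtain C where "\<forall>\<^sub>F x in at_infinity. norm (u a b x) \<le> C * norm (norm x powr (- \<tau>))"
  using decay_bigo[OF u_decay, of a b] by (rule landau_o.bigE)
 moreover have "((%x::real^'n. C * norm (norm x powr (- \<tau>))) \<longlongrightarrow> C * norm (0::real)) at_infinity"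
  by (intro tendsto_mult tendsto_const tendsto_norm lim)
 hence "((%x::real^'n. C * norm (norm x powr (- \<tau>))) \<longlongrightarrow> 0) at_infinity" by simp
 ultimately show ?thesis by (rule Lim_null_comparison)
qed

lemma u_small: "\<forall>\<^sub>F x in at_infinity. (\<Oplus>a b. \<bar>u a b x\<bar>) \<le> 1/2"
proof -
 have "((%x. \<Oplus>a b. \<bar>u a b x\<bar>) \<longlongrightarrow> (\<Sum>a\<in>(UNIV::'n set). \<Sum>b\<in>(UNIV::'n set). \<bar>0\<bar>)) at_infinity"
  by (intro tendsto_sum tendsto_rabs u_tendsto)
 hence "((%x. \<Oplus>a b. \<bar>u a b x\<bar>) \<longlongrightarrow> 0) at_infinity" by simp
 from order_tendstoD(2)[OF this, of "1/2"] show ?thesis by (auto elim: eventually_mono)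
qed

lemma U_eq: "x \<in> exterior ==> U a b x = (if a = b then 1 else 0) - (\<Oplus>c. U a c x * u c b x)"
proof -
 assume x: "x \<in> exterior"
 have "(\<Oplus>c. U a c x * u c b x) = (\<Oplus>c. U a c x * G x $ c $ b) - (\<Oplus>c. U a c x * (if c = b then 1 else 0))"
  by (simp add: u_def right_diff_distrib sum_subtractf)
 thus ?thesis using matrix_inv_nth(2)[OF G_det[OF x], of a b]
  by (simp add: if_distrib[of "%r. _ * r"] cong: if_cong)
qed

text \<open>\<open>U_eq\<close> reads \<open>U = 1 - U u\<close>. Far out the entries of
  \<open>u\<close> sum to at most 1/2 in absolute value, so the sum \<open>m\<close> of all
  \<open>|U a b|\<close> satisfies \<open>m \<le> n^2 + m / 2\<close>.\<close>

lemma U_bounded: "decay 0 0 (U a b)"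
proof -
 have "\<forall>\<^sub>F x in at_infinity. norm (U a b x) \<le> 2 * real CARD('n) ^ 2 * norm (norm x powr (- 0))"
  using u_small eventually_exterior
 proof eventually_elim
  case (elim x)
  define m where "m = (\<Oplus>a b. \<bar>U a b x\<bar>)"
  have m0: "m \<ge> 0" by (simp add: m_def sum_nonneg)
  have bd: "\<bar>U a b x\<bar> \<le> 1 + (\<Oplus>c. \<bar>U a c x\<bar> * \<bar>u c b x\<bar>)" for a b
  proof -
   have "\<bar>U a b x\<bar> \<le> \<bar>if a = b then 1 else 0\<bar> + \<bar>\<Oplus>c. U a c x * u c b x\<bar>"
    unfolding U_eq[OF elim(2), of a b] by (rule abs_triangle_ineq4)
   also have "\<bar>\<Oplus>c. U a c x * u c b x\<bar> \<le> (\<Oplus>c. \<bar>U a c x * u c b x\<bar>)" by (rule sum_abs)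
   finally show ?thesis by (simp add: abs_mult split: if_splits)
  qed
  have "m \<le> (\<Sum>a\<in>(UNIV::'n set). \<Sum>b\<in>(UNIV::'n set). 1 + (\<Oplus>c. \<bar>U a c x\<bar> * \<bar>u c b x\<bar>))"
   unfolding m_def by (intro sum_mono bd)
  also have "\<dots> = real CARD('n) ^ 2 + (\<Oplus>a b c. \<bar>U a c x\<bar> * \<bar>u c b x\<bar>)"
   by (simp add: sum.distrib power2_eq_square)
  also have "(\<Oplus>a b c. \<bar>U a c x\<bar> * \<bar>u c b x\<bar>)
    = (\<Oplus>a c. \<bar>U a c x\<bar> * (\<Oplus>b. \<bar>u c b x\<bar>))"
   unfolding sum_distrib_left by (rule sum.cong[OF refl sum.swap])
  also have "\<dots> \<le> (\<Oplus>a c. \<bar>U a c x\<bar> * (1/2))"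
  proof (intro sum_mono mult_left_mono)
   fix c
   have "(\<Oplus>b. \<bar>u c b x\<bar>) \<le> (\<Oplus>a b. \<bar>u a b x\<bar>)"
    by (rule member_le_sum[of c UNIV "%a. \<Oplus>b. \<bar>u a b x\<bar>"]) (auto intro: sum_nonneg)
   thus "(\<Oplus>b. \<bar>u c b x\<bar>) \<le> 1/2" using elim(1) by linarith
  qed auto
  also have "\<dots> = m / 2" by (simp add: m_def sum_divide_distrib)
  finally have "m \<le> 2 * real CARD('n) ^ 2" by simp
  moreover have "\<bar>U a b x\<bar> \<le> (\<Oplus>b. \<bar>U a b x\<bar>)" by (rule member_le_sum) auto
  moreover have "(\<Oplus>b. \<bar>U a b x\<bar>) \<le> m"
   unfolding m_def by (rule member_le_sum[of a UNIV "%a. \<Oplus>b. \<bar>U a b x\<bar>"]) (auto intro: sum_nonneg)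
  moreover have "norm (norm x powr (- 0)) = 1" using elim(2) by auto
  ultimately show ?case by simp
 qed
 thus ?thesis unfolding decay_0 using Cinf_U by (auto intro: bigoI)
qed

lemma partial_G: "x \<in> exterior ==> partial i (%y. G y $ a $ b) x = partial i (u a b) x"
proof -
 assume x: "x \<in> exterior"
 have "partial i (u a b) x = partial i (%y. G y $ a $ b) x - partial i (%y. if a = b then 1 else 0) x"
  unfolding u_def[abs_def] partial_eq_dd by (rule dd_diff) (auto intro: diff[OF G x])
 thus ?thesis by (simp add: partial_eq_dd)
qed

lemma dG_decay: "decay 3 (\<tau> + 1) (partial i (%y. G y $ a $ b))"
proof (rule decay_cong)
 show "decay 3 (\<tau> + 1) (partial i (u a b))"
  using u_decay by (intro decay_partial[of 3 \<tau>]) (auto simp: numeral_eq_Suc)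
qed (simp add: partial_G)

text \<open>A bootstrap: \<open>partial_U\<close> expresses derivatives of \<open>U\<close> through
  \<open>U\<close> and derivatives of \<open>G\<close>, so each step of the induction controls one
  more derivative.\<close>

lemma U_decay0: "decay 4 0 (U a b)"
proof -
 have "m \<le> 4 ==> decay m 0 (U a b)" for m a b
 proof (induction m arbitrary: a b)
  case (Suc m)
  have "decay m 1 (partial v (U a b))" for v
  proof (rule decay_cong)
   show "decay m 1 (%x. - (\<Oplus>c e. U a c x * partial v (%y. G y $ c $ e) x * U e b x))"
    using Suc \<tau> decay_mono[OF dG_decay, of m 1]
    by (intro decay_uminus decay_sum decay_mult[of _ 1 _ 0] decay_mult[of _ 0 _ 1]) auto
  qed (simp add: partial_U)
  thus ?case using U_bounded by (simp add: decay_Suc)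
 qed (rule U_bounded)
 thus ?thesis by simp
qed

lemma U_decay: "decay 4 \<tau> (%x. U a b x - (if a = b then 1 else 0))"
proof (rule decay_cong)
 show "decay 4 \<tau> (%x. - (\<Oplus>c. U a c x * u c b x))"
  by (intro decay_uminus decay_sum decay_mult[OF U_decay0 u_decay]) simp
qed (simp add: U_eq)

lemma U_decay': "m \<le> 4 ==> decay m \<tau> (%x. U a b x - (if a = b then 1 else 0))" "m \<le> 4 ==> decay m 0 (U a b)"
 using decay_mono[OF U_decay] decay_mono[OF U_decay0] by auto

section \<open>Linear parts of the curvature quantities\<close>

definition \<Gamma>1 :: "'n => 'n => 'n => real^'n => real" where
 "\<Gamma>1 k i j x = (partial i (u j k) x + partial j (u i k) x - partial k (u i j) x) / 2"

definition Ric1 :: "'n => 'n => real^'n => real" where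
 "Ric1 i j x = (\<Oplus>k. partial k (\<Gamma>1 k i j) x - partial j (\<Gamma>1 k i k) x)"

definition R1 :: "real^'n => real" where
 "R1 x = (\<Oplus>i. Ric1 i i x)"

lemma sum_delta_mult: "(\<Oplus>l. (if k = l then 1 else 0) * f l) = (f k :: real)" for k :: 'n
 by (simp add: if_distrib[of "%r. r * _"] cong: if_cong)

lemma dG_approx: "approx 3 (\<tau> + 1) (partial i (%y. G y $ a $ b)) (partial i (u a b))"
 by (rule approx_cong[OF approx_refl[OF dG_decay]]) (simp_all add: partial_G)

lemma \<Gamma>_approx: "approx 3 (\<tau> + 1) (christoffel G k i j) (\<Gamma>1 k i j)"
proof (rule approx_cong)
 show "approx 3 (\<tau> + 1) (%x. (\<Oplus>l. U k l x * (partial i (%y. G y $ j $ l) x + partial j (%y. G y $ i $ l) x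
   - partial l (%y. G y $ i $ j) x)) / 2)
  (%x. (\<Oplus>l. (if k = l then 1 else 0) * (partial i (u j l) x + partial j (u i l) x - partial l (u i j) x)) / 2)"
  by (intro approx_half approx_sum approx_mult U_decay' approx_diff approx_add dG_approx) simp
qed (simp_all add: christoffel_def \<Gamma>1_def sum_delta_mult)

lemma Ric_approx: "approx 2 (\<tau> + 2) (%x. ricci G x $ i $ j) (Ric1 i j)"
proof (rule approx_cong)
 have d\<Gamma>: "approx 2 (\<tau> + 2) (partial l (christoffel G k i j)) (partial l (\<Gamma>1 k i j))" for l k i j
  by (rule approx_partial[of 2 "\<tau> + 1"]) (use \<Gamma>_approx in \<open>auto simp: numeral_eq_Suc\<close>)
 have \<Gamma>2: "decay 2 (\<tau> + 1) (christoffel G k i j)" for k i j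
  using decay_mono[OF approx_decay[OF \<Gamma>_approx], of 2 "\<tau> + 1"] by simp
 have \<Gamma>\<Gamma>: "approx 2 (\<tau> + 2) (%x. christoffel G k i j x * christoffel G l a b x) (%x. 0)" for k i j l a b
  by (rule approx_quadratic[OF \<Gamma>2 \<Gamma>2]) simp
 show "approx 2 (\<tau> + 2) (%x. (\<Oplus>k. partial k (christoffel G k i j) x - partial j (christoffel G k i k) x) +
  (\<Oplus>k l. christoffel G k k l x * christoffel G l i j x - christoffel G k j l x * christoffel G l i k x))
  (%x. (\<Oplus>k. partial k (\<Gamma>1 k i j) x - partial j (\<Gamma>1 k i k) x) + (\<Sum>k\<in>(UNIV::'n set). \<Sum>l\<in>(UNIV::'n set). 0 - 0))"
  by (intro approx_add approx_sum approx_diff d\<Gamma> \<Gamma>\<Gamma>)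
qed (simp_all add: ricci_def Ric1_def)

lemma R_approx: "approx 2 (\<tau> + 2) (scalar_curvature G) R1"
proof (rule approx_cong)
 show "approx 2 (\<tau> + 2) (%x. \<Oplus>i j. U i j x * ricci G x $ i $ j)
  (%x. \<Oplus>i j. (if i = j then 1 else 0) * Ric1 i j x)"
  by (intro approx_sum approx_mult U_decay' Ric_approx) simp
qed (simp_all add: scalar_curvature_def R1_def sum_delta_mult)

lemma laplacian_R_approx: "approx 0 (\<tau> + 4) (laplacian G (scalar_curvature G)) (%x. \<Oplus>i. partial i (partial i R1) x)"
proof (rule approx_cong)
 have dR: "approx 1 (\<tau> + 3) (partial k (scalar_curvature G)) (partial k R1)" for k
  by (rule approx_partial[of 1 "\<tau> + 2"]) (use R_approx in \<open>auto simp: numeral_eq_Suc\<close>)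
 have ddR: "approx 0 (\<tau> + 4) (partial i (partial k (scalar_curvature G))) (partial i (partial k R1))" for i k
  by (rule approx_partial[of 0 "\<tau> + 3"]) (use dR in auto)
 have \<Gamma>R: "approx 0 (\<tau> + 4) (%x. christoffel G k i j x * partial k (scalar_curvature G) x) (%x. 0)" for k i j
  by (rule approx_quadratic[of 0 "\<tau> + 1" _ "\<tau> + 3"])
   (auto intro: decay_mono[OF approx_decay[OF \<Gamma>_approx]] decay_mono[OF approx_decay[OF dR]])
 show "approx 0 (\<tau> + 4) (%x. \<Oplus>i j. U i j x * (partial i (partial j (scalar_curvature G)) x
    - (\<Oplus>k. christoffel G k i j x * partial k (scalar_curvature G) x)))
  (%x. \<Oplus>i j. (if i = j then 1 else 0) * (partial i (partial j R1) x - (\<Sum>k\<in>(UNIV::'n set). 0)))"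
  by (intro approx_sum approx_mult U_decay' approx_diff ddR \<Gamma>R) simp
qed (simp_all add: laplacian_def partials_def sum_delta_mult)

lemma Ric_Ric_decay: "decay 2 (2 * \<tau> + 4) (%x. ricci G x $ i $ j * ricci G x $ a $ b)"
 by (rule decay_mult[OF approx_decay[OF Ric_approx] approx_decay[OF Ric_approx]]) simp

lemma inner_Ric_decay: "decay 2 (2 * \<tau> + 4) (%x. matrix_inner (G x) (ricci G x) (ricci G x))"
proof (rule decay_cong)
 show "decay 2 (2 * \<tau> + 4) (%x. \<Oplus>i j a. \<Sum>b\<in>UNIV.
   U i a x * (U j b x * (ricci G x $ i $ j * ricci G x $ a $ b)))"
  by (intro decay_sum decay_mult[where a = 0 and b = "2*\<tau>+4", OF U_decay'(2)] Ric_Ric_decay) auto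
qed (simp add: matrix_inner_def mult.assoc)

text \<open>The quadratic terms of \<open>Q\<close> have size \<open>|x|^(-2\<tau>-4)\<close> and
  disappear in the error, whatever their coefficients; the Laplacian of the linearised scalar
  curvature is all that stays.\<close>

lemma Q_approx: "approx 0 (\<tau> + 4) (Q_coord G)
 (%x. - 1 / (2 * (real CARD('n) - 1)) * (\<Oplus>i. partial i (partial i R1) x))"
proof (rule approx_cong)
 let ?n = "real CARD('n)"
 have RR: "approx 0 (\<tau> + 4) (%x. scalar_curvature G x * scalar_curvature G x) (%x. 0)"
  by (rule approx_quadratic[of 0 "\<tau> + 2" _ "\<tau> + 2"]) (auto intro: decay_mono[OF approx_decay[OF R_approx]])
 have II: "approx 0 (\<tau> + 4) (%x. matrix_inner (G x) (ricci G x) (ricci G x)) (%x. 0)"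
  by (rule approx_zero[of 0 "2 * \<tau> + 4"]) (auto intro: decay_mono[OF inner_Ric_decay])
 show "approx 0 (\<tau> + 4) (%x. - 1 / (2 * (?n - 1)) * laplacian G (scalar_curvature G) x
   - 2 / (?n - 2)\<^sup>2 * matrix_inner (G x) (ricci G x) (ricci G x)
   + (?n ^ 3 - 4 * ?n\<^sup>2 + 16 * ?n - 16) / (8 * (?n - 1)\<^sup>2 * (?n - 2)\<^sup>2) * (scalar_curvature G x * scalar_curvature G x))
  (%x. - 1 / (2 * (?n - 1)) * (\<Oplus>i. partial i (partial i R1) x) - 2 / (?n - 2)\<^sup>2 * 0
   + (?n ^ 3 - 4 * ?n\<^sup>2 + 16 * ?n - 16) / (8 * (?n - 1)\<^sup>2 * (?n - 2)\<^sup>2) * 0)"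
  by (intro approx_add approx_diff approx_cmult laplacian_R_approx RR II)
qed (simp_all add: Q_coord_def Let_def power2_eq_square)

definition \<kappa>1 :: real where "\<kappa>1 = - 2 / (real CARD('n) - 2)\<^sup>2"

definition \<kappa>2 :: real where "\<kappa>2 = (real CARD('n) ^ 3 - 4 * (real CARD('n))\<^sup>2 + 16 * real CARD('n) - 16)
 / (8 * (real CARD('n) - 1)\<^sup>2 * (real CARD('n) - 2)\<^sup>2)"

text \<open>The derivative of \<open>\<kappa>1 |Ric|^2 + \<kappa>2 R^2\<close>, the part of
  \<open>Q\<close> without derivatives of the curvature, with respect to \<open>Ric\<close>.
  \<open>S1\<close> is its linear part.\<close>

definition Sg :: "'n => 'n => real^'n => real" where
 "Sg i j x = 2 * \<kappa>1 * (\<Oplus>a b. U i a x * (U j b x * ricci G x $ a $ b))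
  + 2 * \<kappa>2 * (U i j x * scalar_curvature G x)"

definition S1 :: "'n => 'n => real^'n => real" where
 "S1 i j x = 2 * \<kappa>1 * Ric1 i j x + 2 * \<kappa>2 * ((if i = j then 1 else 0) * R1 x)"

lemma Sg_approx: "approx 2 (\<tau> + 2) (Sg i j) (S1 i j)"
proof (rule approx_cong)
 show "approx 2 (\<tau> + 2) (%x. 2 * \<kappa>1 * (\<Oplus>a b. U i a x * (U j b x * ricci G x $ a $ b))
   + 2 * \<kappa>2 * (U i j x * scalar_curvature G x))
  (%x. 2 * \<kappa>1 * (\<Oplus>a b. (if i = a then 1 else 0) * ((if j = b then 1 else 0) * Ric1 a b x))
   + 2 * \<kappa>2 * ((if i = j then 1 else 0) * R1 x))"
  by (intro approx_add approx_cmult approx_sum approx_mult U_decay' Ric_approx R_approx) simp_all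
qed (simp_all add: Sg_def S1_def sum_delta_mult sum_distrib_left[symmetric])

end

section \<open>First variation of the curvature quantities\<close>

definition d_inv :: "(real^'n::finite => real^'n^'n) => (real^'n => real^'n^'n) => 'n => 'n => real^'n => real" where
 "d_inv G H a b x = - (\<Oplus>c e. matrix_inv (G x) $ a $ c * H x $ c $ e * matrix_inv (G x) $ e $ b)"

text \<open>Varying the inverse metric against the lowered Christoffel symbols gives back
  Christoffel symbols; this is the second term, in which \<open>H\<close> is not
  differentiated.\<close>

definition d_christoffel ::
 "(real^'n::finite => real^'n^'n) => (real^'n => real^'n^'n) => 'n => 'n => 'n => real^'n => real" where
 "d_christoffel G H k i j x =
  1 / 2 * (\<Oplus>l. matrix_inv (G x) $ k $ l * (partial i (%y. H y $ j $ l) x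
    + partial j (%y. H y $ i $ l) x - partial l (%y. H y $ i $ j) x))
  - (\<Oplus>c e. matrix_inv (G x) $ k $ c * H x $ c $ e * christoffel G e i j x)"

definition d_ricci ::
 "(real^'n::finite => real^'n^'n) => (real^'n => real^'n^'n) => 'n => 'n => real^'n => real" where
 "d_ricci G H i j x =
  (\<Oplus>k. partial k (d_christoffel G H k i j) x - partial j (d_christoffel G H k i k) x) +
  (\<Oplus>k. \<Sum>l\<in>UNIV.
    (christoffel G k k l x * d_christoffel G H l i j x + d_christoffel G H k k l x * christoffel G l i j x)
    - (christoffel G k j l x * d_christoffel G H l i k x + d_christoffel G H k j l x * christoffel G l i k x))"

lemma sum_swap_pairs:
 fixes f :: "'a => 'a => 'a => 'a => 'b::comm_monoid_add"
 shows "(\<Sum>i\<in>A. \<Sum>j\<in>A. \<Sum>a\<in>A. \<Sum>b\<in>A. f i j a b) = (\<Sum>i\<in>A. \<Sum>j\<in>A. \<Sum>a\<in>A. \<Sum>b\<in>A. f a b i j)"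
proof -
 have pair: "(\<Sum>i\<in>A. \<Sum>j\<in>A. h i j) = (\<Sum>p\<in>A \<times> A. h (fst p) (snd p))" for h :: "'a => 'a => 'b"
  unfolding sum.cartesian_product by (simp add: case_prod_unfold)
 have "(\<Sum>i\<in>A. \<Sum>j\<in>A. \<Sum>a\<in>A. \<Sum>b\<in>A. f i j a b) = (\<Sum>p\<in>A \<times> A. \<Sum>q\<in>A \<times> A. f (fst p) (snd p) (fst q) (snd q))"
  by (simp only: pair)
 also have "\<dots> = (\<Sum>q\<in>A \<times> A. \<Sum>p\<in>A \<times> A. f (fst p) (snd p) (fst q) (snd q))" by (rule sum.swap)
 also have "\<dots> = (\<Sum>i\<in>A. \<Sum>j\<in>A. \<Sum>a\<in>A. \<Sum>b\<in>A. f a b i j)"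
  by (simp only: pair)
 finally show ?thesis .
qed

context variation
begin

definition Ut where "Ut a b t x = matrix_inv (Gt t x) $ a $ b"
definition DGt where "DGt k i j t x = partial k (%y. Gt t y $ i $ j) x"
definition \<Gamma>t where "\<Gamma>t k i j t = christoffel (Gt t) k i j"
definition D\<Gamma>t where "D\<Gamma>t m k i j t = partial m (\<Gamma>t k i j t)"
definition Rict where "Rict i j t x = ricci (Gt t) x $ i $ j"
definition Rt where "Rt t = scalar_curvature (Gt t)"
definition wt where "wt t x = sqrt (det (Gt t x))"

lemma joints: "joint T (Ut a b)" "joint T (DGt k i j)" "joint T (\<Gamma>t k i j)" "joint T (D\<Gamma>t m k i j)"
 "joint T (Rict i j)" "joint T Rt" "joint T wt"
 unfolding Ut_def DGt_def \<Gamma>t_def[abs_def] D\<Gamma>t_def[abs_def] Rict_def Rt_def[abs_def] wt_def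
 by (intro joint_matrix_inv joint_partial joint_christoffel joint_ricci joint_scalar joint_sqrt_det
   open_T joint_Gt det_Gt; assumption)+

lemmas dt_rules = dt_add[OF open_T] dt_diff[OF open_T] dt_sum[OF open_T] dt_mult[OF open_T]

lemmas joint_rules = Cinf_add[OF open_T] Cinf_diff[OF open_T] Cinf_mult[OF open_T] Cinf_sum[OF open_T] joints

lemma at_0: "Ut a b 0 x = U a b x" "\<Gamma>t k i j 0 = christoffel G k i j" "Rict i j 0 x = ricci G x $ i $ j"
 "Rt 0 = scalar_curvature G" "wt 0 x = sqrt (det (G x))" "DGt k i j 0 x = partial k (%y. G y $ i $ j) x"
 by (simp_all add: Ut_def \<Gamma>t_def Rict_def Rt_def wt_def DGt_def Gt0)

context
 fixes x :: "real^'n" assumes x: "x \<in> S"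
begin

lemma dt_Gt: "dt (%t x. Gt t x $ i $ j) 0 x = H x $ i $ j"
proof -
 have "((%s. Gt s x $ i $ j) has_real_derivative H x $ i $ j) (at 0)"
  unfolding Gt_def by (auto intro!: derivative_eq_intros)
 from DERIV_unique[OF time_slice[OF joint_Gt T0[OF x]] this] show ?thesis .
qed

lemma dt_Ut: "dt (Ut a b) 0 x = d_inv G H a b x"
proof -
 have *: "det (Gt (fst z) (snd z)) \<noteq> 0" if "z \<in> T" for z using det_Gt(2)[of "fst z" "snd z"] that by simp
 from dd_matrix_inv[where G = "%z. Gt (fst z) (snd z)", OF open_T joint_Gt this T0[OF x], where v = "(1, 0)"]
 show ?thesis using dt_Gt unfolding d_inv_def dt_def Ut_def by (simp add: Gt0)
qed

lemma dt_wt: "dt wt 0 x = sqrt (det (G x)) * ((\<Oplus>a b. U a b x * H x $ a $ b) / 2)"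
proof -
 have "det (Gt (fst (0, x)) (snd (0, x))) > 0" using det_Gt(1)[OF T0[OF x]] by simp
 from dd_sqrt_det[where G = "%z. Gt (fst z) (snd z)", OF open_T joint_Gt this T0[OF x], where v = "(1, 0)"]
 show ?thesis using dt_Gt H_sym unfolding dt_def wt_def by (simp add: Gt0 transpose_def vec_eq_iff)
qed

end

lemma dt_DGt:
 assumes x: "x \<in> S"
 shows "dt (DGt k i j) 0 x = partial k (%y. H y $ i $ j) x"
proof -
 have "dt (DGt k i j) 0 x = partial k (dt (%t x. Gt t x $ i $ j) 0) x"
  unfolding DGt_def by (rule dt_partial[OF open_T joint_Gt T0[OF x]])
 also have "\<dots> = partial k (%y. H y $ i $ j) x"
  by (rule partial_cong[OF S x dt_Gt])
 finally show ?thesis .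
qed

lemma dt_\<Gamma>t:
 assumes x: "x \<in> S"
 shows "dt (\<Gamma>t k i j) 0 x = d_christoffel G H k i j x"
proof -
 let ?D = "%l t x. DGt i j l t x + DGt j i l t x - DGt l i j t x"
 have eq: "\<Gamma>t k i j = (%t x. 1 / 2 * (\<Oplus>l. Ut k l t x * ?D l t x))"
  by (simp add: \<Gamma>t_def christoffel_def Ut_def DGt_def fun_eq_iff)
 have "dt (\<Gamma>t k i j) 0 x = 1 / 2 * dt (%t x. \<Oplus>l. Ut k l t x * ?D l t x) 0 x"
  unfolding eq by (rule dt_cmult[OF open_T _ T0[OF x]]) (intro joint_rules)
 also have "dt (%t x. \<Oplus>l. Ut k l t x * ?D l t x) 0 x
   = (\<Oplus>l. Ut k l 0 x * (dt (DGt i j l) 0 x + dt (DGt j i l) 0 x - dt (DGt l i j) 0 x) + dt (Ut k l) 0 x * ?D l 0 x)"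
  by (simp only: dt_rules joint_rules T0[OF x])
 also have "\<dots> = (\<Oplus>l. U k l x * (partial i (%y. H y $ j $ l) x
    + partial j (%y. H y $ i $ l) x - partial l (%y. H y $ i $ j) x)) + (\<Oplus>l. d_inv G H k l x * ?D l 0 x)"
  by (simp only: dt_DGt[OF x] dt_Ut[OF x] at_0 sum.distrib)
 also have "(\<Oplus>l. d_inv G H k l x * ?D l 0 x)
   = - (\<Oplus>l c e. U k c x * H x $ c $ e * (U e l x * ?D l 0 x))"
  by (simp add: d_inv_def sum_distrib_right sum_negf mult.assoc)
 also have "(\<Oplus>l c e. U k c x * H x $ c $ e * (U e l x * ?D l 0 x))
   = (\<Oplus>c e l. U k c x * H x $ c $ e * (U e l x * ?D l 0 x))"
  by (rule sum_rotate3[symmetric])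
 also have "\<dots> = (\<Oplus>c e. U k c x * H x $ c $ e * (2 * christoffel G e i j x))"
 proof -
  have "2 * christoffel G e i j x = (\<Oplus>l. U e l x * ?D l 0 x)" for e
   by (simp add: christoffel_def at_0)
  thus ?thesis by (simp only: sum_distrib_left)
 qed
 also have "1 / 2 * ((\<Oplus>l. U k l x * (partial i (%y. H y $ j $ l) x
    + partial j (%y. H y $ i $ l) x - partial l (%y. H y $ i $ j) x))
   + - (\<Oplus>c e. U k c x * H x $ c $ e * (2 * christoffel G e i j x))) = d_christoffel G H k i j x"
 proof -
  have "(\<Oplus>c e. U k c x * H x $ c $ e * (2 * christoffel G e i j x))
   = 2 * (\<Oplus>c e. U k c x * H x $ c $ e * christoffel G e i j x)"
   by (simp add: sum_distrib_left mult.left_commute)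
  thus ?thesis unfolding d_christoffel_def by (simp only:) (simp add: algebra_simps)
 qed
 finally show ?thesis .
qed

lemma dt_D\<Gamma>t:
 assumes x: "x \<in> S"
 shows "dt (D\<Gamma>t m k i j) 0 x = partial m (d_christoffel G H k i j) x"
proof -
 have "dt (D\<Gamma>t m k i j) 0 x = partial m (dt (\<Gamma>t k i j) 0) x"
  unfolding D\<Gamma>t_def[abs_def] by (rule dt_partial[OF open_T joints(3) T0[OF x]])
 also have "\<dots> = partial m (d_christoffel G H k i j) x"
  by (rule partial_cong[OF S x dt_\<Gamma>t])
 finally show ?thesis .
qed

lemma dt_Rict:
 assumes x: "x \<in> S"
 shows "dt (Rict i j) 0 x = d_ricci G H i j x"
proof -
 have eq: "Rict i j = (%t x. (\<Oplus>k. D\<Gamma>t k k i j t x - D\<Gamma>t j k i k t x)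
   + (\<Oplus>k l. \<Gamma>t k k l t x * \<Gamma>t l i j t x - \<Gamma>t k j l t x * \<Gamma>t l i k t x))"
  by (simp add: Rict_def ricci_def D\<Gamma>t_def \<Gamma>t_def fun_eq_iff)
 have "dt (Rict i j) 0 x = (\<Oplus>k. dt (D\<Gamma>t k k i j) 0 x - dt (D\<Gamma>t j k i k) 0 x)
   + (\<Oplus>k l. (\<Gamma>t k k l 0 x * dt (\<Gamma>t l i j) 0 x + dt (\<Gamma>t k k l) 0 x * \<Gamma>t l i j 0 x)
    - (\<Gamma>t k j l 0 x * dt (\<Gamma>t l i k) 0 x + dt (\<Gamma>t k j l) 0 x * \<Gamma>t l i k 0 x))"
  unfolding eq by (simp only: dt_rules joint_rules T0[OF x])
 thus ?thesis by (simp only: dt_D\<Gamma>t[OF x] dt_\<Gamma>t[OF x] at_0 d_ricci_def)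
qed

lemma Rt_eq: "Rt = (%t x. \<Oplus>i j. Ut i j t x * Rict i j t x)"
 by (simp add: Rt_def scalar_curvature_def Ut_def Rict_def fun_eq_iff)

lemma dt_scalar_sq:
 assumes x: "x \<in> S"
 shows "dt (%t x. Rt t x * Rt t x) 0 x = 2 * scalar_curvature G x *
  ((\<Oplus>i j. U i j x * d_ricci G H i j x) + (\<Oplus>i j. d_inv G H i j x * ricci G x $ i $ j))"
proof -
 have "dt Rt 0 x = (\<Oplus>i j. Ut i j 0 x * dt (Rict i j) 0 x + dt (Ut i j) 0 x * Rict i j 0 x)"
  unfolding Rt_eq by (simp only: dt_rules joint_rules T0[OF x])
 moreover have "dt (%t x. Rt t x * Rt t x) 0 x = Rt 0 x * dt Rt 0 x + dt Rt 0 x * Rt 0 x"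
  by (simp only: dt_rules joint_rules T0[OF x])
 ultimately show ?thesis
  by (simp add: dt_Rict[OF x] dt_Ut[OF x] at_0 sum.distrib)
qed

lemma dt_ricci_sq:
 assumes x: "x \<in> S"
 shows "dt (%t x. matrix_inner (Gt t x) (ricci (Gt t) x) (ricci (Gt t) x)) 0 x =
  2 * (\<Oplus>i j a b. U i a x * U j b x * ricci G x $ a $ b * d_ricci G H i j x)
  + ((\<Oplus>i j a b. U i a x * ricci G x $ i $ j * ricci G x $ a $ b * d_inv G H j b x)
  + (\<Oplus>i j a b. U j b x * ricci G x $ i $ j * ricci G x $ a $ b * d_inv G H i a x))"
proof -
 let ?A = "\<Oplus>i j a b. U i a x * U j b x * ricci G x $ i $ j * d_ricci G H a b x"
 let ?B = "\<Oplus>i j a b. U i a x * U j b x * ricci G x $ a $ b * d_ricci G H i j x"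
 have eq: "(%t x. matrix_inner (Gt t x) (ricci (Gt t) x) (ricci (Gt t) x))
  = (%t x. \<Oplus>i j a b. Ut i a t x * Ut j b t x * Rict i j t x * Rict a b t x)"
  by (simp add: matrix_inner_def Ut_def Rict_def fun_eq_iff)
 have "dt (%t x. matrix_inner (Gt t x) (ricci (Gt t) x) (ricci (Gt t) x)) 0 x
  = (\<Oplus>i j a b. U i a x * U j b x * ricci G x $ i $ j * d_ricci G H a b x
   + (U i a x * U j b x * d_ricci G H i j x + (U i a x * d_inv G H j b x + d_inv G H i a x * U j b x) * ricci G x $ i $ j)
    * ricci G x $ a $ b)"
  unfolding eq by (simp only: dt_rules joint_rules T0[OF x] dt_Rict[OF x] dt_Ut[OF x] at_0)
 also have "\<dots> = ?A + ?B
  + ((\<Oplus>i j a b. U i a x * ricci G x $ i $ j * ricci G x $ a $ b * d_inv G H j b x)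
  + (\<Oplus>i j a b. U j b x * ricci G x $ i $ j * ricci G x $ a $ b * d_inv G H i a x))"
  by (simp add: sum.distrib[symmetric] algebra_simps)
 also have "?A = ?B"
  by (subst sum_swap_pairs) (simp add: U_sym[OF x] cong: sum.cong)
 finally show ?thesis by simp
qed

end

lemma partial_cmult: "f differentiable (at x) ==> partial i (%y. c * f y) x = c * partial i f x"
 by (simp add: partial_eq_dd dd_cmult)

context variation
begin

text \<open>At each fixed \<open>t\<close> the weighted Laplacian is a divergence by
  \<open>laplacian_divergence\<close> on the slice of \<open>T\<close>, and the time derivative
  passes through the partial derivatives.\<close>

lemma divergence_part:
 assumes x: "x \<in> S" and f: "joint T f"
 shows "dt (%t x. wt t x * laplacian (Gt t) (f t) x) 0 x =
  (\<Oplus>i. partial i (dt (%t x. wt t x * (\<Oplus>j. Ut i j t x * partial j (f t) x)) 0) x)"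
proof -
 let ?F = "%i t x. wt t x * (\<Oplus>j. Ut i j t x * partial j (f t) x)"
 have F: "joint T (?F i)" for i by (intro joint_rules joint_partial[OF open_T f])
 have "wt t y * laplacian (Gt t) (f t) y = (\<Oplus>i. partial i (?F i t) y)" if ty: "(t, y) \<in> T" for t y
 proof -
  let ?S = "{z. (t, z) \<in> T}"
  have "open ((%z. (t, z)) -` T)"
   by (rule continuous_open_vimage[OF open_T]) (intro continuous_intros)
  hence S': "open ?S" by (simp add: vimage_def)
  interpret s: metric_coords ?S "Gt t"
  proof
   show "Cinf ?S (%x. Gt t x $ i $ j)" for i j by (rule joint_at[OF joint_Gt S']) simp
   show "Gt t z $ i $ j = Gt t z $ j $ i" if "z \<in> ?S" for z i j
    using G_sym[of z i j] H_sym[of z] that by (auto simp: Gt_def T_def transpose_def vec_eq_iff)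
  qed (use S' det_Gt in auto)
  have "Cinf ?S (f t)" by (rule joint_at[OF f S']) simp
  from s.laplacian_divergence[OF this _, of y] ty det_Gt(1) show ?thesis
   by (simp add: wt_def Ut_def)
 qed
 hence "dt (%t x. wt t x * laplacian (Gt t) (f t) x) 0 x = dt (%t x. \<Oplus>i. partial i (?F i t) x) 0 x"
  unfolding dt_def using T0[OF x] by (intro dd_cong[OF open_T]) auto
 also have "\<dots> = (\<Oplus>i. dt (%t. partial i (?F i t)) 0 x)"
  by (intro dt_sum[OF open_T _ T0[OF x]] joint_partial[OF open_T F])
 also have "\<dots> = (\<Oplus>i. partial i (dt (?F i) 0) x)"
  by (intro sum.cong refl dt_partial[OF open_T F T0[OF x]])
 finally show ?thesis .
qed

definition dB :: "real^'n => real" where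
 "dB = dt (%t x. - 2 / (real CARD('n) - 2)\<^sup>2 * matrix_inner (Gt t x) (ricci (Gt t) x) (ricci (Gt t) x)
  + (real CARD('n) ^ 3 - 4 * (real CARD('n))\<^sup>2 + 16 * real CARD('n) - 16)
    / (8 * (real CARD('n) - 1)\<^sup>2 * (real CARD('n) - 2)\<^sup>2) * (Rt t x * Rt t x)) 0"

definition B0 :: "real^'n => real" where
 "B0 x = - 2 / (real CARD('n) - 2)\<^sup>2 * matrix_inner (G x) (ricci G x) (ricci G x)
  + (real CARD('n) ^ 3 - 4 * (real CARD('n))\<^sup>2 + 16 * real CARD('n) - 16)
    / (8 * (real CARD('n) - 1)\<^sup>2 * (real CARD('n) - 2)\<^sup>2) * (scalar_curvature G x * scalar_curvature G x)"

text \<open>Differentiate \<open>wt * Q = - wt * laplacian R / (2 (n - 1)) + wt * B\<close> at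
  \<open>t = 0\<close>, with \<open>B\<close> the quadratic terms. The Laplacian becomes the
  divergence of fields vanishing off \<open>K\<close>, and the variations of \<open>wt\<close> on
  the two sides give the trace terms with \<open>- Q\<close> and \<open>B0\<close>.\<close>

lemma DQt_decompose:
 "\<exists>F. (\<forall>i. Cinf S (F i) \<and> (\<forall>x\<in>S - K. F i x = 0)) \<and>
  (\<forall>x\<in>S. DQt x * sqrt (det (G x)) = (\<Oplus>i. partial i (F i) x)
   + ((\<Oplus>a b. (B0 x - Q_coord G x) / 2 * U a b x * H x $ a $ b) + dB x) * sqrt (det (G x)))"
proof -
 let ?c = "- 1 / (2 * (real CARD('n) - 1))"
 let ?L = "%i t x. wt t x * (\<Oplus>j. Ut i j t x * partial j (Rt t) x)"
 let ?B = "%t x. - 2 / (real CARD('n) - 2)\<^sup>2 * matrix_inner (Gt t x) (ricci (Gt t) x) (ricci (Gt t) x)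
  + (real CARD('n) ^ 3 - 4 * (real CARD('n))\<^sup>2 + 16 * real CARD('n) - 16)
    / (8 * (real CARD('n) - 1)\<^sup>2 * (real CARD('n) - 2)\<^sup>2) * (Rt t x * Rt t x)"
 define Q where "Q = (%t. Q_coord (Gt t))"
 have jQ: "joint T Q" unfolding Q_def by (rule joint_Q[OF open_T joint_Gt det_Gt(2)])
 have jI: "joint T (%t x. matrix_inner (Gt t x) (ricci (Gt t) x) (ricci (Gt t) x))"
  by (intro joint_matrix_inner[OF open_T joint_Gt det_Gt(2)] joint_ricci[OF open_T joint_Gt det_Gt(2)])
 have jB: "joint T ?B" by (intro Cinf_add Cinf_mult Cinf_const open_T jI joints)
 have jL: "joint T (?L i)" for i by (intro joint_rules joint_partial[OF open_T joints(6)])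
 have jlap: "joint T (%t. laplacian (Gt t) (Rt t))"
  by (rule joint_laplacian[OF open_T joint_Gt det_Gt(2) joints(6)])
 define F where "F = (%i x. ?c * dt (?L i) 0 x)"
 have "Cinf S (F i)" for i
  unfolding F_def by (intro Cinf_mult Cinf_const S Cinf_dt[OF jL])
 moreover have "F i x = 0" if x: "x \<in> S - K" for i x
 proof -
  have Z: "open (S - K)" using S K(1) by (intro open_Diff compact_imp_closed)
  have GG: "Gt t y = Gt 0 y" if "y \<in> S - K" for t y using that Gt_outside by simp
  have R: "Rt t y = Rt 0 y" if "y \<in> S - K" for t y
   unfolding Rt_def by (rule scalar_cong[OF Z GG that])
  have dR: "partial j (Rt t) x = partial j (Rt 0) x" for j t
   by (rule partial_cong[OF Z x R])
  have "?L i t x = ?L i 0 x" for t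
   unfolding wt_def Ut_def dR[of _ t] GG[OF x, of t] ..
  from dt_outside[OF jL x this] show ?thesis by (simp add: F_def)
 qed
 moreover have "DQt x * sqrt (det (G x)) = (\<Oplus>i. partial i (F i) x)
   + ((\<Oplus>a b. (B0 x - Q_coord G x) / 2 * U a b x * H x $ a $ b) + dB x) * sqrt (det (G x))"
  if x: "x \<in> S" for x
 proof -
  note T0x = T0[OF x]
  have Qeq: "(%t x. wt t x * Q t x) = (%t x. ?c * (wt t x * laplacian (Gt t) (Rt t) x) + wt t x * ?B t x)"
   by (simp add: Q_def Q_coord_def Let_def Rt_def[abs_def] fun_eq_iff power2_eq_square algebra_simps)
  have e1: "dt (%t x. wt t x * Q t x) 0 x = wt 0 x * dt Q 0 x + dt wt 0 x * Q 0 x"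
   by (rule dt_mult[OF open_T joints(7) jQ T0x])
  have e2: "dt (%t x. wt t x * Q t x) 0 x
    = ?c * dt (%t x. wt t x * laplacian (Gt t) (Rt t) x) 0 x + dt (%t x. wt t x * ?B t x) 0 x"
  proof -
   have j: "joint T (%t x. wt t x * laplacian (Gt t) (Rt t) x)"
    by (rule Cinf_mult[OF open_T joints(7) jlap])
   have j': "joint T (%t x. wt t x * ?B t x)" by (rule Cinf_mult[OF open_T joints(7) jB])
   have j'': "joint T (%t x. ?c * (wt t x * laplacian (Gt t) (Rt t) x))"
    by (rule Cinf_mult[OF open_T Cinf_const[OF open_T] j])
   show ?thesis unfolding Qeq by (simp only: dt_add[OF open_T j'' j' T0x] dt_cmult[OF open_T j T0x])
  qed
  have e3: "dt (%t x. wt t x * ?B t x) 0 x = wt 0 x * dt ?B 0 x + dt wt 0 x * ?B 0 x"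
   by (rule dt_mult[OF open_T joints(7) jB T0x])
  have e4: "dt ?B 0 x = dB x" by (simp add: dB_def)

  have e6: "Q 0 x = Q_coord G x" "dt Q 0 x = DQt x" by (simp_all add: Q_def Gt0 DQt[OF x])
  have e7: "?c * dt (%t x. wt t x * laplacian (Gt t) (Rt t) x) 0 x = (\<Oplus>i. partial i (F i) x)"
  proof -
   have "partial i (F i) x = ?c * partial i (dt (?L i) 0) x" for i
    unfolding F_def by (rule partial_cmult[OF diff[OF Cinf_dt[OF jL] x]])
   thus ?thesis unfolding divergence_part[OF x joints(6)] sum_distrib_left by simp
  qed
  define s where "s = (\<Oplus>a b. U a b x * H x $ a $ b) / 2"
  have e8: "(\<Oplus>a b. (B0 x - Q_coord G x) / 2 * U a b x * H x $ a $ b) = (B0 x - Q_coord G x) * s"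
   by (simp add: s_def sum_distrib_left sum_divide_distrib mult.assoc)
  have "wt 0 x * dt Q 0 x + dt wt 0 x * Q 0 x = ?c * dt (%t x. wt t x * laplacian (Gt t) (Rt t) x) 0 x
    + (wt 0 x * dt ?B 0 x + dt wt 0 x * ?B 0 x)"
   using e1 e2 e3 by (simp only:)
  hence "sqrt (det (G x)) * DQt x + sqrt (det (G x)) * s * Q_coord G x
    = (\<Oplus>i. partial i (F i) x) + (sqrt (det (G x)) * dB x + sqrt (det (G x)) * s * B0 x)"
   by (simp only: e4 e6 e7 at_0 dt_wt[OF x] s_def B0_def Gt0)
  thus ?thesis unfolding e8 by (simp add: algebra_simps)
 qed
 ultimately show ?thesis by (intro exI[of _ F]) blast
qed

lemma dB_eq:
 assumes x: "x \<in> S"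
 shows "dB x = - 2 / (real CARD('n) - 2)\<^sup>2 *
  (2 * (\<Oplus>i j a b. U i a x * U j b x * ricci G x $ a $ b * d_ricci G H i j x)
  + ((\<Oplus>i j a b. U i a x * ricci G x $ i $ j * ricci G x $ a $ b * d_inv G H j b x)
  + (\<Oplus>i j a b. U j b x * ricci G x $ i $ j * ricci G x $ a $ b * d_inv G H i a x)))
  + (real CARD('n) ^ 3 - 4 * (real CARD('n))\<^sup>2 + 16 * real CARD('n) - 16)
    / (8 * (real CARD('n) - 1)\<^sup>2 * (real CARD('n) - 2)\<^sup>2) * (2 * scalar_curvature G x *
  ((\<Oplus>i j. U i j x * d_ricci G H i j x) + (\<Oplus>i j. d_inv G H i j x * ricci G x $ i $ j)))"
proof -
 have jI: "joint T (%t x. matrix_inner (Gt t x) (ricci (Gt t) x) (ricci (Gt t) x))"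
  by (intro joint_matrix_inner[OF open_T joint_Gt det_Gt(2)] joint_ricci[OF open_T joint_Gt det_Gt(2)])
 have jR: "joint T (%t x. Rt t x * Rt t x)" by (intro Cinf_mult open_T joints)
 have jc: "joint T (%t x. c * F t x)" if "joint T F" for c F
  by (rule Cinf_mult[OF open_T Cinf_const[OF open_T] that])
 show ?thesis
  unfolding dB_def dt_add[OF open_T jc[OF jI] jc[OF jR] T0[OF x]] dt_cmult[OF open_T jI T0[OF x]]
   dt_cmult[OF open_T jR T0[OF x]] dt_scalar_sq[OF x] dt_ricci_sq[OF x] ..
qed

end

section \<open>Integration by parts in the end and adjoints modulo quadratic terms\<close>

context asymptotics
begin

abbreviation w :: "real^'n => real" where
 "w x \<equiv> sqrt (det (G x))"

definition I :: "(real^'n => real) => real" where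
 "I f = (LINT x|lborel. indicator exterior x * (f x * w x))"

lemma Cinf_w: "Cinf exterior w"
 by (rule Cinf_sqrt[OF S Cinf_det[OF S G] det_pos])

lemma w_pos: "x \<in> exterior ==> w x > 0"
 using det_pos by simp

lemma parts:
 fixes f \<psi> :: "real^'n => real"
 assumes f: "Cinf exterior f" and \<psi>: "Cinf exterior \<psi>" "!!x. x \<in> exterior - K ==> \<psi> x = 0"
  and K: "compact K" "K \<subseteq> exterior"
 shows "integrable lborel (%x. indicator exterior x * (f x * \<psi> x))"
  and "integrable lborel (%x. indicator exterior x * (f x * partial i \<psi> x))"
  and "(LINT x|lborel. indicator exterior x * (f x * partial i \<psi> x))
   = - (LINT x|lborel. indicator exterior x * (partial i f x * \<psi> x))"
proof -
 define \<phi> where "\<phi> = (%x. if x \<in> exterior then \<psi> x else 0)"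
 have \<phi>: "Cinf UNIV \<phi>"
  unfolding \<phi>_def by (rule Cinf_extend_zero[OF S compact_imp_closed[OF K(1)] K(2) \<psi>])
 have z: "\<phi> x = 0" if "x \<notin> K" for x using \<psi>(2) that by (auto simp: \<phi>_def)
 have dz: "dd v \<phi> x = 0" if "x \<notin> K" for v x
 proof -
  have "dd v \<phi> x = dd v (%x. 0) x"
   by (rule dd_cong[of "- K"]) (use K(1) that z in \<open>auto intro: compact_imp_closed open_Compl\<close>)
  thus ?thesis by simp
 qed
 have e: "indicator exterior x * (h x * \<phi> x) = indicator exterior x * (h x * \<psi> x)" for h x
  by (simp add: \<phi>_def indicator_def)
 have e': "indicator exterior x * (h x * dd (axis i 1) \<phi> x) = indicator exterior x * (h x * partial i \<psi> x)" for h x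
 proof (cases "x \<in> exterior")
  case True
  have "dd (axis i 1) \<phi> x = dd (axis i 1) \<psi> x" by (rule dd_cong[OF S True]) (simp add: \<phi>_def)
  thus ?thesis by (simp add: partial_eq_dd)
 qed simp
 note ibp = integration_by_parts_compact[OF S f _ K]
 show "integrable lborel (%x. indicator exterior x * (f x * \<psi> x))"
  using ibp(2)[OF \<phi> z] unfolding e .
 show "integrable lborel (%x. indicator exterior x * (f x * partial i \<psi> x))"
  using ibp(2)[OF Cinf_dd[OF \<phi>, of "axis i 1"] dz] unfolding e' by simp
 show "(LINT x|lborel. indicator exterior x * (f x * partial i \<psi> x))
   = - (LINT x|lborel. indicator exterior x * (partial i f x * \<psi> x))"
  using ibp(1)[OF \<phi> z, where v = "axis i 1"] unfolding e e' by (simp add: partial_eq_dd)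
qed

text \<open>What integration by parts needs to know of a differential operator acting on variations:
  smooth values that vanish off the support.\<close>

definition locop :: "((real^'n => real^'n^'n) => real^'n => real) => bool" where
 "locop \<Lambda> \<longleftrightarrow> (\<forall>H K. variation exterior G H K \<longrightarrow>
  Cinf exterior (\<Lambda> H) \<and> (\<forall>x\<in>exterior - K. \<Lambda> H x = 0))"

text \<open>\<open>I\<close> integrates against the density \<open>w\<close>, whose logarithmic
  derivative is \<open>\<alpha> / 2\<close>; this is the origin of the second summand.\<close>

lemma I_parts:
 assumes f: "Cinf exterior f" and \<Lambda>: "locop \<Lambda>" and var: "variation exterior G H K"
 shows "integrable lborel (%x. indicator exterior x * ((f x * \<Lambda> H x) * w x))"
  and "integrable lborel (%x. indicator exterior x * ((f x * partial i (\<Lambda> H) x) * w x))"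
  and "I (%x. f x * partial i (\<Lambda> H) x) = - I (%x. (partial i f x + f x * (\<alpha> i x / 2)) * \<Lambda> H x)"
proof -
 have K: "compact K" "K \<subseteq> exterior"
  using variation.K[OF var] by auto
 have \<psi>: "Cinf exterior (\<Lambda> H)" "!!x. x \<in> exterior - K ==> \<Lambda> H x = 0"
  using \<Lambda> var unfolding locop_def by blast+
 have fw: "Cinf exterior (%x. f x * w x)" by (rule Cinf_mult[OF S f Cinf_w])
 note p = parts[OF fw \<psi> K]
 have r: "(f x * w x) * h = (f x * h) * w x" for x h by simp
 show "integrable lborel (%x. indicator exterior x * ((f x * \<Lambda> H x) * w x))"
  using p(1) unfolding r .
 show "integrable lborel (%x. indicator exterior x * ((f x * partial i (\<Lambda> H) x) * w x))"
  using p(2) unfolding r .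
 have eq: "indicator exterior x * (partial i (%x. f x * w x) x * \<Lambda> H x)
   = indicator exterior x * ((partial i f x + f x * (\<alpha> i x / 2)) * \<Lambda> H x * w x)" for x
 proof (cases "x \<in> exterior")
  case True
  have "partial i (%x. f x * w x) x = f x * partial i w x + partial i f x * w x"
   by (rule partial_mult[OF diff[OF f True] diff[OF Cinf_w True]])
  thus ?thesis using partial_sqrt_det[OF True det_pos[OF True], of i] by (simp add: algebra_simps)
 qed simp
 show "I (%x. f x * partial i (\<Lambda> H) x) = - I (%x. (partial i f x + f x * (\<alpha> i x / 2)) * \<Lambda> H x)"
  using p(3)[of i] unfolding eq unfolding r I_def .
qed

lemma locop_H: "locop (%H x. H x $ a $ b)"
 unfolding locop_def
proof (intro allI impI conjI ballI)
 fix H K assume var: "variation exterior G H K"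
 then interpret v: variation exterior G H K .
 show "Cinf exterior (%x. H x $ a $ b)" by (rule Cinf_subset[OF v.H]) simp
 show "H x $ a $ b = 0" if "x \<in> exterior - K" for x using v.H0 that by simp
qed

lemma locop_partial:
 assumes "locop \<Lambda>"
 shows "locop (%H. partial i (\<Lambda> H))"
 unfolding locop_def
proof (intro allI impI conjI ballI)
 fix H K assume var: "variation exterior G H K"
 then interpret v: variation exterior G H K .
 have \<psi>: "Cinf exterior (\<Lambda> H)" "!!x. x \<in> exterior - K ==> \<Lambda> H x = 0"
  using assms var unfolding locop_def by blast+
 show "Cinf exterior (partial i (\<Lambda> H))" unfolding partial_eq_dd by (rule Cinf_dd[OF \<psi>(1)])
 fix x assume x: "x \<in> exterior - K"
 have "open (exterior - K)" using S v.K(1) by (intro open_Diff compact_imp_closed)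
 hence "partial i (\<Lambda> H) x = partial i (%x. 0) x" using x \<psi>(2) by (rule partial_cong)
 thus "partial i (\<Lambda> H) x = 0" by (simp add: partial_eq_dd)
qed

lemma locop_mult:
 assumes "Cinf exterior f" "locop \<Lambda>"
 shows "locop (%H x. f x * \<Lambda> H x)"
 using assms unfolding locop_def by (auto intro: Cinf_mult[OF S])

lemma locop_add: "locop \<Lambda> ==> locop \<Lambda>' ==> locop (%H x. \<Lambda> H x + \<Lambda>' H x)"
 unfolding locop_def by (auto intro: Cinf_add[OF S])

lemma locop_diff: "locop \<Lambda> ==> locop \<Lambda>' ==> locop (%H x. \<Lambda> H x - \<Lambda>' H x)"
 unfolding locop_def by (auto intro: Cinf_diff[OF S])

lemma locop_sum:
 assumes "!!i. locop (\<Lambda> i)"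
 shows "locop (%H x. \<Sum>i\<in>J. \<Lambda> i H x)"
 using assms unfolding locop_def by (auto intro!: Cinf_sum[OF S] sum.neutral)

text \<open>\<open>reps \<Lambda> L\<close> means that the formal \<open>L\<^sup>2\<close>-adjoint of \<open>\<Lambda>\<close> at the function \<open>1\<close> is \<open>L\<close> up to terms
 that are quadratic in the decaying quantities.\<close>

definition reps :: "((real^'n => real^'n^'n) => real^'n => real) => ('n => 'n => real^'n => real) => bool" where
 "reps \<Lambda> L \<longleftrightarrow> (\<exists>Y. (\<forall>a b. Cinf exterior (Y a b) \<and> decay 0 (2 * \<tau> + 4) (%x. Y a b x - L a b x)) \<and>
  (\<forall>H K. variation exterior G H K \<longrightarrow>
    integrable lborel (%x. indicator exterior x * (\<Lambda> H x * w x)) \<and>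
    I (\<Lambda> H) = I (%x. \<Oplus>a b. Y a b x * H x $ a $ b)))"

lemma integrable_pairing:
 assumes Y: "!!a b. Cinf exterior (Y a b)" and var: "variation exterior G H K"
 shows "integrable lborel (%x. indicator exterior x * ((\<Oplus>a b. Y a b x * H x $ a $ b) * w x))"
 unfolding sum_distrib_left sum_distrib_right
 by (intro Bochner_Integration.integrable_sum I_parts(1)[OF Y locop_H var])

lemma I_add:
 assumes "integrable lborel (%x. indicator exterior x * (f x * w x))" "integrable lborel (%x. indicator exterior x * (g x * w x))"
 shows "integrable lborel (%x. indicator exterior x * ((f x + g x) * w x))" "I (%x. f x + g x) = I f + I g"
 unfolding I_def distrib_left distrib_right
 by (rule Bochner_Integration.integrable_add[OF assms], rule Bochner_Integration.integral_add[OF assms])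

lemma I_cmult:
 assumes "integrable lborel (%x. indicator exterior x * (f x * w x))"
 shows "integrable lborel (%x. indicator exterior x * ((c * f x) * w x))" "I (%x. c * f x) = c * I f"
proof -
 have r: "indicator exterior x * ((c * f x) * w x) = c * (indicator exterior x * (f x * w x))" for x by simp
 show "integrable lborel (%x. indicator exterior x * ((c * f x) * w x))"
  unfolding r using assms by (rule integrable_mult_right)
 show "I (%x. c * f x) = c * I f" unfolding I_def r by (rule Bochner_Integration.integral_mult_right_zero)
qed

lemma I_cong:
 assumes "!!x. x \<in> exterior ==> f x = g x"
 shows "I f = I g" "integrable lborel (%x. indicator exterior x * (f x * w x)) \<longleftrightarrow>
  integrable lborel (%x. indicator exterior x * (g x * w x))"
proof -
 have "(%x. indicator exterior x * (f x * w x)) = (%x. indicator exterior x * (g x * w x))"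
  using assms by (auto simp: fun_eq_iff indicator_def)
 thus "I f = I g" "integrable lborel (%x. indicator exterior x * (f x * w x)) \<longleftrightarrow>
  integrable lborel (%x. indicator exterior x * (g x * w x))" by (simp_all only: I_def)
qed

lemma reps_cong:
 assumes "reps \<Lambda> L" "!!H K x. variation exterior G H K ==> x \<in> exterior ==> \<Lambda> H x = \<Lambda>' H x"
  "!!a b x. x \<in> exterior ==> L a b x = L' a b x"
 shows "reps \<Lambda>' L'"
proof -
 obtain Y where Y: "!!a b. Cinf exterior (Y a b)" "!!a b. decay 0 (2 * \<tau> + 4) (%x. Y a b x - L a b x)"
  "!!H K. variation exterior G H K ==> integrable lborel (%x. indicator exterior x * (\<Lambda> H x * w x)) \<and>
    I (\<Lambda> H) = I (%x. \<Oplus>a b. Y a b x * H x $ a $ b)"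
  using assms(1) unfolding reps_def by blast
 have "decay 0 (2 * \<tau> + 4) (%x. Y a b x - L' a b x)" for a b
  by (rule decay_cong[OF Y(2)[of a b]]) (simp add: assms(3))
 moreover have "integrable lborel (%x. indicator exterior x * (\<Lambda>' H x * w x)) \<and>
    I (\<Lambda>' H) = I (%x. \<Oplus>a b. Y a b x * H x $ a $ b)" if "variation exterior G H K" for H K
  using Y(3)[OF that] I_cong[of "\<Lambda> H" "\<Lambda>' H"] assms(2)[OF that] by simp
 ultimately show ?thesis unfolding reps_def using Y(1) by blast
qed

lemma reps_add:
 assumes "reps \<Lambda> L" "reps \<Lambda>' L'"
 shows "reps (%H x. \<Lambda> H x + \<Lambda>' H x) (%a b x. L a b x + L' a b x)"
proof -
 obtain Y where Y: "!!a b. Cinf exterior (Y a b)" "!!a b. decay 0 (2 * \<tau> + 4) (%x. Y a b x - L a b x)"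
  "!!H K. variation exterior G H K ==> integrable lborel (%x. indicator exterior x * (\<Lambda> H x * w x))"
  "!!H K. variation exterior G H K ==> I (\<Lambda> H) = I (%x. \<Oplus>a b. Y a b x * H x $ a $ b)"
  using assms(1) unfolding reps_def by blast
 obtain Y' where Y': "!!a b. Cinf exterior (Y' a b)" "!!a b. decay 0 (2 * \<tau> + 4) (%x. Y' a b x - L' a b x)"
  "!!H K. variation exterior G H K ==> integrable lborel (%x. indicator exterior x * (\<Lambda>' H x * w x))"
  "!!H K. variation exterior G H K ==> I (\<Lambda>' H) = I (%x. \<Oplus>a b. Y' a b x * H x $ a $ b)"
  using assms(2) unfolding reps_def by blast
 show ?thesis
  unfolding reps_def
 proof (intro exI[of _ "%a b x. Y a b x + Y' a b x"] conjI allI impI)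
  fix a b
  show "Cinf exterior (%x. Y a b x + Y' a b x)" by (rule Cinf_add[OF S Y(1) Y'(1)])
  show "decay 0 (2 * \<tau> + 4) (%x. Y a b x + Y' a b x - (L a b x + L' a b x))"
   by (rule decay_cong[OF decay_add[OF Y(2)[of a b] Y'(2)[of a b]]]) simp
 next
  fix H K assume var: "variation exterior G H K"
  show "integrable lborel (%x. indicator exterior x * ((\<Lambda> H x + \<Lambda>' H x) * w x))"
   by (rule I_add(1)[OF Y(3)[OF var] Y'(3)[OF var]])
  have "I (%x. \<Lambda> H x + \<Lambda>' H x) = I (%x. (\<Oplus>a b. Y a b x * H x $ a $ b) + (\<Oplus>a b. Y' a b x * H x $ a $ b))"
   by (simp add: I_add(2)[OF Y(3)[OF var] Y'(3)[OF var]] Y(4)[OF var] Y'(4)[OF var]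
     I_add(2)[OF integrable_pairing[OF Y(1) var] integrable_pairing[OF Y'(1) var]])
  thus "I (%x. \<Lambda> H x + \<Lambda>' H x) = I (%x. \<Oplus>a b. (Y a b x + Y' a b x) * H x $ a $ b)"
   by (simp add: distrib_right sum.distrib)
 qed
qed

lemma reps_cmult:
 assumes "reps \<Lambda> L"
 shows "reps (%H x. c * \<Lambda> H x) (%a b x. c * L a b x)"
proof -
 obtain Y where Y: "!!a b. Cinf exterior (Y a b)" "!!a b. decay 0 (2 * \<tau> + 4) (%x. Y a b x - L a b x)"
  "!!H K. variation exterior G H K ==> integrable lborel (%x. indicator exterior x * (\<Lambda> H x * w x))"
  "!!H K. variation exterior G H K ==> I (\<Lambda> H) = I (%x. \<Oplus>a b. Y a b x * H x $ a $ b)"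
  using assms unfolding reps_def by blast
 show ?thesis
  unfolding reps_def
 proof (intro exI[of _ "%a b x. c * Y a b x"] conjI allI impI)
  fix a b
  show "Cinf exterior (%x. c * Y a b x)" by (rule Cinf_mult[OF S Cinf_const[OF S] Y(1)])
  show "decay 0 (2 * \<tau> + 4) (%x. c * Y a b x - c * L a b x)"
   by (rule decay_cong[OF decay_cmult[OF Y(2)[of a b], of c]]) (simp add: right_diff_distrib)
 next
  fix H K assume var: "variation exterior G H K"
  show "integrable lborel (%x. indicator exterior x * (c * \<Lambda> H x * w x))"
   by (rule I_cmult(1)[OF Y(3)[OF var]])
  have "I (%x. c * \<Lambda> H x) = I (%x. c * (\<Oplus>a b. Y a b x * H x $ a $ b))"
   by (simp add: I_cmult(2)[OF Y(3)[OF var]] Y(4)[OF var] I_cmult(2)[OF integrable_pairing[OF Y(1) var]])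
  thus "I (%x. c * \<Lambda> H x) = I (%x. \<Oplus>a b. c * Y a b x * H x $ a $ b)"
   by (simp add: sum_distrib_left mult.assoc)
 qed
qed

lemma reps_uminus: "reps \<Lambda> L ==> reps (%H x. - \<Lambda> H x) (%a b x. - L a b x)"
 using reps_cmult[of \<Lambda> L "-1"] by simp

lemma reps_diff: "reps \<Lambda> L ==> reps \<Lambda>' L' ==> reps (%H x. \<Lambda> H x - \<Lambda>' H x) (%a b x. L a b x - L' a b x)"
 using reps_add[OF _ reps_uminus] by fastforce

lemma reps_zero: "reps (%H x. 0) (%a b x. 0)"
 unfolding reps_def by (intro exI[of _ "%a b x. 0"]) (auto simp: Cinf_const[OF S] decay_zero)

lemma reps_sum:
 assumes "!!i. reps (\<Lambda> i) (L i)"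
 shows "reps (%H x. \<Sum>i\<in>J. \<Lambda> i H x) (%a b x. \<Sum>i\<in>J. L i a b x)"
 by (induction J rule: infinite_finite_induct) (auto intro: reps_zero reps_add assms)

definition E :: "'n => 'n => (real^'n => real) => 'n => 'n => real^'n => real" where
 "E i j f a b x = (if a = i \<and> b = j then f x else 0)"

text \<open>In an expression \<open>f * \<partial>\<^sup>m H\<close> the coefficient \<open>f\<close> may be replaced by \<open>f1\<close>.\<close>

definition coef :: "nat => (real^'n => real) => (real^'n => real) => bool" where
 "coef m f f1 \<longleftrightarrow> approx m (\<tau> + 4 - real m) f f1"

lemma coef_Cinf: "coef m f f1 ==> Cinf exterior f" "coef m f f1 ==> Cinf exterior f1"
 unfolding coef_def by (erule approx_Cinf)+

lemma coef_U: "coef m f f1 ==> m \<le> 4 ==> coef m (%x. U a b x * f x) (%x. (if a = b then 1 else 0) * f1 x)"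
 unfolding coef_def by (intro approx_mult U_decay')

text \<open>A coefficient that decays quadratically from the start contributes nothing to the linear
  part of the adjoint.\<close>

lemma coef_zero: "decay m (2 * \<tau> + 4 - real m) f ==> coef m f (%x. 0)"
 unfolding coef_def by (erule approx_zero) simp

lemma \<alpha>_decay: "decay 3 (\<tau> + 1) (%x. \<alpha> i x / 2)"
 unfolding \<alpha>_def
 by (intro decay_divide decay_sum decay_mult[where a = 0 and b = "\<tau> + 1"] U_decay'(2) dG_decay) auto

text \<open>One integration by parts lowers the order by one: the derivative raises the rate of
  \<open>f\<close> by one, and the density term \<open>f * \<alpha> / 2\<close> is a product of two
  decaying factors, hence quadratic.\<close>

lemma coef_partial:
 assumes f: "coef (Suc m) f f1" and m: "m \<le> 3"
 shows "coef m (%x. partial i f x + f x * (\<alpha> i x / 2)) (partial i f1)"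
proof -
 have "coef m (partial i f) (partial i f1)"
  using f unfolding coef_def by (rule approx_partial) simp
 moreover have "coef m (%x. f x * (\<alpha> i x / 2)) (%x. 0)"
 proof (rule coef_zero)
  have "decay m (\<tau> + 4 - real (Suc m)) f"
   using approx_decay[OF f[unfolded coef_def]] by (rule decay_mono) auto
  moreover have "decay m (\<tau> + 1) (%x. \<alpha> i x / 2)" using decay_mono[OF \<alpha>_decay, of m] m by simp
  ultimately show "decay m (2 * \<tau> + 4 - real m) (%x. f x * (\<alpha> i x / 2))"
   by (rule decay_mult) simp
 qed
 ultimately show ?thesis unfolding coef_def using approx_add by fastforce
qed

lemma reps_H:
 assumes f: "coef 0 f f1"
 shows "reps (%H x. f x * H x $ i $ j) (E i j f1)"
 unfolding reps_def
proof (intro exI[of _ "E i j f"] conjI allI impI)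
 fix a b
 show "Cinf exterior (E i j f a b)"
  using coef_Cinf[OF f] Cinf_const[OF S] by (cases "a = i \<and> b = j") (auto simp: E_def[abs_def])
 have "decay 0 (2 * \<tau> + 4) (%x. f x - f1 x)"
  using f unfolding coef_def approx_def by (auto elim: decay_mono)
 thus "decay 0 (2 * \<tau> + 4) (%x. E i j f a b x - E i j f1 a b x)"
  by (cases "a = i \<and> b = j") (auto simp: E_def decay_zero)
next
 fix H K assume var: "variation exterior G H K"
 show "integrable lborel (%x. indicator exterior x * (f x * H x $ i $ j * w x))"
  by (rule I_parts(1)[OF coef_Cinf(1)[OF f] locop_H var])
 have "(\<Oplus>a b. E i j f a b x * H x $ a $ b) = f x * H x $ i $ j" for x
 proof -
  have "(\<Oplus>b. E i j f a b x * H x $ a $ b) = (if a = i then f x * H x $ i $ j else 0)" for a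
   by (simp add: E_def if_distrib[of "%r. r * _"] cong: if_cong)
  thus ?thesis by simp
 qed
 thus "I (%x. f x * H x $ i $ j) = I (%x. \<Oplus>a b. E i j f a b x * H x $ a $ b)" by simp
qed

text \<open>Moves one derivative from the variation to the coefficient at the price of a sign.
  Repeated down to order 0, where \<open>reps_H\<close> applies, it computes adjoints
  mechanically.\<close>

lemma reps_parts:
 assumes f: "Cinf exterior f" and \<Lambda>: "locop \<Lambda>"
  and r: "reps (%H x. (partial i f x + f x * (\<alpha> i x / 2)) * \<Lambda> H x) L"
 shows "reps (%H x. f x * partial i (\<Lambda> H) x) (%a b x. - L a b x)"
proof -
 obtain Y where Y: "!!a b. Cinf exterior (Y a b)" "!!a b. decay 0 (2 * \<tau> + 4) (%x. Y a b x - - L a b x)"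
  "!!H K. variation exterior G H K ==> I (%x. - ((partial i f x + f x * (\<alpha> i x / 2)) * \<Lambda> H x))
   = I (%x. \<Oplus>a b. Y a b x * H x $ a $ b)"
  using reps_uminus[OF r] unfolding reps_def by blast
 have "I (%x. f x * partial i (\<Lambda> H) x) = I (%x. \<Oplus>a b. Y a b x * H x $ a $ b)"
  if "variation exterior G H K" for H K
  using Y(3)[OF that] I_parts(3)[OF f \<Lambda> that, of i] by (simp add: I_def)
 thus ?thesis unfolding reps_def using Y(1,2) I_parts(2)[OF f \<Lambda>] by (intro exI[of _ Y]) blast
qed

end

section \<open>Adjoints of the variations of Christoffel symbols, Ricci curvature and Q\<close>

context asymptotics
begin

lemma reps_dH:
 assumes f: "coef 1 f f1"
 shows "reps (%H x. f x * partial m (%y. H y $ i $ j) x) (%a b x. - E i j (partial m f1) a b x)"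
proof -
 have "coef 0 (%x. partial m f x + f x * (\<alpha> m x / 2)) (partial m f1)"
  using f by (intro coef_partial) simp_all
 from reps_parts[where \<Lambda> = "%H x. H x $ i $ j", OF coef_Cinf(1)[OF f] locop_H reps_H[OF this]] show ?thesis .
qed

lemma reps_UdH:
 assumes f: "coef 1 f f1"
 shows "reps (%H x. U k l x * f x * partial m (%y. H y $ i $ j) x)
  (%a b x. (if k = l then 1 else 0) * - E i j (partial m f1) a b x)"
proof (rule reps_cong[OF reps_dH[OF coef_U[OF f]]])
 fix a b and x :: "real^'n" assume x: "x \<in> exterior"
 have "partial m (%x. (if k = l then 1 else 0) * f1 x) x = (if k = l then 1 else 0) * partial m f1 x"
  by (rule partial_cmult[OF diff[OF coef_Cinf(2)[OF f] x]])
 thus "- E i j (partial m (%x. (if k = l then 1 else 0) * f1 x)) a b x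
   = (if k = l then 1 else 0) * - E i j (partial m f1) a b x"
  by (simp add: E_def)
qed simp_all

text \<open>The linear part of the adjoint of \<open>f * d_christoffel\<close>: the three
  derivatives of \<open>H\<close> move to \<open>f\<close> with a change of sign.\<close>

definition LC :: "(real^'n => real) => 'n => 'n => 'n => 'n => 'n => real^'n => real" where
 "LC f k i j a b x = - 1 / 2 * (E j k (partial i f) a b x + E i k (partial j f) a b x - E i j (partial k f) a b x)"

lemma \<Gamma>_decay: "decay 3 (\<tau> + 1) (christoffel G k i j)"
 by (rule approx_decay[OF \<Gamma>_approx])

lemma reps_C:
 assumes f: "coef 1 f f1"
 shows "reps (%H x. f x * d_christoffel G H k i j x) (LC f1 k i j)"
proof (rule reps_cong)
 have df: "decay 0 (\<tau> + 3) f" using approx_decay[OF f[unfolded coef_def]] by (rule decay_mono) auto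
 have dU\<Gamma>: "decay 0 (\<tau> + 1) (%x. U k c x * christoffel G e i j x)" for c e
  by (rule decay_mult[where a = 0 and b = "\<tau> + 1", OF U_decay'(2) decay_mono[OF \<Gamma>_decay]]) auto
 have q: "coef 0 (%x. f x * (U k c x * christoffel G e i j x)) (%x. 0)" for c e
  by (rule coef_zero, rule decay_mult[OF df dU\<Gamma>]) simp
 show "reps (%H x. 1 / 2 * (\<Oplus>l. U k l x * f x * partial i (%y. H y $ j $ l) x
    + U k l x * f x * partial j (%y. H y $ i $ l) x - U k l x * f x * partial l (%y. H y $ i $ j) x)
   - (\<Oplus>c e. (f x * (U k c x * christoffel G e i j x)) * H x $ c $ e))
  (%a b x. 1 / 2 * (\<Oplus>l. (if k = l then 1 else 0) * - E j l (partial i f1) a b x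
    + (if k = l then 1 else 0) * - E i l (partial j f1) a b x
    - (if k = l then 1 else 0) * - E i j (partial l f1) a b x)
   - (\<Oplus>c e. E c e (%x. 0) a b x))"
  by (intro reps_diff reps_cmult reps_sum reps_add reps_UdH f reps_H q)
next
 fix H K and x :: "real^'n"
 show "1 / 2 * (\<Oplus>l. U k l x * f x * partial i (%y. H y $ j $ l) x
    + U k l x * f x * partial j (%y. H y $ i $ l) x - U k l x * f x * partial l (%y. H y $ i $ j) x)
   - (\<Oplus>c e. (f x * (U k c x * christoffel G e i j x)) * H x $ c $ e)
  = f x * d_christoffel G H k i j x"
  by (simp add: d_christoffel_def sum_distrib_left algebra_simps)
next
 fix a b and x :: "real^'n"
 have "E c e (%x. 0) a b x = 0" for c e by (simp add: E_def)
 thus "1 / 2 * (\<Oplus>l. (if k = l then 1 else 0) * - E j l (partial i f1) a b x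
    + (if k = l then 1 else 0) * - E i l (partial j f1) a b x
    - (if k = l then 1 else 0) * - E i j (partial l f1) a b x)
   - (\<Oplus>c e. E c e (%x. 0) a b x) = LC f1 k i j a b x"
  by (simp only: sum.distrib sum_subtractf sum_delta_mult) (simp add: LC_def field_simps)
qed

lemma locop_C: "locop (%H. d_christoffel G H k i j)"
proof -
 have eq: "(%H. d_christoffel G H k i j) = (%H x. 1 / 2 * (\<Oplus>l. U k l x * (partial i (%y. H y $ j $ l) x
    + partial j (%y. H y $ i $ l) x - partial l (%y. H y $ i $ j) x))
  - (\<Oplus>c e. (U k c x * christoffel G e i j x) * H x $ c $ e))"
  by (simp add: d_christoffel_def fun_eq_iff mult.assoc mult.left_commute mult.commute)
 show ?thesis unfolding eq
  by (intro locop_diff locop_mult locop_sum locop_add locop_partial locop_H Cinf_U Cinf_christoffel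
    Cinf_mult Cinf_const S)
qed

lemma reps_dC:
 assumes f: "coef 2 f f1"
 shows "reps (%H x. f x * partial m (d_christoffel G H k i j) x) (%a b x. - LC (partial m f1) k i j a b x)"
proof -
 have "coef 1 (%x. partial m f x + f x * (\<alpha> m x / 2)) (partial m f1)"
  using f by (intro coef_partial) (simp_all add: numeral_2_eq_2)
 from reps_parts[where \<Lambda> = "%H. d_christoffel G H k i j", OF coef_Cinf(1)[OF f] locop_C reps_C[OF this]]
 show ?thesis .
qed

text \<open>The coefficient \<open>f * \<Gamma>\<close> is already a product of two decaying
  factors, so this part of the Ricci variation is invisible at linear order.\<close>

lemma reps_\<Gamma>C:
 assumes f: "coef 2 f f1"
 shows "reps (%H x. f x * christoffel G c d e x * d_christoffel G H k i j x) (%a b x. 0)"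
proof -
 have df: "decay 1 (\<tau> + 2) f" using approx_decay[OF f[unfolded coef_def]] by (rule decay_mono) auto
 have d\<Gamma>: "decay 1 (\<tau> + 1) (christoffel G c d e)" by (rule decay_mono[OF \<Gamma>_decay]) auto
 have "coef 1 (%x. f x * christoffel G c d e x) (%x. 0)"
  by (rule coef_zero, rule decay_mult[OF df d\<Gamma>]) simp
 from reps_C[OF this, of k i j] show ?thesis
  by (rule reps_cong) (simp_all add: LC_def E_def partial_eq_dd)
qed

definition LR :: "(real^'n => real) => 'n => 'n => 'n => 'n => real^'n => real" where
 "LR f i j a b x = (\<Oplus>k. - LC (partial k f) k i j a b x - - LC (partial j f) k i k a b x)"

lemma reps_Ric:
 assumes f: "coef 2 f f1"
 shows "reps (%H x. f x * d_ricci G H i j x) (LR f1 i j)"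
proof (rule reps_cong)
 show "reps (%H x. (\<Oplus>k. f x * partial k (d_christoffel G H k i j) x - f x * partial j (d_christoffel G H k i k) x) +
  (\<Oplus>k. \<Sum>l\<in>UNIV.
    (f x * christoffel G k k l x * d_christoffel G H l i j x + f x * christoffel G l i j x * d_christoffel G H k k l x)
    - (f x * christoffel G k j l x * d_christoffel G H l i k x + f x * christoffel G l i k x * d_christoffel G H k j l x)))
  (%a b x. (\<Oplus>k. - LC (partial k f1) k i j a b x - - LC (partial j f1) k i k a b x) +
  (\<Sum>k\<in>(UNIV::'n set). \<Sum>l\<in>(UNIV::'n set). (0 + 0) - (0 + 0)))"
  by (intro reps_add reps_diff reps_sum reps_dC reps_\<Gamma>C[OF f] f)
next
 fix H K and x :: "real^'n"
 show "(\<Oplus>k. f x * partial k (d_christoffel G H k i j) x - f x * partial j (d_christoffel G H k i k) x) +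
  (\<Oplus>k. \<Sum>l\<in>UNIV.
    (f x * christoffel G k k l x * d_christoffel G H l i j x + f x * christoffel G l i j x * d_christoffel G H k k l x)
    - (f x * christoffel G k j l x * d_christoffel G H l i k x + f x * christoffel G l i k x * d_christoffel G H k j l x))
  = f x * d_ricci G H i j x"
  by (simp add: d_ricci_def distrib_left sum_distrib_left right_diff_distrib mult_ac)
qed (simp add: LR_def)

lemma reps_dinv:
 assumes f: "decay 0 (2 * \<tau> + 4) f"
 shows "reps (%H x. f x * d_inv G H a b x) (%a b x. 0)"
proof (rule reps_cong)
 have UU: "decay 0 0 (%x. U a c x * U e b x)" for c e
  by (rule decay_mult[OF U_decay'(2) U_decay'(2)]) auto
 have q: "coef 0 (%x. f x * (U a c x * U e b x)) (%x. 0)" for c e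
  by (rule coef_zero, rule decay_mult[OF f UU]) simp
 show "reps (%H x. - (\<Oplus>c e. (f x * (U a c x * U e b x)) * H x $ c $ e))
  (%a b x. - (\<Oplus>c e. E c e (%x. 0) a b x))"
  by (intro reps_uminus reps_sum reps_H q)
 show "- (\<Oplus>c e. (f x * (U a c x * U e b x)) * H x $ c $ e) = f x * d_inv G H a b x" for H x
  by (simp add: d_inv_def sum_distrib_left mult_ac)
qed (simp add: E_def)

text \<open>The expression of \<open>dB_eq\<close> as an operator on arbitrary \<open>H\<close>, the
  form in which it can be an argument of \<open>reps\<close>.\<close>

definition dQ0 :: "(real^'n => real^'n^'n) => real^'n => real" where
 "dQ0 H x = \<kappa>1 *
  (2 * (\<Oplus>i j a b. U i a x * U j b x * ricci G x $ a $ b * d_ricci G H i j x)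
  + ((\<Oplus>i j a b. U i a x * ricci G x $ i $ j * ricci G x $ a $ b * d_inv G H j b x)
  + (\<Oplus>i j a b. U j b x * ricci G x $ i $ j * ricci G x $ a $ b * d_inv G H i a x)))
  + \<kappa>2 * (2 * scalar_curvature G x *
  ((\<Oplus>i j. U i j x * d_ricci G H i j x) + (\<Oplus>i j. d_inv G H i j x * ricci G x $ i $ j)))"

definition Ylin :: "'n => 'n => real^'n => real" where
 "Ylin a b x = (\<Oplus>i j. LR (S1 i j) i j a b x)"

lemma Ric_decay: "decay 2 (\<tau> + 2) (%x. ricci G x $ i $ j)" "decay 2 (\<tau> + 2) (scalar_curvature G)"
 by (rule approx_decay[OF Ric_approx], rule approx_decay[OF R_approx])

lemma reps_dQ0: "reps dQ0 Ylin"
proof (rule reps_cong)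
 have RR: "decay 0 (2 * \<tau> + 4) (%x. U c d x * ricci G x $ i $ j * ricci G x $ a $ b)" for c d i j a b
  unfolding mult.assoc
  by (rule decay_mult[where a = 0 and b = "2 * \<tau> + 4", OF U_decay'(2) decay_mono[OF Ric_Ric_decay]]) auto
 have SR: "decay 0 (2 * \<tau> + 4) (%x. 2 * \<kappa>2 * (scalar_curvature G x * ricci G x $ i $ j))" for i j
  by (intro decay_cmult decay_mult[OF decay_mono[OF Ric_decay(2)] decay_mono[OF Ric_decay(1)]]) auto
 have c: "coef 2 (Sg i j) (S1 i j)" for i j
 proof -
  have "\<tau> + 4 - real 2 = \<tau> + 2" by simp
  thus ?thesis unfolding coef_def by (simp only: Sg_approx)
 qed
 show "reps (%H x. (\<Oplus>i j. Sg i j x * d_ricci G H i j x) + (\<kappa>1 *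
   ((\<Oplus>i j a b. U i a x * ricci G x $ i $ j * ricci G x $ a $ b * d_inv G H j b x)
   + (\<Oplus>i j a b. U j b x * ricci G x $ i $ j * ricci G x $ a $ b * d_inv G H i a x))
   + (\<Oplus>i j. 2 * \<kappa>2 * (scalar_curvature G x * ricci G x $ i $ j) * d_inv G H i j x)))
  (%a b x. (\<Oplus>i j. LR (S1 i j) i j a b x) + (\<kappa>1 *
   ((\<Sum>i\<in>(UNIV::'n set). \<Sum>j\<in>(UNIV::'n set). \<Sum>a\<in>(UNIV::'n set). \<Sum>b\<in>(UNIV::'n set). 0)
   + (\<Sum>i\<in>(UNIV::'n set). \<Sum>j\<in>(UNIV::'n set). \<Sum>a\<in>(UNIV::'n set). \<Sum>b\<in>(UNIV::'n set). 0))
   + (\<Sum>i\<in>(UNIV::'n set). \<Sum>j\<in>(UNIV::'n set). 0)))"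
  by (intro reps_add reps_cmult reps_sum reps_Ric reps_dinv RR SR c)
next
 fix H K and x :: "real^'n"
 let ?X = "\<kappa>1 *
   ((\<Oplus>i j a b. U i a x * ricci G x $ i $ j * ricci G x $ a $ b * d_inv G H j b x)
   + (\<Oplus>i j a b. U j b x * ricci G x $ i $ j * ricci G x $ a $ b * d_inv G H i a x))"
 have 1: "(\<Oplus>i j. Sg i j x * d_ricci G H i j x)
  = 2 * \<kappa>1 * (\<Oplus>i j a b. U i a x * U j b x * ricci G x $ a $ b * d_ricci G H i j x)
   + 2 * \<kappa>2 * scalar_curvature G x * (\<Oplus>i j. U i j x * d_ricci G H i j x)"
  by (simp add: Sg_def distrib_right distrib_left sum.distrib sum_distrib_left sum_distrib_right mult_ac)
 have 2: "(\<Oplus>i j. 2 * \<kappa>2 * (scalar_curvature G x * ricci G x $ i $ j) * d_inv G H i j x)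
  = 2 * \<kappa>2 * scalar_curvature G x * (\<Oplus>i j. d_inv G H i j x * ricci G x $ i $ j)"
  by (simp add: sum_distrib_left mult_ac)
 show "(\<Oplus>i j. Sg i j x * d_ricci G H i j x) + (?X
   + (\<Oplus>i j. 2 * \<kappa>2 * (scalar_curvature G x * ricci G x $ i $ j) * d_inv G H i j x)) = dQ0 H x"
  unfolding 1 2 dQ0_def by (simp only: distrib_left mult.assoc mult.left_commute[of _ 2] add_ac)
qed (simp add: Ylin_def)

text \<open>In \<open>DQt_decompose\<close> the divergence integrates to zero, the trace term with
  \<open>B0\<close> is quadratic, and \<open>dB\<close> is represented by \<open>Ylin\<close>. The
  term with \<open>- Q / 2\<close> from the volume density is kept exactly, because its bound is no
  better than that of \<open>Ylin\<close>.\<close>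

lemma DQ_adjoint:
 obtains Y where "!!a b. Cinf exterior (Y a b)" "!!a b. decay 0 (2 * \<tau> + 4) (%x. Y a b x - Ylin a b x)"
  "!!H K. variation exterior G H K ==> (LINT x|lborel. indicator exterior x * (variation.DQt G H x * w x))
    = I (%x. \<Oplus>a b. (Y a b x - Q_coord G x / 2 * U a b x) * H x $ a $ b)"
proof -
 define B where "B = (%x. \<kappa>1 * matrix_inner (G x) (ricci G x) (ricci G x) + \<kappa>2 * (scalar_curvature G x * scalar_curvature G x))"
 have dB: "decay 0 (2 * \<tau> + 4) B"
  unfolding B_def by (intro decay_add decay_cmult decay_mono[OF inner_Ric_decay]
   decay_mult[OF decay_mono[OF Ric_decay(2)] decay_mono[OF Ric_decay(2)]]) auto
 have c: "coef 0 (%x. B x / 2 * U a b x) (%x. 0)" for a b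
  by (rule coef_zero, rule decay_mult[where a = "2 * \<tau> + 4" and b = 0, OF decay_divide[OF dB] U_decay'(2)]) auto
 have "reps (%H x. (\<Oplus>a b. (B x / 2 * U a b x) * H x $ a $ b) + dQ0 H x)
  (%a b x. (\<Oplus>i j. E i j (%x. 0) a b x) + Ylin a b x)"
  by (intro reps_add reps_sum reps_H c reps_dQ0)
 hence "reps (%H x. (\<Oplus>a b. (B x / 2 * U a b x) * H x $ a $ b) + dQ0 H x) Ylin"
  by (rule reps_cong) (simp_all add: E_def)
 then obtain Y where Y: "!!a b. Cinf exterior (Y a b)" "!!a b. decay 0 (2 * \<tau> + 4) (%x. Y a b x - Ylin a b x)"
  and YI: "!!H K. variation exterior G H K ==>
   integrable lborel (%x. indicator exterior x * (((\<Oplus>a b. (B x / 2 * U a b x) * H x $ a $ b) + dQ0 H x) * w x))"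
  "!!H K. variation exterior G H K ==> I (%x. (\<Oplus>a b. (B x / 2 * U a b x) * H x $ a $ b) + dQ0 H x)
   = I (%x. \<Oplus>a b. Y a b x * H x $ a $ b)"
  unfolding reps_def by blast
 have CQ: "Cinf exterior (%x. - (Q_coord G x / 2 * U a b x))" for a b
  by (intro Cinf_uminus Cinf_mult Cinf_divide Cinf_const Cinf_Q Cinf_U S) simp
 show ?thesis
 proof (rule that[OF Y])
  fix H K assume var: "variation exterior G H K"
  then interpret v: variation exterior G H K .
  let ?f = "%x. (\<Oplus>a b. (B x / 2 * U a b x) * H x $ a $ b) + dQ0 H x"
  let ?g = "%x. \<Oplus>a b. - (Q_coord G x / 2 * U a b x) * H x $ a $ b"
  obtain F where F: "!!i. Cinf exterior (F i)" "!!i x. x \<in> exterior - K ==> F i x = 0"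
   "!!x. x \<in> exterior ==> v.DQt x * w x = (\<Oplus>i. partial i (F i) x)
   + ((\<Oplus>a b. (v.B0 x - Q_coord G x) / 2 * U a b x * H x $ a $ b) + v.dB x) * w x"
   using v.DQt_decompose by blast
  note p = parts[OF Cinf_const[OF S, of 1] F(1,2) v.K, unfolded mult_1]
  have pz: "(LINT x|lborel. indicator exterior x * partial i (F i) x) = 0" for i
   using p(3)[of i i] by (simp add: partial_eq_dd)
  have pt: "indicator exterior x * (v.DQt x * w x) = (\<Oplus>i. indicator exterior x * partial i (F i) x)
    + indicator exterior x * ((?f x + ?g x) * w x)" for x
  proof (cases "x \<in> exterior")
   case True
   have "v.B0 x = B x" by (simp add: v.B0_def B_def \<kappa>1_def \<kappa>2_def)
   moreover have "v.dB x = dQ0 H x" unfolding v.dB_eq[OF True] dQ0_def \<kappa>1_def \<kappa>2_def ..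
   moreover have "(\<Oplus>a b. (B x - Q_coord G x) / 2 * U a b x * H x $ a $ b)
    = (\<Oplus>a b. (B x / 2 * U a b x) * H x $ a $ b) + ?g x"
    by (simp add: sum.distrib[symmetric] diff_divide_distrib algebra_simps)
   ultimately show ?thesis using F(3)[OF True] True by simp
  qed simp
  have ig: "integrable lborel (%x. indicator exterior x * (?g x * w x))" by (rule integrable_pairing[OF CQ var])
  have "(LINT x|lborel. indicator exterior x * (v.DQt x * w x))
   = (\<Oplus>i. LINT x|lborel. indicator exterior x * partial i (F i) x) + I (%x. ?f x + ?g x)"
  proof -
   have i1: "integrable lborel (%x. indicator exterior x * partial i (F i) x)" for i by (rule p(2))
   show ?thesis
    unfolding pt I_def Bochner_Integration.integral_sum[OF i1, symmetric]
    by (rule Bochner_Integration.integral_add[OF Bochner_Integration.integrable_sum[OF i1] I_add(1)[OF YI(1)[OF var] ig]])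
  qed
  also have "\<dots> = I (%x. ?f x + ?g x)" by (simp add: pz)
  also have "\<dots> = I (%x. \<Oplus>a b. Y a b x * H x $ a $ b) + I ?g"
   by (simp only: I_add(2)[OF YI(1)[OF var] ig] YI(2)[OF var])
  also have "\<dots> = I (%x. (\<Oplus>a b. Y a b x * H x $ a $ b) + ?g x)"
   by (rule I_add(2)[OF integrable_pairing[OF Y(1) var] ig, symmetric])
  also have "\<dots> = I (%x. \<Oplus>a b. (Y a b x - Q_coord G x / 2 * U a b x) * H x $ a $ b)"
   by (rule arg_cong[where f = I]) (simp add: fun_eq_iff sum.distrib[symmetric] algebra_simps)
  finally show "(LINT x|lborel. indicator exterior x * (v.DQt x * w x))
    = I (%x. \<Oplus>a b. (Y a b x - Q_coord G x / 2 * U a b x) * H x $ a $ b)" .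
 qed
qed

end

lemma sum_pair_delta: "(\<Oplus>i j. if i = a \<and> j = b then F i j else 0) = (F a b :: real)"
 for a b :: "'n::finite"
proof -
 have "(\<Oplus>j. if i = a \<and> j = b then F i j else 0) = (if i = a then F a b else 0)" for i
  by (cases "i = a") auto
 thus ?thesis by simp
qed

lemma split_if_sum: "p * (q * ((if P then 1 else 0) + (if R then 1 else 0))) = (if P then p * q else 0) + (if R then p * q else (0 :: real))"
 by (cases P; cases R) (simp_all add: algebra_simps)

text \<open>By \<open>du_bois_reymond\<close> the function vanishes almost everywhere; the open set
  where it does not is null, hence empty.\<close>

lemma vanish_of_integral:
 fixes f :: "real^'n::finite => real"
 assumes \<Omega>: "open \<Omega>" and f: "continuous_on \<Omega> f"
  and z: "!!\<phi> a b. Cinf UNIV \<phi> ==> cbox a b \<subseteq> \<Omega> ==> (!!x. x \<notin> cbox a b ==> \<phi> x = 0) ==>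
   (LINT x|lborel. indicator \<Omega> x * (f x * \<phi> x)) = 0"
  and x: "x \<in> \<Omega>"
 shows "f x = 0"
proof -
 have ae: "AE x in lborel. x \<in> \<Omega> \<longrightarrow> f x = 0"
 proof (rule du_bois_reymond[OF \<Omega> _ z])
  fix a b :: "real^'n" assume "cbox a b \<subseteq> \<Omega>"
  hence "continuous_on (cbox a b) f" using f continuous_on_subset by blast
  from borel_integrable_compact[OF compact_cbox this]
  show "integrable lborel (%x. indicator (cbox a b) x * f x)" by simp
 qed auto
 define Z where "Z = \<Omega> \<inter> f -` (- {0})"
 have Z: "open Z" unfolding Z_def by (rule continuous_open_preimage[OF f \<Omega>]) auto
 have "AE x in lborel. x \<notin> Z" using ae by (auto simp: Z_def)
 hence "Z \<in> null_sets lborel" using Z by (subst AE_iff_null_sets) auto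
 hence "negligible Z" unfolding negligible_iff_null_sets by (rule null_sets_completionI)
 hence "Z = {}" using open_not_negligible[OF Z] by blast
 thus ?thesis using x by (auto simp: Z_def)
qed

section \<open>The J-Einstein tensor at infinity\<close>

context asymptotics
begin

lemma decay_E: "decay m c f ==> decay m c (E i j f a b)"
 by (cases "a = i \<and> b = j") (auto simp: E_def[abs_def] decay_zero)

lemma S1_decay: "decay 2 (\<tau> + 2) (S1 i j)"
 using Sg_approx by (simp add: approx_def)

lemma ddS1_decay: "decay 0 (\<tau> + 4) (partial k (partial l (S1 i j)))"
 by (rule decay_partial[of 0 "\<tau> + 3"], rule decay_partial[of "Suc 0" "\<tau> + 2"])
  (use S1_decay in \<open>auto simp: numeral_2_eq_2\<close>)

lemma Ylin_decay: "decay 0 (\<tau> + 4) (Ylin a b)"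
 unfolding Ylin_def LR_def LC_def
 by (intro decay_sum decay_diff decay_uminus decay_cmult decay_add decay_E ddS1_decay)

text \<open>The right-hand side is the adjoint of the linearised Ricci operator of the flat metric,
  applied to \<open>S1\<close>.\<close>

lemma Ylin_eq: "Ylin a b x = 1 / 2 * ((\<Oplus>i. partial i (partial b (S1 i a)) x)
  + (\<Oplus>j. partial j (partial b (S1 a j)) x) - (\<Oplus>k. partial k (partial k (S1 a b)) x)
  - (if a = b then 1 else 0) * (\<Oplus>i j. partial i (partial j (S1 i j)) x))"
proof -
 have LR: "LR f i j a b x = 1 / 2 * ((\<Oplus>k. E j k (partial i (partial k f)) a b x)
   + (\<Oplus>k. E i k (partial j (partial k f)) a b x) - (\<Oplus>k. E i j (partial k (partial k f)) a b x)
   - (\<Oplus>k. E k k (partial i (partial j f)) a b x))" for f i j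
 proof -
  have "LR f i j a b x = (\<Oplus>k. 1 / 2 * (E j k (partial i (partial k f)) a b x
    + E i k (partial j (partial k f)) a b x - E i j (partial k (partial k f)) a b x - E k k (partial i (partial j f)) a b x))"
   unfolding LR_def by (rule sum.cong) (simp_all add: LC_def field_simps)
  thus ?thesis by (simp only: sum_distrib_left[symmetric] sum.distrib sum_subtractf)
 qed
 have 1: "(\<Oplus>i j k. E j k (partial i (partial k (S1 i j))) a b x)
   = (\<Oplus>i. partial i (partial b (S1 i a)) x)"
  unfolding E_def by (simp add: eq_commute[of a] eq_commute[of b] sum_pair_delta)
 have 2: "(\<Oplus>i j k. E i k (partial j (partial k (S1 i j))) a b x)
   = (\<Oplus>j. partial j (partial b (S1 a j)) x)"
  unfolding E_def by (subst sum.swap) (simp add: eq_commute[of a] eq_commute[of b] sum_pair_delta)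
 have 3: "(\<Oplus>i j k. E i j (partial k (partial k (S1 i j))) a b x)
   = (\<Oplus>k. partial k (partial k (S1 a b)) x)"
  unfolding E_def by (subst sum_rotate3) (simp add: eq_commute[of a] eq_commute[of b] sum_pair_delta)
 have "(\<Oplus>k. E k k f a b x) = (if a = b then 1 else 0) * f x" for f
  unfolding E_def by (cases "a = b") (auto intro!: sum.neutral)
 hence 4: "(\<Oplus>i j k. E k k (partial i (partial j (S1 i j))) a b x)
   = (if a = b then 1 else 0) * (\<Oplus>i j. partial i (partial j (S1 i j)) x)"
  by (simp only: sum_distrib_left)
 show ?thesis
  unfolding Ylin_def LR sum_distrib_left[symmetric] sum.distrib sum_subtractf 1 2 3 4 ..
qed

text \<open>The two representations of \<open>DQ\<close> are compared on all test tensors. These are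
  symmetric, so only \<open>D a b + D b a = 0\<close> follows, which suffices because
  \<open>P\<close> is symmetric. Lowering indices gives \<open>P = G Y G - Q/2 G\<close> with
  \<open>Y\<close> symmetrised; in \<open>- P/2 - Q/4 G\<close> the terms with \<open>Q\<close>
  cancel, and the factors \<open>G\<close> may be replaced by the identity.\<close>

lemma J_asymptotics:
 fixes P :: "real^'n => real^'n^'n"
 assumes P: "!!i j. Cinf exterior (%x. P x $ i $ j)" "!!x i j. x \<in> exterior ==> P x $ i $ j = P x $ j $ i"
  and adj: "!!H K. variation exterior G H K ==> (LINT x|lborel. indicator exterior x * (variation.DQt G H x * w x))
   = (LINT x|lborel. indicator exterior x * (matrix_inner (G x) (H x) (P x) * w x))"
 shows "approx 0 (\<tau> + 4) (%x. - 1 / 2 * P x $ a $ b - 1 / 4 * Q_coord G x * G x $ a $ b)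
  (%x. - 1 / 2 * ((Ylin a b x + Ylin b a x) / 2))"
proof -
 obtain Y where Y: "!!a b. Cinf exterior (Y a b)" "!!a b. decay 0 (2 * \<tau> + 4) (%x. Y a b x - Ylin a b x)"
  "!!H K. variation exterior G H K ==> (LINT x|lborel. indicator exterior x * (variation.DQt G H x * w x))
    = I (%x. \<Oplus>a b. (Y a b x - Q_coord G x / 2 * U a b x) * H x $ a $ b)"
  using DQ_adjoint by blast
 define Z where "Z = (%i j x. \<Oplus>a b. U i a x * U j b x * P x $ a $ b)"
 define D where "D = (%a b x. (Y a b x - Q_coord G x / 2 * U a b x) - Z a b x)"
 have CZ: "Cinf exterior (Z i j)" for i j
  unfolding Z_def by (intro Cinf_sum Cinf_mult S Cinf_U P)
 have CY: "Cinf exterior (%x. Y a b x - Q_coord G x / 2 * U a b x)" for a b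
  by (intro Cinf_diff Cinf_mult Cinf_divide Cinf_const Cinf_Q Cinf_U S Y) simp
 have CD: "Cinf exterior (D a b)" for a b unfolding D_def by (intro Cinf_diff S CY CZ)
 have I0: "I (%x. \<Oplus>a b. D a b x * H x $ a $ b) = 0" if var: "variation exterior G H K" for H K
 proof -
  have "matrix_inner (G x) (H x) (P x) = (\<Oplus>a b. Z a b x * H x $ a $ b)" for x
   by (simp add: matrix_inner_def Z_def sum_distrib_right sum_distrib_left mult_ac)
  hence "I (%x. \<Oplus>a b. (Y a b x - Q_coord G x / 2 * U a b x) * H x $ a $ b)
    = I (%x. \<Oplus>a b. Z a b x * H x $ a $ b)"
   using adj[OF var] Y(3)[OF var] by (simp add: I_def)
  moreover have "I (%x. (\<Oplus>a b. D a b x * H x $ a $ b) + (\<Oplus>a b. Z a b x * H x $ a $ b))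
    = I (%x. \<Oplus>a b. D a b x * H x $ a $ b) + I (%x. \<Oplus>a b. Z a b x * H x $ a $ b)"
   by (rule I_add(2)[OF integrable_pairing[OF CD var] integrable_pairing[OF CZ var]])
  moreover have "(%x. (\<Oplus>a b. D a b x * H x $ a $ b) + (\<Oplus>a b. Z a b x * H x $ a $ b))
    = (%x. \<Oplus>a b. (Y a b x - Q_coord G x / 2 * U a b x) * H x $ a $ b)"
   by (simp add: fun_eq_iff D_def sum.distrib[symmetric] distrib_right[symmetric])
  ultimately show ?thesis by simp
 qed
 have D0: "D a b x + D b a x = 0" if x: "x \<in> exterior" for a b x
 proof -
  let ?f = "%x. (D a b x + D b a x) * w x"
  have "?f x = 0"
  proof (rule vanish_of_integral[OF S _ _ x])
   show "continuous_on exterior ?f"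
    by (intro Cinf_continuous_on Cinf_mult Cinf_add S CD Cinf_w)
   fix \<phi> :: "real^'n => real" and c d :: "real^'n"
   assume \<phi>: "Cinf UNIV \<phi>" "cbox c d \<subseteq> exterior" "!!x. x \<notin> cbox c d ==> \<phi> x = 0"
   \<comment> \<open>A symmetrised matrix unit times a bump; for \<open>a = b\<close> it has the
     entry 2, in accordance with \<open>D a b + D b a\<close>.\<close>
   define H where "H = (%y. \<chi> i j. \<phi> y * ((if i = a \<and> j = b then 1 else 0) + (if i = b \<and> j = a then 1 else 0)))"
   have var: "variation exterior G H (cbox c d)"
   proof
    show "Cinf UNIV (%x. H x $ i $ j)" for i j
     unfolding H_def vec_lambda_beta by (intro Cinf_mult Cinf_const open_UNIV \<phi>)
    show "transpose (H x) = H x" for x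
     unfolding vec_eq_iff transpose_def H_def vec_lambda_beta
    proof (intro allI)
     fix i j
     show "\<phi> x * ((if j = a \<and> i = b then 1 else 0) + (if j = b \<and> i = a then 1 else 0))
       = \<phi> x * ((if i = a \<and> j = b then 1 else 0) + (if i = b \<and> j = a then 1 else 0))"
      by (cases "i = a"; cases "j = a"; cases "i = b"; cases "j = b") simp_all
    qed
    show "H x = 0" if "x \<notin> cbox c d" for x
     unfolding vec_eq_iff H_def vec_lambda_beta zero_index \<phi>(3)[OF that] by simp
    show "det (G x) > 0" if "x \<in> exterior" for x by (rule det_pos[OF that])
   qed (rule compact_cbox, rule \<phi>(2))
   have "(\<Oplus>i j. D i j x * H x $ i $ j) = (D a b x + D b a x) * \<phi> x" for x
   proof -
    have "D i j x * H x $ i $ j = (if i = a \<and> j = b then D i j x * \<phi> x else 0) + (if i = b \<and> j = a then D i j x * \<phi> x else 0)" for i j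
     unfolding H_def vec_lambda_beta by (rule split_if_sum)
    thus ?thesis by (simp only: sum.distrib sum_pair_delta) (rule distrib_right[symmetric])
   qed
   hence "I (%x. (D a b x + D b a x) * \<phi> x) = 0" using I0[OF var] by (simp only:)
   moreover have "?f x * \<phi> x = (D a b x + D b a x) * \<phi> x * w x" for x by (simp only: mult.assoc mult.commute[of "w x"])
   ultimately show "(LINT x|lborel. indicator exterior x * (?f x * \<phi> x)) = 0"
    unfolding I_def by (simp only:)
  qed
  thus ?thesis using w_pos[OF x] by simp
 qed
 let ?Y = "%c d x. (Y c d x + Y d c x) / 2"
 have Peq: "P x $ a $ b = (\<Oplus>d c. G x $ a $ c * (G x $ d $ b * ?Y c d x)) - Q_coord G x / 2 * G x $ a $ b"
  if x: "x \<in> exterior" for x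
 proof -
  define V where "V = matrix_inv (G x)"
  have Zsym: "Z j i x = Z i j x" for i j
   unfolding Z_def using P(2)[OF x] by (subst sum.swap) (simp add: mult_ac)
  have Zeq: "Z c d x = ?Y c d x - Q_coord G x / 2 * V $ c $ d" for c d
  proof -
   have "(Y c d x - Q_coord G x / 2 * V $ c $ d - Z c d x) + (Y d c x - Q_coord G x / 2 * V $ d $ c - Z d c x) = 0"
    using D0[OF x, of c d] unfolding D_def V_def .
   moreover have "V $ d $ c = V $ c $ d" "Z d c x = Z c d x" unfolding V_def by (rule U_sym[OF x], rule Zsym)
   ultimately show ?thesis by (simp add: field_simps)
  qed
  have ZV: "Z i j x = (V ** P x ** V) $ i $ j" for i j
  proof -
   have "(V ** P x ** V) $ i $ j = (\<Oplus>b a. V $ i $ a * P x $ a $ b * V $ b $ j)"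
    by (simp add: matrix_matrix_mult_def sum_distrib_right)
   also have "\<dots> = (\<Oplus>a b. V $ i $ a * P x $ a $ b * V $ b $ j)" by (rule sum.swap)
   also have "\<dots> = Z i j x" unfolding Z_def V_def using U_sym[OF x, of j] by (simp add: mult_ac)
   finally show ?thesis ..
  qed
  have "P x = G x ** V ** P x ** (V ** G x)"
   unfolding V_def using invertible_matrix_inv[OF G_det[OF x]] by simp
  also have "\<dots> = G x ** (V ** P x ** V) ** G x" by (simp add: matrix_mul_assoc)
  finally have "P x $ a $ b = (G x ** (V ** P x ** V) ** G x) $ a $ b" by (rule arg_cong)
  also have "\<dots> = (\<Oplus>d. (\<Oplus>c. G x $ a $ c * Z c d x) * G x $ d $ b)"
  proof -
   have mm: "(A ** B) $ i $ j = (\<Oplus>k. A $ i $ k * B $ k $ j)" for A B :: "real^'n^'n" and i j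
    by (simp add: matrix_matrix_mult_def)
   show ?thesis by (simp only: mm[of "G x ** (V ** P x ** V)"] mm[of "G x"] ZV)
  qed
  also have "\<dots> = (\<Oplus>d. (\<Oplus>c. G x $ a $ c * ?Y c d x) * G x $ d $ b)
    - (\<Oplus>d. Q_coord G x / 2 * (\<Oplus>c. G x $ a $ c * V $ c $ d) * G x $ d $ b)"
  proof -
   have "(\<Oplus>c. G x $ a $ c * Z c d x) = (\<Oplus>c. G x $ a $ c * ?Y c d x)
     - Q_coord G x / 2 * (\<Oplus>c. G x $ a $ c * V $ c $ d)" for d
    unfolding Zeq right_diff_distrib sum_subtractf by (simp add: sum_distrib_left mult_ac)
   thus ?thesis by (simp only: left_diff_distrib sum_subtractf)
  qed
  also have "(\<Oplus>d. Q_coord G x / 2 * (\<Oplus>c. G x $ a $ c * V $ c $ d) * G x $ d $ b) = Q_coord G x / 2 * G x $ a $ b"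
   unfolding V_def matrix_inv_nth(1)[OF G_det[OF x]] mult.assoc sum_distrib_left[symmetric] sum_delta_mult ..
  also have "(\<Oplus>d. (\<Oplus>c. G x $ a $ c * ?Y c d x) * G x $ d $ b)
    = (\<Oplus>d c. G x $ a $ c * (G x $ d $ b * ?Y c d x))"
   by (simp add: sum_distrib_right sum_distrib_left mult_ac)
  finally show ?thesis .
 qed
 show ?thesis
 proof (rule approx_cong)
  have y: "approx 0 (\<tau> + 4) (?Y c d) (%x. (Ylin c d x + Ylin d c x) / 2)" for c d
   by (intro approx_half approx_add) (auto simp: approx_def Ylin_decay intro: decay_mono[OF Y(2)])
  have g: "decay 0 \<tau> (%x. G x $ a $ b - (if a = b then 1 else 0))" for a b
   by (rule decay_mono[OF G_decay]) auto
  show "approx 0 (\<tau> + 4) (%x. - 1 / 2 * (\<Oplus>d c. G x $ a $ c * (G x $ d $ b * ?Y c d x)))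
   (%x. - 1 / 2 * (\<Oplus>d c. (if a = c then 1 else 0) * ((if d = b then 1 else 0) * ((Ylin c d x + Ylin d c x) / 2))))"
   by (intro approx_cmult approx_sum approx_mult g y)
  fix x :: "real^'n" assume x: "x \<in> exterior"
  show "- 1 / 2 * (\<Oplus>d c. G x $ a $ c * (G x $ d $ b * ?Y c d x))
    = - 1 / 2 * P x $ a $ b - 1 / 4 * Q_coord G x * G x $ a $ b"
   unfolding Peq[OF x] by (simp add: algebra_simps)
  show "- 1 / 2 * (\<Oplus>d c. (if a = c then 1 else 0) * ((if d = b then 1 else 0) * ((Ylin c d x + Ylin d c x) / 2)))
    = - 1 / 2 * ((Ylin a b x + Ylin b a x) / 2)"
   unfolding sum_delta_mult unfolding eq_commute[of _ b] sum_delta_mult ..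
 qed
qed

end

section \<open>The linearised identities\<close>

lemma partial_simps:
 fixes f g :: "real^'n::finite => real"
 assumes "Cinf UNIV f" "Cinf UNIV g"
 shows "partial i (%x. f x + g x) = (%x. partial i f x + partial i g x)"
  "partial i (%x. f x - g x) = (%x. partial i f x - partial i g x)"
 using assms by (auto simp: fun_eq_iff partial_eq_dd dd_add dd_diff Cinf_differentiable)

lemma partial_scale:
 fixes f :: "real^'n::finite => real"
 assumes "Cinf UNIV f"
 shows "partial i (%x. c * f x) = (%x. c * partial i f x)"
 using assms by (auto simp: fun_eq_iff partial_eq_dd dd_cmult Cinf_differentiable)

lemma partial_sum:
 fixes f :: "'i => real^'n::finite => real"
 assumes "!!k. Cinf UNIV (f k)"
 shows "partial i (%x. \<Sum>k\<in>A. f k x) = (%x. \<Sum>k\<in>A. partial i (f k) x)"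
proof -
 have "f k differentiable (at x)" for k x by (rule Cinf_differentiable[OF assms]) simp
 thus ?thesis by (simp add: fun_eq_iff partial_eq_dd dd_sum)
qed

lemma partial_commute:
 fixes f :: "real^'n::finite => real"
 assumes "Cinf UNIV f"
 shows "partial i (partial j f) = partial j (partial i f)"
 using dd_commute[OF open_UNIV assms] by (simp add: fun_eq_iff partial_eq_dd)

lemma Cinf_partial: "Cinf S f ==> Cinf S (partial i f)"
 unfolding partial_eq_dd by (rule Cinf_dd)

lemmas Cinf_UNIV = Cinf_add[OF open_UNIV] Cinf_diff[OF open_UNIV] Cinf_mult[OF open_UNIV] Cinf_sum[OF open_UNIV]
 Cinf_const[OF open_UNIV] Cinf_partial

definition lin_\<Gamma> :: "('n => 'n => real^'n::finite => real) => 'n => 'n => 'n => real^'n => real" where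
 "lin_\<Gamma> v k i j x = (partial i (v j k) x + partial j (v i k) x - partial k (v i j) x) / 2"

definition lin_Ric :: "('n => 'n => real^'n::finite => real) => 'n => 'n => real^'n => real" where
 "lin_Ric v i j x = (\<Oplus>k. partial k (lin_\<Gamma> v k i j) x - partial j (lin_\<Gamma> v k i k) x)"

definition lin_R :: "('n => 'n => real^'n::finite => real) => real^'n => real" where
 "lin_R v x = (\<Oplus>i. lin_Ric v i i x)"

definition lin_S :: "real => real => ('n => 'n => real^'n::finite => real) => 'n => 'n => real^'n => real" where
 "lin_S c1 c2 v i j x = 2 * c1 * lin_Ric v i j x + 2 * c2 * ((if i = j then 1 else 0) * lin_R v x)"

definition lin_J :: "('n => 'n => real^'n::finite => real) => 'n => 'n => real^'n => real" where
 "lin_J S a b x = 1 / 2 * ((\<Oplus>i. partial i (partial b (S i a)) x)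
  + (\<Oplus>j. partial j (partial b (S a j)) x) - (\<Oplus>k. partial k (partial k (S a b)) x)
  - (if a = b then 1 else 0) * (\<Oplus>i j. partial i (partial j (S i j)) x))"

context
 fixes Z :: "(real^'n::finite) set" and v v' :: "'n => 'n => real^'n => real"
 assumes Z: "open Z"
begin

lemma lin_Ric_cong:
 assumes v: "!!i j x. x \<in> Z ==> v i j x = v' i j x" and x: "x \<in> Z"
 shows "lin_Ric v i j x = lin_Ric v' i j x"
proof -
 have "partial i (v a b) y = partial i (v' a b) y" if "y \<in> Z" for i a b y
  by (rule partial_cong[OF Z that v])
 hence "lin_\<Gamma> v k i j y = lin_\<Gamma> v' k i j y" if "y \<in> Z" for k i j y
  using that by (simp add: lin_\<Gamma>_def)
 hence "partial l (lin_\<Gamma> v k i j) x = partial l (lin_\<Gamma> v' k i j) x" for l k i j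
  by (rule partial_cong[OF Z x])
 thus ?thesis by (simp add: lin_Ric_def)
qed

lemma lin_R_cong: "(!!i j x. x \<in> Z ==> v i j x = v' i j x) ==> x \<in> Z ==> lin_R v x = lin_R v' x"
 using lin_Ric_cong by (simp add: lin_R_def)

lemma lin_S_cong: "(!!i j x. x \<in> Z ==> v i j x = v' i j x) ==> x \<in> Z ==> lin_S c1 c2 v i j x = lin_S c1 c2 v' i j x"
 using lin_Ric_cong lin_R_cong by (simp add: lin_S_def)

lemma lin_J_cong:
 assumes v: "!!i j x. x \<in> Z ==> v i j x = v' i j x" and x: "x \<in> Z"
 shows "lin_J v a b x = lin_J v' a b x"
proof -
 have "partial i (v a b) y = partial i (v' a b) y" if "y \<in> Z" for i a b y
  by (rule partial_cong[OF Z that v])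
 hence "partial j (partial i (v a b)) x = partial j (partial i (v' a b)) x" for i j a b
  by (rule partial_cong[OF Z x])
 thus ?thesis by (simp add: lin_J_def)
qed

end

context
 fixes v :: "'n::finite => 'n => real^'n => real"
 assumes v: "!!a b. Cinf UNIV (v a b)" and v_sym: "!!a b. v a b = v b a"
begin

lemma lin_Ric_eq: "lin_Ric v i j = (%x. 1 / 2 * (\<Oplus>k. partial k (partial i (v j k)) x
  + partial k (partial j (v i k)) x - partial k (partial k (v i j)) x - partial j (partial i (v k k)) x))"
proof
 fix x
 have \<Gamma>: "lin_\<Gamma> v k i j = (%x. 1 / 2 * (partial i (v j k) x + partial j (v i k) x - partial k (v i j) x))" for k i j
  by (simp add: lin_\<Gamma>_def fun_eq_iff)
 have d: "partial l (lin_\<Gamma> v k i j) x = 1 / 2 * (partial l (partial i (v j k)) x + partial l (partial j (v i k)) x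
   - partial l (partial k (v i j)) x)" for l k i j
  unfolding \<Gamma> by (simp only: partial_simps partial_scale Cinf_UNIV v)
 have d': "partial l (lin_\<Gamma> v k i k) x = 1 / 2 * partial l (partial i (v k k)) x" for l k i
  by (simp add: d)
 show "lin_Ric v i j x = 1 / 2 * (\<Oplus>k. partial k (partial i (v j k)) x
  + partial k (partial j (v i k)) x - partial k (partial k (v i j)) x - partial j (partial i (v k k)) x)"
  unfolding lin_Ric_def d d' by (simp add: sum_distrib_left sum_divide_distrib diff_divide_distrib)
qed

lemma Cinf_lin_Ric: "Cinf UNIV (lin_Ric v i j)"
 unfolding lin_Ric_eq by (intro Cinf_UNIV v)

lemma Cinf_lin_R: "Cinf UNIV (lin_R v)"
 unfolding lin_R_def[abs_def] by (intro Cinf_UNIV Cinf_lin_Ric)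

lemma lin_Ric_sym: "lin_Ric v i j = lin_Ric v j i"
 unfolding lin_Ric_eq v_sym[of j i] partial_commute[OF v, of j i] by (simp only: add.commute)

lemma lin_R_eq: "lin_R v = (%x. (\<Oplus>i k. partial i (partial k (v i k)) x)
  - (\<Oplus>i k. partial k (partial k (v i i)) x))"
proof
 fix x
 have 1: "(\<Oplus>i k. partial k (partial i (v i k)) x) = (\<Oplus>i k. partial i (partial k (v i k)) x)"
  by (simp only: partial_commute[OF v])
 have 2: "(\<Oplus>i k. partial i (partial i (v k k)) x) = (\<Oplus>i k. partial k (partial k (v i i)) x)"
  by (rule sum.swap)
 show "lin_R v x = (\<Oplus>i k. partial i (partial k (v i k)) x)
  - (\<Oplus>i k. partial k (partial k (v i i)) x)"
  unfolding lin_R_def lin_Ric_eq sum_distrib_left[symmetric] sum.distrib sum_subtractf 1 2 by simp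
qed

lemma partial_lin_R: "partial j (lin_R v) x = (\<Oplus>i k. partial j (partial i (partial k (v i k))) x)
  - (\<Oplus>i k. partial j (partial k (partial k (v i i))) x)"
 unfolding lin_R_eq by (simp only: partial_simps partial_scale partial_sum Cinf_UNIV v)

text \<open>The linearised contracted Bianchi identity. Derivatives commute, so the first and the
  third of the four sums agree and the other two form the gradient of
  \<open>lin_R v\<close>.\<close>

lemma div_lin_Ric: "(\<Oplus>i. partial i (lin_Ric v i j) x) = 1 / 2 * partial j (lin_R v) x"
proof -
 have "partial i (lin_Ric v i j) x = 1 / 2 * (\<Oplus>k. partial i (partial k (partial i (v j k))) x
  + partial i (partial k (partial j (v i k))) x - partial i (partial k (partial k (v i j))) x
  - partial i (partial j (partial i (v k k))) x)" for i
  unfolding lin_Ric_eq by (simp only: partial_simps partial_scale partial_sum Cinf_UNIV v)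
 moreover have "partial i (partial k (partial j (v i k))) = partial j (partial i (partial k (v i k)))" for i k
  by (simp only: partial_commute[OF v, of k j] partial_commute[OF Cinf_partial[OF v], of i j])
 moreover have "partial i (partial j (partial i (v k k))) = partial j (partial i (partial i (v k k)))" for i k
  by (rule partial_commute[OF Cinf_partial[OF v]])
 ultimately have "(\<Oplus>i. partial i (lin_Ric v i j) x) = 1 / 2 * ((\<Oplus>i k. partial i (partial k (partial i (v j k))) x)
   + (\<Oplus>i k. partial j (partial i (partial k (v i k))) x)
   - (\<Oplus>i k. partial i (partial k (partial k (v i j))) x)
   - (\<Oplus>i k. partial j (partial i (partial i (v k k))) x))"
  by (simp only: sum_distrib_left[symmetric] sum.distrib sum_subtractf)
 also have "(\<Oplus>i k. partial i (partial k (partial k (v i j))) x)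
   = (\<Oplus>i k. partial i (partial k (partial i (v j k))) x)"
  by (subst sum.swap) (simp only: partial_commute[OF Cinf_partial[OF v]] v_sym[of j])
 also have "(\<Oplus>i k. partial j (partial i (partial i (v k k))) x)
   = (\<Oplus>i k. partial j (partial k (partial k (v i i))) x)"
  by (rule sum.swap)
 finally show ?thesis unfolding partial_lin_R by simp
qed

lemma Cinf_lin_S: "Cinf UNIV (lin_S c1 c2 v i j)"
 unfolding lin_S_def[abs_def] by (intro Cinf_UNIV Cinf_lin_Ric Cinf_lin_R)

lemma lin_S_sym: "lin_S c1 c2 v i j = lin_S c1 c2 v j i"
 using lin_Ric_sym[of i j] by (auto simp: lin_S_def[abs_def])

lemma div_lin_S: "(\<Oplus>i. partial i (lin_S c1 c2 v i j) x) = (c1 + 2 * c2) * partial j (lin_R v) x"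
proof -
 have "partial i (lin_S c1 c2 v i j) x = 2 * c1 * partial i (lin_Ric v i j) x
   + 2 * c2 * ((if j = i then 1 else 0) * partial i (lin_R v) x)" for i
  unfolding lin_S_def[abs_def] eq_commute[of j i] by (simp only: partial_simps partial_scale Cinf_UNIV Cinf_lin_Ric Cinf_lin_R)
 moreover have "(\<Oplus>i. (if j = i then 1 else 0) * partial i (lin_R v) x) = partial j (lin_R v) x"
  by (simp add: if_distrib[of "%r. r * _"] cong: if_cong)
 ultimately show ?thesis
  by (simp only: sum.distrib sum_distrib_left[symmetric] div_lin_Ric) (simp add: algebra_simps)
qed

lemma trace_lin_S: "(\<Oplus>i. lin_S c1 c2 v i i x) = (2 * c1 + 2 * c2 * real CARD('n)) * lin_R v x"
 by (simp add: lin_S_def sum.distrib sum_distrib_left[symmetric] lin_R_def[symmetric] algebra_simps)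

end

section \<open>Divergence, trace and flux of the fourth order linear operator\<close>

context
 fixes S :: "'n::finite => 'n => real^'n => real" and R :: "real^'n => real" and c t :: real
 assumes S: "!!i j. Cinf UNIV (S i j)" "!!i j. S i j = S j i" and R: "Cinf UNIV R"
  and div: "!!j x. (\<Oplus>i. partial i (S i j) x) = c * partial j R x"
  and tr: "!!x. (\<Oplus>i. S i i x) = t * R x"
begin

text \<open>Only the relations \<open>div\<close> and \<open>tr\<close> between \<open>S\<close> and
  \<open>R\<close> matter here, not the origin of \<open>S\<close>: the assumed divergence turns
  second derivatives of \<open>S\<close> with a contracted index into second derivatives of
  \<open>R\<close>.\<close>

lemma lin_J_eq: "lin_J S a b = (%x. c * partial a (partial b R) x - 1 / 2 * (\<Oplus>k. partial k (partial k (S a b)) x)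
  - 1 / 2 * c * ((if a = b then 1 else 0) * (\<Oplus>k. partial k (partial k R) x)))"
proof
 fix x
 have 1: "(\<Oplus>i. partial i (partial b (S i a)) x) = c * partial b (partial a R) x" for a b x
 proof -
  have "(\<Oplus>i. partial i (partial b (S i a)) x) = (\<Oplus>i. partial b (partial i (S i a)) x)"
   by (simp only: partial_commute[OF S(1), of _ b])
  also have "\<dots> = partial b (%x. \<Oplus>i. partial i (S i a) x) x"
   by (simp only: partial_sum Cinf_UNIV S)
  also have "\<dots> = c * partial b (partial a R) x" unfolding div by (simp only: partial_scale[OF Cinf_partial[OF R]])
  finally show ?thesis .
 qed
 have 2: "(\<Oplus>i j. partial i (partial j (S i j)) x) = c * (\<Oplus>k. partial k (partial k R) x)"
  by (subst sum.swap) (simp only: 1 sum_distrib_left)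
 have 3: "(\<Oplus>j. partial j (partial b (S a j)) x) = c * partial b (partial a R) x"
  using 1[of b a x] by (simp only: S(2)[of a])
 show "lin_J S a b x = c * partial a (partial b R) x - 1 / 2 * (\<Oplus>k. partial k (partial k (S a b)) x)
  - 1 / 2 * c * ((if a = b then 1 else 0) * (\<Oplus>k. partial k (partial k R) x))"
  unfolding lin_J_def 1 2 3 partial_commute[OF R, of b a] by (simp add: algebra_simps)
qed

lemma lin_J_sym: "lin_J S a b = lin_J S b a"
 unfolding lin_J_eq using partial_commute[OF R, of a b] S(2)[of a b] by auto

lemma Cinf_lin_J: "Cinf UNIV (lin_J S a b)"
 unfolding lin_J_eq by (intro Cinf_UNIV S R)

text \<open>By \<open>lin_J_eq\<close> every term is a multiple of the gradient of the Laplacian of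
  \<open>R\<close>, with coefficients \<open>c\<close>, \<open>- c / 2\<close> and
  \<open>- c / 2\<close>.\<close>

lemma div_lin_J: "(\<Oplus>j. partial j (lin_J S i j) x) = 0"
proof -
 let ?\<Delta> = "%x. \<Oplus>k. partial k (partial k R) x"
 have "partial j (lin_J S i j) x = c * partial j (partial i (partial j R)) x
   - 1 / 2 * (\<Oplus>k. partial j (partial k (partial k (S i j))) x)
   - 1 / 2 * c * ((if i = j then 1 else 0) * partial j ?\<Delta> x)" for j
  unfolding lin_J_eq by (simp only: partial_simps partial_scale partial_sum Cinf_UNIV S R)
 hence "(\<Oplus>j. partial j (lin_J S i j) x) = c * (\<Oplus>j. partial j (partial i (partial j R)) x)
   - 1 / 2 * (\<Oplus>j k. partial j (partial k (partial k (S i j))) x)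
   - 1 / 2 * c * (\<Oplus>j. (if i = j then 1 else 0) * partial j ?\<Delta> x)"
  by (simp only: sum_subtractf sum_distrib_left)
 moreover have "(\<Oplus>j. (if i = j then 1 else 0) * partial j ?\<Delta> x) = partial i ?\<Delta> x"
  by (simp add: if_distrib[of "%r. r * _"] cong: if_cong)
 moreover have "(\<Oplus>j. partial j (partial i (partial j R)) x) = partial i ?\<Delta> x"
  by (simp only: partial_sum Cinf_UNIV R partial_commute[OF Cinf_partial[OF R], of _ i])
 moreover have "(\<Oplus>j k. partial j (partial k (partial k (S i j))) x) = c * partial i ?\<Delta> x"
 proof -
  have "partial j (partial k (partial k (S i j))) = partial k (partial k (partial j (S j i)))" for j k
   by (simp only: partial_commute[OF Cinf_partial[OF S(1)], of j k] partial_commute[OF S(1), of j k] S(2)[of i j])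
  hence "(\<Oplus>j k. partial j (partial k (partial k (S i j))) x)
   = (\<Oplus>j k. partial k (partial k (partial j (S j i))) x)" by simp
  also have "\<dots> = (\<Oplus>k. partial k (partial k (%x. \<Oplus>j. partial j (S j i) x)) x)"
   by (subst sum.swap) (simp only: partial_sum Cinf_UNIV S)
  also have "\<dots> = (\<Oplus>k. c * partial k (partial k (partial i R)) x)"
   unfolding div by (simp only: partial_scale[OF Cinf_partial[OF R]]
    partial_scale[OF Cinf_partial[OF Cinf_partial[OF R]]])
  also have "\<dots> = c * partial i ?\<Delta> x"
   by (simp only: partial_sum Cinf_UNIV R sum_distrib_left[symmetric] partial_commute[OF R, of _ i]
     partial_commute[OF Cinf_partial[OF R], of _ i])
  finally show ?thesis .
 qed
 ultimately show ?thesis by simp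
qed

lemma trace_lin_J: "(\<Oplus>i. lin_J S i i x)
 = (c - t / 2 - real CARD('n) * c / 2) * (\<Oplus>k. partial k (partial k R) x)"
proof -
 have "(\<Oplus>i k. partial k (partial k (S i i)) x) = (\<Oplus>k. partial k (partial k (%x. \<Oplus>i. S i i x)) x)"
  by (subst sum.swap) (simp only: partial_sum Cinf_UNIV S)
 also have "\<dots> = t * (\<Oplus>k. partial k (partial k R) x)"
  unfolding tr by (simp only: partial_scale[OF R] partial_scale[OF Cinf_partial[OF R]] sum_distrib_left)
 finally have "(\<Oplus>i k. partial k (partial k (S i i)) x) = t * (\<Oplus>k. partial k (partial k R) x)" .
 moreover have "(\<Oplus>i. lin_J S i i x) = c * (\<Oplus>k. partial k (partial k R) x)
   - 1 / 2 * (\<Oplus>i k. partial k (partial k (S i i)) x)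
   - (\<Sum>i\<in>(UNIV :: 'n set). 1 / 2 * c * (1 * (\<Oplus>k. partial k (partial k R) x)))"
  unfolding lin_J_eq by (simp only: sum_subtractf sum_distrib_left refl if_True)
 ultimately show ?thesis by (simp add: algebra_simps)
qed

text \<open>As \<open>lin_J S\<close> is divergence free, contracting it with the position field
  gives a field whose divergence is the trace, a multiple of the Laplacian of \<open>R\<close>. The
  divergence theorem, used twice, turns this into the flux of the gradient of
  \<open>R\<close>.\<close>

lemma lin_J_flux:
 assumes r: "r > 0"
 shows "(LINT x:sphere 0 r|sphere_measure r. \<Oplus>j. (\<Oplus>i. x $ i * lin_J S i j x) * ((1 / r) *\<^sub>R x) $ j)
  = (c - t / 2 - real CARD('n) * c / 2) * (LINT x:sphere 0 r|sphere_measure r. \<Oplus>j. partial j R x * ((1 / r) *\<^sub>R x) $ j)"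
proof -
 have Cx: "Cinf UNIV (%x :: real^'n. x $ i)" for i
  by (rule Cinf_linear[OF open_UNIV bounded_linear_vec_nth])
 have px: "partial j (%x :: real^'n. x $ i) x = (if j = i then 1 else 0)" for i j x
  by (simp add: partial_eq_dd dd_bounded_linear[OF bounded_linear_vec_nth] axis_def eq_commute)
 have CV: "Cinf UNIV (%x. \<Oplus>i. x $ i * lin_J S i j x)" for j
  by (intro Cinf_UNIV Cinf_lin_J Cx)
 have dV: "(\<Oplus>j. partial j (%x. \<Oplus>i. x $ i * lin_J S i j x) x)
   = (c - t / 2 - real CARD('n) * c / 2) * (\<Oplus>j. partial j (partial j R) x)" for x
 proof -
  have "partial j (%x. \<Oplus>i. x $ i * lin_J S i j x) x
    = (\<Oplus>i. x $ i * partial j (lin_J S i j) x + (if j = i then 1 else 0) * lin_J S i j x)" for j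
   by (simp only: partial_sum Cinf_UNIV Cinf_lin_J Cx
     partial_mult[OF Cinf_differentiable[OF Cx] Cinf_differentiable[OF Cinf_lin_J]] UNIV_I px)
  hence "(\<Oplus>j. partial j (%x. \<Oplus>i. x $ i * lin_J S i j x) x)
   = (\<Oplus>j i. x $ i * partial j (lin_J S i j) x) + (\<Oplus>j. lin_J S j j x)"
   by (simp add: sum.distrib if_distrib[of "%r. r * _"] cong: if_cong)
  also have "(\<Oplus>j i. x $ i * partial j (lin_J S i j) x) = 0"
   by (subst sum.swap) (simp only: sum_distrib_left[symmetric] div_lin_J, simp)
  finally show ?thesis by (simp add: trace_lin_J)
 qed
 show ?thesis
  unfolding sphere_divergence[where V = "%j. partial j R", OF Cinf_partial[OF R] r]
   sphere_divergence[where V = "%j x. \<Oplus>i. x $ i * lin_J S i j x", OF CV r] dV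
  by (subst Bochner_Integration.integral_mult_right_zero[symmetric]) (simp add: mult.left_commute)
qed

end

section \<open>Integrals over large spheres\<close>

lemma sphere_measure_sphere:
 assumes r: "r > 0"
 shows "set_integrable (sphere_measure r) (sphere (0 :: real^'n::finite) r) (%x. 1 :: real)"
  "(LINT x:sphere (0 :: real^'n) r|sphere_measure r. 1) = real CARD('n) * unit_ball_vol (real CARD('n)) * r ^ CARD('n) / r"
proof -
 have "(LINT x:sphere (0 :: real^'n) r|sphere_measure r. 1)
   = real CARD('n) / r * (LINT x|lborel. indicator (ball (0 :: real^'n) r) x * 1)"
  by (rule sphere_measure_integral) (use r in \<open>auto simp: set_borel_measurable_def intro!: borel_measurable_indicator borel_closed\<close>)
 also have "(LINT x|lborel. indicator (ball (0 :: real^'n) r) x * 1) = unit_ball_vol (real CARD('n)) * r ^ CARD('n)"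
  using r by (simp add: content_ball)
 finally show eq: "(LINT x:sphere (0 :: real^'n) r|sphere_measure r. 1)
  = real CARD('n) * unit_ball_vol (real CARD('n)) * r ^ CARD('n) / r" by simp
 \<comment> \<open>A positive value certifies integrability, since the integral of a function that
   is not integrable is 0 by convention.\<close>
 have "\<dots> > 0" using r by (intro divide_pos_pos mult_pos_pos) auto
 thus "set_integrable (sphere_measure r) (sphere (0 :: real^'n) r) (%x. 1 :: real)"
  using eq not_integrable_integral_eq unfolding set_integrable_def set_lebesgue_integral_def
  by (metis less_irrefl)
qed

context
 fixes f :: "real^'n::finite => real" and r :: real
 assumes r: "r > 0" and f: "continuous_on (sphere 0 r) f"
begin

lemma sphere_integrable: "set_integrable (sphere_measure r) (sphere 0 r) f"
 and sphere_integral_bound: "(!!x. norm x = r ==> \<bar>f x\<bar> \<le> C) ==>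
  \<bar>LINT x:sphere 0 r|sphere_measure r. f x\<bar> \<le> C * (real CARD('n) * unit_ball_vol (real CARD('n)) * r ^ CARD('n) / r)"
proof -
 have meas: "(%x. indicator (sphere 0 r) x *\<^sub>R f x) \<in> borel_measurable (sphere_measure r)"
 proof -
  have "(%x. indicator (sphere 0 r) x *\<^sub>R f x) \<in> borel_measurable borel"
   by (rule borel_measurable_continuous_on_indicator[OF _ f]) simp
  thus ?thesis by (simp add: sphere_measure_def)
 qed
 have one: "integrable (sphere_measure r) (%x :: real^'n. indicator (sphere 0 r) x *\<^sub>R (1 :: real))"
  using sphere_measure_sphere(1)[OF r] unfolding set_integrable_def .
 have int: "integrable (sphere_measure r) (%x. indicator (sphere 0 r) x *\<^sub>R f x)"
  if "!!x. norm x = r ==> \<bar>f x\<bar> \<le> C" for C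
 proof (rule Bochner_Integration.integrable_bound[OF _ meas])
  show "integrable (sphere_measure r) (%x :: real^'n. C * (indicator (sphere 0 r) x *\<^sub>R (1 :: real)))"
   using one by (rule integrable_mult_right)
  show "AE x in sphere_measure r. norm (indicator (sphere 0 r) x *\<^sub>R f x)
    \<le> norm (C * (indicator (sphere 0 r) x *\<^sub>R (1 :: real)))"
  proof (rule AE_I2)
   fix x :: "real^'n"
   show "norm (indicator (sphere 0 r) x *\<^sub>R f x) \<le> norm (C * (indicator (sphere 0 r) x *\<^sub>R (1 :: real)))"
    using that[of x] by (auto split: split_indicator)
  qed
 qed
 have "compact (f ` sphere 0 r)" by (rule compact_continuous_image[OF f]) simp
 then obtain C0 where "\<forall>y\<in>f ` sphere 0 r. norm y \<le> C0" using compact_imp_bounded bounded_iff by blast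
 hence "!!x. norm x = r ==> \<bar>f x\<bar> \<le> C0" by auto
 from int[OF this] show "set_integrable (sphere_measure r) (sphere 0 r) f"
  unfolding set_integrable_def .
 assume C: "!!x. norm x = r ==> \<bar>f x\<bar> \<le> C"
 have "norm (LINT x|sphere_measure r. indicator (sphere 0 r) x *\<^sub>R f x)
   \<le> (LINT x|sphere_measure r. C * (indicator (sphere (0 :: real^'n) r) x *\<^sub>R (1 :: real)))"
 proof (rule Bochner_Integration.integral_norm_bound_integral)
  show "integrable (sphere_measure r) (%x. indicator (sphere 0 r) x *\<^sub>R f x)" by (rule int[of C]) (rule C)
  show "integrable (sphere_measure r) (%x :: real^'n. C * (indicator (sphere 0 r) x *\<^sub>R (1 :: real)))"
   using one by (rule integrable_mult_right)
  fix x :: "real^'n"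
  show "norm (indicator (sphere 0 r) x *\<^sub>R f x) \<le> C * (indicator (sphere 0 r) x *\<^sub>R (1 :: real))"
   using C[of x] by (auto split: split_indicator)
 qed
 also have "\<dots> = C * (LINT x:sphere (0 :: real^'n) r|sphere_measure r. 1)"
  unfolding set_lebesgue_integral_def by (rule Bochner_Integration.integral_mult_right_zero)
 finally have "norm (LINT x|sphere_measure r. indicator (sphere 0 r) x *\<^sub>R f x)
   \<le> C * (real CARD('n) * unit_ball_vol (real CARD('n)) * r ^ CARD('n) / r)"
  unfolding sphere_measure_sphere(2)[OF r] .
 thus "\<bar>LINT x:sphere 0 r|sphere_measure r. f x\<bar>
   \<le> C * (real CARD('n) * unit_ball_vol (real CARD('n)) * r ^ CARD('n) / r)"
  unfolding set_lebesgue_integral_def real_norm_def .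
qed

end

lemma sphere_integral_cong:
 fixes f g :: "real^'n::finite => real"
 assumes "!!x. norm x = r ==> f x = g x"
 shows "(LINT x:sphere 0 r|sphere_measure r. f x) = (LINT x:sphere 0 r|sphere_measure r. g x)"
 unfolding set_lebesgue_integral_def
 by (rule Bochner_Integration.integral_cong[OF refl]) (use assms in \<open>auto split: split_indicator\<close>)

text \<open>Dyadic comparison: where \<open>2^k \<le> |x| < 2^(k+1)\<close> the function is at most
  \<open>q^k\<close> with \<open>q = 2^(-s)\<close>, and the ball of radius \<open>2^(k+1)\<close>
  has volume of order \<open>2^(n k)\<close>; the series converges because
  \<open>q 2^n < 1\<close>.\<close>

lemma integrable_norm_powr:
 assumes s: "s > real CARD('n)"
 shows "integrable lborel (%x :: real^'n::finite. indicator exterior x * norm x powr (- s))"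
proof -
 let ?n = "CARD('n)"
 define q where "q = 2 powr (- s)"
 define g where "g = (%k (x :: real^'n). indicator (ball 0 (2 ^ Suc k)) x * q ^ k)"
 have q: "0 < q" "q < 1" using s unfolding q_def by (auto simp: powr_less_one)
 have qk: "q ^ k = (2 ^ k) powr (- s)" for k
  by (induction k) (auto simp: q_def powr_mult)
 have qn: "q * 2 ^ ?n < 1"
 proof -
  have "q * 2 ^ ?n = 2 powr (- s + real ?n)" unfolding q_def powr_add by (simp add: powr_realpow)
  also have "\<dots> < 1" using s by (intro powr_less_one) auto
  finally show ?thesis .
 qed
 have gi: "integrable lborel (g k)" for k
  unfolding g_def by (intro integrable_mult_left integrable_real_indicator) (auto simp: emeasure_ball)
 have gn: "(LINT x|lborel. norm (g k x)) = unit_ball_vol (real ?n) * 2 ^ ?n * (q * 2 ^ ?n) ^ k" for k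
 proof -
  have "(LINT x|lborel. norm (g k x)) = (LINT x|lborel. indicator (ball (0 :: real^'n) (2 ^ Suc k)) x * q ^ k)"
   using q by (intro Bochner_Integration.integral_cong refl) (auto simp: g_def)
  also have "\<dots> = unit_ball_vol (real ?n) * (2 ^ Suc k) ^ ?n * q ^ k"
   by (simp add: content_ball del: power_Suc)
  also have "\<dots> = unit_ball_vol (real ?n) * 2 ^ ?n * (q * 2 ^ ?n) ^ k"
   by (simp add: power_mult_distrib power_mult[symmetric] mult.commute)
  finally show ?thesis .
 qed
 have sg: "summable (%k. g k x)" and sgn: "summable (%k. norm (g k x))" for x
 proof -
  have sq: "summable (%k. q ^ k)" using q by (intro summable_geometric) auto
  have b: "norm (norm (g k x)) \<le> q ^ k" for k using q by (auto simp: g_def split: split_indicator)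
  show "summable (%k. norm (g k x))"
   by (rule summable_comparison_test'[OF sq, of 0]) (rule b)
  thus "summable (%k. g k x)" by (rule summable_norm_cancel)
 qed
 have "integrable lborel (%x. \<Sum>k. g k x)"
 proof (rule integrable_suminf[OF gi])
  show "AE x in lborel. summable (%i. norm (g i x))" using sgn by simp
  show "summable (%i. LINT x|lborel. norm (g i x))"
   unfolding gn using qn q by (intro summable_mult summable_geometric) auto
 qed
 thus ?thesis
 proof (rule Bochner_Integration.integrable_bound)
  show "(%x :: real^'n. indicator exterior x * norm x powr (- s)) \<in> borel_measurable lborel" by measurable
  show "AE x :: real^'n in lborel. norm (indicator exterior x * norm x powr (- s)) \<le> norm (\<Sum>k. g k x)"
  proof (rule AE_I2)
   fix x :: "real^'n"
   have g0: "0 \<le> g k x" for k using q by (auto simp: g_def)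
   show "norm (indicator exterior x * norm x powr (- s)) \<le> norm (\<Sum>k. g k x)"
   proof (cases "x \<in> exterior")
    case True
    hence x: "norm x > 1" by simp
    have ex: "\<exists>m. norm x < 2 ^ m" by (rule real_arch_pow) simp
    define m where "m = (LEAST m. norm x < 2 ^ m)"
    have m: "norm x < 2 ^ m" unfolding m_def using ex by (rule LeastI_ex)
    have "m \<noteq> 0" using m x by (cases m) auto
    then obtain k where k: "m = Suc k" by (cases m) auto
    have "\<not> norm x < 2 ^ k" using k unfolding m_def by (metis lessI not_less_Least)
    hence k2: "2 ^ k \<le> norm x" by simp
    have "norm x powr (- s) \<le> (2 ^ k) powr (- s)"
     using s k2 by (intro powr_mono2') auto
    also have "\<dots> = g k x" using m k by (simp add: g_def qk)
    also have "g k x = (\<Sum>i\<in>{k}. g i x)" by simp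
    also have "\<dots> \<le> (\<Sum>k. g k x)" by (rule sum_le_suminf[OF sg]) (use g0 in auto)
    finally show ?thesis using True by simp
   qed (simp add: suminf_nonneg[OF sg g0])
  qed
 qed
qed

lemma tendsto_ball_integral:
 fixes f :: "'a::euclidean_space => real"
 assumes f: "integrable lborel f"
 shows "((%r. LINT x|lborel. indicator (ball 0 r) x * f x) \<longlongrightarrow> (LINT x|lborel. f x)) at_top"
proof (rule integral_dominated_convergence_at_top)
 show m: "f \<in> borel_measurable lborel" using f by simp
 show "(%x. indicator (ball 0 r) x * f x) \<in> borel_measurable lborel" for r
  using m by measurable
 show "integrable lborel (%x. norm (f x))" using f by simp
 show "AE x in lborel. ((%r. indicator (ball 0 r) x * f x) \<longlongrightarrow> f x) at_top"
 proof (rule AE_I2)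
  fix x :: 'a
  have "\<forall>\<^sub>F r in at_top. indicator (ball 0 r) x * f x = f x"
   using eventually_gt_at_top[of "norm x"] by eventually_elim simp
  thus "((%r. indicator (ball 0 r) x * f x) \<longlongrightarrow> f x) at_top" by (rule tendsto_eventually)
 qed
 show "\<forall>\<^sub>F r in at_top. AE x in lborel. norm (indicator (ball 0 r) x * f x) \<le> norm (f x)"
  by (intro always_eventually allI AE_I2) (auto split: split_indicator)
qed

section \<open>Fluxes through large spheres in the end\<close>

context asymptotics
begin

lemma w_bound: "\<forall>\<^sub>F x in at_infinity. w x > 1 / 2"
proof -
 have G1: "((%x. G x $ i $ j) \<longlongrightarrow> (mat 1 :: real^'n^'n) $ i $ j) at_infinity" for i j
 proof -
  have "((%x. u i j x + (if i = j then 1 else 0)) \<longlongrightarrow> 0 + (if i = j then 1 else 0)) at_infinity"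
   by (intro tendsto_add u_tendsto tendsto_const)
  thus ?thesis by (simp add: u_def mat_def)
 qed
 have "((%x. det (G x)) \<longlongrightarrow> det (mat 1 :: real^'n^'n)) at_infinity"
  unfolding det_def by (intro tendsto_sum tendsto_mult tendsto_const tendsto_prod G1)
 hence "(w \<longlongrightarrow> sqrt 1) at_infinity" by (intro tendsto_real_sqrt) simp
 from order_tendstoD(1)[OF this, of "1 / 2"] show ?thesis by simp
qed

text \<open>The thresholds 2 and 3 concern the squared norm: \<open>v\<close> vanishes near the unit
  ball, so it is smooth on the whole space, and it equals \<open>u\<close> where
  \<open>|x| > 2\<close>.\<close>

definition v :: "'n => 'n => real^'n => real" where
 "v a b = (%x. if x \<in> exterior then radial_step 2 3 x * u a b x else 0)"

abbreviation far :: "(real^'n) set" where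
 "far \<equiv> {x. norm x > 2}"

lemma far: "open far" "x \<in> far ==> x \<in> exterior"
 by (auto intro!: open_Collect_less continuous_intros)

lemma Cinf_v: "Cinf UNIV (v a b)"
 unfolding v_def
proof (rule Cinf_extend_zero[of _ "{x. x \<bullet> x \<ge> 2}"])
 show "closed {x :: real^'n. x \<bullet> x \<ge> 2}" by (intro closed_Collect_le continuous_intros)
 show "{x :: real^'n. x \<bullet> x \<ge> 2} \<subseteq> exterior"
 proof
  fix x :: "real^'n" assume "x \<in> {x. x \<bullet> x \<ge> 2}"
  hence "norm x ^ 2 \<ge> 2" by (simp add: power2_norm_eq_inner)
  hence "\<not> norm x \<le> 1" using power_mono[of "norm x" 1 2] by auto
  thus "x \<in> exterior" by simp
 qed
 show "Cinf exterior (%x. radial_step 2 3 x * u a b x)"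
  by (intro Cinf_mult S Cinf_subset[OF radial_step(1)] decay_Cinf[OF u_decay]) auto
 show "radial_step 2 3 x * u a b x = 0" if "x \<in> exterior - {x. x \<bullet> x \<ge> 2}" for x
  using radial_step(2)[of 2 3 x] that by auto
qed (rule S)

lemma v_sym: "v a b = v b a"
 using G_sym by (auto simp: v_def u_def fun_eq_iff)

lemma v_far: "x \<in> far ==> v a b x = u a b x"
proof -
 assume x: "x \<in> far"
 hence "norm x ^ 2 \<ge> 2 ^ 2" by (intro power_mono) auto
 hence "x \<bullet> x \<ge> 3" by (simp add: power2_norm_eq_inner)
 thus ?thesis using radial_step(3)[of 2 3 x] far(2)[OF x] by (simp add: v_def)
qed

lemma lin_u: "R1 = lin_R u" "S1 = lin_S \<kappa>1 \<kappa>2 u" "Ylin = lin_J S1"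
proof -
 have \<Gamma>: "\<Gamma>1 = lin_\<Gamma> u" by (simp add: \<Gamma>1_def lin_\<Gamma>_def fun_eq_iff)
 have Ric: "Ric1 = lin_Ric u" unfolding fun_eq_iff Ric1_def lin_Ric_def \<Gamma> by simp
 show R: "R1 = lin_R u" unfolding fun_eq_iff R1_def lin_R_def Ric by simp
 show "S1 = lin_S \<kappa>1 \<kappa>2 u" unfolding fun_eq_iff S1_def lin_S_def Ric R by simp
 show "Ylin = lin_J S1" unfolding fun_eq_iff Ylin_eq lin_J_def by simp
qed

abbreviation Rv :: "real^'n => real" where "Rv \<equiv> lin_R v"
abbreviation Sv :: "'n => 'n => real^'n => real" where "Sv \<equiv> lin_S \<kappa>1 \<kappa>2 v"
abbreviation \<Delta>R :: "real^'n => real" where "\<Delta>R \<equiv> %x. \<Oplus>k. partial k (partial k Rv) x"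

lemma R1_far: "x \<in> far ==> R1 x = Rv x"
 unfolding lin_u by (rule lin_R_cong[OF far(1)]) (simp_all only: v_far)

lemma Ylin_far: "x \<in> far ==> Ylin a b x = lin_J Sv a b x"
 unfolding lin_u by (rule lin_J_cong[OF far(1)], rule lin_S_cong[OF far(1)]) (simp_all only: v_far)

lemma \<Delta>R_far: "x \<in> far ==> (\<Oplus>i. partial i (partial i R1) x) = \<Delta>R x"
 by (intro sum.cong refl partial_cong[OF far(1)] R1_far) auto

lemmas Cinf_Rv = Cinf_lin_R[of v, OF Cinf_v v_sym]

lemma Cinf_\<Delta>R: "Cinf UNIV \<Delta>R"
 by (intro Cinf_UNIV Cinf_Rv)

lemma flux_Rv: "r > 0 ==> (LINT x:sphere 0 r|sphere_measure r. \<Oplus>j. partial j Rv x * ((1 / r) *\<^sub>R x) $ j)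
  = (LINT x|lborel. indicator (ball 0 r) x * \<Delta>R x)"
 by (rule sphere_divergence[OF Cinf_partial[OF Cinf_Rv]])

text \<open>Beyond radius 2 the derivatives of the metric are those of \<open>v\<close>, and up to
  renaming of indices the energy integrand is minus the gradient of \<open>Rv\<close>. The flux
  depends on \<open>v\<close> near the sphere only, so the ball integral does not depend on the
  cutoff.\<close>

lemma energy_flux_eq:
 assumes r: "r > 2"
 shows "energy_flux G r = - (LINT x|lborel. indicator (ball 0 r) x * \<Delta>R x)"
proof -
 have d1: "partial k (%y. G y $ a $ b) y = partial k (v a b) y" if "y \<in> far" for k a b y
  unfolding partial_G[OF far(2)[OF that]] by (rule partial_cong[OF far(1) that]) (simp only: v_far)
 have d2: "partial i (partial k (%y. G y $ a $ b)) y = partial i (partial k (v a b)) y" if "y \<in> far" for i k a b y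
  by (rule partial_cong[OF far(1) that d1])
 have d3: "partials [j, i, k] (%y. G y $ a $ b) y = partial j (partial i (partial k (v a b))) y" if "y \<in> far" for j i k a b y
  unfolding partials_def by simp (rule partial_cong[OF far(1) that d2])
 have "energy_flux G r = (LINT x:sphere 0 r|sphere_measure r. - (\<Oplus>j. partial j Rv x * ((1 / r) *\<^sub>R x) $ j))"
  unfolding energy_flux_def
 proof (rule sphere_integral_cong)
  fix x :: "real^'n" assume "norm x = r"
  hence x: "x \<in> far" using r by simp
  have "(\<Oplus>i a. partials [j, i, i] (%y. G y $ a $ a) x - partials [j, a, i] (%y. G y $ a $ i) x)
    = - partial j Rv x" for j
  proof -
   have "(\<Oplus>i a. partials [j, i, i] (%y. G y $ a $ a) x - partials [j, a, i] (%y. G y $ a $ i) x)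
    = (\<Oplus>i a. partial j (partial i (partial i (v a a))) x)
     - (\<Oplus>i a. partial j (partial a (partial i (v a i))) x)"
    by (simp only: d3[OF x] sum_subtractf)
   also have "(\<Oplus>i a. partial j (partial i (partial i (v a a))) x)
     = (\<Oplus>i k. partial j (partial k (partial k (v i i))) x)" by (rule sum.swap)
   also have "(\<Oplus>i a. partial j (partial a (partial i (v a i))) x)
     = (\<Oplus>i k. partial j (partial i (partial k (v i k))) x)" by (rule sum.swap)
   finally show ?thesis by (simp add: partial_lin_R[of v, OF Cinf_v v_sym])
  qed
  thus "(\<Oplus>j. (\<Oplus>i a. partials [j, i, i] (%y. G y $ a $ a) x - partials [j, a, i] (%y. G y $ a $ i) x)
    * ((1 / r) *\<^sub>R x) $ j) = - (\<Oplus>j. partial j Rv x * ((1 / r) *\<^sub>R x) $ j)"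
   by (simp add: sum_negf)
 qed
 also have "\<dots> = - (LINT x:sphere 0 r|sphere_measure r. \<Oplus>j. partial j Rv x * ((1 / r) *\<^sub>R x) $ j)"
  by (simp add: set_lebesgue_integral_def)
 finally show ?thesis using flux_Rv r by simp
qed

lemma flux_lin_J:
 assumes n: "CARD('n) \<ge> 3" and r: "r > 2"
 shows "(LINT x:sphere 0 r|sphere_measure r. \<Oplus>j. (\<Oplus>i. x $ i * lin_J Sv i j x) * ((1 / r) *\<^sub>R x) $ j)
  = (real CARD('n) - 4) / (4 * (real CARD('n) - 1)) * energy_flux G r"
proof -
 let ?n = "real CARD('n)"
 define c where "c = \<kappa>1 + 2 * \<kappa>2"
 define t where "t = 2 * \<kappa>1 + 2 * \<kappa>2 * ?n"
 have n3: "?n \<ge> 3" using n by simp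
 have "(LINT x:sphere 0 r|sphere_measure r. \<Oplus>j. (\<Oplus>i. x $ i * lin_J Sv i j x) * ((1 / r) *\<^sub>R x) $ j)
  = (c - t / 2 - ?n * c / 2) * (LINT x:sphere 0 r|sphere_measure r. \<Oplus>j. partial j Rv x * ((1 / r) *\<^sub>R x) $ j)"
 proof (rule lin_J_flux)
  show "Cinf UNIV (Sv i j)" for i j by (rule Cinf_lin_S[of v, OF Cinf_v v_sym])
  show "Sv i j = Sv j i" for i j by (rule lin_S_sym[of v, OF Cinf_v v_sym])
  show "Cinf UNIV Rv" by (rule Cinf_Rv)
  show "(\<Oplus>i. partial i (Sv i j) x) = c * partial j Rv x" for j x
   unfolding c_def by (rule div_lin_S[of v, OF Cinf_v v_sym])
  show "(\<Oplus>i. Sv i i x) = t * Rv x" for x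
   unfolding t_def by (rule trace_lin_S[of v, OF Cinf_v v_sym])
 qed (use r in simp)
 also have "c - t / 2 - ?n * c / 2 = - ((?n - 4) / (4 * (?n - 1)))"
 proof -
  have "c - t / 2 - ?n * c / 2 = - (?n * \<kappa>1 / 2) - 2 * (?n - 1) * \<kappa>2"
   by (simp add: c_def t_def field_simps)
  also have "2 * (?n - 1) * \<kappa>2 = (?n ^ 3 - 4 * ?n\<^sup>2 + 16 * ?n - 16) / (4 * (?n - 1) * (?n - 2)\<^sup>2)"
  proof -
   have frac: "2 * a * (N / (8 * a\<^sup>2 * b)) = N / (4 * a * b)" if "a \<noteq> 0" for a b N :: real
    using that by (cases "b = 0") (auto simp: power2_eq_square field_simps)
   show ?thesis unfolding \<kappa>2_def by (rule frac) (use n3 in simp)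
  qed
  also have "?n * \<kappa>1 / 2 = - (4 * ?n * (?n - 1)) / (4 * (?n - 1) * (?n - 2)\<^sup>2)"
   using n3 by (simp add: \<kappa>1_def field_simps)
  also have "- (- (4 * ?n * (?n - 1)) / (4 * (?n - 1) * (?n - 2)\<^sup>2))
    - (?n ^ 3 - 4 * ?n\<^sup>2 + 16 * ?n - 16) / (4 * (?n - 1) * (?n - 2)\<^sup>2)
   = - (((?n - 4) * (?n - 2)\<^sup>2) / (4 * (?n - 1) * (?n - 2)\<^sup>2))"
  proof -
   \<comment> \<open>Here the numerator \<open>n^3 - 4 n^2 + 16 n - 16\<close> in \<open>Q\<close>
     matters: combined with the contribution of \<open>|Ric|^2\<close> it becomes a multiple of
     \<open>(n - 2)^2\<close>, which then cancels.\<close>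
   have "4 * ?n * (?n - 1) - (?n ^ 3 - 4 * ?n\<^sup>2 + 16 * ?n - 16) = - ((?n - 4) * (?n - 2)\<^sup>2)"
    by (simp add: power2_eq_square power3_eq_cube algebra_simps)
   thus ?thesis by (simp only: minus_divide_left minus_minus diff_divide_distrib[symmetric])
  qed
  also have "\<dots> = - ((?n - 4) / (4 * (?n - 1)))" using n3 by simp
  finally show ?thesis .
 qed
 finally show ?thesis using flux_Rv[of r] energy_flux_eq[OF r] r by simp
qed

text \<open>Far out \<open>\<Delta>R\<close> equals \<open>-2 (n - 1) (Q - q)\<close> with
  \<open>q\<close> of order \<open>|x|^(-2\<tau>-4)\<close>. There \<open>Q\<close> is integrable
  because it is so against the density \<open>w\<close>, which exceeds 1/2, and \<open>q\<close>
  because \<open>2\<tau> + 4 > n\<close>; on the remaining ball \<open>\<Delta>R\<close> is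
  bounded.\<close>

lemma integrable_\<Delta>R:
 assumes n: "CARD('n) \<ge> 3" and \<tau>n: "\<tau> > (real CARD('n) - 4) / 2"
  and Q: "integrable lborel (%x. indicator exterior x * (Q_coord G x * w x))"
 shows "integrable lborel \<Delta>R"
proof -
 let ?m = "2 * (real CARD('n) - 1)"
 define s where "s = \<tau> + 4 + \<tau>"
 have m: "?m > 0" using n by simp
 have s: "s > real CARD('n)" using \<tau>n by (simp add: s_def field_simps)
 define q where "q = (%x. Q_coord G x - - 1 / ?m * (\<Oplus>i. partial i (partial i R1) x))"
 have "decay 0 s q" using Q_approx unfolding approx_def q_def s_def by simp
 from decay_bigo[OF this] obtain C where C: "C > 0" "\<forall>\<^sub>F x in at_infinity. norm (q x) \<le> C * norm (norm x powr - s)"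
  by (rule landau_o.bigE)
 have "\<forall>\<^sub>F x in at_infinity. norm (q x) \<le> C * norm (norm x powr - s) \<and> w x > 1 / 2"
  using C(2) w_bound by (rule eventually_conj)
 then obtain \<rho>0 where \<rho>0: "!!x. norm x \<ge> \<rho>0 ==> norm (q x) \<le> C * norm (norm x powr - s) \<and> w x > 1 / 2"
  unfolding eventually_at_infinity by blast
 define \<rho> where "\<rho> = max \<rho>0 2"
 obtain B where B: "B \<ge> 0" "!!x. x \<in> cball 0 \<rho> ==> \<bar>\<Delta>R x\<bar> \<le> B"
  using Cinf_bounded_on_cball[OF Cinf_\<Delta>R] by blast
 let ?b = "%x. B * indicator (cball 0 \<rho>) x + ?m * 2 * norm (indicator exterior x * (Q_coord G x * w x))
   + ?m * C * (indicator exterior x * norm x powr - s)"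
 have int: "integrable lborel ?b"
  using Q integrable_norm_powr[OF s] emeasure_compact_finite[OF compact_cball, of "0 :: real^'n" \<rho>]
  by (intro Bochner_Integration.integrable_add integrable_mult_right integrable_norm integrable_real_indicator) auto
 show ?thesis
 proof (rule Bochner_Integration.integrable_bound[OF int])
  show "\<Delta>R \<in> borel_measurable lborel" using Cinf_borel_measurable[OF Cinf_\<Delta>R] by simp
  show "AE x in lborel. norm (\<Delta>R x) \<le> norm (?b x)"
  proof (rule AE_I2)
   fix x :: "real^'n"
   have nn: "0 \<le> ?m * 2 * norm (indicator exterior x * (Q_coord G x * w x))"
    "0 \<le> ?m * C * (indicator exterior x * norm x powr - s)"
    "0 \<le> B * indicator (cball 0 \<rho>) x" using m C B by auto
   have "\<bar>\<Delta>R x\<bar> \<le> ?b x"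
   proof (cases "x \<in> cball 0 \<rho>")
    case True
    have "\<bar>\<Delta>R x\<bar> \<le> B * indicator (cball 0 \<rho>) x" using B(2)[OF True] True by (simp add: indicator_def)
    thus ?thesis using nn(1,2) by linarith
   next
    case False
    hence x: "x \<in> far" "norm x \<ge> \<rho>0" "x \<in> exterior" by (auto simp: \<rho>_def)
    have "\<Delta>R x = - ?m * (Q_coord G x - q x)"
    proof -
     have gen: "L = - k * (Q - (Q - - 1 / k * L))" if "k > 0" for k L Q :: real using that by simp
     show ?thesis unfolding q_def \<Delta>R_far[OF x(1), symmetric] by (rule gen[OF m])
    qed
    hence "\<bar>\<Delta>R x\<bar> = ?m * \<bar>Q_coord G x - q x\<bar>" using m by (simp add: abs_mult)
    also have "\<dots> \<le> ?m * (\<bar>Q_coord G x\<bar> + \<bar>q x\<bar>)" using m by (intro mult_left_mono) auto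
    also have "\<dots> \<le> ?m * (2 * \<bar>Q_coord G x * w x\<bar> + C * norm x powr - s)"
    proof (intro mult_left_mono add_mono)
     have "\<bar>Q_coord G x\<bar> * 1 \<le> \<bar>Q_coord G x\<bar> * (2 * w x)"
      using \<rho>0[OF x(2)] by (intro mult_left_mono) auto
     thus "\<bar>Q_coord G x\<bar> \<le> 2 * \<bar>Q_coord G x * w x\<bar>" using w_pos[OF x(3)] by (simp add: abs_mult)
     show "\<bar>q x\<bar> \<le> C * norm x powr - s" using \<rho>0[OF x(2)] by simp
    qed (use m in simp)
    also have "\<dots> = ?m * 2 * norm (indicator exterior x * (Q_coord G x * w x)) + ?m * C * (indicator exterior x * norm x powr - s)"
     using x(3) by (simp add: indicator_def algebra_simps)
    finally show ?thesis using nn(3) by linarith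
   qed
   thus "norm (\<Delta>R x) \<le> norm (?b x)" by simp
  qed
 qed
qed

text \<open>\<open>flux_lin_J\<close> is exact for the linear part. The remainder is of order
  \<open>r^(-2\<tau>-4)\<close>; with the length \<open>r\<close> of the position field and the area
  of the sphere it contributes at most a multiple of \<open>r^(n-2\<tau>-4)\<close>, which tends to
  0.\<close>

lemma radial_flux_asymptotics:
 fixes J :: "real^'n => real^'n^'n"
 assumes n: "CARD('n) \<ge> 3" and \<tau>n: "\<tau> > (real CARD('n) - 4) / 2"
  and J: "!!a b. approx 0 (\<tau> + 4) (%x. J x $ a $ b) (%x. - 1 / 2 * ((Ylin a b x + Ylin b a x) / 2))"
 shows "((%r. radial_flux J r - - ((real CARD('n) - 4) / (8 * (real CARD('n) - 1)) * energy_flux G r)) \<longlongrightarrow> 0) at_top"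
proof -
 let ?n = "real CARD('n)"
 define s where "s = \<tau> + 4 + \<tau>"
 have s: "s > ?n" using \<tau>n by (simp add: s_def field_simps)
 define d where "d = (%a b x. J x $ a $ b - - 1 / 2 * ((Ylin a b x + Ylin b a x) / 2))"
 have dd: "decay 0 s (d a b)" for a b using J[of a b] by (simp add: approx_def d_def s_def)
 define D where "D = (%x. \<Oplus>i j. \<bar>d i j x\<bar>)"
 have "D \<in> O[at_infinity](%x. norm x powr - s)"
  unfolding D_def by (intro big_sum_in_bigo) (simp add: decay_bigo[OF dd])
 then obtain C where C: "C > 0" "\<forall>\<^sub>F x in at_infinity. norm (D x) \<le> C * norm (norm x powr - s)"
  by (rule landau_o.bigE)
 then obtain \<rho> where \<rho>: "!!x. norm x \<ge> \<rho> ==> norm (D x) \<le> C * norm (norm x powr - s)"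
  unfolding eventually_at_infinity by blast
 let ?K = "C * (?n * unit_ball_vol ?n)"
 have bnd: "norm (radial_flux J r - - ((?n - 4) / (8 * (?n - 1)) * energy_flux G r)) \<le> ?K * r powr - (s - ?n)"
  if r: "r > 2" "r \<ge> \<rho>" for r
 proof -
  let ?L = "%x. \<Oplus>j. (\<Oplus>i. x $ i * lin_J Sv i j x) * ((1 / r) *\<^sub>R x) $ j"
  let ?D = "%x. \<Oplus>j. (\<Oplus>i. x $ i * d i j x) * ((1 / r) *\<^sub>R x) $ j"
  have r0: "r > 0" using r by simp
  have sub: "sphere 0 r \<subseteq> (exterior :: (real^'n) set)" using r by auto
  have cx: "continuous_on (sphere 0 r) (%x :: real^'n. x $ i)" for i
   by (intro continuous_intros)
  have cL: "continuous_on (sphere 0 r) (lin_J Sv i j)" for i j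
  proof -
   have "Cinf UNIV (lin_J Sv i j)"
    unfolding lin_J_def[abs_def] by (intro Cinf_UNIV Cinf_lin_S[of v, OF Cinf_v v_sym])
   thus ?thesis by (rule continuous_on_subset[OF Cinf_continuous_on]) simp
  qed
  have cd: "continuous_on (sphere 0 r) (d i j)" for i j
   by (rule continuous_on_subset[OF Cinf_continuous_on[OF decay_Cinf[OF dd]] sub])
  have L: "continuous_on (sphere 0 r) ?L" and Dc: "continuous_on (sphere 0 r) ?D"
   unfolding vector_scaleR_component real_scaleR_def
   by (intro continuous_on_sum continuous_on_mult continuous_on_const cx cL cd)+
  have "radial_flux J r = (LINT x:sphere 0 r|sphere_measure r. - 1 / 2 * ?L x + ?D x)"
   unfolding radial_flux_def
  proof (rule sphere_integral_cong)
   fix x :: "real^'n" assume "norm x = r"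
   hence x: "x \<in> far" using r by simp
   \<comment> \<open>The linear operator is symmetric by itself, so the symmetrisation forced by the
     symmetric test tensors may be dropped.\<close>
   have sym: "lin_J Sv a b x = lin_J Sv b a x" for a b
    using lin_J_sym[of Sv Rv "\<kappa>1 + 2 * \<kappa>2" "2 * \<kappa>1 + 2 * \<kappa>2 * ?n" a b]
     Cinf_lin_S[of v, OF Cinf_v v_sym] lin_S_sym[of v, OF Cinf_v v_sym] Cinf_Rv
     div_lin_S[of v, OF Cinf_v v_sym] trace_lin_S[of v, OF Cinf_v v_sym] by (simp only:)
   have Je: "J x $ i $ j = - 1 / 2 * lin_J Sv i j x + d i j x" for i j
    unfolding d_def Ylin_far[OF x] sym[of j i] by simp
   have "x \<bullet> (J x *v ((1 / r) *\<^sub>R x)) = (\<Oplus>i j. x $ i * J x $ i $ j * ((1 / r) *\<^sub>R x) $ j)"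
    by (simp add: inner_vec_def matrix_vector_mult_def sum_distrib_left mult.assoc)
   also have "\<dots> = (\<Oplus>j i. x $ i * J x $ i $ j * ((1 / r) *\<^sub>R x) $ j)" by (rule sum.swap)
   also have "\<dots> = (\<Oplus>j i. - 1 / 2 * (x $ i * lin_J Sv i j x * ((1 / r) *\<^sub>R x) $ j)
     + x $ i * d i j x * ((1 / r) *\<^sub>R x) $ j)"
    unfolding Je by (intro sum.cong refl) (simp add: algebra_simps)
   also have "\<dots> = - 1 / 2 * ?L x + ?D x"
    by (simp only: sum.distrib sum_distrib_left[symmetric] sum_distrib_right[symmetric])
   finally show "x \<bullet> (J x *v ((1 / r) *\<^sub>R x)) = - 1 / 2 * ?L x + ?D x" .
  qed
  also have "\<dots> = (LINT x:sphere 0 r|sphere_measure r. - 1 / 2 * ?L x) + (LINT x:sphere 0 r|sphere_measure r. ?D x)"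
   by (rule set_integral_add(2)[OF sphere_integrable sphere_integrable])
    (intro r0 continuous_on_mult continuous_on_const L Dc)+
  also have "(LINT x:sphere 0 r|sphere_measure r. - 1 / 2 * ?L x) = - 1 / 2 * (LINT x:sphere 0 r|sphere_measure r. ?L x)"
   by (rule set_integral_mult_right)
  finally have "radial_flux J r - - ((?n - 4) / (8 * (?n - 1)) * energy_flux G r) = (LINT x:sphere 0 r|sphere_measure r. ?D x)"
   unfolding flux_lin_J[OF n r(1)] by (simp add: field_simps)
  also have "\<bar>\<dots>\<bar> \<le> (r * (C * r powr - s)) * (?n * unit_ball_vol ?n * r ^ CARD('n) / r)"
  proof (rule sphere_integral_bound[OF r0 Dc])
   fix x :: "real^'n" assume x: "norm x = r"
   have xi: "\<bar>x $ i\<bar> \<le> r" for i using component_le_norm_cart[of x i] x by simp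
   have \<nu>: "\<bar>((1 / r) *\<^sub>R x) $ j\<bar> \<le> 1" for j using xi[of j] r0 by (simp add: abs_mult field_simps)
   have "\<bar>?D x\<bar> \<le> (\<Oplus>j. \<bar>(\<Oplus>i. x $ i * d i j x) * ((1 / r) *\<^sub>R x) $ j\<bar>)" by (rule sum_abs)
   also have "\<dots> \<le> (\<Oplus>j. (\<Oplus>i. r * \<bar>d i j x\<bar>) * 1)"
    unfolding abs_mult
   proof (intro sum_mono mult_mono \<nu>)
    fix j
    have "\<bar>\<Oplus>i. x $ i * d i j x\<bar> \<le> (\<Oplus>i. \<bar>x $ i * d i j x\<bar>)" by (rule sum_abs)
    also have "\<dots> \<le> (\<Oplus>i. r * \<bar>d i j x\<bar>)"
     unfolding abs_mult by (intro sum_mono mult_right_mono xi) auto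
    finally show "\<bar>\<Oplus>i. x $ i * d i j x\<bar> \<le> (\<Oplus>i. r * \<bar>d i j x\<bar>)" .
   qed (use r0 in \<open>auto intro: sum_nonneg\<close>)
   also have "\<dots> = r * D x"
    unfolding D_def by (subst sum.swap) (simp add: sum_distrib_left)
   also have "\<dots> \<le> r * (C * r powr - s)"
   proof (rule mult_left_mono)
    have "D x \<le> norm (D x)" by simp
    also have "\<dots> \<le> C * norm (norm x powr - s)" by (rule \<rho>) (use x r in simp)
    finally show "D x \<le> C * r powr - s" using x by simp
   qed (use r0 in simp)
   finally show "\<bar>?D x\<bar> \<le> r * (C * r powr - s)" .
  qed
  also have "\<dots> = ?K * (r powr - s * r powr ?n)"
   using r0 by (simp add: powr_realpow field_simps)
  also have "r powr - s * r powr ?n = r powr - (s - ?n)" by (simp flip: powr_add)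
  finally show ?thesis by simp
 qed
 have "\<forall>\<^sub>F r in at_top. norm (radial_flux J r - - ((?n - 4) / (8 * (?n - 1)) * energy_flux G r)) \<le> ?K * r powr - (s - ?n)"
  using eventually_gt_at_top[of "2 :: real"] eventually_ge_at_top[of \<rho>] by eventually_elim (rule bnd)
 moreover have "((%r. ?K * r powr - (s - ?n)) \<longlongrightarrow> ?K * 0) at_top"
  using s by (intro tendsto_mult tendsto_const tendsto_neg_powr filterlim_ident) auto
 hence "((%r. ?K * r powr - (s - ?n)) \<longlongrightarrow> 0) at_top" by simp
 ultimately show ?thesis by (rule Lim_null_comparison)
qed

text \<open>\<open>energy\<close> is a \<open>Lim\<close> and has a meaning only once convergence is
  known; this comes from the integrability of \<open>\<Delta>R\<close> over the whole space.\<close>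

lemma energy_limit:
 assumes "CARD('n) \<ge> 3" "\<tau> > (real CARD('n) - 4) / 2"
  and "integrable lborel (%x. indicator exterior x * (Q_coord G x * w x))"
 shows "(energy_flux G \<longlongrightarrow> energy G) at_top"
proof -
 have "((%r. - (LINT x|lborel. indicator (ball 0 r) x * \<Delta>R x)) \<longlongrightarrow> - (LINT x|lborel. \<Delta>R x)) at_top"
  by (intro tendsto_minus tendsto_ball_integral integrable_\<Delta>R assms)
 moreover have "\<forall>\<^sub>F r in at_top. - (LINT x|lborel. indicator (ball 0 r) x * \<Delta>R x) = energy_flux G r"
  using eventually_gt_at_top[of 2] by eventually_elim (simp only: energy_flux_eq)
 ultimately have lim: "(energy_flux G \<longlongrightarrow> - (LINT x|lborel. \<Delta>R x)) at_top" by (rule Lim_transform_eventually)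
 have "energy G = - (LINT x|lborel. \<Delta>R x)"
  unfolding energy_def by (rule tendsto_Lim[OF _ lim]) simp
 with lim show ?thesis by simp
qed

end

theorem theorem2:
  fixes M :: "'a topology"
    and A :: "('a, 'n::finite) chart set"
    and g :: "('a, 'n) tensor2"
    and e :: "('a, 'n) chart"
    and \<mu> :: "'a measure"
    and DQ_adj :: "('a \<Rightarrow> real) \<Rightarrow> ('a, 'n) tensor2"
    and k :: nat and p \<tau> :: real
  assumes "CARD('n) \<ge> 3" and "p > real CARD('n)" and "k \<ge> 5"
    and "AE_manifold M A g k p \<tau> e"
    and "\<tau> > max 0 ((real CARD('n) - 4) / 2)"
    and "riemannian_volume M A g \<mu>"
    and "integrable \<mu> (Q_curvature A g)"
    and "formal_adjoint M A g \<mu> (DQ A g) DQ_adj"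
  shows "(energy_flux (g e) \<longlongrightarrow> energy (g e)) at_top \<and>
    (\<exists>L. (radial_flux (J_einstein A g DQ_adj e) \<longlongrightarrow> L) at_top \<and>
         (real CARD('n) - 4) / (8 * (real CARD('n) - 1)) * energy (g e) = - L)"
proof -
 note AE = assms(4)[unfolded AE_manifold_def]
 have ends: "e \<in> A" "chart_image e = exterior"
  and sob: "!!a b. (%x. g e x $ a $ b - (if a = b then 1 else 0)) \<in> weighted_sobolev exterior k p (- \<tau>)"
  using AE unfolding AE_end_def by auto
 have \<tau>: "\<tau> > 0" "\<tau> > (real CARD('n) - 4) / 2" using assms(5) by auto
 interpret ec: end_chart M A g \<mu> e
  by unfold_locales (use AE assms(6) ends in auto)
 have mc: "metric_coords exterior (g e)" using ec.metric_coords_e unfolding ends(2) .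
 interpret mc: metric_coords exterior "g e" by (rule mc)
 interpret as: asymptotics "g e" \<tau>
 proof
  show "det (g e x) > 0" if "x \<in> exterior" for x by (rule ec.g_det_pos[OF ends(1)]) (use that ends(2) in simp)
  fix a b
  have C: "Cinf exterior (%x. g e x $ a $ b - (if a = b then 1 else 0))"
   by (intro Cinf_diff Cinf_const mc.S mc.G)
  \<comment> \<open>This is the place where \<open>k \<ge> 5\<close> enters: the orders up to 4 must
    be strictly below \<open>k\<close>.\<close>
  have "partials is (%x. g e x $ a $ b - (if a = b then 1 else 0)) \<in> O[at_infinity](%x. norm x powr (- \<tau> - real (length is)))"
   if "length is \<le> 4" for "is"
   by (rule weighted_sobolev_decay[OF C assms(2) _ sob]) (use that assms(3) in simp)
  thus "decay 4 \<tau> (%x. g e x $ a $ b - (if a = b then 1 else 0))"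
   using C unfolding decay_def by blast
 qed (rule \<tau>(1))
 define P where "P = DQ_adj (%_. 1) e"
 have var: "variation (chart_image e) (g e) H K" if "variation exterior (g e) H K" for H K
  using that ends(2) by simp
 \<comment> \<open>The zero variation, supported in the empty set.
   \<open>formal_adjoint_chart\<close> is stated for a given variation, and any of them yields that
   the adjoint at the function 1 is a tensor field.\<close>
 have zero: "variation exterior (g e) (%_. 0) {}"
  by unfold_locales (auto simp: Cinf_const as.det_pos transpose_def vec_eq_iff)
 have Pt: "sym_tensor_field A (DQ_adj (%_. 1))"
  by (rule ec.formal_adjoint_chart(2)[OF var[OF zero] assms(8)])
 have J: "as.approx 0 (\<tau> + 4) (%x. J_einstein A g DQ_adj e x $ a $ b)
  (%x. - 1 / 2 * ((as.Ylin a b x + as.Ylin b a x) / 2))" for a b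
 proof (rule as.approx_cong[OF as.J_asymptotics[of P]])
  show "Cinf exterior (%x. P x $ i $ j)" for i j
   using ec.tensor_Cinf[OF Pt ends(1)] unfolding P_def ends(2) .
  show "P x $ i $ j = P x $ j $ i" if "x \<in> exterior" for x i j
   using ec.tensor_sym[OF Pt ends(1)] that unfolding P_def ends(2) by blast
  show "(LINT x|lborel. indicator exterior x * (variation.DQt (g e) H x * sqrt (det (g e x))))
   = (LINT x|lborel. indicator exterior x * (matrix_inner (g e x) (H x) (P x) * sqrt (det (g e x))))"
   if "variation exterior (g e) H K" for H K
   using ec.formal_adjoint_chart(1)[OF var[OF that] assms(8)] unfolding ends(2) P_def .
  fix x :: "real^'n" assume x: "x \<in> exterior"
  hence x': "x \<in> chart_image e" using ends(2) by simp
  have "Q_curvature A g (chart_inv e x) = Q_coord (g e) x"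
   using ec.Q_curvature_chart[OF ec.chart_inv(1)[OF ends(1) x']] ec.chart_inv(2)[OF ends(1) x'] by simp
  thus "- 1 / 2 * P x $ a $ b - 1 / 4 * Q_coord (g e) x * g e x $ a $ b = J_einstein A g DQ_adj e x $ a $ b"
   by (simp add: J_einstein_def J_tensor_def P_def)
 qed simp
 have Q: "integrable lborel (%x. indicator exterior x * (Q_coord (g e) x * sqrt (det (g e x))))"
  using ec.integrable_Q_coord[OF assms(7)] unfolding ends(2) .
 let ?c = "(real CARD('n) - 4) / (8 * (real CARD('n) - 1))"
 have E: "(energy_flux (g e) \<longlongrightarrow> energy (g e)) at_top"
  by (rule as.energy_limit[OF assms(1) \<tau>(2) Q])
 have "((%r. radial_flux (J_einstein A g DQ_adj e) r - - (?c * energy_flux (g e) r) + - (?c * energy_flux (g e) r))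
   \<longlongrightarrow> 0 + - (?c * energy (g e))) at_top"
  by (intro tendsto_add tendsto_minus tendsto_mult tendsto_const E as.radial_flux_asymptotics assms(1) \<tau>(2) J)
 hence "(radial_flux (J_einstein A g DQ_adj e) \<longlongrightarrow> - (?c * energy (g e))) at_top" by simp
 with E show ?thesis by (intro conjI exI[of _ "- (?c * energy (g e))"]) simp_all
qed

end
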